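(* (Verschiebung Integral Formula.) Let $p$ be a prime and $k$ a finite field with $q=p^r$ elements. Let $n$ be a positive integer, let $V$ be a nonzero finite-dimensional $k$-vector space of dimension $\delta(V)$, and let $1\le m\le\delta(V)-1$ be an integer. For each linear subspace $W\in\mathrm{Gr}(m,V)$ (i.e. of dimension $m$), let $\pi_W:V\twoheadrightarrow V/W$ be the quotient map. Then $$\frac1{|\mathrm{Gr}_k(m-1,\delta(V)-1)|}\sum_{W\in\mathrm{Gr}(m,V)}\underline T(\pi_W)\circ\underline\Omega(\pi_W)=\mathrm{Ver}^{mr},$$ as $\mathbf W(k)$-linear maps $\underline\Omega^{n}(V)\to\underline\Omega^{n+mr}(V)$.
   Context: $\mathbf W_j(k)=\mathbf W(k)/p^j$ (Witt vectors); $V^*=\mathrm{Hom}_k(V,k)$. Small Omega powers: $\Gamma^j_A(M)$ is the degree $j$ part of the divided power algebra; linear maps out of it correspond to polynomial laws on $M$ homogeneous of degree $j$. For $n\ge0$ let $\overline\tau_n:k\to\mathbf W_{n+1}(k)$, $\overline\tau_n(x)=\tilde x^{p^n}$ for any lift $\tilde x$ of $x$ (a polynomial law of degree $p^n$). The law $(v,\phi)\mapsto\overline\tau_n(\phi(v))$ induces a bilinear pairing $\Delta$ of $\Gamma^{p^n}_{\mathbf W_{n+1}(k)}(V)$ with $\Gamma^{p^n}_{\mathbf W_{n+1}(k)}(V^* )$, valued in $\mathbf W_{n+1}(k)$, with $\langle[v]_{p^n},[\phi]_{p^n}\rangle=\overline\tau_n(\phi(v))$. Put $\Omega^n(V)=\Gamma^{p^n}_{\mathbf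 W_{n+1}(k)}(V)/\mathrm{Ker}(\Delta)$, let $(v)_n$ be the class of $[v]_{p^n}$, and let $\underline\Omega^n(V)\subset\Omega^n(V)$ be the $\mathbf W_{n+1}(k)$-submodule spanned by all $(v)_n$, $v\in V$. The induced pairing $\underline\Omega^n(V)\times\underline\Omega^n(V^* )\to\mathbf W_{n+1}(k)$ is perfect. A $k$-linear map $f:V\to V'$ induces $\underline\Omega(f)=\underline\Omega^n(f):\underline\Omega^n(V)\to\underline\Omega^n(V')$, $(v)_n\mapsto(f(v))_n$. Verschiebung: since $|k|=p^r$, $V^{(r)}=V\otimes_{k,x\mapsto x^{p^r}}k$ is identified with $V$, and $\mathrm{Ver}^{mr}:\underline\Omega^{n}(V)\to\underline\Omega^{n+mr}(V)$ is the $\mathbf W(k)$-linear map with $(v)_n\mapsto p^{mr}(v)_{n+mr}$ (the dual of the Frobenius $(\phi)_{n+mr}\mapsto(\phi)_n$ for $V^*$). Transfer: for a subspace $W'\subset V'$ of codimension $c$, the descending transfer $\underline{DT}_{W',V'}:\underline\Omega^{n+rc}(V')\to\underline\Omega^n(W')$ is the unique $\mathbf W(k)$-linear map with $(v)_{n+rc}\mapsto(v)_n$ if $v\in W'$ and $(v)_{n+rc}\mapsto0$ otherwise (such a map exists). For a surjection $\pi:V\to V'$ of finite-dimensional spaces with kernel of dimension $c$, $\underline T(\pi):\underline\Omega^n(V')\to\underline\Omega^{n+rc}(V)$ is the ascending transfer: the dual of $\underline{DT}_{V'^*,V^*}$ (with $V'^*\subset V^*$ via $\pi^*$), i.e. $\langle\underline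 T(\pi)(x),y\rangle=p^{rc}\langle x,\underline{DT}_{V'^*,V^*}(y)\rangle\in\mathbf W_{n+rc+1}(k)$, where $p^{rc}:\mathbf W_{n+1}(k)\to\mathbf W_{n+rc+1}(k)$ is the injection $1\mapsto p^{rc}$. $\mathrm{Gr}_k(a,b)$ denotes the finite set of $a$-dimensional $k$-subspaces of $k^b$; its cardinality is congruent to $1$ mod $p$ (for $0\le a\le b$), hence invertible in $\mathbf W(k)$.
   Formalization: The normalising constant is corrected from |Gr_k(m-1,δ(V)-1)| to |Gr_k(m,δ(V)-1)|, the number of m-dimensional W inside a hyperplane; the printed constant fails, e.g. for q=2, n=1, m=1, δ(V)=3, where pairing gives 6 against 2 in Z/8. *)

theory Defs
  imports
    "Jordan_Normal_Form.Missing_VectorSpace"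
    "HOL-Algebra.Indexed_Polynomials"
    "HOL-Algebra.QuotRing"
    "HOL-Algebra.IntRing"
begin

hide_const (open) Multiset.mult

section \<open>Modules\<close>

text \<open>Vector spaces and modules are records over \<^typ>\<open>'a ring\<close>; the ring part of a module record
  (\<open>mult\<close>, \<open>one\<close>) carries no information unless the module is an algebra.\<close>

definition self_module :: "'a ring \<Rightarrow> ('a, 'a) module" where
  "self_module R = ring.extend R (module.fields (mult R))"

definition res_scalars :: "('a \<Rightarrow> 'b) \<Rightarrow> ('b, 'm) module \<Rightarrow> ('a, 'm) module" where
  "res_scalars h M =
     \<lparr>carrier = carrier M, mult = mult M, one = one M, zero = zero M, add = add M,
      smult = (\<lambda>a x. h a \<odot>\<^bsub>M\<^esub> x)\<rparr>"

definition quot_module :: "('a, 'm) module \<Rightarrow> 'm set \<Rightarrow> ('a, 'm set) module" where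
  "quot_module M N =
     \<lparr>carrier = a_rcosets\<^bsub>M\<^esub> N, mult = (\<lambda>_ _. N), one = N, zero = N, add = set_add M,
      smult = (\<lambda>a C. \<Union>x\<in>C. N +>\<^bsub>M\<^esub> (a \<odot>\<^bsub>M\<^esub> x))\<rparr>"

definition bilinear_pairing ::
  "'a ring \<Rightarrow> ('a, 'm) module \<Rightarrow> ('a, 'n) module \<Rightarrow> ('m \<Rightarrow> 'n \<Rightarrow> 'a) \<Rightarrow> bool" where
  "bilinear_pairing A M N D \<longleftrightarrow>
     (\<forall>x\<in>carrier M. D x \<in> LinearCombinations.module_hom A N (self_module A)) \<and>
     (\<forall>y\<in>carrier N. (\<lambda>x. D x y) \<in> LinearCombinations.module_hom A M (self_module A))"

definition dual_space :: "'k ring \<Rightarrow> ('k, 'v) module \<Rightarrow> ('k, 'v \<Rightarrow> 'k) module" where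
  "dual_space K V = (ring.func_space K (carrier V))
     \<lparr>carrier := LinearCombinations.module_hom K V (self_module K) \<inter> extensional (carrier V)\<rparr>"

definition dual_map ::
  "('k, 'v) module \<Rightarrow> ('v \<Rightarrow> 'u) \<Rightarrow> ('u \<Rightarrow> 'k) \<Rightarrow> ('v \<Rightarrow> 'k)" where
  "dual_map V f \<phi> = restrict (\<phi> \<circ> f) (carrier V)"

definition Gr :: "'k ring \<Rightarrow> nat \<Rightarrow> ('k, 'v) module \<Rightarrow> 'v set set" where
  "Gr K m V = {W. VectorSpace.subspace K W V \<and> vectorspace.dim K (V\<lparr>carrier := W\<rparr>) = m}"

text \<open>\<open>Gr_std K a b\<close> is the set of \<open>a\<close>-dimensional subspaces of \<open>k\<^sup>b\<close>. The normalising factor in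
  the Verschiebung integral formula is the number of those \<open>W \<in> Gr K m V\<close> on which a given nonzero
  linear form \<open>\<phi>\<close> vanishes, i.e. of the \<open>m\<close>-dimensional subspaces of the hyperplane \<open>ker \<phi>\<close>: this is
  \<open>card (Gr_std K m (dim V - 1))\<close>. The number \<open>card (Gr_std K (m - 1) (dim V - 1))\<close> counts instead
  the \<open>W\<close> that contain a given line, and with it the formula fails, e.g. for \<open>|k| = 2\<close>,
  \<open>dim V = 3\<close>, \<open>m = n = 1\<close>: paired with \<open>(\<phi>)\<^sub>2\<close>, the sum of the transfers sends \<open>(v)\<^sub>1\<close> with
  \<open>\<phi>(v) = 1\<close> to \<open>3 * 2\<close>, and the Verschiebung to \<open>2\<close>, in \<open>\<int>/8\<close>.\<close>

definition Gr_std :: "'k ring \<Rightarrow> nat \<Rightarrow> nat \<Rightarrow> (nat \<Rightarrow> 'k) set set" where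
  "Gr_std K a b = Gr K a (ring.func_space K {..<b})"


section \<open>Polynomial rings\<close>

text \<open>The polynomial ring \<open>A[X\<^sub>i : i \<in> I]\<close>. Library indexed polynomials come with all
  operations except the product of two polynomials.\<close>

definition mvpoly :: "'a ring \<Rightarrow> 'i set \<Rightarrow> ('i multiset \<Rightarrow> 'a) ring" where
  "mvpoly A I =
     \<lparr>carrier = ring.indexed_pset A I (carrier A),
      mult = (\<lambda>f g \<mu>. \<Oplus>\<^bsub>A\<^esub>\<nu>\<in>{\<nu>. \<nu> \<subseteq># \<mu>}. f \<nu> \<otimes>\<^bsub>A\<^esub> g (\<mu> - \<nu>)),
      one = ring.indexed_const A \<one>\<^bsub>A\<^esub>,
      zero = ring.indexed_const A \<zero>\<^bsub>A\<^esub>,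
      add = ring.indexed_padd A\<rparr>"

definition int_poly_eval :: "'k ring \<Rightarrow> ('i \<Rightarrow> 'k) \<Rightarrow> ('i multiset \<Rightarrow> int) \<Rightarrow> 'k" where
  "int_poly_eval K x f =
     (\<Oplus>\<^bsub>K\<^esub>\<mu>\<in>{\<mu>. f \<mu> \<noteq> 0}. add_pow K (f \<mu>) (\<Otimes>\<^bsub>K\<^esub>i\<in>set_mset \<mu>. x i [^]\<^bsub>K\<^esub> count \<mu> i))"


section \<open>Witt vectors\<close>

text \<open>\<open>ghost p P x n\<close> is the Witt polynomial
  \<open>x\<^sub>0^(p^n) + p x\<^sub>1^(p^(n-1)) + \<dots> + p^n x\<^sub>n\<close>.\<close>

definition ghost :: "nat \<Rightarrow> 'x ring \<Rightarrow> (nat \<Rightarrow> 'x) \<Rightarrow> nat \<Rightarrow> 'x" where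
  "ghost p P x n = (\<Oplus>\<^bsub>P\<^esub>i\<in>{..n}. add_pow P (p ^ i) (x i [^]\<^bsub>P\<^esub> (p ^ (n - i))))"

text \<open>The universal polynomials over \<open>\<int>\<close>, in the variables \<open>X\<^sub>i\<close> (\<open>Inl i\<close>) and \<open>Y\<^sub>i\<close>
  (\<open>Inr i\<close>), that define the sum and product of Witt vectors.\<close>

abbreviation int_mvpoly :: "((nat + nat) multiset \<Rightarrow> int) ring" where
  "int_mvpoly \<equiv> mvpoly \<Z> UNIV"

definition witt_universal ::
  "nat \<Rightarrow> (((nat + nat) multiset \<Rightarrow> int) \<Rightarrow> ((nat + nat) multiset \<Rightarrow> int) \<Rightarrow> ((nat + nat) multiset \<Rightarrow> int))
     \<Rightarrow> nat \<Rightarrow> (nat + nat) multiset \<Rightarrow> int" where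
  "witt_universal p opn = (THE S. \<forall>n. S n \<in> carrier int_mvpoly \<and>
     ghost p int_mvpoly S n =
       opn (ghost p int_mvpoly (\<lambda>i. ring.indexed_var \<Z> (Inl i)) n)
           (ghost p int_mvpoly (\<lambda>i. ring.indexed_var \<Z> (Inr i)) n))"

definition witt_ring :: "nat \<Rightarrow> 'k ring \<Rightarrow> (nat \<Rightarrow> 'k) ring" where
  "witt_ring p K =
     \<lparr>carrier = UNIV \<rightarrow> carrier K,
      mult = (\<lambda>x y n. int_poly_eval K (case_sum x y) (witt_universal p (mult int_mvpoly) n)),
      one = (\<lambda>n. if n = 0 then \<one>\<^bsub>K\<^esub> else \<zero>\<^bsub>K\<^esub>),
      zero = (\<lambda>n. \<zero>\<^bsub>K\<^esub>),
      add = (\<lambda>x y n. int_poly_eval K (case_sum x y) (witt_universal p (add int_mvpoly) n))\<rparr>"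

definition witt_ideal :: "nat \<Rightarrow> 'k ring \<Rightarrow> nat \<Rightarrow> (nat \<Rightarrow> 'k) set" where
  "witt_ideal p K j = PIdl\<^bsub>witt_ring p K\<^esub> (add_pow (witt_ring p K) (p ^ j) \<one>\<^bsub>witt_ring p K\<^esub>)"

definition witt_trunc :: "nat \<Rightarrow> 'k ring \<Rightarrow> nat \<Rightarrow> (nat \<Rightarrow> 'k) set ring" where
  "witt_trunc p K j = witt_ring p K Quot witt_ideal p K j"

definition witt_proj :: "nat \<Rightarrow> 'k ring \<Rightarrow> nat \<Rightarrow> (nat \<Rightarrow> 'k) \<Rightarrow> (nat \<Rightarrow> 'k) set" where
  "witt_proj p K j a = witt_ideal p K j +>\<^bsub>witt_ring p K\<^esub> a"

text \<open>The residue map \<open>W\<^sub>j(k) \<rightarrow> k\<close> for \<open>j \<ge> 1\<close>: all members of a coset of \<open>p^j W(k)\<close> have the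
  same zeroth component.\<close>

definition witt_residue :: "(nat \<Rightarrow> 'k) set \<Rightarrow> 'k" where
  "witt_residue C = (THE c. \<exists>a\<in>C. c = a 0)"

definition witt_lift :: "nat \<Rightarrow> 'k ring \<Rightarrow> nat \<Rightarrow> 'k \<Rightarrow> (nat \<Rightarrow> 'k) set" where
  "witt_lift p K j c = (SOME a. a \<in> carrier (witt_trunc p K j) \<and> witt_residue a = c)"

text \<open>The injection \<open>W\<^sub>j(k) \<rightarrow> W\<^sub>j\<^sub>+\<^sub>d(k)\<close>, \<open>1 \<mapsto> p^d\<close>.\<close>

definition witt_shift :: "nat \<Rightarrow> 'k ring \<Rightarrow> nat \<Rightarrow> nat \<Rightarrow> (nat \<Rightarrow> 'k) set \<Rightarrow> (nat \<Rightarrow> 'k) set" where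
  "witt_shift p K j d C = (\<Union>a\<in>C. witt_proj p K (j + d) (add_pow (witt_ring p K) (p ^ d) a))"


section \<open>Divided powers\<close>

text \<open>The divided power algebra of an \<open>A\<close>-module \<open>M\<close> is the quotient of the polynomial ring over
  \<open>A\<close> in variables \<open>(m, i)\<close>, standing for the symbols \<open>[m]\<^sub>i\<close>, by the ideal generated by
  \<open>dp_relations A M\<close>.\<close>

definition dp_poly :: "'a ring \<Rightarrow> ('a, 'm) module \<Rightarrow> (('m \<times> nat) multiset \<Rightarrow> 'a) ring" where
  "dp_poly A M = mvpoly A (carrier M \<times> UNIV)"

definition dp_relations :: "'a ring \<Rightarrow> ('a, 'm) module \<Rightarrow> (('m \<times> nat) multiset \<Rightarrow> 'a) set" where
  "dp_relations A M =
    (let P = dp_poly A M; \<gamma> = (\<lambda>m i. ring.indexed_var A (m, i)) in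
       {\<gamma> m 0 \<ominus>\<^bsub>P\<^esub> \<one>\<^bsub>P\<^esub> | m. m \<in> carrier M}
     \<union> {\<gamma> (a \<odot>\<^bsub>M\<^esub> m) i \<ominus>\<^bsub>P\<^esub> (ring.indexed_const A (a [^]\<^bsub>A\<^esub> i) \<otimes>\<^bsub>P\<^esub> \<gamma> m i)
          | a m i. a \<in> carrier A \<and> m \<in> carrier M}
     \<union> {\<gamma> (m \<oplus>\<^bsub>M\<^esub> m') i \<ominus>\<^bsub>P\<^esub> (\<Oplus>\<^bsub>P\<^esub>s\<in>{..i}. \<gamma> m s \<otimes>\<^bsub>P\<^esub> \<gamma> m' (i - s))
          | m m' i. m \<in> carrier M \<and> m' \<in> carrier M}
     \<union> {(\<gamma> m s \<otimes>\<^bsub>P\<^esub> \<gamma> m t) \<ominus>\<^bsub>P\<^esub> (add_pow P ((s + t) choose s) (\<gamma> m (s + t)))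
          | m s t. m \<in> carrier M})"

definition dp_ideal :: "'a ring \<Rightarrow> ('a, 'm) module \<Rightarrow> (('m \<times> nat) multiset \<Rightarrow> 'a) set" where
  "dp_ideal A M = Idl\<^bsub>dp_poly A M\<^esub> (dp_relations A M)"

definition dp_algebra ::
  "'a ring \<Rightarrow> ('a, 'm) module \<Rightarrow> ('a, (('m \<times> nat) multiset \<Rightarrow> 'a) set) module" where
  "dp_algebra A M =
    (let Q = dp_poly A M Quot dp_ideal A M in
     ring.extend Q (module.fields
       (\<lambda>a x. (dp_ideal A M +>\<^bsub>dp_poly A M\<^esub> ring.indexed_const A a) \<otimes>\<^bsub>Q\<^esub> x)))"

definition dp_sym ::
  "'a ring \<Rightarrow> ('a, 'm) module \<Rightarrow> 'm \<Rightarrow> nat \<Rightarrow> (('m \<times> nat) multiset \<Rightarrow> 'a) set" where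
  "dp_sym A M m i = dp_ideal A M +>\<^bsub>dp_poly A M\<^esub> ring.indexed_var A (m, i)"

definition dp_monomial ::
  "'a ring \<Rightarrow> ('a, 'm) module \<Rightarrow> ('m \<times> nat) list \<Rightarrow> (('m \<times> nat) multiset \<Rightarrow> 'a) set" where
  "dp_monomial A M xs =
     foldr (\<lambda>(m, i) y. dp_sym A M m i \<otimes>\<^bsub>dp_algebra A M\<^esub> y) xs \<one>\<^bsub>dp_algebra A M\<^esub>"

definition dp_lists :: "'m set \<Rightarrow> nat \<Rightarrow> ('m \<times> nat) list set" where
  "dp_lists S j = {xs. set xs \<subseteq> S \<times> UNIV \<and> sum_list (map snd xs) = j}"

definition dp_power ::
  "'a ring \<Rightarrow> ('a, 'm) module \<Rightarrow> nat \<Rightarrow> ('a, (('m \<times> nat) multiset \<Rightarrow> 'a) set) module" where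
  "dp_power A M j = (dp_algebra A M)
     \<lparr>carrier := LinearCombinations.module.span A (dp_algebra A M) (dp_monomial A M ` dp_lists (carrier M) j)\<rparr>"


section \<open>Small Omega powers\<close>

type_synonym 'k witt_quot = "(nat \<Rightarrow> 'k) set"
type_synonym ('k, 'v) dp_elem = "(('v \<times> nat) multiset \<Rightarrow> 'k witt_quot) set"
type_synonym ('k, 'v) omega_elem = "('k, 'v) dp_elem set"

definition Gamma :: "nat \<Rightarrow> 'k ring \<Rightarrow> nat \<Rightarrow> ('k, 'v) module \<Rightarrow> ('k witt_quot, ('k, 'v) dp_elem) module" where
  "Gamma p K n V = dp_power (witt_trunc p K (n + 1)) (res_scalars witt_residue V) (p ^ n)"

definition Gamma_monomial :: "nat \<Rightarrow> 'k ring \<Rightarrow> nat \<Rightarrow> ('k, 'v) module \<Rightarrow> ('v \<times> nat) list \<Rightarrow> ('k, 'v) dp_elem" where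
  "Gamma_monomial p K n V = dp_monomial (witt_trunc p K (n + 1)) (res_scalars witt_residue V)"

text \<open>Write \<open>A = W\<^sub>n\<^sub>+\<^sub>1(k)\<close>. On an \<open>A\<close>-algebra \<open>R\<close> the law \<open>(v, \<phi>) \<mapsto> \<tau>\<^sub>n(\<phi>(v))\<close> raises a lift of
  \<open>\<phi>(v) \<in> R/pR\<close> to \<open>R\<close> to the power \<open>p^n\<close>. For \<open>R = A[S\<^sub>i, T\<^sub>j]\<close>, with \<open>S\<^sub>i\<close> = \<open>Inl i\<close> and
  \<open>T\<^sub>j\<close> = \<open>Inr j\<close>, its value at \<open>(\<Sum> S\<^sub>i v\<^sub>i, \<Sum> T\<^sub>j \<phi>\<^sub>j)\<close> is \<open>(\<Sum> c\<^sub>i\<^sub>j S\<^sub>i T\<^sub>j)^(p^n)\<close>, where \<open>c\<^sub>i\<^sub>j\<close>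
  lifts \<open>\<phi>\<^sub>j(v\<^sub>i)\<close>. As \<open>[\<Sum> S\<^sub>i v\<^sub>i]\<close> expands to the sum of the \<open>S^a \<Prod> [v\<^sub>i]\<^sub>a\<^sub>_\<^sub>i\<close>, and likewise
  for the \<open>\<phi>\<^sub>j\<close>, the induced pairing sends \<open>\<Prod> [v\<^sub>i]\<^sub>a\<^sub>_\<^sub>i\<close> and \<open>\<Prod> [\<phi>\<^sub>j]\<^sub>b\<^sub>_\<^sub>j\<close> to the coefficient of
  \<open>S^a T^b\<close>. (The values at \<open>([v], [\<phi>])\<close> alone, which are \<open>\<tau>\<^sub>n(\<phi>(v))\<close>, would not determine the
  pairing, because the \<open>[v]\<close> need not span over a finite field.)\<close>

definition tau_law_coeff ::
  "nat \<Rightarrow> 'k ring \<Rightarrow> nat \<Rightarrow> ('v \<times> nat) list \<Rightarrow> (('v \<Rightarrow> 'k) \<times> nat) list \<Rightarrow> 'k witt_quot" where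
  "tau_law_coeff p K n xs ys =
    (let A = witt_trunc p K (n + 1);
         R = mvpoly A (UNIV :: (nat + nat) set);
         c = (\<lambda>i j. witt_lift p K (n + 1) (fst (ys ! j) (fst (xs ! i))));
         F = (\<Oplus>\<^bsub>R\<^esub>i\<in>{..<length xs}. \<Oplus>\<^bsub>R\<^esub>j\<in>{..<length ys}.
                ring.indexed_const A (c i j) \<otimes>\<^bsub>R\<^esub>
                (ring.indexed_var A (Inl i) \<otimes>\<^bsub>R\<^esub> ring.indexed_var A (Inr j)))
     in (F [^]\<^bsub>R\<^esub> (p ^ n))
          ((\<Sum>i<length xs. replicate_mset (snd (xs ! i)) (Inl i)) +
           (\<Sum>j<length ys. replicate_mset (snd (ys ! j)) (Inr j))))"

text \<open>Only the values of \<open>Delta\<close> on the carriers matter; there it is unique because the monomials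
  span.\<close>

definition Delta ::
  "nat \<Rightarrow> 'k ring \<Rightarrow> nat \<Rightarrow> ('k, 'v) module \<Rightarrow> ('k, 'v) dp_elem \<Rightarrow> ('k, 'v \<Rightarrow> 'k) dp_elem \<Rightarrow> 'k witt_quot" where
  "Delta p K n V = (SOME D.
     bilinear_pairing (witt_trunc p K (n + 1)) (Gamma p K n V) (Gamma p K n (dual_space K V)) D \<and>
     (\<forall>xs\<in>dp_lists (carrier V) (p ^ n). \<forall>ys\<in>dp_lists (carrier (dual_space K V)) (p ^ n).
        D (Gamma_monomial p K n V xs) (Gamma_monomial p K n (dual_space K V) ys)
          = tau_law_coeff p K n xs ys))"

definition Delta_ker :: "nat \<Rightarrow> 'k ring \<Rightarrow> nat \<Rightarrow> ('k, 'v) module \<Rightarrow> ('k, 'v) dp_elem set" where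
  "Delta_ker p K n V = {x \<in> carrier (Gamma p K n V).
     \<forall>y\<in>carrier (Gamma p K n (dual_space K V)). Delta p K n V x y = \<zero>\<^bsub>witt_trunc p K (n + 1)\<^esub>}"

definition Omega_full ::
  "nat \<Rightarrow> 'k ring \<Rightarrow> nat \<Rightarrow> ('k, 'v) module \<Rightarrow> ('k witt_quot, ('k, 'v) omega_elem) module" where
  "Omega_full p K n V = quot_module (Gamma p K n V) (Delta_ker p K n V)"

definition omega_class :: "nat \<Rightarrow> 'k ring \<Rightarrow> nat \<Rightarrow> ('k, 'v) module \<Rightarrow> 'v \<Rightarrow> ('k, 'v) omega_elem" where
  "omega_class p K n V v =
     Delta_ker p K n V +>\<^bsub>Gamma p K n V\<^esub>
       dp_sym (witt_trunc p K (n + 1)) (res_scalars witt_residue V) v (p ^ n)"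

text \<open>The small Omega power, as a module over \<open>W(k)\<close> through \<open>W(k) \<rightarrow> W\<^sub>n\<^sub>+\<^sub>1(k)\<close>.\<close>

definition Omega ::
  "nat \<Rightarrow> 'k ring \<Rightarrow> nat \<Rightarrow> ('k, 'v) module \<Rightarrow> (nat \<Rightarrow> 'k, ('k, 'v) omega_elem) module" where
  "Omega p K n V = res_scalars (witt_proj p K (n + 1))
     ((Omega_full p K n V)\<lparr>carrier := LinearCombinations.module.span (witt_trunc p K (n + 1)) (Omega_full p K n V)
        (omega_class p K n V ` carrier V)\<rparr>)"

text \<open>The kernel of \<open>Delta\<close> for the dual space, which is formed with the bidual, is also the
  right kernel of \<open>Delta\<close> for \<open>V\<close>, so the pairing below is well defined on classes.\<close>

definition omega_pairing ::
  "nat \<Rightarrow> 'k ring \<Rightarrow> nat \<Rightarrow> ('k, 'v) module \<Rightarrow> ('k, 'v) omega_elem \<Rightarrow> ('k, 'v \<Rightarrow> 'k) omega_elem \<Rightarrow> 'k witt_quot" where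
  "omega_pairing p K n V Z Y = (THE c. \<exists>x\<in>Z. \<exists>y\<in>Y. c = Delta p K n V x y)"

text \<open>The \<open>W(k)\<close>-linear map out of the small Omega power with prescribed values on the classes
  \<open>(v)\<^sub>n\<close>; it is unique on the carrier, which these classes span.\<close>

definition omega_lin ::
  "nat \<Rightarrow> 'k ring \<Rightarrow> nat \<Rightarrow> ('k, 'v) module \<Rightarrow> (nat \<Rightarrow> 'k, 'm) module \<Rightarrow> ('v \<Rightarrow> 'm)
     \<Rightarrow> ('k, 'v) omega_elem \<Rightarrow> 'm" where
  "omega_lin p K n V N g = (SOME F. F \<in> LinearCombinations.module_hom (witt_ring p K) (Omega p K n V) N \<and>
     (\<forall>v\<in>carrier V. F (omega_class p K n V v) = g v))"

definition omega_map ::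
  "nat \<Rightarrow> 'k ring \<Rightarrow> nat \<Rightarrow> ('k, 'v) module \<Rightarrow> ('k, 'u) module \<Rightarrow> ('v \<Rightarrow> 'u)
     \<Rightarrow> ('k, 'v) omega_elem \<Rightarrow> ('k, 'u) omega_elem" where
  "omega_map p K n V V' f =
     omega_lin p K n V (Omega p K n V') (\<lambda>v. omega_class p K n V' (f v))"

text \<open>In the following maps \<open>r\<close> is given by \<open>|k| = p^r\<close>.\<close>

definition Ver ::
  "nat \<Rightarrow> nat \<Rightarrow> 'k ring \<Rightarrow> nat \<Rightarrow> nat \<Rightarrow> ('k, 'v) module \<Rightarrow> ('k, 'v) omega_elem \<Rightarrow> ('k, 'v) omega_elem" where
  "Ver p r K m n V =
     omega_lin p K n V (Omega p K (n + m * r) V)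
       (\<lambda>v. add_pow (Omega p K (n + m * r) V) (p ^ (m * r)) (omega_class p K (n + m * r) V v))"

text \<open>The descending transfer for a subspace of \<open>V'\<close> that is given as an injective linear map
  \<open>\<iota> : U \<rightarrow> V'\<close>; the codimension is \<open>c\<close>.\<close>

definition desc_transfer ::
  "nat \<Rightarrow> nat \<Rightarrow> 'k ring \<Rightarrow> nat \<Rightarrow> ('k, 'u) module \<Rightarrow> ('k, 'v) module \<Rightarrow> ('u \<Rightarrow> 'v)
     \<Rightarrow> ('k, 'v) omega_elem \<Rightarrow> ('k, 'u) omega_elem" where
  "desc_transfer p r K n U V' \<iota> =
    (let c = vectorspace.dim K V' - vectorspace.dim K U in
     omega_lin p K (n + r * c) V' (Omega p K n U)
       (\<lambda>v. if v \<in> \<iota> ` carrier U then omega_class p K n U (the_inv_into (carrier U) \<iota> v)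
            else \<zero>\<^bsub>Omega p K n U\<^esub>))"

definition asc_transfer ::
  "nat \<Rightarrow> nat \<Rightarrow> 'k ring \<Rightarrow> nat \<Rightarrow> ('k, 'v) module \<Rightarrow> ('k, 'u) module \<Rightarrow> ('v \<Rightarrow> 'u)
     \<Rightarrow> ('k, 'u) omega_elem \<Rightarrow> ('k, 'v) omega_elem" where
  "asc_transfer p r K n V V' \<pi> x =
    (let c = vectorspace.dim K (V\<lparr>carrier := {v \<in> carrier V. \<pi> v = \<zero>\<^bsub>V'\<^esub>}\<rparr>) in
     THE z. z \<in> carrier (Omega p K (n + r * c) V) \<and>
       (\<forall>y\<in>carrier (Omega p K (n + r * c) (dual_space K V)).
          omega_pairing p K (n + r * c) V z y =
          witt_shift p K (n + 1) (r * c)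
            (omega_pairing p K n V' x
              (desc_transfer p r K n (dual_space K V') (dual_space K V) (dual_map V \<pi>) y))))"

end

theory Submission
  imports Defs "HOL-Library.Poly_Mapping" "HOL-Library.Function_Algebras"
begin

text \<open>For linear forms \<open>\<phi>\<^sub>j\<close>, the function \<open>v \<mapsto> (\<Sum> T\<^sub>j [\<phi>\<^sub>j v])^(p^n)\<close> is a combination of the
  functions \<open>v \<mapsto> [\<psi> v]^(p^n)\<close> with \<open>\<psi>\<close> a linear form; this rests on the valuation of a Jacobi sum.
  So an element of a small Omega power is determined by its pairings with the classes \<open>(\<phi>)\<^sub>n\<close>, and
  linear maps into it exist as soon as the pairings of their values extend linearly.

  Let \<open>\<pi> : V \<rightarrow> U\<close> be surjective with kernel of dimension \<open>c\<close>. The sum of \<open>[\<phi> v]^(p^n)\<close> over the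
  fiber at \<open>w\<close>, minus the sum over the kernel, is \<open>q^c [\<psi> w]^(p^n)\<close> if \<open>\<phi> = \<psi> \<circ> \<pi>\<close>, and \<open>0\<close> if \<open>\<phi>\<close>
  does not vanish on the kernel. Hence the ascending transfer of \<open>(w)\<close> is the sum of the \<open>(v)\<close> over the
  fiber minus the sum over the kernel, and its composite with \<open>\<Omega>(\<pi>)\<close> has pairing with \<open>(\<phi>)\<close> equal to
  that of the Verschiebung or to \<open>0\<close>. In the sum over all \<open>W\<close>, a form \<open>\<phi> \<noteq> 0\<close> contributes once for
  every \<open>m\<close>-dimensional subspace of its kernel.\<close>

text \<open>The kernel of \<open>Delta\<close> is tested against all monomials of the divided powers
  of the dual, while the explicit pairing formula concerns only classes of single forms; closing
  this gap brings in the Jacobi sum. In the induction on n, the p-th power of a combination leaves,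
  besides pure p-th powers, p times products of p factors [x_i]^(p^n). Such a product is extracted
  from the sum of [t_1 x_1 + ... + t_p x_p]^(p^(n+1)) over all t_i in k, with weights homogeneous of
  degree -1: substituting t_i / x_i for t_i pulls the product out and leaves a constant, which must
  be p times a unit. Modulo p^2 the p-th power of a Teichmueller representative equals the p-th
  power of any other lift, so the sum may be formed in W(k) before the power is taken; iterated
  differences then give p! (q - 1)^p, of valuation exactly 1. Identities of this kind, and the ring
  axioms themselves, are checked in integral polynomial rings, where p is not a zero divisor, and
  then specialised.\<close>

abbreviation lookup :: "('a \<Rightarrow>\<^sub>0 'b::zero) \<Rightarrow> 'a \<Rightarrow> 'b" where "lookup \<equiv> Poly_Mapping.lookup"
abbreviation single :: "'a \<Rightarrow> 'b::zero \<Rightarrow> ('a \<Rightarrow>\<^sub>0 'b)" where "single \<equiv> Poly_Mapping.single"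
abbreviation keys :: "('a \<Rightarrow>\<^sub>0 'b::zero) \<Rightarrow> 'a set" where "keys \<equiv> Poly_Mapping.keys"

text \<open>The target is only a record with operations: a map onto its carrier, from a subset of a
  ring type that is closed under the ring operations, transports all axioms at once. Polynomial
  rings over arbitrary rings and the ring of Witt vectors are both obtained in this way.\<close>

lemma cring_image:
 fixes h :: "'r::comm_ring_1 \<Rightarrow> 'x" and R :: "('x, 'z) ring_scheme" (structure)
 assumes carr: "carrier R = h ` S"
  and S: "0 \<in> S" "1 \<in> S" "\<And>x y. x \<in> S \<Longrightarrow> y \<in> S \<Longrightarrow> x + y \<in> S"
   "\<And>x y. x \<in> S \<Longrightarrow> y \<in> S \<Longrightarrow> x * y \<in> S" "\<And>x. x \<in> S \<Longrightarrow> - x \<in> S"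
  and add: "\<And>x y. x \<in> S \<Longrightarrow> y \<in> S \<Longrightarrow> h (x + y) = h x \<oplus> h y"
  and mult: "\<And>x y. x \<in> S \<Longrightarrow> y \<in> S \<Longrightarrow> h (x * y) = h x \<otimes> h y"
  and zero: "h 0 = \<zero>" and one: "h 1 = \<one>"
 shows "cring R"
proof (rule cringI)
 show "abelian_group R"
 proof (rule abelian_groupI)
  fix x assume "x \<in> carrier R"
  then obtain a where a: "a \<in> S" "x = h a" using carr by auto
  show "\<exists>y\<in>carrier R. y \<oplus> x = \<zero>"
   using a S add[of "- a" a] zero carr by (intro bexI[of _ "h (- a)"]) auto
 qed (use carr S add zero in \<open>auto simp flip: add zero simp: ac_simps\<close>)
 show "comm_monoid R"
  by (rule comm_monoidI)
   (use carr S mult one in \<open>auto simp flip: mult one simp: ac_simps\<close>)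
 show "(x \<oplus> y) \<otimes> z = x \<otimes> z \<oplus> y \<otimes> z"
  if "x \<in> carrier R" "y \<in> carrier R" "z \<in> carrier R" for x y z
  using that carr S by (auto simp flip: mult add simp: distrib_right)
qed

section \<open>Polynomials\<close>

lemma finite_submultisets: "finite {\<nu>. \<nu> \<subseteq># (\<mu> :: 'i multiset)}"
 by (rule finite_subset[of _ "\<Union>n\<le>size \<mu>. multisets_of_size (set_mset \<mu>) n"])
  (auto dest: mset_subset_eqD size_mset_mono simp: multisets_of_size_def finite_multisets_of_size[unfolded multisets_of_size_def])

text \<open>The product of finitely supported functions sums over all pairs of exponents, the
  product of \<open>mvpoly\<close> over submultisets. A contributing pair is determined by its first
  entry, which must be contained in \<mu>.\<close>

lemma lookup_times_multiset:
 fixes f g :: "'i multiset \<Rightarrow>\<^sub>0 'b::comm_ring_1"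
 shows "lookup (f * g) \<mu> = (\<Sum>\<nu>\<in>{\<nu>. \<nu> \<subseteq># \<mu>}. lookup f \<nu> * lookup g (\<mu> - \<nu>))"
proof -
 have inner: "Sum_any (\<lambda>q. lookup g q when \<mu> = l + q) = (if l \<subseteq># \<mu> then lookup g (\<mu> - l) else 0)" for l
 proof (cases "l \<subseteq># \<mu>")
  case True
  then have "(\<lambda>q. lookup g q when \<mu> = l + q) = (\<lambda>q. lookup g q when q = \<mu> - l)"
   by (intro ext) (auto simp: when_def)
  then have "Sum_any (\<lambda>q. lookup g q when \<mu> = l + q) = Sum_any (\<lambda>q. lookup g q when q = \<mu> - l)"
   by (rule arg_cong[where f=Sum_any])
  then show ?thesis using True by simp
 next
  case False
  then have "(\<lambda>q. lookup g q when \<mu> = l + q) = (\<lambda>q. 0)"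
   by (intro ext) (auto simp: when_def)
  then have "Sum_any (\<lambda>q. lookup g q when \<mu> = l + q) = Sum_any (\<lambda>q :: 'i multiset. 0 :: 'b)"
   by (rule arg_cong[where f=Sum_any])
  then show ?thesis using False by simp
 qed
 have "lookup (f * g) \<mu> = Sum_any (\<lambda>l. lookup f l * (if l \<subseteq># \<mu> then lookup g (\<mu> - l) else 0))"
  by (simp add: lookup_mult inner)
 also have "\<dots> = (\<Sum>l\<in>{\<nu>. \<nu> \<subseteq># \<mu>}. lookup f l * (if l \<subseteq># \<mu> then lookup g (\<mu> - l) else 0))"
  by (rule Sum_any.expand_superset) (auto simp: finite_submultisets split: if_splits)
 finally show ?thesis by simp
qed

lemma poly_mapping_additive_induct [case_names single add zero]:
 assumes "\<And>k c. P (single k c)" "\<And>f g. P f \<Longrightarrow> P g \<Longrightarrow> P (f + g)" "P 0"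
 shows "P (f :: 'k \<Rightarrow>\<^sub>0 'b::comm_monoid_add)"
proof -
 have "P (\<Sum>k\<in>A. single k (lookup f k))" if "finite A" for A
  using that by induction (auto intro: assms)
 moreover have "f = (\<Sum>k\<in>keys f. single k (lookup f k))"
  by (rule poly_mapping_eqI) (auto simp: lookup_sum lookup_single when_def in_keys_iff)
 ultimately show ?thesis by (metis finite_keys)
qed

lemma lookup_zero_fun [simp]: "lookup 0 = (\<lambda>_. 0)"
 by (rule ext) simp

section \<open>Evaluation of integral polynomials in a commutative ring\<close>

definition monomial_value :: "('k, 'z) ring_scheme \<Rightarrow> ('i \<Rightarrow> 'k) \<Rightarrow> 'i multiset \<Rightarrow> 'k" where
 "monomial_value R x \<mu> = (\<Otimes>\<^bsub>R\<^esub>i\<in>set_mset \<mu>. x i [^]\<^bsub>R\<^esub> count \<mu> i)"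

text \<open>The ring record has no extra fields here, since \<open>mvpoly\<close> and
  \<open>int_poly_eval\<close> accept only this record type.\<close>

locale plain_cring = cring R for R :: "'a ring" (structure)

context plain_cring
begin

lemma add_pow_zero_int [simp]: "add_pow R (0 :: int) x = \<zero>"
 by (simp add: add_pow_def)

lemma monomial_value_closed [simp]:
 "(\<And>i. x i \<in> carrier R) \<Longrightarrow> monomial_value R x \<mu> \<in> carrier R"
 unfolding monomial_value_def by (intro finprod_closed) auto

lemma monomial_value_superset:
 assumes "\<And>i. x i \<in> carrier R" "finite S" "set_mset \<mu> \<subseteq> S"
 shows "monomial_value R x \<mu> = (\<Otimes>i\<in>S. x i [^] count \<mu> i)"
 unfolding monomial_value_def
 by (rule finprod_mono_neutral_cong_left) (use assms in \<open>auto simp: not_in_iff\<close>)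

lemma monomial_value_add:
 assumes x: "\<And>i. x i \<in> carrier R"
 shows "monomial_value R x (\<mu> + \<nu>) = monomial_value R x \<mu> \<otimes> monomial_value R x \<nu>"
proof -
 let ?S = "set_mset (\<mu> + \<nu>)"
 have "monomial_value R x (\<mu> + \<nu>) = (\<Otimes>i\<in>?S. x i [^] count \<mu> i \<otimes> x i [^] count \<nu> i)"
  unfolding monomial_value_def by (rule finprod_cong') (use x in \<open>auto simp: nat_pow_mult\<close>)
 also have "\<dots> = (\<Otimes>i\<in>?S. x i [^] count \<mu> i) \<otimes> (\<Otimes>i\<in>?S. x i [^] count \<nu> i)"
  by (rule finprod_multf) (use x in auto)
 finally show ?thesis
  using x by (simp add: monomial_value_superset[of x ?S])
qed

lemma monomial_value_empty [simp]: "monomial_value R x {#} = \<one>"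
 by (simp add: monomial_value_def)

lemma monomial_value_single [simp]: "x i \<in> carrier R \<Longrightarrow> monomial_value R x {#i#} = x i"
 by (simp add: monomial_value_def)

text \<open>Evaluation sums over the support, which changes under addition; a common finite superset
  makes the sums for f, g and f + g comparable.\<close>

lemma int_poly_eval_superset:
 assumes x: "\<And>i. x i \<in> carrier R" and "finite S" "keys f \<subseteq> S"
 shows "int_poly_eval R x (lookup f) = (\<Oplus>\<mu>\<in>S. add_pow R (lookup f \<mu> :: int) (monomial_value R x \<mu>))"
proof -
 have "int_poly_eval R x (lookup f) = (\<Oplus>\<mu>\<in>keys f. add_pow R (lookup f \<mu>) (monomial_value R x \<mu>))"
  by (simp add: int_poly_eval_def monomial_value_def keys.rep_eq)
 also have "\<dots> = (\<Oplus>\<mu>\<in>S. add_pow R (lookup f \<mu> :: int) (monomial_value R x \<mu>))"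
  by (rule add.finprod_mono_neutral_cong_left) (use assms in \<open>auto simp: in_keys_iff\<close>)
 finally show ?thesis .
qed

lemma int_poly_eval_closed [simp]:
 "(\<And>i. x i \<in> carrier R) \<Longrightarrow> int_poly_eval R x (lookup f) \<in> carrier R"
 by (subst int_poly_eval_superset[of x "keys f"]) (auto intro!: finsum_closed)

lemma int_poly_eval_add:
 assumes x: "\<And>i. x i \<in> carrier R"
 shows "int_poly_eval R x (lookup (f + g)) = int_poly_eval R x (lookup f) \<oplus> int_poly_eval R x (lookup g)"
proof -
 let ?S = "keys f \<union> keys g"
 have "int_poly_eval R x (lookup (f + g)) = (\<Oplus>\<mu>\<in>?S. add_pow R (lookup (f + g) \<mu>) (monomial_value R x \<mu>))"
  by (rule int_poly_eval_superset) (use x keys_add[of f g] in auto)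
 also have "\<dots> = (\<Oplus>\<mu>\<in>?S. add_pow R (lookup f \<mu>) (monomial_value R x \<mu>)
   \<oplus> add_pow R (lookup g \<mu>) (monomial_value R x \<mu>))"
  by (rule finsum_cong') (use x in \<open>auto simp: lookup_add add.int_pow_mult\<close>)
 also have "\<dots> = (\<Oplus>\<mu>\<in>?S. add_pow R (lookup f \<mu>) (monomial_value R x \<mu>))
   \<oplus> (\<Oplus>\<mu>\<in>?S. add_pow R (lookup g \<mu>) (monomial_value R x \<mu>))"
  by (rule finsum_addf) (use x in auto)
 finally show ?thesis
  using x by (simp add: int_poly_eval_superset[of x ?S])
qed

lemma int_poly_eval_single:
 assumes x: "\<And>i. x i \<in> carrier R"
 shows "int_poly_eval R x (lookup (single \<mu> c)) = add_pow R c (monomial_value R x \<mu>)"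
 by (subst int_poly_eval_superset[of x "{\<mu>}"]) (use x in auto)

lemma int_poly_eval_zero: 
 assumes x: "\<And>i. x i \<in> carrier R"
 shows "int_poly_eval R x (\<lambda>_. 0) = \<zero>"
 by (simp add: int_poly_eval_def)

lemma int_poly_eval_one:
 assumes x: "\<And>i. x i \<in> carrier R"
 shows "int_poly_eval R x (lookup 1) = \<one>"
 using int_poly_eval_single[where x=x and \<mu>="{#}" and c=1, OF x] by simp

lemma int_poly_eval_var:
 assumes x: "\<And>i. x i \<in> carrier R"
 shows "int_poly_eval R x (lookup (single {#i#} 1)) = x i"
 using int_poly_eval_single[where x=x and \<mu>="{#i#}" and c=1, OF x] x by simp

lemma int_poly_eval_mult:
 assumes x: "\<And>i. x i \<in> carrier R"
 shows "int_poly_eval R x (lookup (f * g)) = int_poly_eval R x (lookup f) \<otimes> int_poly_eval R x (lookup g)"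
proof (induction f rule: poly_mapping_additive_induct)
 case (single k c)
 show ?case
 proof (induction g rule: poly_mapping_additive_induct)
  case (single l d)
  have "add_pow R (c * d) (a \<otimes> b) = add_pow R c a \<otimes> add_pow R d b"
   if "a \<in> carrier R" "b \<in> carrier R" for a b
   using that by (simp add: add_pow_ldistr_int add_pow_rdistr_int add.int_pow_pow mult.commute)
  then show ?case using x
   by (simp add: mult_single int_poly_eval_single monomial_value_add)
 qed (use x in \<open>simp_all add: int_poly_eval_add int_poly_eval_zero distrib_left r_distr\<close>)
qed (use x in \<open>simp_all add: int_poly_eval_add int_poly_eval_zero distrib_right l_distr\<close>)

lemma int_poly_eval_power:
 assumes x: "\<And>i. x i \<in> carrier R"
 shows "int_poly_eval R x (lookup (f ^ n)) = int_poly_eval R x (lookup f) [^] n"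
 by (induction n) (use x in \<open>simp_all add: int_poly_eval_one int_poly_eval_mult m_comm\<close>)

lemma int_poly_eval_uminus:
 assumes x: "\<And>i. x i \<in> carrier R"
 shows "int_poly_eval R x (lookup (- f)) = \<ominus> int_poly_eval R x (lookup f)"
 using int_poly_eval_add[where x=x and f="- f" and g=f, OF x] x
 by (intro minus_equality[symmetric]) (simp_all add: int_poly_eval_zero)

lemma int_poly_eval_diff:
 assumes x: "\<And>i. x i \<in> carrier R"
 shows "int_poly_eval R x (lookup (f - g)) = int_poly_eval R x (lookup f) \<ominus> int_poly_eval R x (lookup g)"
 using int_poly_eval_add[where x=x and f=f and g="- g", OF x] x by (simp add: int_poly_eval_uminus minus_eq)

lemma int_poly_eval_sum:
 assumes x: "\<And>i. x i \<in> carrier R" and "finite S"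
 shows "int_poly_eval R x (lookup (sum f S)) = (\<Oplus>i\<in>S. int_poly_eval R x (lookup (f i)))"
 using assms(2) by (induction S) (use x in \<open>simp_all add: int_poly_eval_zero int_poly_eval_add\<close>)

lemma int_poly_eval_of_nat_mult:
 assumes x: "\<And>i. x i \<in> carrier R"
 shows "int_poly_eval R x (lookup (of_nat n * f)) = add_pow R n (int_poly_eval R x (lookup f))"
 by (induction n) (use x in \<open>simp_all add: int_poly_eval_zero int_poly_eval_add distrib_right a_comm\<close>)

end

lemma ring_hom_add_pow:
 assumes "h \<in> ring_hom R S" "cring R" "cring S" "a \<in> carrier R"
 shows "h (add_pow R (c::int) a) = add_pow S c (h a)"
proof -
 interpret ring_hom_cring R S h
  using assms by (simp add: ring_hom_cring_def ring_hom_cring_axioms_def)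
 have "group_hom (add_monoid R) (add_monoid S) h"
  by (intro group_hom.intro group_hom_axioms.intro) (auto simp: hom_def R.add.group_axioms S.add.group_axioms)
 from group_hom.hom_int_pow[OF this, of a c] show ?thesis
  using assms(4) by (simp add: add_pow_def)
qed

text \<open>Naturality of evaluation; it carries the universal Witt polynomials from integral lifts
  down to K.\<close>

lemma int_poly_eval_hom:
 assumes "h \<in> ring_hom R S" "cring (R :: 'a ring)" "cring (S :: 'b ring)" and x: "\<And>i. x i \<in> carrier R"
 shows "h (int_poly_eval R x (lookup f)) = int_poly_eval S (h \<circ> x) (lookup f)"
proof -
 interpret ring_hom_cring R S h
  using assms by (simp add: ring_hom_cring_def ring_hom_cring_axioms_def)
 interpret RR: plain_cring R by (unfold_locales)
 interpret SS: plain_cring S by (unfold_locales)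
 have hx: "(h \<circ> x) i \<in> carrier S" for i using x by simp
 have "h (monomial_value R x \<mu>) = monomial_value S (h \<circ> x) \<mu>" for \<mu>
  unfolding monomial_value_def using x by (subst hom_finprod) (auto intro!: S.finprod_cong')
 then show ?thesis using x hx
  apply (subst RR.int_poly_eval_superset[OF x finite_keys order_refl])
  apply (subst SS.int_poly_eval_superset[OF hx finite_keys order_refl])
  apply (subst hom_finsum)
  apply (auto intro!: S.finsum_cong' simp: ring_hom_add_pow[OF assms(1-3)])
  done
qed

lemma (in abelian_monoid) finsum_delta:
 assumes "finite A" "a \<in> A \<Longrightarrow> f a \<in> carrier G"
 shows "(\<Oplus>i\<in>A. if a = i then f i else \<zero>) = (if a \<in> A then f a else \<zero>)"
proof (cases "a \<in> A")
 case True
 have "(\<Oplus>i\<in>A. if a = i then f i else \<zero>) = (\<Oplus>i\<in>A. if a = i then f a else \<zero>)"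
  by (rule finsum_cong') (use assms True in auto)
 also have "\<dots> = f a"
  using finsum_singleton[of a A "\<lambda>_. f a"] assms True by simp
 finally show ?thesis using True by simp
next
 case False
 then have "(\<Oplus>i\<in>A. if a = i then f i else \<zero>) = \<zero>"
  by (intro finsum_all0) auto
 then show ?thesis using False by simp
qed

section \<open>Polynomial rings over an arbitrary commutative ring\<close>

definition mono :: "('a, 'z) ring_scheme \<Rightarrow> 'a \<Rightarrow> 'i multiset \<Rightarrow> 'i multiset \<Rightarrow> 'a" where
 "mono R c \<mu> = (\<lambda>\<nu>. if \<nu> = \<mu> then c else \<zero>\<^bsub>R\<^esub>)"

lemma (in ring) indexed_const_eq_mono: "indexed_const c = mono R c {#}"
 by (rule ext) (simp add: indexed_const_def mono_def)

lemma (in ring) indexed_pmult_mono: "indexed_pmult (mono R c \<mu>) i = mono R c (add_mset i \<mu>)"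
 by (rule ext) (auto simp: indexed_pmult_def mono_def dest: multi_member_split)

lemma (in ring) indexed_var_eq_mono: "indexed_var i = mono R \<one> {#i#}"
 by (simp add: indexed_var_def indexed_const_eq_mono indexed_pmult_mono)

lemma (in ring) mono_in_pset:
 assumes "c \<in> carrier R" "set_mset \<mu> \<subseteq> I"
 shows "mono R c \<mu> \<in> indexed_pset I (carrier R)"
 using assms(2)
proof (induction \<mu>)
 case empty
 then show ?case using indexed_pset.indexed_const[OF assms(1), of I]
  by (simp add: indexed_const_eq_mono)
next
 case (add i \<mu>)
 then show ?case
  using indexed_pset.indexed_pmult[of "mono R c \<mu>" I "carrier R" i] by (simp add: indexed_pmult_mono)
qed

text \<open>The inductive generation of polynomials is replaced by a condition on coefficients. For
  the converse, a finitely supported function is built up by splitting off one monomial at a time,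
  by induction on its support.\<close>

lemma (in ring) indexed_pset_iff:
 "f \<in> indexed_pset I (carrier R) \<longleftrightarrow>
   finite {\<mu>. f \<mu> \<noteq> \<zero>} \<and> (\<forall>\<mu>. f \<mu> \<in> carrier R) \<and> (\<forall>\<mu>. f \<mu> \<noteq> \<zero> \<longrightarrow> set_mset \<mu> \<subseteq> I)"
proof
 assume "f \<in> indexed_pset I (carrier R)"
 then show "finite {\<mu>. f \<mu> \<noteq> \<zero>} \<and> (\<forall>\<mu>. f \<mu> \<in> carrier R) \<and> (\<forall>\<mu>. f \<mu> \<noteq> \<zero> \<longrightarrow> set_mset \<mu> \<subseteq> I)"
 proof induction
  case (indexed_const k)
  then show ?case
   by (auto simp: indexed_const_eq_mono mono_def)
 next
  case (indexed_padd P Q)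
  have "finite {\<mu>. indexed_padd P Q \<mu> \<noteq> \<zero>}"
   by (rule finite_subset[of _ "{\<mu>. P \<mu> \<noteq> \<zero>} \<union> {\<mu>. Q \<mu> \<noteq> \<zero>}"])
    (use indexed_padd in \<open>auto simp: indexed_padd_def\<close>)
  moreover have "set_mset \<mu> \<subseteq> I" if "indexed_padd P Q \<mu> \<noteq> \<zero>" for \<mu>
  proof (rule ccontr)
   assume "\<not> set_mset \<mu> \<subseteq> I"
   with indexed_padd have "P \<mu> = \<zero>" "Q \<mu> = \<zero>" by blast+
   with that show False by (simp add: indexed_padd_def)
  qed
  moreover have "\<forall>\<mu>. indexed_padd P Q \<mu> \<in> carrier R"
   using indexed_padd by (auto simp: indexed_padd_def)
  ultimately show ?case by blast
 next
  case (indexed_pmult P i)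
  have "finite {\<mu>. indexed_pmult P i \<mu> \<noteq> \<zero>}"
   by (rule finite_subset[of _ "add_mset i ` {\<mu>. P \<mu> \<noteq> \<zero>}"])
    (use indexed_pmult in \<open>auto simp: indexed_pmult_def image_iff dest!: multi_member_split split: if_splits\<close>)
  moreover have "set_mset \<mu> \<subseteq> I" if "indexed_pmult P i \<mu> \<noteq> \<zero>" for \<mu>
  proof -
   from that obtain \<nu> where "\<mu> = add_mset i \<nu>" "P \<nu> \<noteq> \<zero>"
    by (auto simp: indexed_pmult_def dest!: multi_member_split split: if_splits)
   then show ?thesis using indexed_pmult by auto
  qed
  moreover have "\<forall>\<mu>. indexed_pmult P i \<mu> \<in> carrier R"
   using indexed_pmult by (auto simp: indexed_pmult_def)
  ultimately show ?case by blast
 qed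
next
 have "f \<in> indexed_pset I (carrier R)"
  if "finite S" "{\<mu>. f \<mu> \<noteq> \<zero>} = S" "\<forall>\<mu>. f \<mu> \<in> carrier R" "\<forall>\<mu>. f \<mu> \<noteq> \<zero> \<longrightarrow> set_mset \<mu> \<subseteq> I" for S
  using that
 proof (induction S arbitrary: f)
  case empty
  then have "f = mono R \<zero> {#}" by (auto simp: mono_def fun_eq_iff)
  then show ?case using mono_in_pset[of \<zero> "{#}" I] by simp
 next
  case (insert \<mu> S)
  have "f(\<mu> := \<zero>) \<in> indexed_pset I (carrier R)"
   by (rule insert.IH) (use insert in auto)
  moreover have "mono R (f \<mu>) \<mu> \<in> indexed_pset I (carrier R)"
   by (rule mono_in_pset) (use insert in auto)
  moreover have "f = indexed_padd (f(\<mu> := \<zero>)) (mono R (f \<mu>) \<mu>)"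
   using insert.prems by (auto simp: indexed_padd_def mono_def fun_eq_iff)
  ultimately show ?case by (metis indexed_pset.indexed_padd)
 qed
 then show "f \<in> indexed_pset I (carrier R)"
  if "finite {\<mu>. f \<mu> \<noteq> \<zero>} \<and> (\<forall>\<mu>. f \<mu> \<in> carrier R) \<and> (\<forall>\<mu>. f \<mu> \<noteq> \<zero> \<longrightarrow> set_mset \<mu> \<subseteq> I)"
  using that by blast
qed

locale mvpolys = plain_cring R for R :: "'a ring" (structure) +
 fixes I :: "'i set"
begin

abbreviation "P \<equiv> mvpoly R I"

lemma carrier_mvpoly:
 "f \<in> carrier P \<longleftrightarrow>
   finite {\<mu>. f \<mu> \<noteq> \<zero>} \<and> (\<forall>\<mu>. f \<mu> \<in> carrier R) \<and> (\<forall>\<mu>. f \<mu> \<noteq> \<zero> \<longrightarrow> set_mset \<mu> \<subseteq> I)"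
 using indexed_pset_iff[of f I] by (simp add: mvpoly_def)

lemma coeff_closed: "f \<in> carrier P \<Longrightarrow> f \<mu> \<in> carrier R"
 by (simp add: carrier_mvpoly)

lemma coeff_add: "(f \<oplus>\<^bsub>P\<^esub> g) \<mu> = f \<mu> \<oplus> g \<mu>"
 by (simp add: mvpoly_def indexed_padd_def)

lemma coeff_zero: "\<zero>\<^bsub>P\<^esub> \<mu> = \<zero>"
 by (simp add: mvpoly_def indexed_const_def)

lemma coeff_mult: "(f \<otimes>\<^bsub>P\<^esub> g) \<mu> = (\<Oplus>\<nu>\<in>{\<nu>. \<nu> \<subseteq># \<mu>}. f \<nu> \<otimes> g (\<mu> - \<nu>))"
 by (simp add: mvpoly_def)

lemma one_eq_mono: "\<one>\<^bsub>P\<^esub> = mono R \<one> {#}"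
 by (simp add: mvpoly_def indexed_const_eq_mono)

lemma mono_closed: "c \<in> carrier R \<Longrightarrow> set_mset \<mu> \<subseteq> I \<Longrightarrow> mono R c \<mu> \<in> carrier P"
 using mono_in_pset[of c \<mu> I] by (simp add: mvpoly_def)

text \<open>Every polynomial over R is the image of one whose coefficients are integral polynomials
  in variables indexed by the elements of R itself. The ring axioms are inherited from that
  polynomial ring through \<open>cring_image\<close>.\<close>

lemma cring_mvpoly: "cring P"
proof -
 \<comment> \<open>There is a variable for every element of the type; those outside the carrier are
   evaluated to zero.\<close>
 let ?x = "\<lambda>a. if a \<in> carrier R then a else \<zero>"
 define ev :: "('a multiset \<Rightarrow>\<^sub>0 int) \<Rightarrow> 'a" where "ev f = int_poly_eval R ?x (lookup f)" for f
 have x: "?x a \<in> carrier R" for a by simp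
 note evs = int_poly_eval_add[where x="?x", OF x] int_poly_eval_mult[where x="?x", OF x]
  int_poly_eval_one[where x="?x", OF x] int_poly_eval_zero[where x="?x", OF x]
  int_poly_eval_closed[where x="?x", OF x] int_poly_eval_sum[where x="?x", OF x]
 have ev_var: "ev (single {#a#} 1) = a" if "a \<in> carrier R" for a
  using int_poly_eval_var[where x="?x", OF x, of a] that by (simp add: ev_def)
 define h :: "('i multiset \<Rightarrow>\<^sub>0 ('a multiset \<Rightarrow>\<^sub>0 int)) \<Rightarrow> 'i multiset \<Rightarrow> 'a"
  where "h F = (\<lambda>\<mu>. ev (lookup F \<mu>))" for F
 define S :: "('i multiset \<Rightarrow>\<^sub>0 ('a multiset \<Rightarrow>\<^sub>0 int)) set"
  where "S = {F. \<forall>\<mu>\<in>keys F. set_mset \<mu> \<subseteq> I}"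
 have ev0: "ev 0 = \<zero>" by (simp add: ev_def evs)
 show ?thesis
 proof (rule cring_image[of P h S])
  show "carrier P = h ` S"
  proof (intro equalityI subsetI)
   fix f assume f: "f \<in> carrier P"
   \<comment> \<open>A coefficient is lifted to the variable named after it, except that zero is
     lifted to 0 to keep the support finite.\<close>
   define F where "F = Abs_poly_mapping (\<lambda>\<mu>. if f \<mu> = \<zero> then 0 else single {#f \<mu>#} (1::int))"
   have F: "lookup F \<mu> = (if f \<mu> = \<zero> then 0 else single {#f \<mu>#} 1)" for \<mu>
    unfolding F_def
    by (subst lookup_Abs_poly_mapping) (use f in \<open>auto simp: carrier_mvpoly elim: rev_finite_subset\<close>)
   have "h F = f"
    using f by (auto simp: h_def F ev0 ev_var carrier_mvpoly fun_eq_iff)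
   moreover have "F \<in> S" using f by (auto simp: S_def F carrier_mvpoly in_keys_iff split: if_splits)
   ultimately show "f \<in> h ` S" by blast
  next
   fix f assume "f \<in> h ` S"
   then obtain F where F: "F \<in> S" "f = h F" by auto
   have "{\<mu>. f \<mu> \<noteq> \<zero>} \<subseteq> keys F" using ev0 by (auto simp: F h_def in_keys_iff)
   then show "f \<in> carrier P"
    using F(1) by (auto simp: carrier_mvpoly S_def F(2) h_def ev_def evs intro: finite_subset)
  qed
  show "h (F + G) = h F \<oplus>\<^bsub>P\<^esub> h G" for F G
   by (rule ext) (simp add: h_def coeff_add lookup_add ev_def evs)
  show "h (F * G) = h F \<otimes>\<^bsub>P\<^esub> h G" for F G
   by (rule ext) (simp add: h_def coeff_mult lookup_times_multiset ev_def evs finite_submultisets)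
  show "h 0 = \<zero>\<^bsub>P\<^esub>" by (rule ext) (simp add: h_def ev0 coeff_zero)
  show "h 1 = \<one>\<^bsub>P\<^esub>"
   by (rule ext) (simp add: h_def one_eq_mono mono_def lookup_one when_def ev0 ev_def evs)
  show "F * G \<in> S" if "F \<in> S" "G \<in> S" for F G
   using that keys_mult[of F G] unfolding S_def by fastforce
  show "F + G \<in> S" if "F \<in> S" "G \<in> S" for F G
   using that keys_add[of F G] unfolding S_def by fastforce
 qed (auto simp: S_def)
qed

sublocale P: plain_cring P
 by (intro plain_cring.intro cring_mvpoly)

lemma coeff_finsum:
 assumes "f \<in> A \<rightarrow> carrier P"
 shows "(\<Oplus>\<^bsub>P\<^esub>i\<in>A. f i) \<mu> = (\<Oplus>i\<in>A. f i \<mu>)"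
 using assms
proof (induction A rule: infinite_finite_induct)
 case (insert a A)
 then show ?case by (simp add: coeff_add coeff_closed Pi_def)
qed (simp_all add: coeff_zero)

lemma coeff_add_pow: "f \<in> carrier P \<Longrightarrow> add_pow P (n :: nat) f \<mu> = add_pow R n (f \<mu>)"
 by (induction n) (simp_all add: coeff_zero coeff_add coeff_closed)

lemma coeff_mono_mult:
 assumes "c \<in> carrier R" "set_mset \<mu> \<subseteq> I" "f \<in> carrier P"
 shows "(mono R c \<mu> \<otimes>\<^bsub>P\<^esub> f) \<nu> = (if \<mu> \<subseteq># \<nu> then c \<otimes> f (\<nu> - \<mu>) else \<zero>)"
proof -
 have "(mono R c \<mu> \<otimes>\<^bsub>P\<^esub> f) \<nu> = (\<Oplus>\<rho>\<in>{\<rho>. \<rho> \<subseteq># \<nu>}. if \<mu> = \<rho> then c \<otimes> f (\<nu> - \<rho>) else \<zero>)"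
  unfolding coeff_mult by (rule finsum_cong') (use assms in \<open>auto simp: mono_def coeff_closed\<close>)
 also have "\<dots> = (if \<mu> \<subseteq># \<nu> then c \<otimes> f (\<nu> - \<mu>) else \<zero>)"
  using finsum_delta[of "{\<rho>. \<rho> \<subseteq># \<nu>}" \<mu> "\<lambda>\<rho>. c \<otimes> f (\<nu> - \<rho>)"] assms
  by (simp add: finite_submultisets coeff_closed)
 finally show ?thesis .
qed

lemma mono_mult:
 assumes "c \<in> carrier R" "set_mset \<mu> \<subseteq> I" "d \<in> carrier R" "set_mset \<nu> \<subseteq> I"
 shows "mono R c \<mu> \<otimes>\<^bsub>P\<^esub> mono R d \<nu> = mono R (c \<otimes> d) (\<mu> + \<nu>)"
 by (rule ext) (subst coeff_mono_mult, use assms mono_closed in \<open>auto simp: mono_def subset_mset.le_iff_add\<close>)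

lemma mono_add: "mono R c \<mu> \<oplus>\<^bsub>P\<^esub> mono R d \<mu> = mono R (c \<oplus> d) \<mu>" if "c \<in> carrier R" "d \<in> carrier R"
 by (rule ext) (use that in \<open>simp add: coeff_add mono_def\<close>)

lemma poly_eq_finsum_mono:
 assumes f: "f \<in> carrier P"
 shows "f = (\<Oplus>\<^bsub>P\<^esub>\<mu>\<in>{\<mu>. f \<mu> \<noteq> \<zero>}. mono R (f \<mu>) \<mu>)"
proof (rule ext)
 fix \<nu>
 have fin: "finite {\<mu>. f \<mu> \<noteq> \<zero>}" using f by (simp add: carrier_mvpoly)
 have "(\<Oplus>\<^bsub>P\<^esub>\<mu>\<in>{\<mu>. f \<mu> \<noteq> \<zero>}. mono R (f \<mu>) \<mu>) \<nu> = (\<Oplus>\<mu>\<in>{\<mu>. f \<mu> \<noteq> \<zero>}. if \<nu> = \<mu> then f \<mu> else \<zero>)"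
  by (subst coeff_finsum) (use f in \<open>auto simp: carrier_mvpoly mono_def intro!: mono_closed\<close>)
 also have "\<dots> = f \<nu>"
  using finsum_delta[of "{\<mu>. f \<mu> \<noteq> \<zero>}" \<nu> f] fin f by (auto simp: carrier_mvpoly)
 finally show "f \<nu> = (\<Oplus>\<^bsub>P\<^esub>\<mu>\<in>{\<mu>. f \<mu> \<noteq> \<zero>}. mono R (f \<mu>) \<mu>) \<nu>" by simp
qed

end

interpretation int_mvpoly: mvpolys \<Z> "UNIV :: 'i set"
 by (intro mvpolys.intro plain_cring.intro int.is_cring)

lemma lookup_in_int_mvpoly [simp]: "lookup f \<in> carrier (mvpoly \<Z> (UNIV :: 'i set))"
 using finite_keys[of f] by (simp add: int_mvpoly.carrier_mvpoly keys.rep_eq)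

lemma int_mvpoly_cases:
 assumes "f \<in> carrier (mvpoly \<Z> (UNIV :: 'i set))"
 obtains F where "f = lookup F"
 using assms by (metis Collect_cong int_mvpoly.carrier_mvpoly int_zero_eq lookup_Abs_poly_mapping)

lemma lookup_hom:
 shows "lookup (f + g) = lookup f \<oplus>\<^bsub>mvpoly \<Z> (UNIV :: 'i set)\<^esub> lookup g"
  and "lookup (f * g) = lookup f \<otimes>\<^bsub>mvpoly \<Z> (UNIV :: 'i set)\<^esub> lookup g"
  and "lookup 1 = \<one>\<^bsub>mvpoly \<Z> (UNIV :: 'i set)\<^esub>"
  and "lookup 0 = \<zero>\<^bsub>mvpoly \<Z> (UNIV :: 'i set)\<^esub>"
 by (auto simp: fun_eq_iff int_mvpoly.coeff_add int_mvpoly.coeff_mult lookup_add lookup_times_multiset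
   int_finsum_eq int_mvpoly.one_eq_mono mono_def lookup_one when_def int_mvpoly.coeff_zero)

section \<open>The Dwork lemma\<close>

lemma freshman_dvd:
 fixes a b :: "'a::comm_ring_1"
 assumes "prime p"
 shows "of_nat p dvd (a + b) ^ p - a ^ p - b ^ p"
proof -
 have p: "p > 0" using assms by (rule prime_gt_0_nat)
 have "{..p} = insert 0 (insert p {0<..<p})" using p by auto
 then have "(a + b) ^ p = a ^ p + b ^ p + (\<Sum>k\<in>{0<..<p}. of_nat (p choose k) * a ^ k * b ^ (p - k))"
  using p by (simp add: binomial_ring)
 moreover have "of_nat p dvd (\<Sum>k\<in>{0<..<p}. of_nat (p choose k) * a ^ k * b ^ (p - k))"
 proof (rule dvd_sum)
  fix k assume "k \<in> {0<..<p}"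
  then have "p dvd p choose k" using assms by (intro dvd_choose_prime) auto
  then have "(of_nat p :: 'a) dvd of_nat (p choose k)" by (metis dvd_def of_nat_mult dvd_triv_left)
  then show "of_nat p dvd of_nat (p choose k) * a ^ k * b ^ (p - k)" by (simp add: dvd_mult2)
 qed
 ultimately show ?thesis by simp
qed

text \<open>Each step of the induction gains one factor p: x^p - y^p is x - y times a sum of p
  terms, all congruent to y^(p-1) modulo p, so this sum is itself divisible by p.\<close>

lemma dvd_power_prime_power:
 fixes a b :: "'a::comm_ring_1"
 assumes p: "prime p" and "of_nat p dvd a - b"
 shows "of_nat p ^ Suc k dvd a ^ (p ^ k) - b ^ (p ^ k)"
proof (induction k)
 case 0
 then show ?case using assms by simp
next
 case (Suc k)
 let ?x = "a ^ (p ^ k)" and ?y = "b ^ (p ^ k)"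
 have "?x ^ p - ?y ^ p = (?x - ?y) * (\<Sum>i<p. ?y ^ (p - Suc i) * ?x ^ i)"
  by (rule power_diff_sumr2)
 moreover have "of_nat p dvd (\<Sum>i<p. ?y ^ (p - Suc i) * ?x ^ i)"
 proof -
  have d: "of_nat p dvd ?x - ?y" using Suc by (metis dvd_mult_left power_Suc)
  have pw: "of_nat p dvd ?x ^ i - ?y ^ i" for i
  proof (induction i)
   case (Suc i)
   have "?x ^ Suc i - ?y ^ Suc i = (?x - ?y) * ?x ^ i + ?y * (?x ^ i - ?y ^ i)"
    by (simp add: algebra_simps)
   then show ?case using d Suc by (metis dvd_add dvd_mult dvd_mult2)
  qed simp
  have d1: "of_nat p dvd (\<Sum>i<p. ?y ^ (p - Suc i) * (?x ^ i - ?y ^ i))"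
   by (rule dvd_sum, rule dvd_mult, rule pw)
  have "(\<Sum>i<p. ?y ^ (p - Suc i) * ?y ^ i) = (\<Sum>i<p. ?y ^ (p - 1))"
   by (intro sum.cong) (auto simp flip: power_add)
  moreover have "(\<Sum>i<p. ?y ^ (p - Suc i) * ?x ^ i) =
    (\<Sum>i<p. ?y ^ (p - Suc i) * (?x ^ i - ?y ^ i)) + (\<Sum>i<p. ?y ^ (p - Suc i) * ?y ^ i)"
   by (simp add: right_diff_distrib sum_subtractf)
  moreover have "(\<Sum>i<p. ?y ^ (p - 1)) = of_nat p * ?y ^ (p - 1)" by simp
  ultimately have eq: "(\<Sum>i<p. ?y ^ (p - Suc i) * ?x ^ i) =
    (\<Sum>i<p. ?y ^ (p - Suc i) * (?x ^ i - ?y ^ i)) + of_nat p * ?y ^ (p - 1)" by (simp only:)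
  show ?thesis unfolding eq by (rule dvd_add[OF d1 dvd_triv_left])
 qed
 ultimately have "of_nat p ^ Suc k * of_nat p dvd ?x ^ p - ?y ^ p"
  using Suc by (simp add: mult_dvd_mono)
 then show ?case by (simp add: power_mult mult.commute flip: power_mult)
qed

text \<open>The typed counterpart of \<open>ghost\<close>, for rings in which divisibility arguments
  are carried out.\<close>

definition ghost_map :: "nat \<Rightarrow> (nat \<Rightarrow> 'a::comm_ring_1) \<Rightarrow> nat \<Rightarrow> 'a" where
 "ghost_map p x n = (\<Sum>i\<le>n. of_nat p ^ i * x i ^ (p ^ (n - i)))"

text \<open>The setting of Dwork's lemma. The lift \<phi> of the p-th power map describes the image
  of the ghost map by congruences, and the absence of p-torsion makes the ghost map
  injective.\<close>

locale frobenius_lift =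
 fixes p :: nat and \<phi> :: "'a::comm_ring_1 \<Rightarrow> 'a"
 assumes prime: "prime p"
  and frob_add: "\<phi> (a + b) = \<phi> a + \<phi> b"
  and frob_mult: "\<phi> (a * b) = \<phi> a * \<phi> b"
  and frob_one: "\<phi> 1 = 1"
  and frob_cong: "of_nat p dvd \<phi> a - a ^ p"
  and torsion_free: "of_nat p * a = 0 \<Longrightarrow> a = 0"
begin

lemma frob_zero: "\<phi> 0 = 0"
 using frob_add[of 0 0] by simp

lemma frob_uminus: "\<phi> (- a) = - \<phi> a"
 using frob_add[of a "- a"] by (simp add: frob_zero eq_neg_iff_add_eq_0 add.commute)

lemma frob_power: "\<phi> (a ^ n) = \<phi> a ^ n"
 by (induction n) (simp_all add: frob_one frob_mult)

lemma frob_of_nat: "\<phi> (of_nat n) = of_nat n"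
 by (induction n) (simp_all add: frob_zero frob_one frob_add)

lemma frob_sum: "\<phi> (sum f A) = (\<Sum>i\<in>A. \<phi> (f i))"
 by (induction A rule: infinite_finite_induct) (simp_all add: frob_zero frob_add)

lemma torsion_free_power:
 fixes a :: 'a
 shows "of_nat p ^ n * a = 0 \<Longrightarrow> a = 0"
proof (induction n)
 case (Suc n)
 then show ?case using torsion_free[of "of_nat p ^ n * a"] by (simp add: mult.assoc)
qed simp

lemma dvd_power_cancel:
 fixes a c :: 'a
 assumes "of_nat p ^ n * c dvd of_nat p ^ n * a"
 shows "c dvd a"
proof -
 note assms
 then obtain d where "of_nat p ^ n * a = of_nat p ^ n * c * d" by (auto simp: dvd_def)
 then have "of_nat p ^ n * (a - c * d) = 0" by (simp add: algebra_simps)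
 then show "c dvd a" using torsion_free_power by fastforce
qed

text \<open>These congruences turn out to cut out exactly the image of the ghost map. In this form
  it is visibly stable under the ring operations, because \<phi> respects them.\<close>

definition dwork :: "(nat \<Rightarrow> 'a) set" where
 "dwork = {w. \<forall>n. of_nat p ^ Suc n dvd w (Suc n) - \<phi> (w n)}"

lemma ghost_map_Suc:
 "ghost_map p x (Suc n) = ghost_map p (\<lambda>i. x i ^ p) n + of_nat p ^ Suc n * x (Suc n)"
proof -
 have "x i ^ (p ^ (Suc n - i)) = (x i ^ p) ^ (p ^ (n - i))" if "i \<le> n" for i
  using that by (simp add: Suc_diff_le flip: power_mult)
 then show ?thesis by (simp add: ghost_map_def)
qed

text \<open>Since x_i^p and \<phi>(x_i) agree modulo p, their p^(n-i)-th powers agree modulo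
  p^(n-i+1), and the factor p^i in the ghost component supplies the rest.\<close>

lemma frob_ghost_map: "of_nat p ^ Suc n dvd ghost_map p (\<lambda>i. x i ^ p) n - \<phi> (ghost_map p x n)"
proof -
 have "of_nat p ^ Suc n dvd of_nat p ^ i * (x i ^ p) ^ (p ^ (n - i)) - of_nat p ^ i * \<phi> (x i) ^ (p ^ (n - i))"
  if "i \<le> n" for i
 proof -
  have "of_nat p dvd x i ^ p - \<phi> (x i)"
   using frob_cong[of "x i"] by (metis dvd_minus_iff minus_diff_eq)
  then have "of_nat p ^ i * of_nat p ^ Suc (n - i) dvd
    of_nat p ^ i * ((x i ^ p) ^ (p ^ (n - i)) - \<phi> (x i) ^ (p ^ (n - i)))"
   by (intro mult_dvd_mono dvd_power_prime_power prime) auto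
  moreover have "(of_nat p :: 'a) ^ i * of_nat p ^ Suc (n - i) = of_nat p ^ Suc n"
   using that by (simp flip: power_Suc power_add)
  ultimately show ?thesis by (simp only: right_diff_distrib)
 qed
 then show ?thesis
  by (auto simp: ghost_map_def frob_sum frob_mult frob_power frob_of_nat sum_subtractf[symmetric]
    simp del: power_Suc intro!: dvd_sum)
qed

lemma ghost_map_in_dwork: "ghost_map p x \<in> dwork"
proof -
 have eq: "ghost_map p x (Suc n) - \<phi> (ghost_map p x n) =
   (ghost_map p (\<lambda>i. x i ^ p) n - \<phi> (ghost_map p x n)) + of_nat p ^ Suc n * x (Suc n)" for n
  by (simp add: ghost_map_Suc)
 show ?thesis unfolding dwork_def mem_Collect_eq eq
  by (intro allI dvd_add frob_ghost_map dvd_triv_left)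
qed

lemma ghost_map_split:
 "ghost_map p x n = of_nat p ^ n * x n + (\<Sum>i<n. of_nat p ^ i * x i ^ (p ^ (n - i)))"
 by (simp add: ghost_map_def lessThan_Suc_atMost[symmetric])

text \<open>The components are found one after another: given x_0, ..., x_(n-1), the Dwork
  congruence says that w_n minus their contribution is divisible by p^n, and x_n is the
  quotient.\<close>

lemma dwork_ghost_map:
 assumes w: "w \<in> dwork"
 shows "\<exists>x. ghost_map p x = w"
proof -
 define Q where "Q f n r \<longleftrightarrow> of_nat p ^ n * r + (\<Sum>i<n. of_nat p ^ i * f i ^ (p ^ (n - i))) = w n"
  for f :: "nat \<Rightarrow> 'a" and n r
 have "\<exists>f. \<forall>n. Q f n (f n)"
 proof (rule dependent_wellorder_choice)
  fix n :: nat and f :: "nat \<Rightarrow> 'a"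
  assume IH: "\<And>m. m < n \<Longrightarrow> Q f m (f m)"
  show "\<exists>r. Q f n r"
  proof (cases n)
   case (Suc m)
   have wm: "w m = ghost_map p f m" using IH[of m] Suc by (simp add: Q_def ghost_map_split)
   have "(\<Sum>i<n. of_nat p ^ i * f i ^ (p ^ (n - i))) = ghost_map p (\<lambda>i. f i ^ p) m"
    unfolding ghost_map_def Suc lessThan_Suc_atMost
    by (intro sum.cong) (auto simp: Suc_diff_le simp flip: power_mult)
   moreover have "of_nat p ^ n dvd w n - ghost_map p (\<lambda>i. f i ^ p) m"
   proof -
    have eq: "w n - ghost_map p (\<lambda>i. f i ^ p) m =
      (w n - \<phi> (w m)) - (ghost_map p (\<lambda>i. f i ^ p) m - \<phi> (ghost_map p f m))"
     by (simp add: wm)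
    show ?thesis unfolding eq
     using w frob_ghost_map[of m f] by (rule_tac dvd_diff) (simp_all add: dwork_def Suc del: power_Suc)
   qed
   ultimately show ?thesis unfolding Q_def dvd_def by (metis diff_add_cancel)
  qed (simp add: Q_def)
 next
  fix r :: 'a and f g :: "nat \<Rightarrow> 'a" and n :: nat
  assume "\<And>m. m < n \<Longrightarrow> f m = g m"
  then show "Q f n r = Q g n r" by (simp add: Q_def)
 qed
 then show ?thesis by (auto simp: Q_def fun_eq_iff ghost_map_split)
qed

text \<open>A difference in component n enters ghost component n with the factor p^n, while by
  induction the earlier components contribute only multiples of p^(n+1). So components modulo p can
  be read off from ghost components.\<close>

lemma ghost_map_cong_components:
 fixes x y :: "nat \<Rightarrow> 'a"
 assumes "\<And>n. of_nat p ^ Suc n dvd ghost_map p x n - ghost_map p y n"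
 shows "of_nat p dvd x n - y n"
proof (induction n rule: less_induct)
 case (less n)
 have "of_nat p ^ Suc n dvd of_nat p ^ i * x i ^ (p ^ (n - i)) - of_nat p ^ i * y i ^ (p ^ (n - i))"
  if "i < n" for i
 proof -
  have "of_nat p ^ i * of_nat p ^ Suc (n - i) dvd of_nat p ^ i * (x i ^ (p ^ (n - i)) - y i ^ (p ^ (n - i)))"
   using less that by (intro mult_dvd_mono dvd_power_prime_power prime) auto
  moreover have "(of_nat p :: 'a) ^ i * of_nat p ^ Suc (n - i) = of_nat p ^ Suc n"
   using that by (simp flip: power_Suc power_add)
  ultimately show ?thesis by (simp only: right_diff_distrib)
 qed
 then have "of_nat p ^ Suc n dvd
   (\<Sum>i<n. of_nat p ^ i * x i ^ (p ^ (n - i)) - of_nat p ^ i * y i ^ (p ^ (n - i)))"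
  by (intro dvd_sum) auto
 moreover have "ghost_map p x n - ghost_map p y n = of_nat p ^ n * (x n - y n) +
   (\<Sum>i<n. of_nat p ^ i * x i ^ (p ^ (n - i)) - of_nat p ^ i * y i ^ (p ^ (n - i)))"
  by (simp add: ghost_map_split sum_subtractf algebra_simps)
 ultimately have "of_nat p ^ Suc n dvd of_nat p ^ n * (x n - y n)"
  using assms[of n] by (simp del: power_Suc add: dvd_add_left_iff)
 then have "of_nat p ^ n * of_nat p dvd of_nat p ^ n * (x n - y n)" by (simp add: mult.commute)
 then show ?case by (rule dvd_power_cancel)
qed

lemma ghost_map_inj_prefix:
 fixes x y :: "nat \<Rightarrow> 'a"
 assumes "\<And>n. n < N \<Longrightarrow> ghost_map p x n = ghost_map p y n" and "n < N"
 shows "x n = y n"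
 using assms(2)
proof (induction n rule: less_induct)
 case (less n)
 have "(\<Sum>i<n. of_nat p ^ i * x i ^ (p ^ (n - i))) = (\<Sum>i<n. of_nat p ^ i * y i ^ (p ^ (n - i)))"
  using less by (intro sum.cong) auto
 then have "of_nat p ^ n * (x n - y n) = 0"
  using assms(1)[OF less.prems] by (simp add: ghost_map_split right_diff_distrib)
 then show ?case using torsion_free_power by fastforce
qed

lemma ghost_map_inj:
 fixes x y :: "nat \<Rightarrow> 'a"
 shows "ghost_map p x = ghost_map p y \<Longrightarrow> x = y"
 using ghost_map_inj_prefix[of "Suc n" x y n for n] by (auto simp: fun_eq_iff)

lemma dwork_closed:
 shows "0 \<in> dwork" "1 \<in> dwork" "w \<in> dwork \<Longrightarrow> w' \<in> dwork \<Longrightarrow> w + w' \<in> dwork"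
  "w \<in> dwork \<Longrightarrow> w' \<in> dwork \<Longrightarrow> w * w' \<in> dwork" "w \<in> dwork \<Longrightarrow> - w \<in> dwork"
proof -
 show "0 \<in> dwork" "1 \<in> dwork"
  by (simp_all add: dwork_def frob_zero frob_one)
 show "w + w' \<in> dwork" if "w \<in> dwork" "w' \<in> dwork"
  using that by (auto simp: dwork_def frob_add add_diff_add simp del: power_Suc intro!: dvd_add)
 show "w * w' \<in> dwork" if "w \<in> dwork" "w' \<in> dwork"
 proof -
  have "of_nat p ^ Suc n dvd w (Suc n) * w' (Suc n) - \<phi> (w n) * \<phi> (w' n)" for n
  proof -
   have "w (Suc n) * w' (Suc n) - \<phi> (w n) * \<phi> (w' n) =
     (w (Suc n) - \<phi> (w n)) * w' (Suc n) + \<phi> (w n) * (w' (Suc n) - \<phi> (w' n))"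
    by (simp add: algebra_simps)
   then show ?thesis using that unfolding dwork_def
    by (simp del: power_Suc add: dvd_add dvd_mult dvd_mult2)
  qed
  then show ?thesis by (simp add: dwork_def frob_mult del: power_Suc)
 qed
 show "- w \<in> dwork" if "w \<in> dwork"
 proof -
  have eq: "(- w) (Suc n) - \<phi> ((- w) n) = - (w (Suc n) - \<phi> (w n))" for n
   by (simp add: frob_uminus)
  show ?thesis using that unfolding dwork_def mem_Collect_eq eq dvd_minus_iff .
 qed
qed

end

section \<open>The Frobenius lift on integral polynomials\<close>

text \<open>A ring type as a record, so that evaluation of integral polynomials and its lemmas apply
  to typed rings too.\<close>

definition univ_ring :: "'a::comm_ring_1 ring" where
 "univ_ring = \<lparr>carrier = UNIV, mult = times, one = 1, zero = 0, add = (+)\<rparr>"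

lemma univ_ring_simps [simp]:
 "carrier univ_ring = UNIV" "mult univ_ring = times" "one univ_ring = 1" "zero univ_ring = 0" "add univ_ring = (+)"
 by (simp_all add: univ_ring_def)

interpretation univ: plain_cring univ_ring
 by (rule plain_cring.intro, rule cring_image[where h="\<lambda>x. x" and S=UNIV]) auto

lemma univ_ring_pow [simp]: "x [^]\<^bsub>univ_ring\<^esub> (n::nat) = x ^ n"
 by (induction n) (simp_all add: mult.commute)

lemma univ_ring_add_pow [simp]: "add_pow univ_ring (n::nat) x = of_nat n * x"
 by (induction n) (simp_all add: algebra_simps)

lemma univ_ring_minus [simp]: "\<ominus>\<^bsub>univ_ring\<^esub> x = - x"
 by (rule univ.minus_equality) auto

lemma univ_ring_add_pow_int [simp]: "add_pow univ_ring (c::int) x = of_int c * x"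
 by (cases "c \<ge> 0") (simp_all add: add_pow_int_ge add_pow_int_lt)

definition poly_eval :: "('i \<Rightarrow> 'a::comm_ring_1) \<Rightarrow> ('i multiset \<Rightarrow>\<^sub>0 int) \<Rightarrow> 'a" where
 "poly_eval x f = int_poly_eval univ_ring x (lookup f)"

lemma poly_eval_hom:
 "poly_eval x (f + g) = poly_eval x f + poly_eval x g"
 "poly_eval x (f * g) = poly_eval x f * poly_eval x g"
 "poly_eval x 0 = 0" "poly_eval x 1 = 1"
 "poly_eval x (f ^ n) = poly_eval x f ^ n"
 "poly_eval x (of_nat n) = of_nat n"
 "poly_eval x (single {#i#} 1) = x i"
 "poly_eval x (single {#} c) = of_int c"
 using univ.int_poly_eval_of_nat_mult[of x n 1] univ.int_poly_eval_var[of x i]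
 by (simp_all add: poly_eval_def univ.int_poly_eval_add univ.int_poly_eval_mult univ.int_poly_eval_zero
  univ.int_poly_eval_one univ.int_poly_eval_power univ.int_poly_eval_single[where \<mu>="{#}"])

lemma int_poly_induct [case_names const var add mult]:
 assumes "\<And>c. P (single {#} c)" "\<And>i. P (single {#i#} 1)"
  "\<And>f g. P f \<Longrightarrow> P g \<Longrightarrow> P (f + g)" "\<And>f g. P f \<Longrightarrow> P g \<Longrightarrow> P (f * g)"
 shows "P (f :: 'i multiset \<Rightarrow>\<^sub>0 int)"
proof (induction f rule: poly_mapping_additive_induct)
 case (single \<mu> c)
 show ?case
 proof (induction \<mu>)
  case (add i \<mu>)
  have "single (add_mset i \<mu>) c = single {#i#} 1 * single \<mu> c" by (simp add: mult_single)
  then show ?case using assms add by metis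
 qed (rule assms)
qed (use assms assms(1)[of 0] in auto)

lemma fermat_int: "prime p \<Longrightarrow> int p dvd c ^ p - c"
proof (induction c rule: int_induct[where k=0])
 case base
 then show ?case using prime_gt_0_nat[of p] by (simp add: zero_power)
next
 case (step1 i)
 have eq: "(i + 1) ^ p - (i + 1) = ((i + 1) ^ p - i ^ p - 1 ^ p) + (i ^ p - i)" by simp
 show ?case unfolding eq using freshman_dvd[of p i 1] step1 by (rule_tac dvd_add) auto
next
 case (step2 i)
 have eq: "(i - 1) ^ p - (i - 1) = (i ^ p - i) - (((i - 1) + 1) ^ p - (i - 1) ^ p - 1 ^ p)" by simp
 show ?case unfolding eq using freshman_dvd[of p "i - 1" 1] step2 by (rule_tac dvd_diff) auto
qed

text \<open>The endomorphism raises every variable to its p-th power. The congruence with the p-th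
  power map holds for constants by Fermat's little theorem, and it passes to sums because the mixed
  binomial coefficients are divisible by p.\<close>

lemma frobenius_lift_poly:
 assumes p: "prime p"
 shows "frobenius_lift p (poly_eval (\<lambda>i. single {#i#} 1 ^ p) :: ('i multiset \<Rightarrow>\<^sub>0 int) \<Rightarrow> _)"
proof
 let ?\<phi> = "poly_eval (\<lambda>i. single {#i#} 1 ^ p) :: ('i multiset \<Rightarrow>\<^sub>0 int) \<Rightarrow> ('i multiset \<Rightarrow>\<^sub>0 int)"
 show "of_nat p dvd ?\<phi> a - a ^ p" for a
 proof (induction a rule: int_poly_induct)
  case (const c)
  have "single {#} c ^ n = single {#} (c ^ n)" for n :: nat
   by (induction n) (simp_all add: mult_single)
  moreover have "single ({#} :: 'i multiset) (c :: int) = of_int c" for c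
   by (rule poly_mapping_eqI) (simp add: lookup_of_int lookup_single when_def)
  moreover obtain d where "c ^ p - c = int p * d" using fermat_int[OF p, of c] by (auto simp: dvd_def)
  then have "(of_int (c - c ^ p) :: 'i multiset \<Rightarrow>\<^sub>0 int) = of_nat p * of_int (- d)"
   by (metis minus_diff_eq mult_minus_right of_int_mult of_int_of_nat_eq)
  moreover have "?\<phi> (single {#} c) = of_int c" by (rule poly_eval_hom)
  ultimately show ?case
   by simp
 next
  case (var i)
  then show ?case by (simp add: poly_eval_hom)
 next
  case (add f g)
  have "?\<phi> (f + g) - (f + g) ^ p = (?\<phi> f - f ^ p) + (?\<phi> g - g ^ p) - ((f + g) ^ p - f ^ p - g ^ p)"
   by (simp add: poly_eval_hom)
  then show ?case using add freshman_dvd[OF p, of f g] by (simp only: dvd_add dvd_diff)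
 next
  case (mult f g)
  have "?\<phi> (f * g) - (f * g) ^ p = (?\<phi> f - f ^ p) * ?\<phi> g + f ^ p * (?\<phi> g - g ^ p)"
   by (simp add: poly_eval_hom power_mult_distrib algebra_simps)
  then show ?case using mult by (simp only: dvd_add dvd_mult dvd_mult2)
 qed
 show "a = 0" if "of_nat p * a = 0" for a :: "'i multiset \<Rightarrow>\<^sub>0 int"
 proof (rule poly_mapping_eqI)
  fix \<mu>
  have "lookup (of_nat n * a) \<mu> = int n * lookup a \<mu>" for n
   by (induction n) (simp_all add: lookup_add distrib_right)
  then show "lookup a \<mu> = lookup 0 \<mu>"
   using that p by (metis lookup_zero mult_eq_0_iff of_nat_eq_0_iff prime_gt_0_nat less_numeral_extra(3))
 qed
qed (use p in \<open>auto simp: poly_eval_hom\<close>)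

section \<open>The ring of Witt vectors\<close>

lemma ghost_map_hom:
 assumes "\<And>a b. h (a + b) = h a + h b" "\<And>a b. h (a * b) = h a * h b" "h 1 = 1" "h 0 = 0"
 shows "ghost_map p (\<lambda>i. h (x i)) n = h (ghost_map p x n)"
proof -
 have pw: "h (a ^ m) = h a ^ m" for a m by (induction m) (simp_all add: assms)
 have nt: "h (of_nat m) = of_nat m" for m by (induction m) (simp_all add: assms)
 have "h (sum f A) = (\<Sum>i\<in>A. h (f i))" if "finite A" for f :: "nat \<Rightarrow> 'a" and A
  using that by induction (simp_all add: assms)
 then show ?thesis by (simp add: ghost_map_def assms pw nt)
qed

lemma ghost_lookup:
 "ghost p (mvpoly \<Z> (UNIV :: 'i set)) (\<lambda>i. lookup (x i)) n = lookup (ghost_map p x n)"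
proof -
 have pw: "lookup f [^]\<^bsub>mvpoly \<Z> (UNIV :: 'i set)\<^esub> (m::nat) = lookup (f ^ m)" for f :: "'i multiset \<Rightarrow>\<^sub>0 int" and m
  by (induction m) (simp_all add: lookup_hom int_mvpoly.P.m_comm flip: lookup_hom(2,3))
 have ap: "add_pow (mvpoly \<Z> (UNIV :: 'i set)) (m::nat) (lookup f) = lookup (of_nat m * f)"
  for f :: "'i multiset \<Rightarrow>\<^sub>0 int" and m
  by (induction m) (simp_all add: distrib_right int_mvpoly.P.a_comm lookup_hom(1) flip: lookup_hom(4))
 have sm: "(\<Oplus>\<^bsub>mvpoly \<Z> (UNIV :: 'i set)\<^esub>i\<in>A. lookup (f i)) = lookup (sum f A)" if "finite A"
  for f :: "nat \<Rightarrow> 'i multiset \<Rightarrow>\<^sub>0 int" and A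
  using that
 proof induction
  case (insert a A)
  then show ?case
   by (subst int_mvpoly.P.finsum_insert) (auto simp: lookup_hom(1))
 qed (simp add: lookup_hom(4)[symmetric] del: lookup_zero_fun)
 show ?thesis
  unfolding ghost_def ghost_map_def pw ap by (subst sm) simp_all
qed

text \<open>A solution of the ghost equations of \<open>witt_universal\<close> among finitely
  supported functions; Dwork's lemma guarantees that there is one.\<close>

definition witt_poly_op :: "nat \<Rightarrow> ((nat \<Rightarrow> (nat + nat) multiset \<Rightarrow>\<^sub>0 int) \<Rightarrow> (nat \<Rightarrow> (nat + nat) multiset \<Rightarrow>\<^sub>0 int)
  \<Rightarrow> (nat \<Rightarrow> (nat + nat) multiset \<Rightarrow>\<^sub>0 int)) \<Rightarrow> nat \<Rightarrow> (nat + nat) multiset \<Rightarrow>\<^sub>0 int" where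
 "witt_poly_op p opf = (SOME S. ghost_map p S =
   opf (ghost_map p (\<lambda>i. single {#Inl i#} 1)) (ghost_map p (\<lambda>i. single {#Inr i#} 1)))"

context
 fixes p :: nat
 assumes p: "prime p"
begin

lemma ghost_witt_poly_op:
 assumes "opf = (+) \<or> opf = times"
 shows "ghost_map p (witt_poly_op p opf) =
   opf (ghost_map p (\<lambda>i. single {#Inl i#} 1)) (ghost_map p (\<lambda>i. single {#Inr i#} 1))"
proof -
 interpret frobenius_lift p "poly_eval (\<lambda>i. single {#i#} 1 ^ p) :: ((nat+nat) multiset \<Rightarrow>\<^sub>0 int) \<Rightarrow> _"
  by (rule frobenius_lift_poly[OF p])
 have "opf (ghost_map p (\<lambda>i. single {#Inl i#} 1)) (ghost_map p (\<lambda>i. single {#Inr i#} 1)) \<in> dwork"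
  using assms dwork_closed(3,4) ghost_map_in_dwork by auto
 from dwork_ghost_map[OF this] show ?thesis
  unfolding witt_poly_op_def by (rule someI_ex)
qed

text \<open>The definite description in \<open>witt_universal\<close> denotes something: existence
  is Dwork's lemma over the integral polynomial ring, uniqueness is injectivity of the ghost map.
  Only now can the operations of \<open>witt_ring\<close> be computed with.\<close>

lemma witt_universal_eq:
 assumes opf: "opf = (+) \<and> opn = add int_mvpoly \<or> opf = times \<and> opn = mult int_mvpoly"
 shows "witt_universal p opn n = lookup (witt_poly_op p opf n)"
proof -
 interpret frobenius_lift p "poly_eval (\<lambda>i. single {#i#} 1 ^ p) :: ((nat+nat) multiset \<Rightarrow>\<^sub>0 int) \<Rightarrow> _"
  by (rule frobenius_lift_poly[OF p])
 have var: "ring.indexed_var \<Z> i = lookup (single {#i#} (1::int))" for i :: "nat + nat"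
  by (rule ext) (simp add: int.indexed_var_eq_mono mono_def lookup_single when_def)
 have rhs: "opn (ghost p int_mvpoly (\<lambda>i. ring.indexed_var \<Z> (Inl i)) n)
      (ghost p int_mvpoly (\<lambda>i. ring.indexed_var \<Z> (Inr i)) n) = lookup (ghost_map p (witt_poly_op p opf) n)" for n
  unfolding var ghost_lookup using opf ghost_witt_poly_op[of opf] by (auto simp: lookup_hom)
 have "witt_universal p opn = (\<lambda>n. lookup (witt_poly_op p opf n))"
  unfolding witt_universal_def rhs
 proof (rule the_equality)
  fix S assume S: "\<forall>n. S n \<in> carrier int_mvpoly \<and> ghost p int_mvpoly S n = lookup (ghost_map p (witt_poly_op p opf) n)"
  then have "\<forall>n. \<exists>F. S n = lookup F" by (metis int_mvpoly_cases)
  then obtain F where F: "S = (\<lambda>n. lookup (F n))" by metis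
  have "ghost_map p F = ghost_map p (witt_poly_op p opf)"
   using S by (auto simp: F ghost_lookup fun_eq_iff poly_mapping_eq_iff)
  then show "S = (\<lambda>n. lookup (witt_poly_op p opf n))"
   using ghost_map_inj F by blast
 qed (simp add: ghost_lookup)
 then show ?thesis by simp
qed

end

locale witt = plain_cring K for K :: "'k ring" (structure) +
 fixes p :: nat
 assumes p: "prime p"
begin

abbreviation "W \<equiv> witt_ring p K"

abbreviation "incl \<equiv> \<lambda>a. if a \<in> carrier K then a else \<zero>"

text \<open>The variables are named by the elements of K, so this maps a ring without p-torsion that
  carries a Frobenius lift onto K. Identities between Witt vectors over K are proved by lifting to
  this ring and comparing ghost components.\<close>

definition red :: "('k multiset \<Rightarrow>\<^sub>0 int) \<Rightarrow> 'k" where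
 "red f = int_poly_eval K incl (lookup f)"

lemma incl_closed: "incl a \<in> carrier K" by simp

lemma red_hom:
 "red (f + g) = red f \<oplus> red g" "red (f * g) = red f \<otimes> red g" "red 0 = \<zero>" "red 1 = \<one>"
 "red f \<in> carrier K" "red (f ^ n) = red f [^] n" "red (f - g) = red f \<ominus> red g"
 by (simp_all add: red_def int_poly_eval_add[where x=incl, OF incl_closed] int_poly_eval_mult[where x=incl, OF incl_closed]
  int_poly_eval_one[where x=incl, OF incl_closed] int_poly_eval_zero[where x=incl, OF incl_closed]
  int_poly_eval_power[where x=incl, OF incl_closed] int_poly_eval_closed[where x=incl, OF incl_closed] int_poly_eval_diff[where x=incl, OF incl_closed])

lemma red_of_nat_mult: "red (of_nat n * f) = add_pow K n (red f)"
 by (simp only: red_def int_poly_eval_of_nat_mult[where x=incl, OF incl_closed])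

lemma red_var: "a \<in> carrier K \<Longrightarrow> red (single {#a#} 1) = a"
 unfolding red_def by (subst int_poly_eval_var[where x=incl, OF incl_closed]) simp

sublocale fl: frobenius_lift p "poly_eval (\<lambda>i. single {#i#} 1 ^ p) :: ('k multiset \<Rightarrow>\<^sub>0 int) \<Rightarrow> _"
 by (rule frobenius_lift_poly[OF p])

lemma ex_ghost_map_op:
 fixes x y :: "nat \<Rightarrow> 'k multiset \<Rightarrow>\<^sub>0 int"
 shows "\<exists>z :: nat \<Rightarrow> 'k multiset \<Rightarrow>\<^sub>0 int. ghost_map p z = ghost_map p x + ghost_map p y"
  and "\<exists>z :: nat \<Rightarrow> 'k multiset \<Rightarrow>\<^sub>0 int. ghost_map p z = ghost_map p x * ghost_map p y"
 by (intro fl.dwork_ghost_map fl.dwork_closed(3,4) fl.ghost_map_in_dwork)+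

definition reduce :: "(nat \<Rightarrow> 'k multiset \<Rightarrow>\<^sub>0 int) \<Rightarrow> nat \<Rightarrow> 'k" where
 "reduce x = (\<lambda>n. red (x n))"

lemma carrier_W: "carrier W = UNIV \<rightarrow> carrier K"
 by (simp add: witt_ring_def)

lemma reduce_closed: "reduce x \<in> carrier W"
 by (simp add: carrier_W reduce_def red_hom)

text \<open>The universal polynomials at (x, y) solve the ghost equation that characterises z, so
  their values are z by injectivity of the ghost map. Reduction commutes with evaluation, hence Witt
  operations on reductions are reductions of the lifted operations.\<close>

lemma reduce_op:
 fixes x y z :: "nat \<Rightarrow> 'k multiset \<Rightarrow>\<^sub>0 int"
  and opf :: "(nat \<Rightarrow> (nat + nat) multiset \<Rightarrow>\<^sub>0 int) \<Rightarrow> (nat \<Rightarrow> (nat + nat) multiset \<Rightarrow>\<^sub>0 int) \<Rightarrow> _"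
 assumes opf: "opf = (+) \<and> opn = add int_mvpoly \<or> opf = times \<and> opn = mult int_mvpoly"
  and z: "ghost_map p z = opg (ghost_map p x) (ghost_map p y)"
  and opg: "opf = (+) \<and> opg = (+) \<or> opf = times \<and> opg = times"
 shows "int_poly_eval K (case_sum (reduce x) (reduce y)) (witt_universal p opn n) = reduce z n"
proof -
 let ?S = "witt_poly_op p opf"
 let ?xy = "case_sum x y"
 have "ghost_map p (\<lambda>n. poly_eval ?xy (?S n)) = opg (ghost_map p x) (ghost_map p y)"
 proof
  fix n
  have 1: "ghost_map p (\<lambda>i. poly_eval ?xy (f i)) n = poly_eval ?xy (ghost_map p f n)"
   for f :: "nat \<Rightarrow> (nat+nat) multiset \<Rightarrow>\<^sub>0 int"
   by (rule ghost_map_hom) (simp_all add: poly_eval_hom)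
  have 2: "ghost_map p (\<lambda>i. poly_eval ?xy (single {#Inl i#} 1)) = ghost_map p x"
   "ghost_map p (\<lambda>i. poly_eval ?xy (single {#Inr i#} 1)) = ghost_map p y"
   unfolding poly_eval_hom by simp_all
  have g: "ghost_map p ?S = opf (ghost_map p (\<lambda>i. single {#Inl i#} 1)) (ghost_map p (\<lambda>i. single {#Inr i#} 1))"
   using opf by (intro ghost_witt_poly_op[OF p]) auto
  show "ghost_map p (\<lambda>n. poly_eval ?xy (?S n)) n = opg (ghost_map p x) (ghost_map p y) n"
   unfolding 1 g using opg by (auto simp: poly_eval_hom 1[symmetric] 2)
 qed
 then have zeq: "z = (\<lambda>n. poly_eval ?xy (?S n))"
  using z fl.ghost_map_inj by metis
 have hom: "red \<in> ring_hom univ_ring K"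
  by (rule ring_hom_memI) (simp_all add: red_hom)
 have "red (int_poly_eval univ_ring ?xy (lookup (?S n))) = int_poly_eval K (red \<circ> ?xy) (lookup (?S n))"
  by (rule int_poly_eval_hom[OF hom univ.is_cring is_cring]) simp
 moreover have "red \<circ> ?xy = case_sum (reduce x) (reduce y)"
  by (rule ext) (simp add: reduce_def split: sum.split)
 ultimately show ?thesis
  by (simp add: zeq reduce_def poly_eval_def witt_universal_eq[OF p opf])
qed

lemma reduce_add: "ghost_map p z = ghost_map p x + ghost_map p y \<Longrightarrow> reduce x \<oplus>\<^bsub>W\<^esub> reduce y = reduce z"
 using reduce_op[of "(+)" "add int_mvpoly" z "(+)" x y] by (auto simp: witt_ring_def fun_eq_iff)

lemma reduce_mult: "ghost_map p z = ghost_map p x * ghost_map p y \<Longrightarrow> reduce x \<otimes>\<^bsub>W\<^esub> reduce y = reduce z"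
 using reduce_op[of "times" "mult int_mvpoly" z "times" x y] by (auto simp: witt_ring_def fun_eq_iff)

lemma reduce_zero: "reduce (\<lambda>_. 0) = \<zero>\<^bsub>W\<^esub>"
 by (simp add: reduce_def witt_ring_def red_hom)

lemma reduce_teich: "a \<in> carrier K \<Longrightarrow> reduce (\<lambda>n. if n = 0 then single {#a#} 1 else 0) = (\<lambda>n. if n = 0 then a else \<zero>)"
 by (rule ext) (simp add: reduce_def red_hom red_var)

lemma reduce_one: "reduce (\<lambda>n. if n = 0 then 1 else 0) = \<one>\<^bsub>W\<^esub>"
 by (rule ext) (simp add: reduce_def witt_ring_def red_hom)

lemma ghost_map_teich: "ghost_map p (\<lambda>n. if n = 0 then a else 0) n = a ^ (p ^ n)"
proof -
 have "ghost_map p (\<lambda>n. if n = 0 then a else 0) n = (\<Sum>i\<le>n. if i = 0 then a ^ (p ^ n) else 0)"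
  unfolding ghost_map_def using p by (intro sum.cong) (auto simp: prime_gt_0_nat zero_power)
 then show ?thesis by simp
qed

lemma ghost_map_zero: "ghost_map p (\<lambda>_. 0) = 0"
 using p by (auto simp: ghost_map_def fun_eq_iff prime_gt_0_nat zero_power)

definition lift :: "(nat \<Rightarrow> 'k) \<Rightarrow> nat \<Rightarrow> 'k multiset \<Rightarrow>\<^sub>0 int" where
 "lift u = (\<lambda>n. single {#u n#} 1)"

lemma reduce_lift: "u \<in> carrier W \<Longrightarrow> reduce (lift u) = u"
 by (rule ext) (auto simp: reduce_def lift_def carrier_W Pi_iff red_var)

text \<open>A sequence that satisfies the Dwork congruences is the ghost vector of exactly one
  sequence of components, whose reduction is its image in W. These sequences form a subring of a
  product ring, and \<open>cring_image\<close> transports the axioms.\<close>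

lemma cring_W: "cring W"
proof -
 define h where "h w = reduce (SOME x. ghost_map p x = w)" for w
 have h: "h (ghost_map p x) = reduce x" for x
  unfolding h_def by (metis (mono_tags, lifting) fl.ghost_map_inj someI)
 show ?thesis
 proof (rule cring_image[of W h fl.dwork])
  show "carrier W = h ` fl.dwork"
  proof (intro equalityI subsetI)
   fix u assume "u \<in> carrier W"
   then show "u \<in> h ` fl.dwork"
    using h[of "lift u"] reduce_lift fl.ghost_map_in_dwork by (metis imageI)
  next
   fix u assume "u \<in> h ` fl.dwork"
   then show "u \<in> carrier W" by (auto simp: h_def reduce_closed)
  qed
  show "h (w + w') = h w \<oplus>\<^bsub>W\<^esub> h w'" "h (w * w') = h w \<otimes>\<^bsub>W\<^esub> h w'"
   if w: "w \<in> fl.dwork" "w' \<in> fl.dwork" for w w'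
  proof -
   obtain x y where xy: "w = ghost_map p x" "w' = ghost_map p y"
    using fl.dwork_ghost_map[OF w(1)] fl.dwork_ghost_map[OF w(2)] by blast
   obtain z z' where z: "ghost_map p z = w + w'" "ghost_map p z' = w * w'"
    using ex_ghost_map_op(1,2)[of x y] xy by blast
   show "h (w + w') = h w \<oplus>\<^bsub>W\<^esub> h w'" "h (w * w') = h w \<otimes>\<^bsub>W\<^esub> h w'"
    using reduce_add[of z x y] reduce_mult[of z' x y] z xy h by metis+
  qed
  show "h 0 = \<zero>\<^bsub>W\<^esub>" using h reduce_zero ghost_map_zero by metis
  have "ghost_map p (\<lambda>n. if n = 0 then 1 else 0 :: 'k multiset \<Rightarrow>\<^sub>0 int) = 1"
   by (rule ext) (simp add: ghost_map_teich)
  then show "h 1 = \<one>\<^bsub>W\<^esub>" using h reduce_one by metis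
 qed (rule fl.dwork_closed; assumption)+
qed

sublocale W: plain_cring W
 by (intro plain_cring.intro cring_W)

section \<open>Teichmueller representatives and agreement of components\<close>

definition teich :: "'k \<Rightarrow> nat \<Rightarrow> 'k" where
 "teich a = (\<lambda>n. if n = 0 then a else \<zero>)"

lemma teich_closed [simp]: "a \<in> carrier K \<Longrightarrow> teich a \<in> carrier W"
 by (simp add: teich_def carrier_W)

lemma teich_0 [simp]: "teich a 0 = a"
 by (simp add: teich_def)

lemma teich_zero: "teich \<zero> = \<zero>\<^bsub>W\<^esub>"
 by (simp add: teich_def witt_ring_def)

lemma teich_one: "teich \<one> = \<one>\<^bsub>W\<^esub>"
 by (simp add: teich_def witt_ring_def)

text \<open>The ghost components of (a, 0, 0, ...) are the powers a^(p^n), which are multiplicative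
  in a.\<close>

lemma teich_mult:
 assumes "a \<in> carrier K" "b \<in> carrier K"
 shows "teich (a \<otimes> b) = teich a \<otimes>\<^bsub>W\<^esub> teich b"
proof -
 let ?t = "\<lambda>f n. if n = (0::nat) then f else (0 :: 'k multiset \<Rightarrow>\<^sub>0 int)"
 have "ghost_map p (?t (single {#a#} 1 * single {#b#} 1)) = ghost_map p (?t (single {#a#} 1)) * ghost_map p (?t (single {#b#} 1))"
  by (rule ext) (simp add: ghost_map_teich power_mult_distrib)
 from reduce_mult[OF this] have "reduce (?t (single {#a#} 1)) \<otimes>\<^bsub>W\<^esub> reduce (?t (single {#b#} 1)) =
  reduce (?t (single {#a#} 1 * single {#b#} 1))" .
 moreover have "reduce (?t (single {#a#} 1 * single {#b#} 1)) = teich (a \<otimes> b)"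
  by (rule ext) (use assms in \<open>simp add: reduce_def teich_def red_hom(2,3) red_var del: mult_single\<close>)
 ultimately show ?thesis using assms by (simp only: reduce_teich teich_def)
qed

lemma teich_pow: "a \<in> carrier K \<Longrightarrow> teich (a [^] (n::nat)) = teich a [^]\<^bsub>W\<^esub> n"
 by (induction n) (simp_all add: teich_one teich_mult)

lemma component0_hom: "(\<lambda>u. u 0) \<in> ring_hom W K"
proof (rule ring_hom_memI)
 fix u v assume uv: "u \<in> carrier W" "v \<in> carrier W"
 show "u 0 \<in> carrier K" using uv by (auto simp: carrier_W)
 obtain z z' where z: "ghost_map p z = ghost_map p (lift u) + ghost_map p (lift v)"
   "ghost_map p z' = ghost_map p (lift u) * ghost_map p (lift v)"
  using ex_ghost_map_op(1,2)[of "lift u" "lift v"] by blast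
 have "z 0 = lift u 0 + lift v 0" "z' 0 = lift u 0 * lift v 0"
  using fun_cong[OF z(1), of 0] fun_cong[OF z(2), of 0] by (simp_all add: ghost_map_def)
 then show "(u \<oplus>\<^bsub>W\<^esub> v) 0 = u 0 \<oplus> v 0" "(u \<otimes>\<^bsub>W\<^esub> v) 0 = u 0 \<otimes> v 0"
  using reduce_add[OF z(1)] reduce_mult[OF z(2)] reduce_lift uv
  by (metis reduce_def red_hom(1,2))+
qed (simp add: witt_ring_def)

text \<open>A lift of v with j leading zeros has j vanishing ghost components. So the sum and u
  share their first j ghost components, and these determine the first j components.\<close>

lemma add_agree:
 assumes "u \<in> carrier W" "v \<in> carrier W" "\<And>i. i < j \<Longrightarrow> v i = \<zero>"
 shows "i < j \<Longrightarrow> (u \<oplus>\<^bsub>W\<^esub> v) i = u i"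
proof -
 assume i: "i < j"
 define y where "y n = (if n < j then 0 else lift v n)" for n
 have y: "reduce y = v"
  using assms reduce_lift[of v] by (auto simp: y_def reduce_def fun_eq_iff red_hom)
 obtain z where z: "ghost_map p z = ghost_map p (lift u) + ghost_map p y"
  using ex_ghost_map_op(1)[of "lift u" y] by blast
 have y0: "ghost_map p y n = 0" if "n < j" for n
  using that p by (auto simp: ghost_map_def y_def prime_gt_0_nat zero_power)
 have "z i = lift u i"
  by (rule fl.ghost_map_inj_prefix[of j z "lift u", OF _ i]) (simp add: z y0)
 then show ?thesis
  using reduce_add[OF z] reduce_lift[OF assms(1)] y by (metis reduce_def)
qed

lemma agree_diff:
 assumes "u \<in> carrier W" "v \<in> carrier W" "\<And>i. i < j \<Longrightarrow> u i = v i" "i < j"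
 shows "(u \<ominus>\<^bsub>W\<^esub> v) i = \<zero>"
proof -
 obtain z where z: "ghost_map p z = ghost_map p (lift u) + - ghost_map p (lift v)"
  using fl.dwork_ghost_map[OF fl.dwork_closed(3)[OF fl.ghost_map_in_dwork fl.dwork_closed(5)[OF fl.ghost_map_in_dwork]]] by blast
 then have "ghost_map p (lift u) = ghost_map p z + ghost_map p (lift v)" by simp
 from reduce_add[OF this[symmetric, THEN sym]] have zv: "reduce z \<oplus>\<^bsub>W\<^esub> v = u"
  using reduce_lift[OF assms(1)] reduce_lift[OF assms(2)] by simp
 have d: "u \<ominus>\<^bsub>W\<^esub> v = reduce z" unfolding zv[symmetric]
  using assms reduce_closed[of z] by (simp add: W.minus_eq W.a_assoc W.r_neg)
 have uv0: "ghost_map p (lift u) n = ghost_map p (lift v) n" if "n < j" for n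
  using that assms(3) by (auto simp: ghost_map_def lift_def intro!: sum.cong)
 have "z i = (\<lambda>_. 0) i"
  by (rule fl.ghost_map_inj_prefix[of j z "\<lambda>_. 0", OF _ assms(4)]) (simp add: z ghost_map_zero uv0)
 then show ?thesis by (simp add: d reduce_def red_hom)
qed

end

section \<open>Witt vectors of a finite field\<close>

lemma ring_hom_cringI':
 "cring R \<Longrightarrow> cring S \<Longrightarrow> h \<in> ring_hom R S \<Longrightarrow> ring_hom_cring R S h"
 by (simp add: ring_hom_cring_def ring_hom_cring_axioms_def)

lemma (in ring) zero_pow: "0 < n \<Longrightarrow> \<zero> [^] (n :: nat) = \<zero>"
 by (cases n) auto

locale finite_witt = witt K p for K :: "'k ring" (structure) and p +
 fixes r :: nat
 assumes field_K: "field K" and finite_K: "finite (carrier K)" and card_K: "card (carrier K) = p ^ r"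
begin

sublocale K: field K by (rule field_K)

lemma q_gt_1: "p ^ r > 1"
proof -
 have "card {\<zero>, \<one>} \<le> card (carrier K)" by (intro card_mono finite_K) auto
 then show ?thesis using K.one_not_zero card_K by auto
qed

lemma r_pos: "r > 0"
 using q_gt_1 by (cases r) auto

lemma add_pow_nat_mult: "a \<in> carrier K \<Longrightarrow> add_pow K (n :: nat) a = add_pow K n \<one> \<otimes> a"
 by (simp add: add_pow_ldistr)

text \<open>Lagrange's theorem for the additive group gives p^r times 1 = 0, and in a field this
  element is the r-th power of p times 1.\<close>

lemma char_K: "a \<in> carrier K \<Longrightarrow> add_pow K p a = \<zero>"
proof -
 have "\<one> [^]\<^bsub>add_monoid K\<^esub> Coset.order (add_monoid K) = \<one>\<^bsub>add_monoid K\<^esub>"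
  by (rule group.pow_order_eq_1[OF a_group]) simp
 then have 0: "add_pow K (p ^ r) \<one> = \<zero>"
  by (simp add: add_pow_def Coset.order_def card_K)
 have pw: "add_pow K (p ^ i) \<one> = add_pow K p \<one> [^] i" for i
 proof (induction i)
  case (Suc i)
  have "add_pow K (p ^ Suc i) \<one> = add_pow K p (add_pow K (p ^ i) \<one>)"
   by (simp add: add.nat_pow_pow mult.commute)
  also have "\<dots> = add_pow K p \<one> \<otimes> add_pow K (p ^ i) \<one>"
   by (rule add_pow_nat_mult) simp
  finally show ?case using Suc by (simp add: m_comm)
 qed simp
 have "add_pow K p \<one> = \<zero>"
 proof (rule ccontr)
  assume nz: "add_pow K p \<one> \<noteq> \<zero>"
  have "add_pow K p \<one> [^] i \<noteq> \<zero>" for i :: nat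
  proof (induction i)
   case (Suc i)
   then show ?case using nz K.integral[of "add_pow K p \<one> [^] i" "add_pow K p \<one>"] by auto
  qed simp
  from this[of r] show False using pw[of r] 0 by metis
 qed
 then show "a \<in> carrier K \<Longrightarrow> add_pow K p a = \<zero>" using add_pow_nat_mult[of a p] by simp
qed

lemma pow_q: "a \<in> carrier K \<Longrightarrow> a [^] (p ^ r) = a"
proof (cases "a = \<zero>")
 case True
 moreover have "0 < p ^ r" using q_gt_1 by linarith
 ultimately show ?thesis by (simp only: zero_pow)
next
 case False
 assume a: "a \<in> carrier K"
 interpret U: group "units_of K" by (rule units_group)
 have aU: "a \<in> carrier (units_of K)" using a False by (simp add: units_of_carrier K.field_Units)
 have "a [^]\<^bsub>units_of K\<^esub> Coset.order (units_of K) = \<one>\<^bsub>units_of K\<^esub>"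
  by (rule U.pow_order_eq_1[OF aU])
 moreover have "Coset.order (units_of K) = p ^ r - 1"
  by (simp add: Coset.order_def units_of_carrier K.field_Units card_K[symmetric] finite_K)
 ultimately have "a [^] (p ^ r - 1) = \<one>"
  using aU by (simp add: units_of_pow units_of_carrier units_of_one)
 then have "a [^] Suc (p ^ r - 1) = a" using a by simp
 moreover have "Suc (p ^ r - 1) = p ^ r" using q_gt_1 by linarith
 ultimately show ?thesis by (simp only:)
qed

lemma pow_q_pow: "a \<in> carrier K \<Longrightarrow> a [^] (p ^ (r * c)) = a"
proof (induction c)
 case (Suc c)
 have "a [^] (p ^ (r * Suc c)) = (a [^] (p ^ r)) [^] (p ^ (r * c))"
  using Suc.prems by (simp add: nat_pow_pow power_add)
 then show ?case using Suc pow_q by simp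
qed simp

lemma pow_pow_inj:
 assumes "a \<in> carrier K" "b \<in> carrier K" "a [^] (p ^ j) = b [^] (p ^ j)"
 shows "a = b"
proof -
 \<comment> \<open>The exponent r (j + 1) is a multiple of r and at least j, as r > 0. So c is
   recovered from its p^j-th power by raising to a further power of p.\<close>
 have j: "r * Suc j = j + (r * Suc j - j)" using r_pos by (simp add: mult_eq_if)
 have "c = (c [^] (p ^ j)) [^] (p ^ (r * Suc j - j))" if "c \<in> carrier K" for c
  using pow_q_pow[OF that, of "Suc j"] that
  by (subst (asm) j) (simp only: power_add nat_pow_pow)
 then show ?thesis using assms by metis
qed

lemma pow_pow_surj:
 assumes "a \<in> carrier K"
 obtains b where "b \<in> carrier K" "b [^] (p ^ j) = a"
proof -
 have j: "r * Suc j = (r * Suc j - j) + j" using r_pos by (simp add: mult_eq_if)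
 have "(a [^] (p ^ (r * Suc j - j))) [^] (p ^ j) = a"
  using pow_q_pow[OF assms, of "Suc j"] assms
  by (subst (asm) j) (simp only: power_add nat_pow_pow)
 then show ?thesis using assms by (intro that) auto
qed

text \<open>In characteristic p, multiplication by p is the shift combined with p-th powers. For
  lifts, the shifted vector \<open>y\<close> has as ghost components p times those of u up to a
  multiple of p^(n+1), and such an error does not affect the components modulo p.\<close>

lemma p_times:
 assumes u: "u \<in> carrier W"
 shows "add_pow W p u = (\<lambda>n. case n of 0 \<Rightarrow> \<zero> | Suc m \<Rightarrow> u m [^] p)"
proof -
 let ?x = "lift u"
 have "\<exists>z :: nat \<Rightarrow> 'k multiset \<Rightarrow>\<^sub>0 int.
   ghost_map p z = (\<lambda>n. of_nat m * ghost_map p ?x n) \<and> reduce z = add_pow W m u" for m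
 proof (induction m)
  case 0
  show ?case by (rule exI[of _ "\<lambda>_. 0"]) (simp add: ghost_map_zero reduce_zero zero_fun_def)
 next
  case (Suc m)
  then obtain z :: "nat \<Rightarrow> 'k multiset \<Rightarrow>\<^sub>0 int"
   where z: "ghost_map p z = (\<lambda>n. of_nat m * ghost_map p ?x n)" "reduce z = add_pow W m u" by blast
  obtain z' :: "nat \<Rightarrow> 'k multiset \<Rightarrow>\<^sub>0 int" where z': "ghost_map p z' = ghost_map p z + ghost_map p ?x"
   using ex_ghost_map_op(1)[of z ?x] by blast
  have "ghost_map p z' = (\<lambda>n. of_nat (Suc m) * ghost_map p ?x n)"
   by (rule ext) (simp add: z' z(1) algebra_simps)
  moreover have "reduce z' = add_pow W (Suc m) u"
   using reduce_add[OF z'] z(2) reduce_lift[OF u] by simp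
  ultimately show ?case by blast
 qed
 from this[of p] obtain z :: "nat \<Rightarrow> 'k multiset \<Rightarrow>\<^sub>0 int"
  where z: "ghost_map p z = (\<lambda>n. of_nat p * ghost_map p ?x n)" "reduce z = add_pow W p u" by blast
 define y :: "nat \<Rightarrow> 'k multiset \<Rightarrow>\<^sub>0 int" where "y n = (case n of 0 \<Rightarrow> 0 | Suc m \<Rightarrow> ?x m ^ p)" for n
 have gy: "ghost_map p y n = of_nat p * ghost_map p ?x n - of_nat p ^ Suc n * ?x n" for n
 proof (cases n)
  case 0
  then show ?thesis using p by (simp add: ghost_map_def y_def)
 next
  case (Suc m)
  have "ghost_map p y n = (\<Sum>i\<le>Suc m. of_nat p ^ i * y i ^ (p ^ (Suc m - i)))"
   by (simp add: ghost_map_def Suc)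
  also have "\<dots> = y 0 ^ (p ^ Suc m) + (\<Sum>i\<le>m. of_nat p ^ Suc i * y (Suc i) ^ (p ^ (m - i)))"
   by (subst sum.atMost_Suc_shift) simp
  also have "y 0 ^ (p ^ Suc m) = 0" using p by (simp add: y_def prime_gt_0_nat zero_power)
  also have "(\<Sum>i\<le>m. of_nat p ^ Suc i * y (Suc i) ^ (p ^ (m - i))) =
    of_nat p * (\<Sum>i\<le>m. of_nat p ^ i * ?x i ^ (p ^ (n - i)))"
   unfolding sum_distrib_left
   by (intro sum.cong) (auto simp: y_def Suc Suc_diff_le mult.assoc simp flip: power_mult)
  finally show ?thesis
   by (simp add: fl.ghost_map_split[of ?x "Suc m"] Suc lessThan_Suc_atMost algebra_simps)
 qed
 have "red (z n) = red (y n)" for n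
 proof -
  have "of_nat p dvd z n - y n"
   by (rule fl.ghost_map_cong_components) (simp add: z(1) gy)
  then obtain d where "z n - y n = of_nat p * d" by (auto simp: dvd_def)
  then have "z n = y n + of_nat p * d" by (simp add: algebra_simps)
  then have "red (z n) = red (y n) \<oplus> add_pow K p (red d)" by (simp only: red_hom(1) red_of_nat_mult)
  then show ?thesis by (simp add: char_K red_hom)
 qed
 then have "add_pow W p u = reduce y"
  unfolding z(2)[symmetric] by (simp add: reduce_def)
 also have "\<dots> = (\<lambda>n. case n of 0 \<Rightarrow> \<zero> | Suc m \<Rightarrow> u m [^] p)"
  using u by (auto simp: reduce_def y_def red_hom lift_def red_var carrier_W Pi_iff fun_eq_iff split: nat.split)
 finally show ?thesis .
qed

lemma p_power_times:
 assumes u: "u \<in> carrier W"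
 shows "add_pow W (p ^ j) u = (\<lambda>n. if n < j then \<zero> else u (n - j) [^] (p ^ j))"
proof (induction j)
 case 0
 then show ?case using u by (auto simp: fun_eq_iff carrier_W Pi_iff)
next
 case (Suc j)
 have u': "u n \<in> carrier K" for n using u by (auto simp: carrier_W)
 have "add_pow W (p ^ Suc j) u = add_pow W p (add_pow W (p ^ j) u)"
  using u by (simp add: W.add.nat_pow_pow mult.commute)
 also have "\<dots> = (\<lambda>n. if n < Suc j then \<zero> else u (n - Suc j) [^] (p ^ Suc j))"
  using u u' p by (subst p_times)
   (auto simp: Suc carrier_W fun_eq_iff nat_pow_pow zero_pow prime_gt_0_nat mult.commute split: nat.split)
 finally show ?case .
qed

lemma W_zero: "\<zero>\<^bsub>W\<^esub> = (\<lambda>_. \<zero>)"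
 by (simp add: witt_ring_def)

text \<open>K is perfect: the entries of a vector with j leading zeros are p^j-th powers, which
  allows division by p^j. Hence reduction modulo p^j amounts to truncation after j
  components.\<close>

lemma p_power_times_iff:
 assumes x: "x \<in> carrier W"
 shows "(\<exists>u\<in>carrier W. x = add_pow W (p ^ j) u) \<longleftrightarrow> (\<forall>i<j. x i = \<zero>)"
proof
 assume "\<forall>i<j. x i = \<zero>"
 have "\<forall>n. \<exists>b. b \<in> carrier K \<and> b [^] (p ^ j) = x (n + j)"
  using x pow_pow_surj by (auto simp: carrier_W Pi_iff) metis
 then obtain u where u: "\<And>n. u n \<in> carrier K" "\<And>n. u n [^] (p ^ j) = x (n + j)" by metis
 have "u \<in> carrier W" using u by (simp add: carrier_W)
 moreover have "x = add_pow W (p ^ j) u"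
  unfolding p_power_times[OF \<open>u \<in> carrier W\<close>] using u \<open>\<forall>i<j. x i = \<zero>\<close> by (auto simp: fun_eq_iff)
 ultimately show "\<exists>u\<in>carrier W. x = add_pow W (p ^ j) u" by blast
qed (auto simp: p_power_times)

section \<open>Truncated Witt vectors of a finite field\<close>

abbreviation "J \<equiv> witt_ideal p K"
abbreviation "A \<equiv> witt_trunc p K"
abbreviation "pr \<equiv> witt_proj p K"

lemma witt_ideal_iff: "x \<in> J j \<longleftrightarrow> x \<in> carrier W \<and> (\<forall>i<j. x i = \<zero>)"
proof -
 have "u \<otimes>\<^bsub>W\<^esub> add_pow W (p ^ j) \<one>\<^bsub>W\<^esub> = add_pow W (p ^ j) u" if "u \<in> carrier W" for u
  using that by (simp add: W.add_pow_rdistr)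
 then have "x \<in> J j \<longleftrightarrow> (\<exists>u\<in>carrier W. x = add_pow W (p ^ j) u)"
  by (simp add: witt_ideal_def cgenideal_def) metis
 then show ?thesis using p_power_times_iff[of x j] by auto
qed

lemma ideal_J: "ideal (J j) W"
 unfolding witt_ideal_def by (rule W.cgenideal_ideal) simp

lemma ring_hom_pr: "pr j \<in> ring_hom W (A j)"
 using ideal.rcos_ring_hom[OF ideal_J] by (simp add: witt_trunc_def witt_proj_def[abs_def])

lemma cring_A: "cring (A j)"
 unfolding witt_trunc_def by (rule ideal.quotient_is_cring[OF ideal_J W.is_cring])

lemma carrier_A: "carrier (A j) = pr j ` carrier W"
 by (auto simp: witt_trunc_def FactRing_def A_RCOSETS_def' witt_proj_def)

text \<open>This is the working description of truncated Witt vectors: a coset modulo p^j is known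
  by the first j components of any representative.\<close>

lemma pr_eq_iff:
 assumes "a \<in> carrier W" "b \<in> carrier W"
 shows "pr j a = pr j b \<longleftrightarrow> (\<forall>i<j. a i = b i)"
proof -
 have "pr j a = pr j b \<longleftrightarrow> a \<ominus>\<^bsub>W\<^esub> b \<in> J j"
  using W.quotient_eq_iff_same_a_r_cos[OF ideal_J assms(1,2)] by (simp add: witt_proj_def)
 also have "\<dots> \<longleftrightarrow> (\<forall>i<j. a i = b i)"
 proof
  assume "a \<ominus>\<^bsub>W\<^esub> b \<in> J j"
  then have d: "a \<ominus>\<^bsub>W\<^esub> b \<in> carrier W" "\<And>i. i < j \<Longrightarrow> (a \<ominus>\<^bsub>W\<^esub> b) i = \<zero>" by (auto simp: witt_ideal_iff)
  have "b \<oplus>\<^bsub>W\<^esub> (a \<ominus>\<^bsub>W\<^esub> b) = a" using assms by (simp add: W.minus_eq W.a_lcomm W.r_neg)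
  then show "\<forall>i<j. a i = b i" using add_agree[OF assms(2) d] by auto
 next
  assume "\<forall>i<j. a i = b i"
  then show "a \<ominus>\<^bsub>W\<^esub> b \<in> J j" using agree_diff[OF assms] assms by (auto simp: witt_ideal_iff)
 qed
 finally show ?thesis .
qed

lemma in_pr_iff:
 assumes "a \<in> carrier W"
 shows "b \<in> pr j a \<longleftrightarrow> b \<in> carrier W \<and> (\<forall>i<j. b i = a i)"
proof
 interpret J: ideal "J j" W by (rule ideal_J)
 assume "b \<in> pr j a"
 moreover from this have b: "b \<in> carrier W"
  using assms W.a_r_coset_subset_G[of "J j" a] J.a_subset by (auto simp: witt_proj_def)
 ultimately have "pr j a = pr j b"
  using W.a_repr_independence[of b "J j" a] assms J.a_subgroup by (auto simp: witt_proj_def)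
 then show "b \<in> carrier W \<and> (\<forall>i<j. b i = a i)" using pr_eq_iff assms b by auto
next
 interpret J: ideal "J j" W by (rule ideal_J)
 assume b: "b \<in> carrier W \<and> (\<forall>i<j. b i = a i)"
 then have "pr j b = pr j a" using pr_eq_iff assms by auto
 moreover have "b \<in> pr j b" using b J.a_rcos_self[of b] by (auto simp: witt_proj_def)
 ultimately show "b \<in> pr j a" by simp
qed

lemma residue_pr: "a \<in> carrier W \<Longrightarrow> j > 0 \<Longrightarrow> witt_residue (pr j a) = a 0"
 unfolding witt_residue_def by (rule the_equality) (auto simp: in_pr_iff)

text \<open>The union in \<open>witt_shift\<close> collapses: representatives that share their first
  j components have p^d-fold multiples that share the first j + d.\<close>

lemma shift_pr:
 assumes "a \<in> carrier W"
 shows "witt_shift p K j d (pr j a) = pr (j + d) (add_pow W (p ^ d) a)"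
proof -
 have "pr (j + d) (add_pow W (p ^ d) b) = pr (j + d) (add_pow W (p ^ d) a)" if "b \<in> pr j a" for b
 proof -
  have b: "b \<in> carrier W" "\<And>i. i < j \<Longrightarrow> b i = a i" using that assms by (auto simp: in_pr_iff)
  show ?thesis
   unfolding pr_eq_iff[OF W.add.nat_pow_closed[OF b(1)] W.add.nat_pow_closed[OF assms]]
   using b assms by (auto simp: p_power_times)
 qed
 moreover have "a \<in> pr j a" using assms by (simp add: in_pr_iff)
 ultimately show ?thesis unfolding witt_shift_def by blast
qed

lemma lift_exists:
 assumes "c \<in> carrier K" "j > 0"
 shows "witt_lift p K j c \<in> carrier (A j)" "witt_residue (witt_lift p K j c) = c"
proof -
 have "\<exists>a. a \<in> carrier (A j) \<and> witt_residue a = c"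
  using assms by (intro exI[of _ "pr j (teich c)"]) (auto simp: carrier_A residue_pr)
 from someI_ex[OF this] show "witt_lift p K j c \<in> carrier (A j)" "witt_residue (witt_lift p K j c) = c"
  unfolding witt_lift_def by auto
qed

text \<open>Multiplying u by the Teichmueller representative of the inverse of its residue gives 1 -
  t with t divisible by p. The geometric series in t converges, as t^j has j leading zeros, and its
  sum inverts 1 - t.\<close>

lemma Units_W:
 assumes u: "u \<in> carrier W" and u0: "u 0 \<noteq> \<zero>"
 shows "u \<in> Units W"
proof -
 have u0': "u 0 \<in> carrier K" using u by (auto simp: carrier_W)
 interpret c0: ring_hom_cring W K "\<lambda>u. u 0"
  by (intro ring_hom_cringI' W.is_cring is_cring component0_hom)
 let ?y = "teich (inv (u 0))"
 have iv: "inv (u 0) \<in> carrier K" "u 0 \<otimes> inv (u 0) = \<one>" using u0 u0' K.field_Units by auto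
 define t where "t = \<one>\<^bsub>W\<^esub> \<ominus>\<^bsub>W\<^esub> (u \<otimes>\<^bsub>W\<^esub> ?y)"
 have t: "t \<in> carrier W" using u iv by (simp add: t_def)
 have "t 0 = \<zero>" using u iv by (simp add: t_def W.minus_eq r_neg)
 then obtain t' where t': "t' \<in> carrier W" "t = add_pow W p t'"
  using p_power_times_iff[OF t, of 1] by auto
 have tp: "t [^]\<^bsub>W\<^esub> j = add_pow W (p ^ j) (t' [^]\<^bsub>W\<^esub> j)" for j :: nat
 proof (induction j)
  case (Suc j)
  have "t [^]\<^bsub>W\<^esub> Suc j = add_pow W (p ^ j) (t' [^]\<^bsub>W\<^esub> j) \<otimes>\<^bsub>W\<^esub> add_pow W p t'"
   using Suc t' by simp
  also have "\<dots> = add_pow W (p ^ Suc j) (t' [^]\<^bsub>W\<^esub> Suc j)"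
   using t'(1) by (simp add: W.add_pow_ldistr W.add_pow_rdistr W.add.nat_pow_pow mult.commute)
  finally show ?case .
 qed simp
 have tz: "(t [^]\<^bsub>W\<^esub> j) i = \<zero>" if "i < j" for i j
  unfolding tp using that t'(1) by (simp add: p_power_times)
 define s where "s j = (\<Oplus>\<^bsub>W\<^esub>i\<in>{..<j}. t [^]\<^bsub>W\<^esub> i)" for j :: nat
 have s: "s j \<in> carrier W" for j using t by (simp add: s_def)
 have s_Suc: "s (Suc j) = s j \<oplus>\<^bsub>W\<^esub> t [^]\<^bsub>W\<^esub> j" for j
  using t s by (simp add: s_def lessThan_Suc W.a_comm)
 have agree: "s (j + d) i = s j i" if "i < j" for i j d
 proof (induction d)
  case (Suc d)
  have "(s (j + d) \<oplus>\<^bsub>W\<^esub> t [^]\<^bsub>W\<^esub> (j + d)) i = s (j + d) i"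
   by (rule add_agree[of _ _ "j + d"]) (use s t that tz in auto)
  then show ?case using Suc by (simp add: s_Suc)
 qed simp
 \<comment> \<open>Component i of the partial sums is constant from index i + 1 on, so this diagonal
   is their limit.\<close>
 define l where "l i = s (Suc i) i" for i
 have l: "l \<in> carrier W" using s by (simp add: l_def carrier_W Pi_iff)
 have l_agree: "pr j l = pr j (s j)" for j
 proof -
  have "l i = s j i" if "i < j" for i
   using agree[of i "Suc i" "j - Suc i"] that by (simp add: l_def)
  then show ?thesis using l s by (subst pr_eq_iff) auto
 qed
 have geo: "(\<one>\<^bsub>W\<^esub> \<ominus>\<^bsub>W\<^esub> t) \<otimes>\<^bsub>W\<^esub> s j \<oplus>\<^bsub>W\<^esub> t [^]\<^bsub>W\<^esub> j = \<one>\<^bsub>W\<^esub>" for j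
 proof (induction j)
  case 0
  then show ?case using t by (simp add: s_def)
 next
  case (Suc j)
  have "(\<one>\<^bsub>W\<^esub> \<ominus>\<^bsub>W\<^esub> t) \<otimes>\<^bsub>W\<^esub> (S \<oplus>\<^bsub>W\<^esub> T) \<oplus>\<^bsub>W\<^esub> T \<otimes>\<^bsub>W\<^esub> t = (\<one>\<^bsub>W\<^esub> \<ominus>\<^bsub>W\<^esub> t) \<otimes>\<^bsub>W\<^esub> S \<oplus>\<^bsub>W\<^esub> T"
   if "S \<in> carrier W" "T \<in> carrier W" for S T
  proof -
   have "(\<one>\<^bsub>W\<^esub> \<ominus>\<^bsub>W\<^esub> t) \<otimes>\<^bsub>W\<^esub> T \<oplus>\<^bsub>W\<^esub> T \<otimes>\<^bsub>W\<^esub> t = (\<one>\<^bsub>W\<^esub> \<ominus>\<^bsub>W\<^esub> t \<oplus>\<^bsub>W\<^esub> t) \<otimes>\<^bsub>W\<^esub> T"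
    using that t by (subst W.l_distr) (simp_all add: W.m_comm[of T t])
   also have "\<dots> = T" using that t by (simp add: W.minus_eq W.a_assoc W.l_neg)
   finally show ?thesis using that t by (simp add: W.r_distr W.a_assoc)
  qed
  then show ?case using Suc s t by (simp add: s_Suc)
 qed
 have "(\<one>\<^bsub>W\<^esub> \<ominus>\<^bsub>W\<^esub> t) \<otimes>\<^bsub>W\<^esub> l = \<one>\<^bsub>W\<^esub>"
 proof
  fix i
  let ?j = "Suc i"
  interpret pr: ring_hom_cring W "A ?j" "pr ?j"
   by (intro ring_hom_cringI' W.is_cring cring_A ring_hom_pr)
  have "pr ?j ((\<one>\<^bsub>W\<^esub> \<ominus>\<^bsub>W\<^esub> t) \<otimes>\<^bsub>W\<^esub> l) = pr ?j ((\<one>\<^bsub>W\<^esub> \<ominus>\<^bsub>W\<^esub> t) \<otimes>\<^bsub>W\<^esub> s ?j)"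
   using t l s l_agree by simp
  then have "((\<one>\<^bsub>W\<^esub> \<ominus>\<^bsub>W\<^esub> t) \<otimes>\<^bsub>W\<^esub> l) i = ((\<one>\<^bsub>W\<^esub> \<ominus>\<^bsub>W\<^esub> t) \<otimes>\<^bsub>W\<^esub> s ?j) i"
   using t l s by (subst (asm) pr_eq_iff) auto
  moreover have "((\<one>\<^bsub>W\<^esub> \<ominus>\<^bsub>W\<^esub> t) \<otimes>\<^bsub>W\<^esub> s ?j \<oplus>\<^bsub>W\<^esub> t [^]\<^bsub>W\<^esub> ?j) i = ((\<one>\<^bsub>W\<^esub> \<ominus>\<^bsub>W\<^esub> t) \<otimes>\<^bsub>W\<^esub> s ?j) i"
   by (rule add_agree[of _ _ ?j])
    (use s t tz[of _ ?j] in \<open>auto simp del: W.nat_pow_Suc nat_pow_Suc\<close>)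
  ultimately show "((\<one>\<^bsub>W\<^esub> \<ominus>\<^bsub>W\<^esub> t) \<otimes>\<^bsub>W\<^esub> l) i = \<one>\<^bsub>W\<^esub> i"
   by (simp only: geo)
 qed
 moreover have "\<one>\<^bsub>W\<^esub> \<ominus>\<^bsub>W\<^esub> t = u \<otimes>\<^bsub>W\<^esub> ?y"
  using u iv by (simp add: t_def W.minus_eq W.minus_add W.a_assoc[symmetric] W.r_neg)
 ultimately have "u \<otimes>\<^bsub>W\<^esub> (?y \<otimes>\<^bsub>W\<^esub> l) = \<one>\<^bsub>W\<^esub>" using u iv l by (simp add: W.m_assoc)
 then show ?thesis using u iv l unfolding Units_def
  by (auto intro!: bexI[of _ "?y \<otimes>\<^bsub>W\<^esub> l"] simp: W.m_comm[of _ u])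
qed

end

section \<open>Congruences modulo powers of p\<close>

context plain_cring
begin

text \<open>Polynomial identities in two variables hold in every commutative ring, because they hold in
 the integral polynomial ring.\<close>

lemma binomial:
 assumes "a \<in> carrier R" "b \<in> carrier R"
 shows "(a \<oplus> b) [^] (m::nat) = (\<Oplus>i\<in>{..m}. add_pow R (m choose i) (a [^] i \<otimes> b [^] (m - i)))"
proof -
 let ?x = "\<lambda>i. if i then a else b"
 have x: "?x i \<in> carrier R" for i using assms by simp
 let ?X = "single {#True#} 1" and ?Y = "single {#False#} 1 :: bool multiset \<Rightarrow>\<^sub>0 int"
 note var = int_poly_eval_var[where x="?x", OF x]
 have "int_poly_eval R ?x (lookup ((?X + ?Y) ^ m)) =
   int_poly_eval R ?x (lookup (\<Sum>i\<in>{..m}. of_nat (m choose i) * (?X ^ i * ?Y ^ (m - i))))"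
  by (simp add: binomial_ring mult.assoc)
 then show ?thesis
  unfolding int_poly_eval_sum[where x="?x", OF x finite_atMost] int_poly_eval_of_nat_mult[where x="?x", OF x]
  by (simp only: int_poly_eval_mult[where x="?x", OF x] int_poly_eval_power[where x="?x", OF x]
   int_poly_eval_add[where x="?x", OF x] var if_True if_False)
qed

lemma power_prime_power_cong:
 assumes "prime (p :: nat)" "a \<in> carrier R" "c \<in> carrier R"
 shows "\<exists>d\<in>carrier R. (a \<oplus> add_pow R p c) [^] (p ^ k) = a [^] (p ^ k) \<oplus> add_pow R (p ^ Suc k) d"
proof -
 let ?x = "\<lambda>i. if i then a else c"
 have x: "?x i \<in> carrier R" for i using assms by simp
 let ?X = "single {#True#} 1" and ?Y = "single {#False#} 1 :: bool multiset \<Rightarrow>\<^sub>0 int"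
 note var = int_poly_eval_var[where x="?x", OF x]
 have "of_nat p ^ Suc k dvd (?X + of_nat p * ?Y) ^ (p ^ k) - ?X ^ (p ^ k)"
  by (rule dvd_power_prime_power[OF assms(1)]) simp
 then obtain D where "(?X + of_nat p * ?Y) ^ (p ^ k) - ?X ^ (p ^ k) = of_nat p ^ Suc k * D" by (rule dvdE)
 then have "(?X + of_nat p * ?Y) ^ (p ^ k) = ?X ^ (p ^ k) + of_nat (p ^ Suc k) * D"
  by (simp add: algebra_simps)
 then have "int_poly_eval R ?x (lookup ((?X + of_nat p * ?Y) ^ (p ^ k))) =
   int_poly_eval R ?x (lookup (?X ^ (p ^ k) + of_nat (p ^ Suc k) * D))" by simp
 then have "(a \<oplus> add_pow R p c) [^] (p ^ k) = a [^] (p ^ k) \<oplus> add_pow R (p ^ Suc k) (int_poly_eval R ?x (lookup D))"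
  by (simp only: int_poly_eval_of_nat_mult[where x="?x", OF x]
   int_poly_eval_power[where x="?x", OF x] int_poly_eval_add[where x="?x", OF x] var if_True if_False)
 then show ?thesis using int_poly_eval_closed[where x="?x", OF x] by blast
qed

text \<open>The mixed coefficients are written as a quotient by p times p, because later only p
  times a mixed product is shown to lie in the span of Teichmueller powers.\<close>

lemma power_prime_add:
 assumes "prime (p :: nat)" "a \<in> carrier R" "b \<in> carrier R"
 shows "(a \<oplus> b) [^] p = a [^] p \<oplus> b [^] p \<oplus>
  (\<Oplus>i\<in>{0<..<p}. add_pow R ((p choose i) div p) (add_pow R p (a [^] i \<otimes> b [^] (p - i))))"
proof -
 have p: "p > 0" using assms(1) by (rule prime_gt_0_nat)
 have S: "{..p} = insert 0 (insert p {0<..<p})" using p by auto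
 have "(\<Oplus>i\<in>{0<..<p}. add_pow R (p choose i) (a [^] i \<otimes> b [^] (p - i))) =
  (\<Oplus>i\<in>{0<..<p}. add_pow R ((p choose i) div p) (add_pow R p (a [^] i \<otimes> b [^] (p - i))))"
 proof (rule finsum_cong')
  fix i assume "i \<in> {0<..<p}"
  then have "p dvd p choose i" using assms(1) by (intro dvd_choose_prime) auto
  then show "add_pow R (p choose i) (a [^] i \<otimes> b [^] (p - i)) =
   add_pow R ((p choose i) div p) (add_pow R p (a [^] i \<otimes> b [^] (p - i)))"
   using assms by (simp add: add.nat_pow_pow)
 qed (use assms in auto)
 then show ?thesis
  unfolding binomial[OF assms(2,3)] S using p assms by (simp add: a_ac)
qed

end

context finite_witt
begin

lemma frob_add: "a \<in> carrier K \<Longrightarrow> b \<in> carrier K \<Longrightarrow> (a \<oplus> b) [^] (p ^ n) = a [^] (p ^ n) \<oplus> b [^] (p ^ n)"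
proof (induction n)
 case (Suc n)
 have z: "(\<Oplus>i\<in>{0<..<p}. add_pow K ((p choose i) div p) (add_pow K p (f i))) = \<zero>"
  if "\<And>i. f i \<in> carrier K" for f
  using that by (intro finsum_all0) (simp add: char_K)
 have "(a \<oplus> b) [^] (p ^ Suc n) = ((a \<oplus> b) [^] (p ^ n)) [^] p"
  using Suc.prems by (simp add: nat_pow_pow mult.commute)
 also have "\<dots> = (a [^] (p ^ n)) [^] p \<oplus> (b [^] (p ^ n)) [^] p"
  using Suc by (simp add: power_prime_add[OF p] z)
 finally show ?case using Suc.prems by (simp add: nat_pow_pow mult.commute)
qed simp

text \<open>Two lifts of one residue differ by a multiple of p, and the power p^k improves a
  congruence modulo p to one modulo p^(k+1). So the law \<tau> does not depend on the lift.\<close>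

lemma power_cong:
 assumes "a \<in> carrier W" "b \<in> carrier W" "a 0 = b 0"
 shows "pr (Suc k) (a [^]\<^bsub>W\<^esub> (p ^ k)) = pr (Suc k) (b [^]\<^bsub>W\<^esub> (p ^ k))"
proof -
 have "(a \<ominus>\<^bsub>W\<^esub> b) 0 = \<zero>" using agree_diff[of a b 1 0] assms by simp
 then obtain c where c: "c \<in> carrier W" "a \<ominus>\<^bsub>W\<^esub> b = add_pow W p c"
  using p_power_times_iff[of "a \<ominus>\<^bsub>W\<^esub> b" 1] assms by auto
 have "a = b \<oplus>\<^bsub>W\<^esub> (a \<ominus>\<^bsub>W\<^esub> b)" using assms by (simp add: W.minus_eq W.a_lcomm W.r_neg)
 then have a: "a = b \<oplus>\<^bsub>W\<^esub> add_pow W p c" using c by simp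
 obtain d where d: "d \<in> carrier W" "a [^]\<^bsub>W\<^esub> (p ^ k) = b [^]\<^bsub>W\<^esub> (p ^ k) \<oplus>\<^bsub>W\<^esub> add_pow W (p ^ Suc k) d"
  using W.power_prime_power_cong[OF p assms(2) c(1), of k] unfolding a by blast
 show ?thesis
  unfolding pr_eq_iff[OF W.nat_pow_closed[OF assms(1)] W.nat_pow_closed[OF assms(2)]]
 proof (intro allI impI)
  fix i assume i: "i < Suc k"
  have "i' < Suc k \<Longrightarrow> add_pow W (p ^ Suc k) d i' = \<zero>" for i'
   using p_power_times[OF d(1), of "Suc k"] by simp
  then show "(a [^]\<^bsub>W\<^esub> (p ^ k)) i = (b [^]\<^bsub>W\<^esub> (p ^ k)) i"
   unfolding d(2) using i assms d by (intro add_agree[of _ _ "Suc k"]) auto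
 qed
qed

lemma add_pow_one_nonzero:
 assumes "\<not> p dvd m"
 shows "add_pow K m \<one> \<noteq> \<zero>"
proof
 assume 0: "add_pow K m \<one> = \<zero>"
 have "coprime m p" using prime_imp_coprime[OF p assms] by (simp add: coprime_commute)
 then obtain u v where uv: "u * m = v * p + 1"
  using bezout_nat[of m p] assms by (metis coprime_imp_gcd_eq_1 dvd_0_right mult.commute)
 have "add_pow K (u * m) \<one> = add_pow K u (add_pow K m \<one>)" by (simp add: add.nat_pow_pow mult.commute)
 moreover have "add_pow K (v * p + 1) \<one> = add_pow K v (add_pow K p \<one>) \<oplus> \<one>"
  by (simp add: add.nat_pow_pow mult.commute flip: add.nat_pow_mult)
 ultimately show False using uv 0 char_K[of \<one>] by simp
qed

section \<open>Teichmueller powers and weights on a finite field\<close>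

definition tn :: "nat \<Rightarrow> 'k \<Rightarrow> nat \<Rightarrow> 'k" where
 "tn n a = teich a [^]\<^bsub>W\<^esub> (p ^ n)"

lemma tn_closed [simp]: "a \<in> carrier K \<Longrightarrow> tn n a \<in> carrier W"
 by (simp add: tn_def)

lemma tn_teich: "a \<in> carrier K \<Longrightarrow> tn n a = teich (a [^] (p ^ n))"
 by (simp add: tn_def teich_pow)

lemma tn_0: "a \<in> carrier K \<Longrightarrow> tn n a 0 = a [^] (p ^ n)"
 by (simp add: tn_teich)

lemma tn_zero: "tn n \<zero> = \<zero>\<^bsub>W\<^esub>"
 using p by (simp add: tn_teich zero_pow prime_gt_0_nat teich_zero)

lemma tn_one: "tn n \<one> = \<one>\<^bsub>W\<^esub>"
 by (simp add: tn_def teich_one)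

lemma tn_mult: "a \<in> carrier K \<Longrightarrow> b \<in> carrier K \<Longrightarrow> tn n (a \<otimes> b) = tn n a \<otimes>\<^bsub>W\<^esub> tn n b"
 by (simp add: tn_def teich_mult W.nat_pow_distrib)

lemma tn_Suc: "a \<in> carrier K \<Longrightarrow> tn (Suc n) a = tn n a [^]\<^bsub>W\<^esub> p"
 by (simp add: tn_def W.nat_pow_pow mult.commute)

text \<open>The p^r-th power map is the identity on k, so only n modulo r matters. This is what
  makes pairings at the levels n and n + rc comparable in the transfers and in the
  Verschiebung.\<close>

lemma tn_add_r: "a \<in> carrier K \<Longrightarrow> tn (n + r * c) a = tn n a"
proof -
 assume a: "a \<in> carrier K"
 have "a [^] (p ^ (n + r * c)) = (a [^] (p ^ (r * c))) [^] (p ^ n)"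
  using a by (simp add: nat_pow_pow power_add mult.commute)
 then show ?thesis using a by (simp add: tn_teich pow_q_pow)
qed

text \<open>The weights are homogeneous of degree -1 in the sense of \<open>wt_scale\<close>, and
  the value at zero makes their sum vanish. As the Teichmueller representatives of the nonzero
  elements are all the roots of unity of order dividing p^r - 1, that value differs from 0 only when
  K has two elements.\<close>

definition wt :: "nat \<Rightarrow> 'k \<Rightarrow> nat \<Rightarrow> 'k" where
 "wt n t = (if t = \<zero> then \<ominus>\<^bsub>W\<^esub> (\<Oplus>\<^bsub>W\<^esub>u\<in>carrier K - {\<zero>}. tn n (inv u)) else tn n (inv t))"

lemma inv_closed' [simp]: "a \<in> carrier K \<Longrightarrow> a \<noteq> \<zero> \<Longrightarrow> inv a \<in> carrier K"
 using K.field_Units by auto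

lemma inv_cancel [simp]: "a \<in> carrier K \<Longrightarrow> a \<noteq> \<zero> \<Longrightarrow> inv a \<otimes> a = \<one>" "a \<in> carrier K \<Longrightarrow> a \<noteq> \<zero> \<Longrightarrow> a \<otimes> inv a = \<one>"
 using K.field_Units by auto

lemma inv_nonzero [simp]: "a \<in> carrier K \<Longrightarrow> a \<noteq> \<zero> \<Longrightarrow> inv a \<noteq> \<zero>"
 using inv_cancel(1)[of a] K.one_not_zero by (metis l_null)

lemma wt_closed [simp]: "t \<in> carrier K \<Longrightarrow> wt n t \<in> carrier W"
 by (auto simp: wt_def intro!: W.finsum_closed W.a_inv_closed)

lemma wt_sum: "(\<Oplus>\<^bsub>W\<^esub>t\<in>carrier K. wt n t) = \<zero>\<^bsub>W\<^esub>"
proof -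
 have S: "carrier K = insert \<zero> (carrier K - {\<zero>})" by auto
 have "(\<Oplus>\<^bsub>W\<^esub>t\<in>carrier K - {\<zero>}. wt n t) = (\<Oplus>\<^bsub>W\<^esub>u\<in>carrier K - {\<zero>}. tn n (inv u))"
  by (rule W.finsum_cong') (auto simp: wt_def)
 then have "(\<Oplus>\<^bsub>W\<^esub>t\<in>insert \<zero> (carrier K - {\<zero>}). wt n t) = \<zero>\<^bsub>W\<^esub>"
  by (subst W.finsum_insert) (auto simp: finite_K W.l_neg wt_def[of n \<zero>] intro!: W.finsum_closed)
 then show ?thesis using S by simp
qed

lemma bij_scale:
 assumes "x \<in> carrier K" "x \<noteq> \<zero>"
 shows "bij_betw (\<lambda>u. u \<otimes> x) (carrier K) (carrier K)" "bij_betw (\<lambda>u. u \<otimes> x) (carrier K - {\<zero>}) (carrier K - {\<zero>})"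
proof -
 have b: "u = (u \<otimes> x) \<otimes> inv x" "u = (u \<otimes> inv x) \<otimes> x" if "u \<in> carrier K" for u
  using that assms by (simp_all add: m_assoc)
 have nz: "u \<otimes> x \<noteq> \<zero>" "u \<otimes> inv x \<noteq> \<zero>" if "u \<in> carrier K" "u \<noteq> \<zero>" for u
  using that assms inv_nonzero[of x] by (auto dest!: K.integral)
 show "bij_betw (\<lambda>u. u \<otimes> x) (carrier K) (carrier K)"
  by (rule bij_betw_byWitness[of _ "\<lambda>u. u \<otimes> inv x"]) (use assms b in auto)
 show "bij_betw (\<lambda>u. u \<otimes> x) (carrier K - {\<zero>}) (carrier K - {\<zero>})"
  by (rule bij_betw_byWitness[of _ "\<lambda>u. u \<otimes> inv x"]) (use assms b nz in auto)
qed

lemma inv_scale: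
 assumes "x \<in> carrier K" "x \<noteq> \<zero>" "t \<in> carrier K" "t \<noteq> \<zero>"
 shows "inv (t \<otimes> inv x) = x \<otimes> inv t"
proof (rule comm_inv_char)
 have "t \<otimes> inv x \<otimes> (x \<otimes> inv t) = t \<otimes> ((inv x \<otimes> x) \<otimes> inv t)"
  using assms by (simp add: m_assoc[of t "inv x" "x \<otimes> inv t"] m_assoc[of "inv x" x "inv t", symmetric])
 then show "t \<otimes> inv x \<otimes> (x \<otimes> inv t) = \<one>" using assms by simp
qed (use assms in auto)

text \<open>At u = 0 the claim is that the sum of all \<open>tn n (inv t)\<close> is unchanged by
  the factor \<open>tn n x\<close>, which only permutes its terms.\<close>

lemma wt_scale:
 assumes "x \<in> carrier K" "x \<noteq> \<zero>" "u \<in> carrier K"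
 shows "wt n (u \<otimes> inv x) = tn n x \<otimes>\<^bsub>W\<^esub> wt n u"
proof (cases "u = \<zero>")
 case True
 have "tn n x \<otimes>\<^bsub>W\<^esub> (\<Oplus>\<^bsub>W\<^esub>t\<in>carrier K - {\<zero>}. tn n (inv t)) = (\<Oplus>\<^bsub>W\<^esub>t\<in>carrier K - {\<zero>}. tn n (inv (t \<otimes> inv x)))"
 proof -
  have "tn n (inv (t \<otimes> inv x)) = tn n x \<otimes>\<^bsub>W\<^esub> tn n (inv t)" if t: "t \<in> carrier K - {\<zero>}" for t
  proof -
   have "inv (t \<otimes> inv x) = x \<otimes> inv t" using t assms by (intro inv_scale) auto
   then show ?thesis using t assms by (simp add: tn_mult)
  qed
  note eq = this
  have "tn n x \<otimes>\<^bsub>W\<^esub> (\<Oplus>\<^bsub>W\<^esub>t\<in>carrier K - {\<zero>}. tn n (inv t)) =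
    (\<Oplus>\<^bsub>W\<^esub>t\<in>carrier K - {\<zero>}. tn n x \<otimes>\<^bsub>W\<^esub> tn n (inv t))"
   by (rule W.finsum_rdistr) (use assms finite_K in auto)
  also have "\<dots> = (\<Oplus>\<^bsub>W\<^esub>t\<in>carrier K - {\<zero>}. tn n (inv (t \<otimes> inv x)))"
  proof (rule W.finsum_cong'[OF refl])
   show "(\<lambda>t. tn n (inv (t \<otimes> inv x))) \<in> carrier K - {\<zero>} \<rightarrow> carrier W"
   proof
    fix t assume "t \<in> carrier K - {\<zero>}"
    from eq[OF this] this show "tn n (inv (t \<otimes> inv x)) \<in> carrier W" using assms by simp
   qed
  qed (rule eq[symmetric])
  finally show ?thesis .
 qed
 also have "\<dots> = (\<Oplus>\<^bsub>W\<^esub>t\<in>carrier K - {\<zero>}. tn n (inv t))"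
 proof -
  let ?h = "\<lambda>t. t \<otimes> inv x" and ?S = "carrier K - {\<zero>}"
  have b: "inj_on ?h ?S" "?h ` ?S = ?S" using bij_scale(2)[of "inv x"] assms by (auto simp: bij_betw_def)
  have "(\<Oplus>\<^bsub>W\<^esub>t\<in>?h ` ?S. tn n (inv t)) = (\<Oplus>\<^bsub>W\<^esub>t\<in>?S. tn n (inv (?h t)))"
   by (rule W.add.finprod_reindex) (use b in auto)
  then show ?thesis unfolding b(2) by simp
 qed
 finally show ?thesis using True assms
  by (simp add: wt_def W.r_minus W.finsum_closed)
next
 case False
 have "inv (u \<otimes> inv x) = x \<otimes> inv u"
  using False assms by (intro inv_scale) auto
 moreover have "u \<otimes> inv x \<noteq> \<zero>" using False assms inv_nonzero[of x] by (auto dest!: K.integral)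
 ultimately show ?thesis using False assms by (simp add: wt_def tn_mult)
qed

text \<open>Written out: the sum over all tuples (t_i) of the product of the weights of the t_i
  times \<open>tn (Suc n)\<close> at z + t_1 x_1 + t_2 x_2 + .... The level of \<open>tn\<close> is
  one above that of the weights, which is what raises the level in the induction on n.\<close>

primrec HH :: "nat \<Rightarrow> 'k list \<Rightarrow> 'k \<Rightarrow> nat \<Rightarrow> 'k" where
 "HH n [] z = tn (Suc n) z"
| "HH n (x # xs) z = (\<Oplus>\<^bsub>W\<^esub>t\<in>carrier K. wt n t \<otimes>\<^bsub>W\<^esub> HH n xs (z \<oplus> t \<otimes> x))"

end

section \<open>Iterated weighted sums of powers\<close>

context
 fixes w y :: "'t \<Rightarrow> 'a::comm_ring_1" and T :: "'t set"
begin

text \<open>The analogue of \<open>HH\<close> with the same increments \<open>y t\<close> in every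
  step and with addition in the ring itself, hence an iterated difference operator applied to
  z^m.\<close>

primrec weighted_shift_sum :: "nat \<Rightarrow> nat \<Rightarrow> 'a \<Rightarrow> 'a" where
 "weighted_shift_sum 0 m z = z ^ m"
| "weighted_shift_sum (Suc j) m z = (\<Sum>t\<in>T. w t * weighted_shift_sum j m (z + y t))"

lemma weighted_shift_sum_add:
 "weighted_shift_sum j m (u + z) = (\<Sum>i\<le>m. of_nat (m choose i) * u ^ i * weighted_shift_sum j (m - i) z)"
proof (induction j arbitrary: z)
 case 0
 then show ?case by (simp add: binomial_ring)
next
 case (Suc j)
 have "weighted_shift_sum (Suc j) m (u + z) = (\<Sum>t\<in>T. w t * weighted_shift_sum j m (u + (z + y t)))"
  by (simp add: add.assoc)
 also have "\<dots> = (\<Sum>t\<in>T. \<Sum>i\<le>m. of_nat (m choose i) * u ^ i * (w t * weighted_shift_sum j (m - i) (z + y t)))"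
  unfolding Suc by (simp add: sum_distrib_left mult_ac)
 also have "\<dots> = (\<Sum>i\<le>m. \<Sum>t\<in>T. of_nat (m choose i) * u ^ i * (w t * weighted_shift_sum j (m - i) (z + y t)))"
  by (rule sum.swap)
 finally show ?case by (simp add: sum_distrib_left)
qed

text \<open>Because the weights sum to zero, each weighted sum lowers the degree in \<open>z\<close> by one.\<close>

lemma weighted_shift_sum_values:
 assumes w: "(\<Sum>t\<in>T. w t) = 0"
 shows "(m < j \<longrightarrow> weighted_shift_sum j m z = 0) \<and>
  weighted_shift_sum j j z = of_nat (fact j) * (\<Sum>t\<in>T. w t * y t) ^ j"
proof (induction j arbitrary: m z)
 case (Suc j)
 have eq: "weighted_shift_sum (Suc j) m z =
   (\<Sum>i\<le>m. of_nat (m choose i) * (\<Sum>t\<in>T. w t * y t ^ i) * weighted_shift_sum j (m - i) z)" for m z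
 proof -
  have "weighted_shift_sum (Suc j) m z = (\<Sum>t\<in>T. w t * weighted_shift_sum j m (y t + z))"
   by (simp add: add.commute)
  also have "\<dots> = (\<Sum>t\<in>T. \<Sum>i\<le>m. of_nat (m choose i) * (w t * y t ^ i) * weighted_shift_sum j (m - i) z)"
   unfolding weighted_shift_sum_add by (simp add: sum_distrib_left mult_ac)
  also have "\<dots> = (\<Sum>i\<le>m. \<Sum>t\<in>T. of_nat (m choose i) * (w t * y t ^ i) * weighted_shift_sum j (m - i) z)"
   by (rule sum.swap)
  finally show ?thesis by (simp add: sum_distrib_left sum_distrib_right mult.assoc)
 qed
 \<comment> \<open>The term i = 0 vanishes because the weights sum to zero, and terms of too low
   degree vanish by induction; in degree j + 1 only i = 1 is left.\<close>
 have term0: "of_nat (m choose i) * (\<Sum>t\<in>T. w t * y t ^ i) * weighted_shift_sum j (m - i) z = 0"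
  if "i = 0 \<or> m - i < j" for m i z
  using that w Suc.IH by auto
 have "weighted_shift_sum (Suc j) m z = 0" if "m < Suc j"
  unfolding eq
 proof (intro sum.neutral ballI term0)
  fix i assume "i \<in> {..m}"
  then show "i = 0 \<or> m - i < j" using that by (cases i) auto
 qed
 moreover have "weighted_shift_sum (Suc j) (Suc j) z =
   (\<Sum>i\<in>{1}. of_nat (Suc j choose i) * (\<Sum>t\<in>T. w t * y t ^ i) * weighted_shift_sum j (Suc j - i) z)"
  unfolding eq
 proof (intro sum.mono_neutral_right ballI term0)
  fix i assume "i \<in> {..Suc j} - {1}"
  then show "i = 0 \<or> Suc j - i < j" by (cases i) auto
 qed auto
 then have "weighted_shift_sum (Suc j) (Suc j) z = of_nat (fact (Suc j)) * (\<Sum>t\<in>T. w t * y t) ^ Suc j"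
  using Suc.IH[of 0 z] by (simp add: algebra_simps)
 ultimately show ?case by blast
qed simp

end

section \<open>Homogeneity of the weighted sums and their value modulo p^2\<close>

context finite_witt
begin

lemma pr_hom: "ring_hom_cring W (A j) (pr j)"
 by (intro ring_hom_cringI W.is_cring cring_A ring_hom_pr)

lemma HH_closed [simp]: "set xs \<subseteq> carrier K \<Longrightarrow> z \<in> carrier K \<Longrightarrow> HH n xs z \<in> carrier W"
 by (induction xs arbitrary: z) (auto intro!: W.finsum_closed)

text \<open>For x nonzero, substitute t = u / x and use the homogeneity of the weights. For x = 0
  the inner sum no longer depends on t, so the left side vanishes with the sum of the weights and
  the right side with \<open>tn n x\<close>.\<close>

lemma HH_scale_head:
 assumes x: "x \<in> carrier K" and xs: "set xs \<subseteq> carrier K" and z: "z \<in> carrier K"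
 shows "HH n (x # xs) z = tn n x \<otimes>\<^bsub>W\<^esub> HH n (\<one> # xs) z"
proof (cases "x = \<zero>")
 case True
 have "HH n (x # xs) z = (\<Oplus>\<^bsub>W\<^esub>t\<in>carrier K. wt n t) \<otimes>\<^bsub>W\<^esub> HH n xs z"
  using xs z True finite_K by (subst W.finsum_ldistr) (auto intro!: W.finsum_cong')
 moreover have "HH n (\<one> # xs) z \<in> carrier W" using xs z by (intro HH_closed) auto
 ultimately show ?thesis using xs z True by (simp add: wt_sum tn_zero del: HH.simps)
next
 case False
 have "HH n (x # xs) z = (\<Oplus>\<^bsub>W\<^esub>t\<in>(\<lambda>u. u \<otimes> inv x) ` carrier K. wt n t \<otimes>\<^bsub>W\<^esub> HH n xs (z \<oplus> t \<otimes> x))"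
  using bij_scale(1)[of "inv x"] x False by (simp add: bij_betw_def)
 also have "\<dots> = (\<Oplus>\<^bsub>W\<^esub>u\<in>carrier K. wt n (u \<otimes> inv x) \<otimes>\<^bsub>W\<^esub> HH n xs (z \<oplus> (u \<otimes> inv x) \<otimes> x))"
  by (rule W.add.finprod_reindex) (use bij_scale(1)[of "inv x"] x False xs z in \<open>auto simp: bij_betw_def\<close>)
 also have "\<dots> = (\<Oplus>\<^bsub>W\<^esub>u\<in>carrier K. tn n x \<otimes>\<^bsub>W\<^esub> (wt n u \<otimes>\<^bsub>W\<^esub> HH n xs (z \<oplus> u \<otimes> \<one>)))"
  by (rule W.finsum_cong') (use x xs z False in \<open>auto simp: wt_scale W.m_assoc m_assoc\<close>)
 also have "\<dots> = tn n x \<otimes>\<^bsub>W\<^esub> HH n (\<one> # xs) z"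
  using x xs z finite_K by (subst W.finsum_rdistr[symmetric]) auto
 finally show ?thesis .
qed

definition tn_prod :: "nat \<Rightarrow> 'k list \<Rightarrow> nat \<Rightarrow> 'k" where
 "tn_prod n xs = foldr (\<lambda>x a. tn n x \<otimes>\<^bsub>W\<^esub> a) xs \<one>\<^bsub>W\<^esub>"

lemma tn_prod_simps [simp]: "tn_prod n [] = \<one>\<^bsub>W\<^esub>" "tn_prod n (x # xs) = tn n x \<otimes>\<^bsub>W\<^esub> tn_prod n xs"
 by (simp_all add: tn_prod_def)

lemma tn_prod_closed [simp]: "set xs \<subseteq> carrier K \<Longrightarrow> tn_prod n xs \<in> carrier W"
 by (induction xs) auto

lemma HH_scale:
 assumes "set xs \<subseteq> carrier K" "z \<in> carrier K"
 shows "HH n xs z = tn_prod n xs \<otimes>\<^bsub>W\<^esub> HH n (replicate (length xs) \<one>) z"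
 using assms
proof (induction xs arbitrary: z)
 case Nil
 then show ?case by simp
next
 case (Cons x xs)
 have rep: "set (replicate (length xs) \<one>) \<subseteq> carrier K" by auto
 have "HH n (\<one> # xs) z = (\<Oplus>\<^bsub>W\<^esub>t\<in>carrier K. tn_prod n xs \<otimes>\<^bsub>W\<^esub> (wt n t \<otimes>\<^bsub>W\<^esub> HH n (replicate (length xs) \<one>) (z \<oplus> t \<otimes> \<one>)))"
  unfolding HH.simps
 proof (rule W.finsum_cong')
  fix t assume t: "t \<in> carrier K"
  have "HH n xs (z \<oplus> t \<otimes> \<one>) = tn_prod n xs \<otimes>\<^bsub>W\<^esub> HH n (replicate (length xs) \<one>) (z \<oplus> t \<otimes> \<one>)"
   using Cons t by simp
  then show "wt n t \<otimes>\<^bsub>W\<^esub> HH n xs (z \<oplus> t \<otimes> \<one>) =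
   tn_prod n xs \<otimes>\<^bsub>W\<^esub> (wt n t \<otimes>\<^bsub>W\<^esub> HH n (replicate (length xs) \<one>) (z \<oplus> t \<otimes> \<one>))"
   using t Cons.prems HH_closed[OF rep] by (simp add: W.m_lcomm)
 qed (use Cons.prems HH_closed[OF rep] in auto)
 also have "\<dots> = tn_prod n xs \<otimes>\<^bsub>W\<^esub> HH n (\<one> # replicate (length xs) \<one>) z"
  using Cons.prems HH_closed[OF rep] finite_K by (subst W.finsum_rdistr[symmetric]) auto
 finally have "HH n (\<one> # xs) z = tn_prod n xs \<otimes>\<^bsub>W\<^esub> HH n (\<one> # replicate (length xs) \<one>) z" .
 moreover have "HH n (\<one> # replicate (length xs) \<one>) z \<in> carrier W"
  using Cons.prems by (intro HH_closed) auto
 ultimately show ?case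
  using HH_scale_head[of x xs z n] Cons.prems by (simp add: W.m_assoc del: HH.simps)
qed

text \<open>\<open>HH\<close> with all entries 1, except that the shifts are added as Witt vectors
  before the power is taken. For m = p the difference disappears modulo p^2, and this version has an
  exact value.\<close>

primrec ER :: "nat \<Rightarrow> nat \<Rightarrow> nat \<Rightarrow> (nat \<Rightarrow> 'k) \<Rightarrow> nat \<Rightarrow> 'k" where
 "ER n 0 m Z = Z [^]\<^bsub>W\<^esub> m"
| "ER n (Suc j) m Z = (\<Oplus>\<^bsub>W\<^esub>t\<in>carrier K. wt n t \<otimes>\<^bsub>W\<^esub> ER n j m (Z \<oplus>\<^bsub>W\<^esub> tn n t))"

lemma ER_closed [simp]: "Z \<in> carrier W \<Longrightarrow> ER n j m Z \<in> carrier W"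
 by (induction j arbitrary: Z) (auto intro!: W.finsum_closed)

text \<open>The summand is 1 at every nonzero t and 0 at zero.\<close>

lemma wt_tn_sum: "(\<Oplus>\<^bsub>W\<^esub>t\<in>carrier K. wt n t \<otimes>\<^bsub>W\<^esub> tn n t) = add_pow W (p ^ r - 1) \<one>\<^bsub>W\<^esub>"
proof -
 have S: "carrier K = insert \<zero> (carrier K - {\<zero>})" by auto
 have "wt n t \<otimes>\<^bsub>W\<^esub> tn n t = \<one>\<^bsub>W\<^esub>" if "t \<in> carrier K - {\<zero>}" for t
  using that by (simp add: wt_def tn_one flip: tn_mult)
 then have "(\<Oplus>\<^bsub>W\<^esub>t\<in>carrier K - {\<zero>}. wt n t \<otimes>\<^bsub>W\<^esub> tn n t) = (\<Oplus>\<^bsub>W\<^esub>t\<in>carrier K - {\<zero>}. \<one>\<^bsub>W\<^esub>)"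
  by (intro W.finsum_cong') auto
 also have "\<dots> = add_pow W (p ^ r - 1) \<one>\<^bsub>W\<^esub>"
  by (subst W.add.finprod_const) (auto simp: finite_K card_K)
 finally have "(\<Oplus>\<^bsub>W\<^esub>t\<in>insert \<zero> (carrier K - {\<zero>}). wt n t \<otimes>\<^bsub>W\<^esub> tn n t) = add_pow W (p ^ r - 1) \<one>\<^bsub>W\<^esub>"
  by (subst W.finsum_insert) (auto simp: finite_K tn_zero)
 then show ?thesis using S by simp
qed

text \<open>\<open>weighted_shift_sum_values\<close> is applied in an integral polynomial ring, with
  one variable for each shift and one for each nonzero weight, and the result is evaluated in
  W.\<close>

lemma ER_value: "ER n j j \<zero>\<^bsub>W\<^esub> = add_pow W (fact j :: nat) (add_pow W (p ^ r - 1) \<one>\<^bsub>W\<^esub> [^]\<^bsub>W\<^esub> j)"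
proof -
 define x where "x i = (case i of Inl t \<Rightarrow> if t \<in> carrier K then tn n t else \<zero>\<^bsub>W\<^esub>
   | Inr t \<Rightarrow> if t \<in> carrier K then wt n t else \<zero>\<^bsub>W\<^esub>)" for i
 have x: "x i \<in> carrier W" for i by (auto simp: x_def split: sum.split)
 define ev where "ev f = int_poly_eval W x (lookup f)" for f
 note W.int_poly_eval_add[where x=x, OF x, folded ev_def] W.int_poly_eval_mult[where x=x, OF x, folded ev_def]
  W.int_poly_eval_zero[where x=x, OF x] W.int_poly_eval_power[where x=x, OF x, folded ev_def]
  W.int_poly_eval_uminus[where x=x, OF x, folded ev_def]
 note ev = this
 have ev0: "ev 0 = \<zero>\<^bsub>W\<^esub>" by (simp add: ev_def ev)
 note ev_sum = W.int_poly_eval_sum[where x=x, OF x, folded ev_def]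
 note ev_var = W.int_poly_eval_var[where x=x, OF x, folded ev_def]
 note ev_nat = W.int_poly_eval_of_nat_mult[where x=x, OF x, folded ev_def]
 \<comment> \<open>The weight at zero is minus the sum of the other weights already among
   polynomials, as the weights have to sum to zero there.\<close>
 define y w :: "'k \<Rightarrow> ('k + 'k) multiset \<Rightarrow>\<^sub>0 int" where "y t = single {#Inl t#} 1"
  and "w t = (if t = \<zero> then - (\<Sum>u\<in>carrier K - {\<zero>}. single {#Inr u#} 1) else single {#Inr t#} 1)" for t
 have evy: "ev (y t) = tn n t" if "t \<in> carrier K" for t
  unfolding y_def ev_var using that by (simp add: x_def)
 have evw: "ev (w t) = wt n t" if "t \<in> carrier K" for t
 proof (cases "t = \<zero>")
  case True
  have "ev (\<Sum>u\<in>carrier K - {\<zero>}. single {#Inr u#} 1) = (\<Oplus>\<^bsub>W\<^esub>u\<in>carrier K - {\<zero>}. tn n (inv u))"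
   using finite_K by (subst ev_sum, simp, intro W.finsum_cong') (auto simp: ev_var x_def wt_def)
  then show ?thesis using True by (simp add: w_def ev wt_def)
 next
  case False
  then show ?thesis using that by (simp add: w_def ev_var x_def del: lookup_single)
 qed
 have S: "carrier K = insert \<zero> (carrier K - {\<zero>})" by auto
 have w0: "(\<Sum>t\<in>carrier K. w t) = 0"
 proof -
  have "(\<Sum>t\<in>carrier K - {\<zero>}. w t) = (\<Sum>u\<in>carrier K - {\<zero>}. single {#Inr u#} 1)"
   by (rule sum.cong) (auto simp: w_def)
  then have "(\<Sum>t\<in>insert \<zero> (carrier K - {\<zero>}). w t) = 0"
   using finite_K by (subst sum.insert) (auto simp: w_def)
  then show ?thesis using S by simp
 qed
 have ER: "ER n j m (ev Z) = ev (weighted_shift_sum w y (carrier K) j m Z)" for j m Z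
 proof (induction j arbitrary: Z)
  case 0
  then show ?case by (simp add: ev)
 next
  case (Suc j)
  have "ER n (Suc j) m (ev Z) = (\<Oplus>\<^bsub>W\<^esub>t\<in>carrier K. ev (w t * weighted_shift_sum w y (carrier K) j m (Z + y t)))"
   unfolding ER.simps
  proof (rule W.finsum_cong')
   fix t assume "t \<in> carrier K"
   then show "wt n t \<otimes>\<^bsub>W\<^esub> ER n j m (ev Z \<oplus>\<^bsub>W\<^esub> tn n t) =
     ev (w t * weighted_shift_sum w y (carrier K) j m (Z + y t))"
    using Suc[of "Z + y t"] by (simp add: ev evy evw)
  qed (auto simp: ev_def x)
  then show ?case using finite_K by (simp add: ev_sum)
 qed
 have "ER n j j \<zero>\<^bsub>W\<^esub> = ev (of_nat (fact j) * (\<Sum>t\<in>carrier K. w t * y t) ^ j)"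
  using ER[of j j 0] weighted_shift_sum_values[OF w0, where j=j and z=0 and y=y] ev0 by simp
 also have "\<dots> = add_pow W (fact j :: nat) ((\<Oplus>\<^bsub>W\<^esub>t\<in>carrier K. ev (w t) \<otimes>\<^bsub>W\<^esub> ev (y t)) [^]\<^bsub>W\<^esub> j)"
  unfolding ev_nat unfolding ev(4) ev_sum[OF finite_K] ev(2) ..
 also have "(\<Oplus>\<^bsub>W\<^esub>t\<in>carrier K. ev (w t) \<otimes>\<^bsub>W\<^esub> ev (y t)) = (\<Oplus>\<^bsub>W\<^esub>t\<in>carrier K. wt n t \<otimes>\<^bsub>W\<^esub> tn n t)"
  by (rule W.finsum_cong') (auto simp: evy evw)
 finally show ?thesis by (simp add: wt_tn_sum)
qed

text \<open>Z and \<open>tn n z\<close> have the same residue, hence p-th powers that agree modulo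
  p^2, and the p-th power of \<open>tn n z\<close> is \<open>tn (Suc n) z\<close>. The hypothesis
  survives adding t to z and \<open>tn n t\<close> to Z, because the p^n-th power map is additive on
  k.\<close>

lemma HH_cong_ER:
 assumes "z \<in> carrier K" "Z \<in> carrier W" "Z 0 = z [^] (p ^ n)"
 shows "pr 2 (HH n (replicate j \<one>) z) = pr 2 (ER n j p Z)"
 using assms
proof (induction j arbitrary: z Z)
 case 0
 have "pr (Suc 1) (tn n z [^]\<^bsub>W\<^esub> (p ^ 1)) = pr (Suc 1) (Z [^]\<^bsub>W\<^esub> (p ^ 1))"
  by (rule power_cong) (use 0 in \<open>auto simp: tn_0\<close>)
 then show ?case using 0 by (simp add: tn_Suc numeral_2_eq_2)
next
 case (Suc j)
 interpret pr: ring_hom_cring W "A 2" "pr 2" by (rule pr_hom)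
 interpret c0: ring_hom_cring W K "\<lambda>u. u 0"
  by (intro ring_hom_cringI W.is_cring is_cring component0_hom)
 have rep: "set (replicate j \<one>) \<subseteq> carrier K" by auto
 have "pr 2 (HH n (replicate (Suc j) \<one>) z) =
   (\<Oplus>\<^bsub>A 2\<^esub>t\<in>carrier K. pr 2 (wt n t \<otimes>\<^bsub>W\<^esub> HH n (replicate j \<one>) (z \<oplus> t \<otimes> \<one>)))"
  unfolding replicate_Suc HH.simps
  by (subst pr.hom_finsum) (use Suc.prems HH_closed[OF rep] in \<open>auto simp: o_def\<close>)
 also have "\<dots> = (\<Oplus>\<^bsub>A 2\<^esub>t\<in>carrier K. pr 2 (wt n t \<otimes>\<^bsub>W\<^esub> ER n j p (Z \<oplus>\<^bsub>W\<^esub> tn n t)))"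
 proof (rule pr.S.finsum_cong')
  fix t assume t: "t \<in> carrier K"
  have "pr 2 (HH n (replicate j \<one>) (z \<oplus> t \<otimes> \<one>)) = pr 2 (ER n j p (Z \<oplus>\<^bsub>W\<^esub> tn n t))"
   by (rule Suc.IH) (use Suc.prems t in \<open>auto simp: tn_0 frob_add\<close>)
  then show "pr 2 (wt n t \<otimes>\<^bsub>W\<^esub> HH n (replicate j \<one>) (z \<oplus> t \<otimes> \<one>)) =
    pr 2 (wt n t \<otimes>\<^bsub>W\<^esub> ER n j p (Z \<oplus>\<^bsub>W\<^esub> tn n t))"
   using t Suc.prems HH_closed[OF rep] by simp
 qed (use Suc.prems in auto)
 also have "\<dots> = pr 2 (ER n (Suc j) p Z)"
  unfolding ER.simps by (subst pr.hom_finsum) (use Suc.prems in \<open>auto simp: o_def\<close>)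
 finally show ?case .
qed

text \<open>The constant \<open>HH n [1, \<dots>, 1] 0\<close> is a Jacobi sum, and this is its Stickelberger valuation.\<close>

lemma HH_const:
 obtains c where "c \<in> Units W" "HH n (replicate p \<one>) \<zero> = add_pow W p c"
proof -
 interpret c0: ring_hom_cring W K "\<lambda>u. u 0"
  by (intro ring_hom_cringI W.is_cring is_cring component0_hom)
 let ?C = "HH n (replicate p \<one>) \<zero>"
 have C: "?C \<in> carrier W" by (rule HH_closed) auto
 define s where "s = add_pow W (p ^ r - 1) \<one>\<^bsub>W\<^esub>"
 define d where "d = add_pow W (fact (p - 1) :: nat) (s [^]\<^bsub>W\<^esub> p)"
 have s: "s \<in> carrier W" by (simp add: s_def)
 have d: "d \<in> carrier W" by (simp add: d_def s)
 have pp: "fact p = p * (fact (p - 1) :: nat)" using p by (simp add: fact_reduce prime_gt_0_nat)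
 have "pr 2 ?C = pr 2 (ER n p p \<zero>\<^bsub>W\<^esub>)"
  by (rule HH_cong_ER) (use p c0.hom_zero in \<open>auto simp: zero_pow prime_gt_0_nat\<close>)
 \<comment> \<open>Exactly one factor p is split off from p! (q - 1)^p; what remains, (p - 1)! (q -
   1)^p, is prime to p.\<close>
 also have "ER n p p \<zero>\<^bsub>W\<^esub> = add_pow W p d"
  using s by (simp add: ER_value d_def s_def pp W.add.nat_pow_pow mult.commute)
 finally have ag: "?C i = add_pow W p d i" if "i < 2" for i
  using that C d by (simp add: pr_eq_iff)
 have "?C 0 = \<zero>" using ag[of 0] d by (simp add: p_times)
 then obtain c where c: "c \<in> carrier W" "?C = add_pow W p c"
  using p_power_times_iff[OF C, of 1] by auto
 have c0: "c 0 \<in> carrier K" "d 0 \<in> carrier K" using c d by (auto simp: carrier_W)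
 \<comment> \<open>Multiplication by p shifts and takes p-th powers, so component 1 of a multiple of
   p shows the residue of the cofactor. The comparison modulo p^2 therefore determines the residue
   of c.\<close>
 have "c 0 [^] p = d 0 [^] p" using ag[of 1] c d by (simp add: p_times)
 then have cd: "c 0 = d 0" using pow_pow_inj[of "c 0" "d 0" 1] c0 by simp
 have hap: "add_pow W m u 0 = add_pow K m (u 0)" if "u \<in> carrier W" for m :: nat and u
  using that by (induction m) auto
 have "\<not> p dvd fact (p - 1)" using p prime_gt_0_nat[OF p] by (simp add: prime_dvd_fact_iff not_le)
 moreover have "\<not> p dvd p ^ r - 1"
 proof
  assume "p dvd p ^ r - 1"
  moreover have "p dvd p ^ r" using r_pos by (simp add: dvd_power)
  ultimately have "p dvd 1" using q_gt_1 by (metis dvd_diffD1 less_imp_le_nat)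
  then show False using p by simp
 qed
 ultimately have "d 0 \<noteq> \<zero>"
 proof -
  have s0: "s 0 = add_pow K (p ^ r - 1) \<one>" by (simp add: s_def hap)
  have "s 0 \<noteq> \<zero>" unfolding s0 by (rule add_pow_one_nonzero) fact
  then have "s 0 [^] m \<noteq> \<zero>" for m :: nat
   by (induction m) (use s in \<open>auto simp: s0 dest!: K.integral\<close>)
  moreover have "d 0 = add_pow K (fact (p - 1) :: nat) \<one> \<otimes> s 0 [^] p"
   using s add_pow_nat_mult[of "s 0 [^] p" "fact (p - 1)"] by (simp add: d_def hap s0)
  ultimately show ?thesis
   using add_pow_one_nonzero[of "fact (p - 1)"] \<open>\<not> p dvd fact (p - 1)\<close> s by (auto simp: s0 dest!: K.integral)
 qed
 then have "c \<in> Units W" using cd c by (intro Units_W) auto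
 then show ?thesis using that c by blast
qed

end

section \<open>Functions spanned by Teichmueller powers of linear forms\<close>

text \<open>\<Psi> stands for the linear forms, whose combinations are compared only on
  \<open>DD\<close>. The values lie in an arbitrary algebra over the Witt vectors, because the
  scalars of the span will be polynomials in indeterminates T_j.\<close>

locale witt_functions = finite_witt K p r for K :: "'k ring" (structure) and p r +
 fixes R :: "'s ring" and h :: "(nat \<Rightarrow> 'k) \<Rightarrow> 's" and DD :: "'v set" and \<Psi> :: "('v \<Rightarrow> 'k) set"
 assumes cring_R: "cring R" and hom_h: "h \<in> ring_hom W R" and finite_\<Psi>: "finite \<Psi>"
  and \<Psi>_closed: "\<psi> \<in> \<Psi> \<Longrightarrow> v \<in> DD \<Longrightarrow> \<psi> v \<in> carrier K"
  and \<Psi>_zero: "\<exists>\<theta>\<in>\<Psi>. \<forall>v\<in>DD. \<theta> v = \<zero>"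
  and \<Psi>_comb: "\<psi> \<in> \<Psi> \<Longrightarrow> \<chi> \<in> \<Psi> \<Longrightarrow> t \<in> carrier K \<Longrightarrow> \<exists>\<theta>\<in>\<Psi>. \<forall>v\<in>DD. \<theta> v = \<chi> v \<oplus> t \<otimes> \<psi> v"
begin

sublocale R: plain_cring R by (rule plain_cring.intro, rule cring_R)
sublocale h: ring_hom_cring W R h by (intro ring_hom_cringI W.is_cring cring_R hom_h)

definition sp :: "nat \<Rightarrow> ('v \<Rightarrow> 's) \<Rightarrow> bool" where
 "sp n f \<longleftrightarrow> (\<exists>c\<in>\<Psi> \<rightarrow> carrier R. \<forall>v\<in>DD. f v = (\<Oplus>\<^bsub>R\<^esub>\<psi>\<in>\<Psi>. c \<psi> \<otimes>\<^bsub>R\<^esub> h (tn n (\<psi> v))))"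

lemma spI:
 "c \<in> \<Psi> \<rightarrow> carrier R \<Longrightarrow> (\<And>v. v \<in> DD \<Longrightarrow> f v = (\<Oplus>\<^bsub>R\<^esub>\<psi>\<in>\<Psi>. c \<psi> \<otimes>\<^bsub>R\<^esub> h (tn n (\<psi> v)))) \<Longrightarrow> sp n f"
 unfolding sp_def by blast

lemma h_pow: "a \<in> carrier W \<Longrightarrow> h (a [^]\<^bsub>W\<^esub> (m::nat)) = h a [^]\<^bsub>R\<^esub> m"
 by (induction m) auto

lemma sp_closed: "sp n f \<Longrightarrow> v \<in> DD \<Longrightarrow> f v \<in> carrier R"
 by (auto simp: sp_def \<Psi>_closed Pi_iff intro!: R.finsum_closed)

lemma sp_cong: "sp n f \<Longrightarrow> (\<And>v. v \<in> DD \<Longrightarrow> f v = g v) \<Longrightarrow> sp n g"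
 unfolding sp_def by auto

lemma sp_zero: "sp n (\<lambda>v. \<zero>\<^bsub>R\<^esub>)"
 unfolding sp_def
 by (rule bexI[of _ "\<lambda>_. \<zero>\<^bsub>R\<^esub>"], rule ballI, rule sym, rule R.finsum_all0) (auto simp: \<Psi>_closed)

lemma sp_add:
 assumes "sp n f" "sp n g"
 shows "sp n (\<lambda>v. f v \<oplus>\<^bsub>R\<^esub> g v)"
proof -
 obtain c d where c: "c \<in> \<Psi> \<rightarrow> carrier R" "\<And>v. v \<in> DD \<Longrightarrow> f v = (\<Oplus>\<^bsub>R\<^esub>\<psi>\<in>\<Psi>. c \<psi> \<otimes>\<^bsub>R\<^esub> h (tn n (\<psi> v)))"
  and d: "d \<in> \<Psi> \<rightarrow> carrier R" "\<And>v. v \<in> DD \<Longrightarrow> g v = (\<Oplus>\<^bsub>R\<^esub>\<psi>\<in>\<Psi>. d \<psi> \<otimes>\<^bsub>R\<^esub> h (tn n (\<psi> v)))"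
  using assms unfolding sp_def by blast
 have "f v \<oplus>\<^bsub>R\<^esub> g v = (\<Oplus>\<^bsub>R\<^esub>\<psi>\<in>\<Psi>. (c \<psi> \<oplus>\<^bsub>R\<^esub> d \<psi>) \<otimes>\<^bsub>R\<^esub> h (tn n (\<psi> v)))" if v: "v \<in> DD" for v
 proof -
  have "f v \<oplus>\<^bsub>R\<^esub> g v = (\<Oplus>\<^bsub>R\<^esub>\<psi>\<in>\<Psi>. c \<psi> \<otimes>\<^bsub>R\<^esub> h (tn n (\<psi> v)) \<oplus>\<^bsub>R\<^esub> d \<psi> \<otimes>\<^bsub>R\<^esub> h (tn n (\<psi> v)))"
   unfolding c(2)[OF v] d(2)[OF v]
   by (rule R.finsum_addf[symmetric]) (use c d v in \<open>auto simp: \<Psi>_closed Pi_iff\<close>)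
  also have "\<dots> = (\<Oplus>\<^bsub>R\<^esub>\<psi>\<in>\<Psi>. (c \<psi> \<oplus>\<^bsub>R\<^esub> d \<psi>) \<otimes>\<^bsub>R\<^esub> h (tn n (\<psi> v)))"
   by (rule R.finsum_cong') (use c d v in \<open>auto simp: \<Psi>_closed Pi_iff R.l_distr\<close>)
  finally show ?thesis .
 qed
 moreover have "(\<lambda>\<psi>. c \<psi> \<oplus>\<^bsub>R\<^esub> d \<psi>) \<in> \<Psi> \<rightarrow> carrier R" using c d by auto
 ultimately show ?thesis by (rule spI[rotated])
qed

lemma sp_smult:
 assumes "sp n f" "a \<in> carrier R"
 shows "sp n (\<lambda>v. a \<otimes>\<^bsub>R\<^esub> f v)"
proof -
 obtain c where c: "c \<in> \<Psi> \<rightarrow> carrier R" "\<And>v. v \<in> DD \<Longrightarrow> f v = (\<Oplus>\<^bsub>R\<^esub>\<psi>\<in>\<Psi>. c \<psi> \<otimes>\<^bsub>R\<^esub> h (tn n (\<psi> v)))"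
  using assms unfolding sp_def by blast
 have "a \<otimes>\<^bsub>R\<^esub> f v = (\<Oplus>\<^bsub>R\<^esub>\<psi>\<in>\<Psi>. (a \<otimes>\<^bsub>R\<^esub> c \<psi>) \<otimes>\<^bsub>R\<^esub> h (tn n (\<psi> v)))" if v: "v \<in> DD" for v
 proof -
  have "a \<otimes>\<^bsub>R\<^esub> f v = (\<Oplus>\<^bsub>R\<^esub>\<psi>\<in>\<Psi>. a \<otimes>\<^bsub>R\<^esub> (c \<psi> \<otimes>\<^bsub>R\<^esub> h (tn n (\<psi> v))))"
   unfolding c(2)[OF v]
   by (rule R.finsum_rdistr) (use c assms v finite_\<Psi> in \<open>auto simp: \<Psi>_closed Pi_iff\<close>)
  also have "\<dots> = (\<Oplus>\<^bsub>R\<^esub>\<psi>\<in>\<Psi>. (a \<otimes>\<^bsub>R\<^esub> c \<psi>) \<otimes>\<^bsub>R\<^esub> h (tn n (\<psi> v)))"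
   by (rule R.finsum_cong') (use c assms v in \<open>auto simp: \<Psi>_closed Pi_iff R.m_assoc\<close>)
  finally show ?thesis .
 qed
 moreover have "(\<lambda>\<psi>. a \<otimes>\<^bsub>R\<^esub> c \<psi>) \<in> \<Psi> \<rightarrow> carrier R" using c assms by auto
 ultimately show ?thesis by (rule spI[rotated])
qed

lemma sp_gen:
 assumes "\<psi> \<in> \<Psi>"
 shows "sp n (\<lambda>v. h (tn n (\<psi> v)))"
proof -
 let ?c = "\<lambda>\<chi>. if \<psi> = \<chi> then \<one>\<^bsub>R\<^esub> else \<zero>\<^bsub>R\<^esub>"
 have "h (tn n (\<psi> v)) = (\<Oplus>\<^bsub>R\<^esub>\<chi>\<in>\<Psi>. ?c \<chi> \<otimes>\<^bsub>R\<^esub> h (tn n (\<chi> v)))" if v: "v \<in> DD" for v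
 proof -
  have "(\<Oplus>\<^bsub>R\<^esub>\<chi>\<in>\<Psi>. ?c \<chi> \<otimes>\<^bsub>R\<^esub> h (tn n (\<chi> v))) = (\<Oplus>\<^bsub>R\<^esub>\<chi>\<in>\<Psi>. if \<psi> = \<chi> then h (tn n (\<chi> v)) else \<zero>\<^bsub>R\<^esub>)"
   by (rule R.finsum_cong') (use v in \<open>auto simp: \<Psi>_closed\<close>)
  then show ?thesis
   using R.finsum_delta[of \<Psi> \<psi> "\<lambda>\<chi>. h (tn n (\<chi> v))"] assms v by (simp add: finite_\<Psi> \<Psi>_closed)
 qed
 moreover have "?c \<in> \<Psi> \<rightarrow> carrier R" by auto
 ultimately show ?thesis by (rule spI[rotated])
qed

lemma sp_finsum:
 assumes "finite S" "\<And>i. i \<in> S \<Longrightarrow> sp n (f i)"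
 shows "sp n (\<lambda>v. \<Oplus>\<^bsub>R\<^esub>i\<in>S. f i v)"
 using assms
proof (induction S)
 case empty
 then show ?case by (simp add: sp_zero)
next
 case (insert a S)
 have "sp n (\<lambda>v. f a v \<oplus>\<^bsub>R\<^esub> (\<Oplus>\<^bsub>R\<^esub>i\<in>S. f i v))"
  using insert by (intro sp_add) auto
 then show ?case
 proof (rule sp_cong)
  fix v assume "v \<in> DD"
  then have "f i v \<in> carrier R" if "i \<in> insert a S" for i
   using insert.prems[OF that] sp_closed by blast
  then show "f a v \<oplus>\<^bsub>R\<^esub> (\<Oplus>\<^bsub>R\<^esub>i\<in>S. f i v) = (\<Oplus>\<^bsub>R\<^esub>i\<in>insert a S. f i v)"
   using insert.hyps by (subst R.finsum_insert) auto
 qed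
qed

text \<open>Once the sums are unfolded, every term is a scalar times \<open>tn (Suc n)\<close> of a
  combination of forms, which is again given by an element of \<Psi>.\<close>

lemma sp_HH:
 assumes "set \<psi>s \<subseteq> \<Psi>" "\<chi> \<in> \<Psi>"
 shows "sp (Suc n) (\<lambda>v. h (HH n (map (\<lambda>\<psi>. \<psi> v) \<psi>s) (\<chi> v)))"
 using assms
proof (induction \<psi>s arbitrary: \<chi>)
 case Nil
 then show ?case using sp_gen by simp
next
 case (Cons \<psi> \<psi>s)
 have cl: "set (map (\<lambda>\<psi>. \<psi> v) \<psi>s) \<subseteq> carrier K" if "v \<in> DD" for v
  using Cons.prems that \<Psi>_closed by auto
 have "sp (Suc n) (\<lambda>v. h (wt n t) \<otimes>\<^bsub>R\<^esub> h (HH n (map (\<lambda>\<psi>. \<psi> v) \<psi>s) (\<chi> v \<oplus> t \<otimes> \<psi> v)))"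
  if t: "t \<in> carrier K" for t
 proof -
  obtain \<theta> where \<theta>: "\<theta> \<in> \<Psi>" "\<And>v. v \<in> DD \<Longrightarrow> \<theta> v = \<chi> v \<oplus> t \<otimes> \<psi> v"
   using \<Psi>_comb[of \<psi> \<chi> t] Cons.prems t by auto
  have "sp (Suc n) (\<lambda>v. h (wt n t) \<otimes>\<^bsub>R\<^esub> h (HH n (map (\<lambda>\<psi>. \<psi> v) \<psi>s) (\<theta> v)))"
   by (rule sp_smult, rule Cons.IH) (use Cons.prems \<theta> t in auto)
  then show ?thesis by (rule sp_cong) (simp add: \<theta>)
 qed
 then have "sp (Suc n) (\<lambda>v. \<Oplus>\<^bsub>R\<^esub>t\<in>carrier K. h (wt n t) \<otimes>\<^bsub>R\<^esub> h (HH n (map (\<lambda>\<psi>. \<psi> v) \<psi>s) (\<chi> v \<oplus> t \<otimes> \<psi> v)))"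
  by (intro sp_finsum finite_K)
 then show ?case
 proof (rule sp_cong)
  fix v assume v: "v \<in> DD"
  have c: "\<chi> v \<in> carrier K" "\<psi> v \<in> carrier K" using Cons.prems v \<Psi>_closed by auto
  show "(\<Oplus>\<^bsub>R\<^esub>t\<in>carrier K. h (wt n t) \<otimes>\<^bsub>R\<^esub> h (HH n (map (\<lambda>\<psi>. \<psi> v) \<psi>s) (\<chi> v \<oplus> t \<otimes> \<psi> v))) =
   h (HH n (map (\<lambda>\<psi>. \<psi> v) (\<psi> # \<psi>s)) (\<chi> v))"
   unfolding list.map HH.simps
   by (subst h.hom_finsum) (use c HH_closed[OF cl[OF v]] in \<open>auto intro!: R.finsum_cong'\<close>)
 qed
qed

text \<open>At z = 0, \<open>HH\<close> of the values is their product times a constant, and this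
  constant is p times a unit by \<open>HH_const\<close>. Dividing by the unit leaves p times the
  product in the span.\<close>

lemma sp_p_tn_prod:
 assumes \<psi>s: "set \<psi>s \<subseteq> \<Psi>" and len: "length \<psi>s = p"
 shows "sp (Suc n) (\<lambda>v. add_pow R p (h (tn_prod n (map (\<lambda>\<psi>. \<psi> v) \<psi>s))))"
proof -
 obtain c where c: "c \<in> Units W" "HH n (replicate p \<one>) \<zero> = add_pow W p c"
  using HH_const[of n] by blast
 note cW = W.Units_closed[OF c(1)] and icW = W.Units_inv_closed[OF c(1)]
 obtain \<theta> where \<theta>: "\<theta> \<in> \<Psi>" "\<And>v. v \<in> DD \<Longrightarrow> \<theta> v = \<zero>" using \<Psi>_zero by blast
 have "sp (Suc n) (\<lambda>v. h (inv\<^bsub>W\<^esub> c) \<otimes>\<^bsub>R\<^esub> h (HH n (map (\<lambda>\<psi>. \<psi> v) \<psi>s) (\<theta> v)))"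
  by (intro sp_smult sp_HH \<psi>s \<theta>) (use icW in auto)
 then show ?thesis
 proof (rule sp_cong)
  fix v assume v: "v \<in> DD"
  let ?xs = "map (\<lambda>\<psi>. \<psi> v) \<psi>s"
  have cl: "set ?xs \<subseteq> carrier K" using \<psi>s v \<Psi>_closed by auto
  have "inv\<^bsub>W\<^esub> c \<otimes>\<^bsub>W\<^esub> HH n ?xs \<zero> = inv\<^bsub>W\<^esub> c \<otimes>\<^bsub>W\<^esub> (tn_prod n ?xs \<otimes>\<^bsub>W\<^esub> add_pow W p c)"
   using HH_scale[OF cl, of \<zero> n] len c(2) by simp
  also have "\<dots> = add_pow W p (tn_prod n ?xs \<otimes>\<^bsub>W\<^esub> (inv\<^bsub>W\<^esub> c \<otimes>\<^bsub>W\<^esub> c))"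
   using cl cW icW by (simp add: W.add_pow_rdistr W.m_lcomm)
  also have "\<dots> = add_pow W p (tn_prod n ?xs)" using cl c(1) by simp
  finally have "h (inv\<^bsub>W\<^esub> c \<otimes>\<^bsub>W\<^esub> HH n ?xs \<zero>) = h (add_pow W p (tn_prod n ?xs))" by simp
  moreover have "h (add_pow W m a) = add_pow R m (h a)" if "a \<in> carrier W" for m :: nat and a
   using that by (induction m) auto
  ultimately show "h (inv\<^bsub>W\<^esub> c) \<otimes>\<^bsub>R\<^esub> h (HH n ?xs (\<theta> v)) = add_pow R p (h (tn_prod n ?xs))"
   using cl icW \<theta> v by simp
 qed
qed

abbreviation fprod :: "('v \<Rightarrow> 's) list \<Rightarrow> 'v \<Rightarrow> 's" where
 "fprod fs v \<equiv> foldr (\<lambda>f a. f v \<otimes>\<^bsub>R\<^esub> a) fs \<one>\<^bsub>R\<^esub>"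

lemma fprod_closed: "\<forall>f\<in>set fs. sp n f \<Longrightarrow> v \<in> DD \<Longrightarrow> fprod fs v \<in> carrier R"
 by (induction fs) (auto intro: sp_closed)

text \<open>The case of forms extends multilinearly: each function in \<open>fs\<close> is expanded
  into forms, which are moved to the list \<open>\<psi>s\<close>, while the total number of factors
  stays p.\<close>

lemma sp_p_prod:
 assumes "\<forall>f\<in>set fs. sp n f" "set \<psi>s \<subseteq> \<Psi>" "length fs + length \<psi>s = p"
 shows "sp (Suc n) (\<lambda>v. add_pow R p (fprod fs v \<otimes>\<^bsub>R\<^esub> h (tn_prod n (map (\<lambda>\<psi>. \<psi> v) \<psi>s))))"
 using assms
proof (induction fs arbitrary: \<psi>s)
 case Nil
 have "sp (Suc n) (\<lambda>v. add_pow R p (h (tn_prod n (map (\<lambda>\<psi>. \<psi> v) \<psi>s))))"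
  using Nil by (intro sp_p_tn_prod) auto
 then show ?case
 proof (rule sp_cong)
  fix v assume "v \<in> DD"
  then have "set (map (\<lambda>\<psi>. \<psi> v) \<psi>s) \<subseteq> carrier K" using Nil \<Psi>_closed by auto
  then show "add_pow R p (h (tn_prod n (map (\<lambda>\<psi>. \<psi> v) \<psi>s))) =
   add_pow R p (fprod [] v \<otimes>\<^bsub>R\<^esub> h (tn_prod n (map (\<lambda>\<psi>. \<psi> v) \<psi>s)))" by simp
 qed
next
 case (Cons f fs)
 obtain c where c: "c \<in> \<Psi> \<rightarrow> carrier R" "\<And>v. v \<in> DD \<Longrightarrow> f v = (\<Oplus>\<^bsub>R\<^esub>\<psi>\<in>\<Psi>. c \<psi> \<otimes>\<^bsub>R\<^esub> h (tn n (\<psi> v)))"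
  using Cons.prems unfolding sp_def by auto
 have "sp (Suc n) (\<lambda>v. \<Oplus>\<^bsub>R\<^esub>\<psi>\<in>\<Psi>. c \<psi> \<otimes>\<^bsub>R\<^esub> add_pow R p (fprod fs v \<otimes>\<^bsub>R\<^esub> h (tn_prod n (map (\<lambda>\<psi>. \<psi> v) (\<psi> # \<psi>s)))))"
  by (intro sp_finsum finite_\<Psi> sp_smult Cons.IH) (use Cons.prems c in auto)
 then show ?case
 proof (rule sp_cong)
  fix v assume v: "v \<in> DD"
  let ?t = "h (tn_prod n (map (\<lambda>\<psi>. \<psi> v) \<psi>s))" and ?F = "fprod fs v"
  have cl: "set (map (\<lambda>\<psi>. \<psi> v) \<psi>s) \<subseteq> carrier K" using Cons.prems v \<Psi>_closed by auto
  have t: "?t \<in> carrier R" using cl by simp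
  have F: "?F \<in> carrier R" using Cons.prems v by (intro fprod_closed) auto
  have c': "c \<psi> \<in> carrier R" "h (tn n (\<psi> v)) \<in> carrier R" "tn n (\<psi> v) \<in> carrier W" if "\<psi> \<in> \<Psi>" for \<psi>
   using that c v \<Psi>_closed by auto
  have "add_pow R p (fprod (f # fs) v \<otimes>\<^bsub>R\<^esub> ?t) = f v \<otimes>\<^bsub>R\<^esub> add_pow R p (?F \<otimes>\<^bsub>R\<^esub> ?t)"
   using F t sp_closed[of n f v] Cons.prems v by (simp add: R.add_pow_rdistr R.m_assoc)
  also have "\<dots> = (\<Oplus>\<^bsub>R\<^esub>\<psi>\<in>\<Psi>. (c \<psi> \<otimes>\<^bsub>R\<^esub> h (tn n (\<psi> v))) \<otimes>\<^bsub>R\<^esub> add_pow R p (?F \<otimes>\<^bsub>R\<^esub> ?t))"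
   unfolding c(2)[OF v] by (rule R.finsum_ldistr) (use F t c' finite_\<Psi> in auto)
  also have "\<dots> = (\<Oplus>\<^bsub>R\<^esub>\<psi>\<in>\<Psi>. c \<psi> \<otimes>\<^bsub>R\<^esub> add_pow R p (?F \<otimes>\<^bsub>R\<^esub> h (tn_prod n (map (\<lambda>\<psi>. \<psi> v) (\<psi> # \<psi>s)))))"
   by (rule R.finsum_cong') (use F t c' cl in \<open>auto simp: R.m_assoc R.add_pow_rdistr R.m_lcomm\<close>)
  finally show "(\<Oplus>\<^bsub>R\<^esub>\<psi>\<in>\<Psi>. c \<psi> \<otimes>\<^bsub>R\<^esub> add_pow R p (?F \<otimes>\<^bsub>R\<^esub> h (tn_prod n (map (\<lambda>\<psi>. \<psi> v) (\<psi> # \<psi>s))))) =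
   add_pow R p (fprod (f # fs) v \<otimes>\<^bsub>R\<^esub> ?t)" by simp
 qed
qed

lemma fprod_replicate:
 assumes "f v \<in> carrier R" "g v \<in> carrier R"
 shows "fprod (replicate i f @ replicate j g) v = f v [^]\<^bsub>R\<^esub> i \<otimes>\<^bsub>R\<^esub> g v [^]\<^bsub>R\<^esub> j"
proof (induction i)
 case 0
 then show ?case using assms by (induction j) (auto simp: R.m_comm)
next
 case (Suc i)
 then show ?case using assms by (simp add: R.m_ac)
qed

text \<open>The terms of f are added one at a time by the binomial theorem. A pure p-th power turns
  \<open>tn n\<close> into \<open>tn (Suc n)\<close>; a mixed term is a multiple of p times a
  product of p functions of level n, which \<open>sp_p_prod\<close> covers.\<close>

lemma sp_power:
 assumes "sp n f"
 shows "sp (Suc n) (\<lambda>v. f v [^]\<^bsub>R\<^esub> p)"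
proof -
 obtain c where c: "c \<in> \<Psi> \<rightarrow> carrier R" "\<And>v. v \<in> DD \<Longrightarrow> f v = (\<Oplus>\<^bsub>R\<^esub>\<psi>\<in>\<Psi>. c \<psi> \<otimes>\<^bsub>R\<^esub> h (tn n (\<psi> v)))"
  using assms unfolding sp_def by auto
 define g where "g \<psi> v = c \<psi> \<otimes>\<^bsub>R\<^esub> h (tn n (\<psi> v))" for \<psi> v
 have g: "sp n (g \<psi>)" "sp (Suc n) (\<lambda>v. g \<psi> v [^]\<^bsub>R\<^esub> p)" if "\<psi> \<in> \<Psi>" for \<psi>
 proof -
  show "sp n (g \<psi>)" unfolding g_def by (intro sp_smult sp_gen that) (use c that in auto)
  have "sp (Suc n) (\<lambda>v. c \<psi> [^]\<^bsub>R\<^esub> p \<otimes>\<^bsub>R\<^esub> h (tn (Suc n) (\<psi> v)))"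
   by (intro sp_smult sp_gen that) (use c that in auto)
  then show "sp (Suc n) (\<lambda>v. g \<psi> v [^]\<^bsub>R\<^esub> p)"
   by (rule sp_cong) (use c that \<Psi>_closed in \<open>auto simp: g_def R.nat_pow_distrib tn_Suc h_pow Pi_iff\<close>)
 qed
 have "sp (Suc n) (\<lambda>v. (\<Oplus>\<^bsub>R\<^esub>\<psi>\<in>S. g \<psi> v) [^]\<^bsub>R\<^esub> p)" if "S \<subseteq> \<Psi>" for S
  using finite_subset[OF that finite_\<Psi>] that
 proof (induction S)
  case empty
  show ?case using sp_zero p by (simp add: R.zero_pow prime_gt_0_nat)
 next
  case (insert \<psi> S)
  let ?a = "g \<psi>" and ?b = "\<lambda>v. \<Oplus>\<^bsub>R\<^esub>\<psi>\<in>S. g \<psi> v"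
  have a: "sp n ?a" and b: "sp n ?b" using insert g by (auto intro!: sp_finsum)
  have ab: "?a v \<in> carrier R" "?b v \<in> carrier R" if "v \<in> DD" for v
   using a b that by (auto intro: sp_closed)
  have mixed: "sp (Suc n) (\<lambda>v. add_pow R (m::nat) (add_pow R p (?a v [^]\<^bsub>R\<^esub> i \<otimes>\<^bsub>R\<^esub> ?b v [^]\<^bsub>R\<^esub> (p - i))))"
   if i: "i \<in> {0<..<p}" for i m
  proof -
   \<comment> \<open>The mixed product is presented as a list of exactly p functions, with an empty
     list of forms.\<close>
   have "sp (Suc n) (\<lambda>v. add_pow R p (fprod (replicate i ?a @ replicate (p - i) ?b) v \<otimes>\<^bsub>R\<^esub> h (tn_prod n (map (\<lambda>\<psi>. \<psi> v) []))))"
    by (rule sp_p_prod) (use a b i in auto)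
   from sp_smult[OF this, of "add_pow R m \<one>\<^bsub>R\<^esub>"]
   have "sp (Suc n) (\<lambda>v. add_pow R m \<one>\<^bsub>R\<^esub> \<otimes>\<^bsub>R\<^esub> add_pow R p (fprod (replicate i ?a @ replicate (p - i) ?b) v \<otimes>\<^bsub>R\<^esub> h (tn_prod n (map (\<lambda>\<psi>. \<psi> v) []))))"
    by simp
   then show ?thesis
    by (rule sp_cong) (use ab in \<open>simp add: fprod_replicate R.add_pow_ldistr del: foldr_append\<close>)
  qed
  have "sp (Suc n) (\<lambda>v. ?a v [^]\<^bsub>R\<^esub> p \<oplus>\<^bsub>R\<^esub> ?b v [^]\<^bsub>R\<^esub> p \<oplus>\<^bsub>R\<^esub>
    (\<Oplus>\<^bsub>R\<^esub>i\<in>{0<..<p}. add_pow R ((p choose i) div p) (add_pow R p (?a v [^]\<^bsub>R\<^esub> i \<otimes>\<^bsub>R\<^esub> ?b v [^]\<^bsub>R\<^esub> (p - i)))))"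
   by (intro sp_add sp_finsum mixed) (use g insert in auto)
  then show ?case
  proof (rule sp_cong)
   fix v assume v: "v \<in> DD"
   have "(\<Oplus>\<^bsub>R\<^esub>\<psi>\<in>insert \<psi> S. g \<psi> v) = ?a v \<oplus>\<^bsub>R\<^esub> ?b v"
    using insert ab[OF v] sp_closed[OF g(1) v] by (subst R.finsum_insert) auto
   then show "?a v [^]\<^bsub>R\<^esub> p \<oplus>\<^bsub>R\<^esub> ?b v [^]\<^bsub>R\<^esub> p \<oplus>\<^bsub>R\<^esub>
    (\<Oplus>\<^bsub>R\<^esub>i\<in>{0<..<p}. add_pow R ((p choose i) div p) (add_pow R p (?a v [^]\<^bsub>R\<^esub> i \<otimes>\<^bsub>R\<^esub> ?b v [^]\<^bsub>R\<^esub> (p - i)))) =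
    (\<Oplus>\<^bsub>R\<^esub>\<psi>\<in>insert \<psi> S. g \<psi> v) [^]\<^bsub>R\<^esub> p"
    using R.power_prime_add[OF p ab[OF v]] by simp
  qed
 qed
 from this[OF order_refl] show ?thesis by (rule sp_cong) (simp add: c(2) g_def)
qed

text \<open>Each p-th power moves one level up by \<open>sp_power\<close>; at level 0 the function
  is a combination of Teichmueller representatives as it stands.\<close>

lemma sp_linear_power:
 assumes "finite I" "\<And>j. j \<in> I \<Longrightarrow> T j \<in> carrier R" "\<And>j. j \<in> I \<Longrightarrow> \<phi> j \<in> \<Psi>"
 shows "sp n (\<lambda>v. (\<Oplus>\<^bsub>R\<^esub>j\<in>I. T j \<otimes>\<^bsub>R\<^esub> h (teich (\<phi> j v))) [^]\<^bsub>R\<^esub> (p ^ n))"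
proof (induction n)
 case 0
 have "sp 0 (\<lambda>v. \<Oplus>\<^bsub>R\<^esub>j\<in>I. T j \<otimes>\<^bsub>R\<^esub> h (tn 0 (\<phi> j v)))"
  by (intro sp_finsum sp_smult sp_gen assms)
 then show ?case
  by (rule sp_cong) (use assms \<Psi>_closed in \<open>auto simp: tn_def Pi_iff intro!: R.finsum_cong'\<close>)
next
 case (Suc n)
 have cl: "(\<Oplus>\<^bsub>R\<^esub>j\<in>I. T j \<otimes>\<^bsub>R\<^esub> h (teich (\<phi> j v))) \<in> carrier R" if "v \<in> DD" for v
  using that assms \<Psi>_closed by (auto intro!: R.finsum_closed)
 show ?case
  by (rule sp_cong[OF sp_power[OF Suc]]) (use cl in \<open>auto simp: R.nat_pow_pow mult.commute\<close>)
qed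

end

section \<open>Multinomial coefficients\<close>

lemma (in abelian_monoid) finsum_swap:
 assumes "finite A" "finite B" "\<And>i j. i \<in> A \<Longrightarrow> j \<in> B \<Longrightarrow> f i j \<in> carrier G"
 shows "(\<Oplus>i\<in>A. \<Oplus>j\<in>B. f i j) = (\<Oplus>j\<in>B. \<Oplus>i\<in>A. f i j)"
 using assms(1,3)
proof (induction A)
 case empty
 then show ?case by (simp add: finsum_all0)
next
 case (insert a A)
 have "(\<Oplus>i\<in>insert a A. \<Oplus>j\<in>B. f i j) = (\<Oplus>j\<in>B. f a j) \<oplus> (\<Oplus>j\<in>B. \<Oplus>i\<in>A. f i j)"
  using insert by (subst finsum_insert) (auto intro!: finsum_closed)
 also have "\<dots> = (\<Oplus>j\<in>B. f a j \<oplus> (\<Oplus>i\<in>A. f i j))"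
  using insert by (intro finsum_addf[symmetric]) (auto intro!: finsum_closed)
 also have "\<dots> = (\<Oplus>j\<in>B. \<Oplus>i\<in>insert a A. f i j)"
  using insert by (intro finsum_cong') (auto intro!: finsum_closed)
 finally show ?case .
qed

definition weight :: "('v \<times> nat) multiset \<Rightarrow> nat" where
 "weight \<mu> = sum_mset (image_mset snd \<mu>)"

definition fact_prod :: "('v \<times> nat) multiset \<Rightarrow> nat" where
 "fact_prod \<mu> = prod_mset (image_mset (\<lambda>x. fact (snd x)) \<mu>)"

definition multinom :: "('v \<times> nat) multiset \<Rightarrow> nat" where
 "multinom \<mu> = fact (weight \<mu>) div fact_prod \<mu>"

lemma weight_simps [simp]: "weight {#} = 0" "weight {#x#} = snd x" "weight (add_mset x \<mu>) = snd x + weight \<mu>"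
 "weight (\<mu> + \<nu>) = weight \<mu> + weight \<nu>"
 by (simp_all add: weight_def)

lemma fact_prod_simps [simp]: "fact_prod {#} = 1" "fact_prod {#x#} = fact (snd x)"
 "fact_prod (add_mset x \<mu>) = fact (snd x) * fact_prod \<mu>"
 "fact_prod (\<mu> + \<nu>) = fact_prod \<mu> * fact_prod \<nu>"
 by (simp_all add: fact_prod_def)

lemma fact_prod_pos [simp]: "fact_prod \<mu> > 0"
 by (induction \<mu>) auto

lemma fact_add: "(fact (a + b) :: nat) = ((a + b) choose a) * (fact a * fact b)"
 using binomial_fact_lemma[of a "a + b"] by (simp add: mult_ac)

lemma multinom_fact: "multinom \<mu> * fact_prod \<mu> = fact (weight \<mu>)"
proof -
 have "fact_prod \<mu> dvd fact (weight \<mu>)"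
 proof (induction \<mu>)
  case (add x \<mu>)
  then show ?case by (simp add: fact_add)
 qed simp
 then show ?thesis by (simp add: multinom_def)
qed

lemma multinom_add: "multinom (\<mu> + \<nu>) = ((weight \<mu> + weight \<nu>) choose weight \<mu>) * multinom \<mu> * multinom \<nu>"
proof -
 have "multinom (\<mu> + \<nu>) * (fact_prod \<mu> * fact_prod \<nu>) =
   ((weight \<mu> + weight \<nu>) choose weight \<mu>) * multinom \<mu> * multinom \<nu> * (fact_prod \<mu> * fact_prod \<nu>)"
 proof -
  have "multinom (\<mu> + \<nu>) * (fact_prod \<mu> * fact_prod \<nu>) =
    ((weight \<mu> + weight \<nu>) choose weight \<mu>) * (fact (weight \<mu>) * fact (weight \<nu>))"
   using multinom_fact[of "\<mu> + \<nu>"] by (simp add: fact_add)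
  then show ?thesis by (simp only: multinom_fact[symmetric] mult_ac)
 qed
 then show ?thesis by (metis fact_prod_pos mult_cancel2 nat_0_less_mult_iff less_numeral_extra(3))
qed

lemma multinom_single [simp]: "multinom {#x#} = 1" "multinom {#} = 1"
 by (simp_all add: multinom_def)

text \<open>The recursion peels off the last exponent, just as
  \<open>coeff_linear_form_power\<close> peels off the last variable.\<close>

primrec multinom_seq :: "(nat \<Rightarrow> nat) \<Rightarrow> nat \<Rightarrow> nat" where
 "multinom_seq a 0 = 1"
| "multinom_seq a (Suc k) = ((\<Sum>i<Suc k. a i) choose a k) * multinom_seq a k"

lemma multinom_seq_fact: "multinom_seq a k * (\<Prod>i<k. fact (a i)) = fact (\<Sum>i<k. a i)"
proof (induction k)
 case (Suc k)
 have "fact (\<Sum>i<Suc k. a i) = ((\<Sum>i<Suc k. a i) choose a k) * (fact (a k) * fact (\<Sum>i<k. a i))"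
  using fact_add[of "a k" "\<Sum>i<k. a i"] by (simp add: add.commute)
 then show ?case by (simp add: Suc[symmetric] mult_ac)
qed simp

lemma weight_mset: "weight (mset xs) = (\<Sum>i<length xs. snd (xs ! i))"
proof -
 have "weight (mset xs) = sum_list (map snd xs)" by (induction xs) auto
 then show ?thesis by (simp add: sum_list_sum_nth atLeast0LessThan)
qed

lemma multinom_mset: "multinom (mset xs) = multinom_seq (\<lambda>i. snd (xs ! i)) (length xs)"
proof -
 have "fact_prod (mset xs) = prod_list (map (\<lambda>x. fact (snd x)) xs)" by (induction xs) auto
 then have "fact_prod (mset xs) = (\<Prod>i<length xs. fact (snd (xs ! i)))"
  by (simp add: prod.list_conv_set_nth atLeast0LessThan)
 then show ?thesis
  using multinom_fact[of "mset xs"] multinom_seq_fact[of "\<lambda>i. snd (xs ! i)" "length xs"]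
  by (metis fact_prod_pos weight_mset mult_cancel2 less_numeral_extra(3))
qed

text \<open>Write i = p^s u with u prime to p. The binomial coefficient is divisible by p^(n-s) and
  the difference of powers by p^(s+1). Thanks to this congruence, lifts of forms that are linear
  only modulo p define functionals on divided powers.\<close>

lemma dvd_binomial_power_diff:
 fixes a b :: "'a::comm_ring_1"
 assumes p: "prime p" and i: "i > 0" "i \<le> p ^ n"
 shows "of_nat (p ^ Suc n) dvd of_nat ((p ^ n) choose i) * ((a + of_nat p * b) ^ i - a ^ i)"
proof -
 obtain u where u: "i = p ^ multiplicity p i * u" "\<not> p dvd u"
  using multiplicity_decompose'[of i p] i p by (metis not_prime_unit less_numeral_extra(3))
 define s where "s = multiplicity p i"
 have u': "i = p ^ s * u" using u by (simp add: s_def)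
 have "p ^ s \<le> i" using u' u(2) i by (cases u) auto
 then have "p ^ s \<le> p ^ n" using i(2) by linarith
 then have sn: "s \<le> n" by (rule power_le_imp_le_exp[OF prime_gt_1_nat[OF p]])
 have "i * ((p ^ n) choose i) = p ^ n * ((p ^ n - 1) choose (i - 1))"
  using times_binomial_minus1_eq[of i "p ^ n"] i by simp
 then have "p ^ s * (u * ((p ^ n) choose i)) = p ^ s * (p ^ (n - s) * ((p ^ n - 1) choose (i - 1)))"
  using sn by (simp add: u' mult.assoc flip: power_add)
 then have "u * ((p ^ n) choose i) = p ^ (n - s) * ((p ^ n - 1) choose (i - 1))"
  using p by (simp add: prime_gt_0_nat)
 then have "p ^ (n - s) dvd u * ((p ^ n) choose i)" by simp
 moreover have "coprime (p ^ (n - s)) u" using prime_imp_coprime[OF p u(2)] by simp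
 ultimately have "p ^ (n - s) dvd (p ^ n) choose i" by (simp add: coprime_dvd_mult_right_iff)
 then obtain m where m: "(p ^ n) choose i = p ^ (n - s) * m" by (auto simp: dvd_def)
 let ?x = "(a + of_nat p * b) ^ (p ^ s)" and ?y = "a ^ (p ^ s)"
 have "of_nat p ^ Suc s dvd ?x - ?y" by (rule dvd_power_prime_power[OF p]) simp
 moreover have "?x ^ u - ?y ^ u = (?x - ?y) * (\<Sum>l<u. ?y ^ (u - Suc l) * ?x ^ l)"
  by (rule power_diff_sumr2)
 ultimately have "of_nat p ^ Suc s dvd ?x ^ u - ?y ^ u" by (simp only: dvd_mult2)
 then have "of_nat p ^ (n - s) * of_nat p ^ Suc s dvd
   (of_nat p ^ (n - s) * of_nat m) * ((a + of_nat p * b) ^ i - a ^ i)"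
  unfolding u' power_mult by (intro mult_dvd_mono dvd_triv_left)
 moreover have "(of_nat p :: 'a) ^ (n - s) * of_nat p ^ Suc s = of_nat (p ^ Suc n)"
  using sn by (simp only: power_add[symmetric] of_nat_power) simp
 ultimately show ?thesis by (simp only: m of_nat_mult of_nat_power)
qed

lemma (in plain_cring) binomial_power_cong:
 assumes p: "prime (p :: nat)" and a: "a \<in> carrier R" "b \<in> carrier R"
  and tors: "\<And>x. x \<in> carrier R \<Longrightarrow> add_pow R (p ^ Suc n) x = \<zero>"
 shows "add_pow R ((p ^ n) choose i) ((a \<oplus> add_pow R p b) [^] i) = add_pow R ((p ^ n) choose i) (a [^] i)"
proof (cases "i = 0 \<or> i > p ^ n")
 case False
 let ?x = "\<lambda>i. if i then a else b"
 have x: "?x i \<in> carrier R" for i using assms by simp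
 let ?X = "single {#True#} 1" and ?Y = "single {#False#} 1 :: bool multiset \<Rightarrow>\<^sub>0 int"
 let ?c = "of_nat ((p ^ n) choose i) :: bool multiset \<Rightarrow>\<^sub>0 int"
 note var = int_poly_eval_var[where x="?x", OF x]
 have "of_nat (p ^ Suc n) dvd ?c * ((?X + of_nat p * ?Y) ^ i - ?X ^ i)"
  by (rule dvd_binomial_power_diff[OF p]) (use False in auto)
 then obtain D where "?c * ((?X + of_nat p * ?Y) ^ i - ?X ^ i) = of_nat (p ^ Suc n) * D" by (rule dvdE)
 then have "?c * (?X + of_nat p * ?Y) ^ i = ?c * ?X ^ i + of_nat (p ^ Suc n) * D"
  by (simp only: right_diff_distrib) (simp add: algebra_simps)
 then have "int_poly_eval R ?x (lookup (?c * (?X + of_nat p * ?Y) ^ i)) =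
   int_poly_eval R ?x (lookup (?c * ?X ^ i + of_nat (p ^ Suc n) * D))" by simp
 then have "add_pow R ((p ^ n) choose i) ((a \<oplus> add_pow R p b) [^] i) =
   add_pow R ((p ^ n) choose i) (a [^] i) \<oplus> add_pow R (p ^ Suc n) (int_poly_eval R ?x (lookup D))"
  by (simp only: int_poly_eval_of_nat_mult[where x="?x", OF x]
   int_poly_eval_power[where x="?x", OF x] int_poly_eval_add[where x="?x", OF x] var if_True if_False)
 then show ?thesis using tors[OF int_poly_eval_closed[where x="?x", OF x]] a by simp
qed (use a in \<open>auto simp: binomial_eq_0\<close>)

section \<open>Coefficients of powers of linear forms\<close>

text \<open>The variable set enters only through the carrier, so products can be formed in the large
  ring while membership in a smaller one is tracked separately.\<close>

lemma mvpoly_same_ops: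
 "mult (mvpoly R I) = mult (mvpoly R J)" "add (mvpoly R I) = add (mvpoly R J)"
 "one (mvpoly R I) = one (mvpoly R J)" "zero (mvpoly R I) = zero (mvpoly R J)"
 by (simp_all add: mvpoly_def)

context mvpolys
begin

lemma carrier_mono: "J \<subseteq> I \<Longrightarrow> f \<in> carrier (mvpoly R J) \<Longrightarrow> f \<in> carrier P"
proof -
 interpret J: mvpolys R J by unfold_locales
 show "J \<subseteq> I \<Longrightarrow> f \<in> carrier (mvpoly R J) \<Longrightarrow> f \<in> carrier P"
  by (auto simp: carrier_mvpoly J.carrier_mvpoly)
qed

lemma sub_closed:
 assumes "J \<subseteq> I" "f \<in> carrier (mvpoly R J)" "g \<in> carrier (mvpoly R J)"
 shows "f \<otimes>\<^bsub>P\<^esub> g \<in> carrier (mvpoly R J)" "f \<oplus>\<^bsub>P\<^esub> g \<in> carrier (mvpoly R J)"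
  "f [^]\<^bsub>P\<^esub> (k::nat) \<in> carrier (mvpoly R J)"
proof -
 interpret J: mvpolys R J by unfold_locales
 show "f \<otimes>\<^bsub>P\<^esub> g \<in> carrier (mvpoly R J)" "f \<oplus>\<^bsub>P\<^esub> g \<in> carrier (mvpoly R J)"
  using J.P.m_closed[OF assms(2,3)] J.P.add.m_closed[OF assms(2,3)] by (simp_all add: mvpoly_same_ops[of R I J])
 show "f [^]\<^bsub>P\<^esub> (k::nat) \<in> carrier (mvpoly R J)"
  using J.P.m_closed[OF _ assms(2)] J.P.one_closed
  by (induction k) (simp_all add: mvpoly_same_ops[of R I J])
qed

primrec power_seq :: "(nat \<Rightarrow> 'i multiset \<Rightarrow> 'a) \<Rightarrow> (nat \<Rightarrow> nat) \<Rightarrow> nat \<Rightarrow> 'i multiset \<Rightarrow> 'a" where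
 "power_seq g a 0 = \<one>\<^bsub>P\<^esub>"
| "power_seq g a (Suc k) = g k [^]\<^bsub>P\<^esub> a k \<otimes>\<^bsub>P\<^esub> power_seq g a k"

lemma power_seq_closed: "(\<And>i. i < k \<Longrightarrow> g i \<in> carrier P) \<Longrightarrow> power_seq g a k \<in> carrier P"
 by (induction k) auto

lemma coeff_var_power_mult:
 assumes J: "J \<subseteq> I" and f: "f \<in> carrier (mvpoly R J)" and y: "y \<in> I" "y \<notin> J" and c: "y \<notin># \<gamma>"
 shows "(mono R \<one> (replicate_mset s y) \<otimes>\<^bsub>P\<^esub> f) (\<gamma> + replicate_mset t y) = (if s = t then f \<gamma> else \<zero>)"
proof -
 interpret J: mvpolys R J by unfold_locales
 have fP: "f \<in> carrier P" using carrier_mono[OF J f] .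
 have sub: "set_mset (replicate_mset s y) \<subseteq> I" using y by auto
 have "(mono R \<one> (replicate_mset s y) \<otimes>\<^bsub>P\<^esub> f) (\<gamma> + replicate_mset t y) =
   (if replicate_mset s y \<subseteq># \<gamma> + replicate_mset t y then \<one> \<otimes> f (\<gamma> + replicate_mset t y - replicate_mset s y) else \<zero>)"
  by (rule coeff_mono_mult[OF one_closed sub fP])
 moreover have "replicate_mset s y \<subseteq># \<gamma> + replicate_mset t y \<longleftrightarrow> s \<le> t"
  using c by (auto simp: subseteq_mset_def not_in_iff)
 moreover have "f (\<gamma> + replicate_mset t y - replicate_mset s y) = \<zero>" if "s < t"
 proof (rule ccontr)
  assume "f (\<gamma> + replicate_mset t y - replicate_mset s y) \<noteq> \<zero>"
  then have "set_mset (\<gamma> + replicate_mset t y - replicate_mset s y) \<subseteq> J"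
   using f J.carrier_mvpoly by blast
  moreover have "count (\<gamma> + replicate_mset t y - replicate_mset s y) y > 0" using that by simp
  ultimately show False using y by (metis count_greater_zero_iff subsetD)
 qed
 ultimately show ?thesis using fP by (auto simp: coeff_closed)
qed

text \<open>The multinomial theorem for the exponents of prescribed variables, by splitting off
  \<open>y k\<close> with the binomial theorem. The factor H absorbs the power of \<open>g k\<close>
  that this produces, so that the induction hypothesis applies to the remaining form.\<close>

lemma coeff_linear_form_power:
 assumes J: "J \<subseteq> I" and y: "\<And>i. i < k \<Longrightarrow> y i \<in> I - J" "inj_on y {..<k}"
  and g: "\<And>i. i < k \<Longrightarrow> g i \<in> carrier (mvpoly R J)" and H: "H \<in> carrier (mvpoly R J)"
  and \<beta>: "\<And>i. i < k \<Longrightarrow> y i \<notin># \<beta>"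
 shows "(H \<otimes>\<^bsub>P\<^esub> (\<Oplus>\<^bsub>P\<^esub>i\<in>{..<k}. mono R \<one> {#y i#} \<otimes>\<^bsub>P\<^esub> g i) [^]\<^bsub>P\<^esub> N) (\<beta> + (\<Sum>i<k. replicate_mset (a i) (y i))) =
   (if (\<Sum>i<k. a i) = N then add_pow R (multinom_seq a k) ((H \<otimes>\<^bsub>P\<^esub> power_seq g a k) \<beta>) else \<zero>)"
 using y g H \<beta>
proof (induction k arbitrary: H N)
 case 0
 have HP: "H \<in> carrier P" using carrier_mono[OF J 0(4)] .
 show ?case
 proof (cases N)
  case 0
  then show ?thesis using HP by (simp add: coeff_closed)
 next
  case (Suc M)
  have "H \<otimes>\<^bsub>P\<^esub> \<zero>\<^bsub>P\<^esub> [^]\<^bsub>P\<^esub> N = \<zero>\<^bsub>P\<^esub>" using HP P.zero_pow[of N] Suc by (simp del: P.nat_pow_Suc)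
  then show ?thesis using Suc
   by (simp only: lessThan_0 sum.empty P.finsum_empty) (simp add: coeff_zero)
 qed
next
 case (Suc k)
 let ?F = "\<Oplus>\<^bsub>P\<^esub>i\<in>{..<k}. mono R \<one> {#y i#} \<otimes>\<^bsub>P\<^esub> g i"
 let ?J = "J \<union> y ` {..<k}"
 let ?\<gamma> = "\<beta> + (\<Sum>i<k. replicate_mset (a i) (y i))"
 have J': "?J \<subseteq> I" "J \<subseteq> ?J" using J Suc.prems(1) by (auto simp: less_Suc_eq)
 interpret JJ: mvpolys R ?J by unfold_locales
 have HJ: "H \<in> carrier (mvpoly R ?J)" "g k \<in> carrier (mvpoly R ?J)"
  using Suc.prems(3,4) J'(2) JJ.carrier_mono by blast+
 have HP: "H \<in> carrier P" "g k \<in> carrier P" "\<And>i. i < k \<Longrightarrow> g i \<in> carrier P"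
  using Suc.prems(3,4) carrier_mono[OF J] by auto
 have yI: "y i \<in> I" if "i < Suc k" for i using Suc.prems(1)[OF that] by auto
 have mP: "mono R \<one> {#y i#} \<in> carrier P" if "i < Suc k" for i using yI[OF that] by (intro mono_closed) auto
 have F: "?F \<in> carrier P" using mP HP by (auto intro!: P.finsum_closed)
 have Fsum: "?F \<in> carrier (mvpoly R ?J)"
 proof -
  have "(\<Oplus>\<^bsub>P\<^esub>i\<in>B. mono R \<one> {#y i#} \<otimes>\<^bsub>P\<^esub> g i) \<in> carrier (mvpoly R ?J)" if "B \<subseteq> {..<k}" for B
   using finite_subset[OF that finite_lessThan] that
  proof (induction B)
   case empty
   then show ?case using JJ.P.zero_closed by (simp add: mvpoly_same_ops[of R I ?J])
  next
   case (insert b B)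
   have "mono R \<one> {#y b#} \<in> carrier (mvpoly R ?J)" using insert by (intro JJ.mono_closed) auto
   moreover have "g b \<in> carrier (mvpoly R ?J)"
    using insert Suc.prems(3)[of b] by (intro JJ.carrier_mono[OF J'(2)]) auto
   ultimately show ?case
    using insert mP HP by (subst P.finsum_insert) (auto intro!: sub_closed[OF J'(1)] simp: less_Suc_eq)
  qed
  then show ?thesis by blast
 qed
 have yne: "y i \<noteq> y k" if "i < k" for i
  using inj_onD[OF Suc.prems(2), of i k] that by auto
 have ynk: "y k \<notin> ?J"
  using Suc.prems(1)[of k] yne by fastforce
 have ynb: "y k \<notin># ?\<gamma>"
  using Suc.prems(5)[of k] yne by (fastforce simp: set_mset_sum split: if_splits)
 have powm: "mono R \<one> {#y k#} [^]\<^bsub>P\<^esub> s = mono R \<one> (replicate_mset s (y k))" for s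
 proof (induction s)
  case (Suc s)
  then show ?case using yI by (simp, subst mono_mult) auto
 qed (simp add: one_eq_mono)
 let ?q = "\<lambda>s. H \<otimes>\<^bsub>P\<^esub> g k [^]\<^bsub>P\<^esub> s \<otimes>\<^bsub>P\<^esub> ?F [^]\<^bsub>P\<^esub> (N - s)"
 have qJ: "?q s \<in> carrier (mvpoly R ?J)" for s
  using HJ Fsum by (intro sub_closed[OF J'(1)])
 have qP: "?q s \<in> carrier P" for s using HP F by simp
 have mono_s: "mono R \<one> (replicate_mset s (y k)) \<in> carrier P" for s
  using yI by (intro mono_closed) auto
 have "H \<otimes>\<^bsub>P\<^esub> (\<Oplus>\<^bsub>P\<^esub>i\<in>{..<Suc k}. mono R \<one> {#y i#} \<otimes>\<^bsub>P\<^esub> g i) [^]\<^bsub>P\<^esub> N =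
   H \<otimes>\<^bsub>P\<^esub> (mono R \<one> {#y k#} \<otimes>\<^bsub>P\<^esub> g k \<oplus>\<^bsub>P\<^esub> ?F) [^]\<^bsub>P\<^esub> N"
  using mP HP by (simp add: lessThan_Suc P.finsum_insert Pi_def)
 also have "\<dots> = (\<Oplus>\<^bsub>P\<^esub>s\<in>{..N}. add_pow P (N choose s) (mono R \<one> (replicate_mset s (y k)) \<otimes>\<^bsub>P\<^esub> ?q s))"
 proof -
  have "H \<otimes>\<^bsub>P\<^esub> add_pow P (N choose s) ((mono R \<one> {#y k#} \<otimes>\<^bsub>P\<^esub> g k) [^]\<^bsub>P\<^esub> s \<otimes>\<^bsub>P\<^esub> ?F [^]\<^bsub>P\<^esub> (N - s)) =
    add_pow P (N choose s) (mono R \<one> (replicate_mset s (y k)) \<otimes>\<^bsub>P\<^esub> ?q s)" for s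
   using mP[of k] HP F mono_s[of s] by (simp add: P.nat_pow_distrib powm P.add_pow_rdistr P.m_ac)
  then show ?thesis
   using mP HP F mono_s qP by (subst P.binomial) (auto simp: P.finsum_rdistr intro!: P.finsum_cong')
 qed
 finally have eq: "H \<otimes>\<^bsub>P\<^esub> (\<Oplus>\<^bsub>P\<^esub>i\<in>{..<Suc k}. mono R \<one> {#y i#} \<otimes>\<^bsub>P\<^esub> g i) [^]\<^bsub>P\<^esub> N =
   (\<Oplus>\<^bsub>P\<^esub>s\<in>{..N}. add_pow P (N choose s) (mono R \<one> (replicate_mset s (y k)) \<otimes>\<^bsub>P\<^esub> ?q s))" .
 have "(H \<otimes>\<^bsub>P\<^esub> (\<Oplus>\<^bsub>P\<^esub>i\<in>{..<Suc k}. mono R \<one> {#y i#} \<otimes>\<^bsub>P\<^esub> g i) [^]\<^bsub>P\<^esub> N) (?\<gamma> + replicate_mset (a k) (y k)) =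
   (\<Oplus>s\<in>{..N}. add_pow R (N choose s) ((mono R \<one> (replicate_mset s (y k)) \<otimes>\<^bsub>P\<^esub> ?q s) (?\<gamma> + replicate_mset (a k) (y k))))"
  unfolding eq using mono_s qP by (subst coeff_finsum) (auto simp: coeff_add_pow coeff_closed intro!: finsum_cong')
 \<comment> \<open>No other factor contains the variable \<open>y k\<close>, so only the term with s
   = \<open>a k\<close> contributes.\<close>
 also have "\<dots> = (\<Oplus>s\<in>{..N}. if a k = s then add_pow R (N choose s) (?q s ?\<gamma>) else \<zero>)"
 proof (rule finsum_cong'[OF refl])
  fix s
  show "add_pow R (N choose s) ((mono R \<one> (replicate_mset s (y k)) \<otimes>\<^bsub>P\<^esub> ?q s) (?\<gamma> + replicate_mset (a k) (y k))) =
   (if a k = s then add_pow R (N choose s) (?q s ?\<gamma>) else \<zero>)"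
   unfolding coeff_var_power_mult[OF J'(1) qJ yI[OF lessI] ynk ynb] by simp
 qed (use qP in \<open>auto simp: coeff_closed\<close>)
 also have "\<dots> = (if a k \<le> N then add_pow R (N choose a k) (?q (a k) ?\<gamma>) else \<zero>)"
  using finsum_delta[of "{..N}" "a k" "\<lambda>s. add_pow R (N choose s) (?q s ?\<gamma>)"] qP by (simp add: coeff_closed)
 also have "\<dots> = (if (\<Sum>i<Suc k. a i) = N then add_pow R (multinom_seq a (Suc k)) ((H \<otimes>\<^bsub>P\<^esub> power_seq g a (Suc k)) \<beta>) else \<zero>)"
 proof (cases "a k \<le> N")
  case True
  have ps: "power_seq g a k \<in> carrier P" using HP by (intro power_seq_closed) auto
  have "?q (a k) ?\<gamma> = (if (\<Sum>i<k. a i) = N - a k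
    then add_pow R (multinom_seq a k) (((H \<otimes>\<^bsub>P\<^esub> g k [^]\<^bsub>P\<^esub> a k) \<otimes>\<^bsub>P\<^esub> power_seq g a k) \<beta>) else \<zero>)"
  proof (rule Suc.IH)
   show "inj_on y {..<k}" using Suc.prems(2) by (auto simp: inj_on_def)
   show "H \<otimes>\<^bsub>P\<^esub> g k [^]\<^bsub>P\<^esub> a k \<in> carrier (mvpoly R J)"
    using Suc.prems(3,4) by (intro sub_closed[OF J]) auto
  qed (use Suc.prems in auto)
  then show ?thesis using True HP ps
   by (auto simp: coeff_closed P.m_assoc add.nat_pow_pow mult.commute add.commute)
 qed auto
 finally show ?case by (simp add: lessThan_Suc add_ac)
qed

end

section \<open>Functionals on divided power algebras\<close>

locale divided_powers = plain_cring A for A :: "'a ring" (structure) +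
 fixes M :: "('a, 'm) module"
 assumes module_M: "Module.module A M"
begin

sublocale M: Module.module A M by (rule module_M)

sublocale D: mvpolys A "carrier M \<times> (UNIV :: nat set)"
 by unfold_locales

lemma dp_poly_eq: "dp_poly A M = D.P"
 by (simp add: dp_poly_def)

abbreviation "gen m i \<equiv> mono A \<one> {#(m, i)#}"

lemma relations_closed: "dp_relations A M \<subseteq> carrier D.P"
proof -
 have g: "gen m i \<in> carrier D.P" if "m \<in> carrier M" for m i
  using that by (intro D.mono_closed) auto
 have c: "mono A a {#} \<in> carrier D.P" if "a \<in> carrier A" for a
  using that by (intro D.mono_closed) auto
 show ?thesis
  unfolding dp_relations_def Let_def dp_poly_eq indexed_var_eq_mono indexed_const_eq_mono
  by (auto intro!: D.P.minus_closed D.P.m_closed D.P.finsum_closed D.P.add.nat_pow_closed g c)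
qed

lemma ideal_dp: "ideal (dp_ideal A M) D.P"
 unfolding dp_ideal_def dp_poly_eq by (rule D.P.genideal_ideal[OF relations_closed])

end

text \<open>The data for the linear map on divided powers of degree N that belongs to the law v ->
  G(v)^N. As G will lift a linear map and be linear only modulo p, its linearity is demanded for
  i-th powers multiplied by \<open>N choose i\<close>, the combination in which they occur in the
  functional.\<close>

locale dp_functional = divided_powers A M + R: plain_cring R
 for A :: "'a ring" (structure) and M :: "('a, 'm) module" and R :: "'s ring" +
 fixes h :: "'a \<Rightarrow> 's" and G :: "'m \<Rightarrow> 's" and N :: nat
 assumes hom_h: "h \<in> ring_hom A R" and G_closed: "v \<in> carrier M \<Longrightarrow> G v \<in> carrier R"
  and G_add: "v \<in> carrier M \<Longrightarrow> v' \<in> carrier M \<Longrightarrow>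
   add_pow R (N choose i) (G (v \<oplus>\<^bsub>M\<^esub> v') [^]\<^bsub>R\<^esub> i) = add_pow R (N choose i) ((G v \<oplus>\<^bsub>R\<^esub> G v') [^]\<^bsub>R\<^esub> i)"
  and G_smult: "v \<in> carrier M \<Longrightarrow> a \<in> carrier A \<Longrightarrow>
   add_pow R (N choose i) (G (a \<odot>\<^bsub>M\<^esub> v) [^]\<^bsub>R\<^esub> i) = add_pow R (N choose i) ((h a \<otimes>\<^bsub>R\<^esub> G v) [^]\<^bsub>R\<^esub> i)"
begin

sublocale h: ring_hom_cring A R h
 by (intro ring_hom_cringI is_cring R.is_cring hom_h)

definition gv :: "'m \<times> nat \<Rightarrow> 's" where
 "gv x = (if fst x \<in> carrier M then G (fst x) [^]\<^bsub>R\<^esub> snd x else \<zero>\<^bsub>R\<^esub>)"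

lemma gv_closed [simp]: "gv x \<in> carrier R"
 by (simp add: gv_def G_closed)

text \<open>For linear G, this value at a product of symbols [v_i]_(a_i) is the coefficient of the
  monomial S^a in the power of G(S_1 v_1 + S_2 v_2 + ...) whose exponent is the total
  weight.\<close>

definition gm :: "('m \<times> nat) multiset \<Rightarrow> 's" where
 "gm \<mu> = add_pow R (multinom \<mu>) (monomial_value R gv \<mu>)"

lemma gm_closed [simp]: "gm \<mu> \<in> carrier R"
 by (simp add: gm_def)

lemma gm_add: "gm (\<mu> + \<nu>) = add_pow R ((weight \<mu> + weight \<nu>) choose weight \<mu>) (gm \<mu> \<otimes>\<^bsub>R\<^esub> gm \<nu>)"
 by (simp add: gm_def multinom_add R.monomial_value_add R.add_pow_ldistr R.add_pow_rdistr R.add.nat_pow_pow mult_ac)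

lemma gm_single: "gm {#(m, i)#} = gv (m, i)"
 by (simp add: gm_def)

definition T :: "('m \<times> nat) multiset \<Rightarrow> 's" where
 "T \<mu> = (if weight \<mu> = N then gm \<mu> else \<zero>\<^bsub>R\<^esub>)"

lemma T_closed [simp]: "T \<mu> \<in> carrier R"
 by (simp add: T_def)

definition LL :: "(('m \<times> nat) multiset \<Rightarrow> 'a) \<Rightarrow> 's" where
 "LL f = (\<Oplus>\<^bsub>R\<^esub>\<mu>\<in>{\<mu>. f \<mu> \<noteq> \<zero>}. h (f \<mu>) \<otimes>\<^bsub>R\<^esub> T \<mu>)"

lemma LL_superset:
 assumes "f \<in> carrier D.P" "finite S" "{\<mu>. f \<mu> \<noteq> \<zero>} \<subseteq> S"
 shows "LL f = (\<Oplus>\<^bsub>R\<^esub>\<mu>\<in>S. h (f \<mu>) \<otimes>\<^bsub>R\<^esub> T \<mu>)"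
 unfolding LL_def
 by (rule R.add.finprod_mono_neutral_cong_left) (use assms in \<open>auto simp: D.coeff_closed\<close>)

lemma LL_closed [simp]: "f \<in> carrier D.P \<Longrightarrow> LL f \<in> carrier R"
 by (auto simp: LL_def D.coeff_closed intro!: R.finsum_closed)

lemma LL_add:
 assumes "f \<in> carrier D.P" "g \<in> carrier D.P"
 shows "LL (f \<oplus>\<^bsub>D.P\<^esub> g) = LL f \<oplus>\<^bsub>R\<^esub> LL g"
proof -
 let ?S = "{\<mu>. f \<mu> \<noteq> \<zero>} \<union> {\<mu>. g \<mu> \<noteq> \<zero>}"
 have fin: "finite ?S" using assms by (auto simp: D.carrier_mvpoly)
 have "LL (f \<oplus>\<^bsub>D.P\<^esub> g) = (\<Oplus>\<^bsub>R\<^esub>\<mu>\<in>?S. h ((f \<oplus>\<^bsub>D.P\<^esub> g) \<mu>) \<otimes>\<^bsub>R\<^esub> T \<mu>)"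
  by (rule LL_superset) (use assms fin in \<open>auto simp: D.coeff_add\<close>)
 also have "\<dots> = (\<Oplus>\<^bsub>R\<^esub>\<mu>\<in>?S. h (f \<mu>) \<otimes>\<^bsub>R\<^esub> T \<mu> \<oplus>\<^bsub>R\<^esub> h (g \<mu>) \<otimes>\<^bsub>R\<^esub> T \<mu>)"
  by (rule R.finsum_cong') (use assms in \<open>auto simp: D.coeff_add D.coeff_closed R.l_distr\<close>)
 also have "\<dots> = (\<Oplus>\<^bsub>R\<^esub>\<mu>\<in>?S. h (f \<mu>) \<otimes>\<^bsub>R\<^esub> T \<mu>) \<oplus>\<^bsub>R\<^esub> (\<Oplus>\<^bsub>R\<^esub>\<mu>\<in>?S. h (g \<mu>) \<otimes>\<^bsub>R\<^esub> T \<mu>)"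
  by (rule R.finsum_addf) (use assms in \<open>auto simp: D.coeff_closed\<close>)
 finally show ?thesis
  using assms fin by (simp add: LL_superset[of f ?S] LL_superset[of g ?S])
qed

lemma LL_mono: "a \<in> carrier A \<Longrightarrow> set_mset \<mu> \<subseteq> carrier M \<times> UNIV \<Longrightarrow> LL (mono A a \<mu>) = h a \<otimes>\<^bsub>R\<^esub> T \<mu>"
 using D.mono_closed[of a \<mu>]
 by (subst LL_superset[of _ "{\<mu>}"]) (auto simp: mono_def split: if_splits)

lemma LL_zero: "LL \<zero>\<^bsub>D.P\<^esub> = \<zero>\<^bsub>R\<^esub>"
 by (simp add: LL_def D.coeff_zero)

lemma LL_uminus: "f \<in> carrier D.P \<Longrightarrow> LL (\<ominus>\<^bsub>D.P\<^esub> f) = \<ominus>\<^bsub>R\<^esub> LL f"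
 using LL_add[of "\<ominus>\<^bsub>D.P\<^esub> f" f] by (intro R.minus_equality[symmetric]) (simp_all add: D.P.l_neg LL_zero)

lemma LL_minus: "f \<in> carrier D.P \<Longrightarrow> g \<in> carrier D.P \<Longrightarrow> LL (f \<ominus>\<^bsub>D.P\<^esub> g) = LL f \<ominus>\<^bsub>R\<^esub> LL g"
 by (simp add: D.P.minus_eq R.minus_eq LL_add LL_uminus)

lemma LL_finsum:
 "finite B \<Longrightarrow> (\<And>i. i \<in> B \<Longrightarrow> f i \<in> carrier D.P) \<Longrightarrow> LL (\<Oplus>\<^bsub>D.P\<^esub>i\<in>B. f i) = (\<Oplus>\<^bsub>R\<^esub>i\<in>B. LL (f i))"
 by (induction B rule: finite_induct) (auto simp: LL_zero LL_add Pi_def D.P.finsum_closed)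

lemma LL_add_pow: "f \<in> carrier D.P \<Longrightarrow> LL (add_pow D.P (k::nat) f) = add_pow R k (LL f)"
 by (induction k) (simp_all add: LL_zero LL_add)

text \<open>Separating the symbols of the relation from the monomial \<kappa> leaves the factor
  \<open>N choose i\<close>. The scalar relation is then an axiom on G, the sum relation an axiom
  together with the binomial theorem, and the product relation is the binomial coefficient that
  \<open>gm_add\<close> produces.\<close>

lemma LL_mono_relation:
 assumes c: "c \<in> carrier A" and \<kappa>: "set_mset \<kappa> \<subseteq> carrier M \<times> UNIV" and \<rho>: "\<rho> \<in> dp_relations A M"
 shows "LL (mono A c \<kappa> \<otimes>\<^bsub>D.P\<^esub> \<rho>) = \<zero>\<^bsub>R\<^esub>"
proof -
 have X: "mono A c \<kappa> \<in> carrier D.P" using c \<kappa> by (rule D.mono_closed)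
 have g: "gen m i \<in> carrier D.P" if "m \<in> carrier M" for m i
  using that by (intro D.mono_closed) auto
 have mm: "mono A c \<kappa> \<otimes>\<^bsub>D.P\<^esub> mono A a \<nu> = mono A (c \<otimes> a) (\<kappa> + \<nu>)"
  "mono A c \<kappa> \<otimes>\<^bsub>D.P\<^esub> mono A a \<nu> \<in> carrier D.P"
  "LL (mono A c \<kappa> \<otimes>\<^bsub>D.P\<^esub> mono A a \<nu>) = h c \<otimes>\<^bsub>R\<^esub> (h a \<otimes>\<^bsub>R\<^esub> T (\<kappa> + \<nu>))"
  if "a \<in> carrier A" "set_mset \<nu> \<subseteq> carrier M \<times> UNIV" for a \<nu>
 proof -
  show e: "mono A c \<kappa> \<otimes>\<^bsub>D.P\<^esub> mono A a \<nu> = mono A (c \<otimes> a) (\<kappa> + \<nu>)"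
   using c \<kappa> that by (intro D.mono_mult)
  show "mono A c \<kappa> \<otimes>\<^bsub>D.P\<^esub> mono A a \<nu> \<in> carrier D.P" unfolding e using c \<kappa> that by (intro D.mono_closed) auto
  show "LL (mono A c \<kappa> \<otimes>\<^bsub>D.P\<^esub> mono A a \<nu>) = h c \<otimes>\<^bsub>R\<^esub> (h a \<otimes>\<^bsub>R\<^esub> T (\<kappa> + \<nu>))"
   unfolding e using c \<kappa> that by (subst LL_mono) (auto simp: R.m_assoc)
 qed
 have diff0: "x \<ominus>\<^bsub>R\<^esub> x = \<zero>\<^bsub>R\<^esub>" if "x \<in> carrier R" for x using that by (simp add: R.minus_eq R.r_neg)
 note hc = h.hom_closed[OF c]
 \<comment> \<open>By \<open>gm_add\<close> the factor is \<open>N choose weight \<kappa>\<close>,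
   which is \<open>N choose i\<close> when the weights add up to N.\<close>
 have Tsingle: "T (\<kappa> + {#(m, i)#}) = (if weight \<kappa> + i = N then add_pow R (N choose i) (gm \<kappa> \<otimes>\<^bsub>R\<^esub> G m [^]\<^bsub>R\<^esub> i) else \<zero>\<^bsub>R\<^esub>)"
  if "m \<in> carrier M" for m i
  using that binomial_symmetric[of i N] gm_add[of \<kappa> "{#(m, i)#}"] by (auto simp: T_def gm_single gv_def)
 have Tpair: "T (\<kappa> + {#(m, s), (m', t)#}) = (if weight \<kappa> + (s + t) = N then
   add_pow R (N choose (s + t)) (gm \<kappa> \<otimes>\<^bsub>R\<^esub> add_pow R ((s + t) choose s) (G m [^]\<^bsub>R\<^esub> s \<otimes>\<^bsub>R\<^esub> G m' [^]\<^bsub>R\<^esub> t)) else \<zero>\<^bsub>R\<^esub>)"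
  if "m \<in> carrier M" "m' \<in> carrier M" for m m' s t
 proof -
  have "gm {#(m, s), (m', t)#} = add_pow R ((s + t) choose s) (G m [^]\<^bsub>R\<^esub> s \<otimes>\<^bsub>R\<^esub> G m' [^]\<^bsub>R\<^esub> t)"
   using gm_add[of "{#(m, s)#}" "{#(m', t)#}"] that by (simp add: gm_single gv_def add_mset_commute)
  then show ?thesis
   using that binomial_symmetric[of "s + t" N] gm_add[of \<kappa> "{#(m, s), (m', t)#}"]
   by (auto simp: T_def)
 qed
 let ?P1 = "\<exists>m. \<rho> = gen m 0 \<ominus>\<^bsub>D.P\<^esub> \<one>\<^bsub>D.P\<^esub> \<and> m \<in> carrier M"
 let ?P2 = "\<exists>a m i. \<rho> = gen (a \<odot>\<^bsub>M\<^esub> m) i \<ominus>\<^bsub>D.P\<^esub> (mono A (a [^] i) {#} \<otimes>\<^bsub>D.P\<^esub> gen m i)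
    \<and> a \<in> carrier A \<and> m \<in> carrier M"
 let ?P3 = "\<exists>m m' i. \<rho> = gen (m \<oplus>\<^bsub>M\<^esub> m') i \<ominus>\<^bsub>D.P\<^esub> (\<Oplus>\<^bsub>D.P\<^esub>s\<in>{..i}. gen m s \<otimes>\<^bsub>D.P\<^esub> gen m' (i - s))
    \<and> m \<in> carrier M \<and> m' \<in> carrier M"
 let ?P4 = "\<exists>m s t. \<rho> = (gen m s \<otimes>\<^bsub>D.P\<^esub> gen m t) \<ominus>\<^bsub>D.P\<^esub> add_pow D.P ((s + t) choose s) (gen m (s + t))
    \<and> m \<in> carrier M"
 have "((?P1 \<or> ?P2) \<or> ?P3) \<or> ?P4"
  using \<rho> unfolding dp_relations_def Let_def dp_poly_eq indexed_var_eq_mono indexed_const_eq_mono Un_iff mem_Collect_eq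
  by assumption
 then show ?thesis
 proof (elim disjE)
  assume ?P1
  then obtain m where zero: "m \<in> carrier M" "\<rho> = gen m 0 \<ominus>\<^bsub>D.P\<^esub> \<one>\<^bsub>D.P\<^esub>" by (elim exE conjE)
  then have "LL (mono A c \<kappa> \<otimes>\<^bsub>D.P\<^esub> \<rho>) =
    LL (mono A c \<kappa> \<otimes>\<^bsub>D.P\<^esub> gen m 0) \<ominus>\<^bsub>R\<^esub> LL (mono A c \<kappa> \<otimes>\<^bsub>D.P\<^esub> mono A \<one> {#})"
   using X g[of m 0] mm(2)[of \<one> "{#}"] D.mono_closed[of \<one> "{#}"]
   by (simp add: D.P.r_minus D.P.minus_eq D.P.r_distr LL_add LL_uminus R.minus_eq D.one_eq_mono)
  moreover have "T (\<kappa> + {#(m, 0)#}) = T \<kappa>"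
   using zero gm_add[of \<kappa> "{#(m, 0)#}"] by (simp add: T_def gm_single gv_def)
  ultimately show ?thesis using zero hc by (simp add: mm(3) diff0)
 next
  assume ?P2
  then obtain a m i where smult: "a \<in> carrier A" "m \<in> carrier M"
    "\<rho> = gen (a \<odot>\<^bsub>M\<^esub> m) i \<ominus>\<^bsub>D.P\<^esub> (mono A (a [^] i) {#} \<otimes>\<^bsub>D.P\<^esub> gen m i)" by (elim exE conjE)
  have e: "mono A (a [^] i) {#} \<otimes>\<^bsub>D.P\<^esub> gen m i = mono A (a [^] i) {#(m, i)#}"
   using smult by (subst D.mono_mult) auto
  have cl: "mono A (a [^] i) {#(m, i)#} \<in> carrier D.P" using smult by (intro D.mono_closed) auto
  have "LL (mono A c \<kappa> \<otimes>\<^bsub>D.P\<^esub> \<rho>) =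
    LL (mono A c \<kappa> \<otimes>\<^bsub>D.P\<^esub> gen (a \<odot>\<^bsub>M\<^esub> m) i) \<ominus>\<^bsub>R\<^esub> LL (mono A c \<kappa> \<otimes>\<^bsub>D.P\<^esub> mono A (a [^] i) {#(m, i)#})"
   using X g[of "a \<odot>\<^bsub>M\<^esub> m" i] cl smult unfolding smult(3) e
   by (simp add: D.P.r_minus D.P.minus_eq D.P.r_distr LL_add LL_uminus R.minus_eq)
  moreover have "T (\<kappa> + {#(a \<odot>\<^bsub>M\<^esub> m, i)#}) = h (a [^] i) \<otimes>\<^bsub>R\<^esub> T (\<kappa> + {#(m, i)#})"
  proof -
   have ha: "h (a [^] i) = h a [^]\<^bsub>R\<^esub> i" using smult by (induction i) auto
   have "add_pow R (N choose i) (gm \<kappa> \<otimes>\<^bsub>R\<^esub> G (a \<odot>\<^bsub>M\<^esub> m) [^]\<^bsub>R\<^esub> i) =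
     gm \<kappa> \<otimes>\<^bsub>R\<^esub> add_pow R (N choose i) (G (a \<odot>\<^bsub>M\<^esub> m) [^]\<^bsub>R\<^esub> i)"
    using smult by (simp add: R.add_pow_rdistr G_closed)
   also have "\<dots> = h a [^]\<^bsub>R\<^esub> i \<otimes>\<^bsub>R\<^esub> add_pow R (N choose i) (gm \<kappa> \<otimes>\<^bsub>R\<^esub> G m [^]\<^bsub>R\<^esub> i)"
    using smult by (simp add: G_smult G_closed R.nat_pow_distrib R.add_pow_rdistr R.m_lcomm)
   finally show ?thesis using smult Tsingle[of "a \<odot>\<^bsub>M\<^esub> m" i] Tsingle[of m i] by (simp add: ha)
  qed
  ultimately show ?thesis using smult hc by (simp add: mm(3) diff0)
 next
  assume ?P3
  then obtain m m' i where add: "m \<in> carrier M" "m' \<in> carrier M"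
    "\<rho> = gen (m \<oplus>\<^bsub>M\<^esub> m') i \<ominus>\<^bsub>D.P\<^esub> (\<Oplus>\<^bsub>D.P\<^esub>s\<in>{..i}. gen m s \<otimes>\<^bsub>D.P\<^esub> gen m' (i - s))" by (elim exE conjE)
  have e: "gen m s \<otimes>\<^bsub>D.P\<^esub> gen m' (i - s) = mono A \<one> {#(m, s), (m', i - s)#}" for s
   using add by (subst D.mono_mult) (auto simp: add_mset_commute)
  have cl: "mono A \<one> {#(m, s), (m', i - s)#} \<in> carrier D.P" for s using add by (intro D.mono_closed) auto
  have "LL (mono A c \<kappa> \<otimes>\<^bsub>D.P\<^esub> \<rho>) = LL (mono A c \<kappa> \<otimes>\<^bsub>D.P\<^esub> gen (m \<oplus>\<^bsub>M\<^esub> m') i) \<ominus>\<^bsub>R\<^esub>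
    LL (mono A c \<kappa> \<otimes>\<^bsub>D.P\<^esub> (\<Oplus>\<^bsub>D.P\<^esub>s\<in>{..i}. mono A \<one> {#(m, s), (m', i - s)#}))"
   using X g[of "m \<oplus>\<^bsub>M\<^esub> m'" i] cl add D.P.finsum_closed[of "\<lambda>s. mono A \<one> {#(m, s), (m', i - s)#}" "{..i}"]
   unfolding add(3) e
   by (simp add: D.P.r_minus D.P.minus_eq D.P.r_distr LL_add LL_uminus R.minus_eq Pi_def)
  also have "LL (mono A c \<kappa> \<otimes>\<^bsub>D.P\<^esub> (\<Oplus>\<^bsub>D.P\<^esub>s\<in>{..i}. mono A \<one> {#(m, s), (m', i - s)#})) =
    (\<Oplus>\<^bsub>R\<^esub>s\<in>{..i}. LL (mono A c \<kappa> \<otimes>\<^bsub>D.P\<^esub> mono A \<one> {#(m, s), (m', i - s)#}))"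
   using X cl by (simp add: D.P.finsum_rdistr LL_finsum Pi_def)
  also have "\<dots> = (\<Oplus>\<^bsub>R\<^esub>s\<in>{..i}. h c \<otimes>\<^bsub>R\<^esub> T (\<kappa> + {#(m, s), (m', i - s)#}))"
   using add hc by (intro R.finsum_cong') (auto simp: mm(3))
  also have "\<dots> = h c \<otimes>\<^bsub>R\<^esub> (\<Oplus>\<^bsub>R\<^esub>s\<in>{..i}. T (\<kappa> + {#(m, s), (m', i - s)#}))"
   using hc by (intro R.finsum_rdistr[symmetric]) auto
  also have "(\<Oplus>\<^bsub>R\<^esub>s\<in>{..i}. T (\<kappa> + {#(m, s), (m', i - s)#})) = T (\<kappa> + {#(m \<oplus>\<^bsub>M\<^esub> m', i)#})"
  proof (cases "weight \<kappa> + i = N")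
   case True
   let ?t = "\<lambda>s. add_pow R (i choose s) (G m [^]\<^bsub>R\<^esub> s \<otimes>\<^bsub>R\<^esub> G m' [^]\<^bsub>R\<^esub> (i - s))"
   have t: "?t s \<in> carrier R" for s using add by (simp add: G_closed)
   have "(\<Oplus>\<^bsub>R\<^esub>s\<in>{..i}. T (\<kappa> + {#(m, s), (m', i - s)#})) =
     (\<Oplus>\<^bsub>R\<^esub>s\<in>{..i}. add_pow R (N choose i) (gm \<kappa>) \<otimes>\<^bsub>R\<^esub> ?t s)"
   proof (rule R.finsum_cong'[OF refl])
    fix s assume "s \<in> {..i}"
    then show "T (\<kappa> + {#(m, s), (m', i - s)#}) = add_pow R (N choose i) (gm \<kappa>) \<otimes>\<^bsub>R\<^esub> ?t s"
     using Tpair[of m m' s "i - s"] add True t[of s] by (simp add: R.add_pow_ldistr)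
   qed (use t in auto)
   also have "\<dots> = add_pow R (N choose i) (gm \<kappa>) \<otimes>\<^bsub>R\<^esub> (G m \<oplus>\<^bsub>R\<^esub> G m') [^]\<^bsub>R\<^esub> i"
    using add t by (subst R.finsum_rdistr[symmetric]) (auto simp: R.binomial G_closed)
   also have "\<dots> = gm \<kappa> \<otimes>\<^bsub>R\<^esub> add_pow R (N choose i) ((G m \<oplus>\<^bsub>R\<^esub> G m') [^]\<^bsub>R\<^esub> i)"
    using add by (simp add: R.add_pow_ldistr R.add_pow_rdistr G_closed)
   also have "\<dots> = T (\<kappa> + {#(m \<oplus>\<^bsub>M\<^esub> m', i)#})"
    using add True Tsingle[of "m \<oplus>\<^bsub>M\<^esub> m'" i] by (simp add: G_add[symmetric] R.add_pow_rdistr G_closed)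
   finally show ?thesis .
  next
   case False
   then show ?thesis using add Tpair[of m m' s "i - s" for s]
    by (intro trans[OF R.finsum_all0]) (auto simp: T_def)
  qed
  finally show ?thesis using add hc by (simp add: mm(3) diff0)
 next
  assume ?P4
  then obtain m s t where mult: "m \<in> carrier M"
    "\<rho> = (gen m s \<otimes>\<^bsub>D.P\<^esub> gen m t) \<ominus>\<^bsub>D.P\<^esub> add_pow D.P ((s + t) choose s) (gen m (s + t))" by (elim exE conjE)
  have e: "gen m s \<otimes>\<^bsub>D.P\<^esub> gen m t = mono A \<one> {#(m, s), (m, t)#}"
   using mult by (subst D.mono_mult) (auto simp: add_mset_commute)
  have cl: "mono A \<one> {#(m, s), (m, t)#} \<in> carrier D.P" using mult by (intro D.mono_closed) auto
  have "LL (mono A c \<kappa> \<otimes>\<^bsub>D.P\<^esub> \<rho>) = LL (mono A c \<kappa> \<otimes>\<^bsub>D.P\<^esub> mono A \<one> {#(m, s), (m, t)#}) \<ominus>\<^bsub>R\<^esub>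
    add_pow R ((s + t) choose s) (LL (mono A c \<kappa> \<otimes>\<^bsub>D.P\<^esub> gen m (s + t)))"
   using X g[of m "s + t"] cl mult unfolding mult(2) e
   by (simp add: D.P.r_minus D.P.minus_eq D.P.r_distr LL_add LL_uminus R.minus_eq D.P.add_pow_rdistr LL_add_pow)
  moreover have "T (\<kappa> + {#(m, s), (m, t)#}) = add_pow R ((s + t) choose s) (T (\<kappa> + {#(m, s + t)#}))"
  proof -
   have "G m [^]\<^bsub>R\<^esub> s \<otimes>\<^bsub>R\<^esub> G m [^]\<^bsub>R\<^esub> t = G m [^]\<^bsub>R\<^esub> (s + t)"
    using mult by (simp add: R.nat_pow_mult G_closed)
   then show ?thesis
    using mult Tpair[of m m s t] Tsingle[of m "s + t"] by (simp add: G_closed R.add_pow_rdistr R.add.nat_pow_pow mult_ac)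
  qed
  ultimately show ?thesis using mult hc by (simp add: mm(3) diff0 R.add_pow_rdistr)
 qed
qed

text \<open>\<open>LL\<close> is not multiplicative, so its kernel need not be an ideal. The
  elements all of whose multiples are killed do form one, and it contains the relations because
  every multiplier is a sum of monomials.\<close>

lemma LL_ideal:
 assumes "f \<in> dp_ideal A M"
 shows "LL f = \<zero>\<^bsub>R\<^esub>"
proof -
 let ?I = "{\<rho> \<in> carrier D.P. \<forall>f\<in>carrier D.P. LL (f \<otimes>\<^bsub>D.P\<^esub> \<rho>) = \<zero>\<^bsub>R\<^esub>}"
 have "ideal ?I D.P"
 proof (rule idealI)
  show "ring D.P" ..
  show "subgroup ?I (add_monoid D.P)"
  proof (rule group.subgroupI[OF D.P.a_group])
   show "inv\<^bsub>add_monoid D.P\<^esub> a \<in> ?I" if "a \<in> ?I" for a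
    unfolding a_inv_def[symmetric] using that by (simp add: D.P.r_minus LL_uminus)
  qed (auto simp: LL_zero D.P.r_distr LL_add intro!: exI[of _ "\<zero>\<^bsub>D.P\<^esub>"])
  show "x \<otimes>\<^bsub>D.P\<^esub> a \<in> ?I" "a \<otimes>\<^bsub>D.P\<^esub> x \<in> ?I" if "a \<in> ?I" "x \<in> carrier D.P" for a x
   using that by (auto simp: D.P.m_assoc[symmetric] D.P.m_comm[of a x])
 qed
 moreover have "dp_relations A M \<subseteq> ?I"
 proof
  fix \<rho> assume \<rho>: "\<rho> \<in> dp_relations A M"
  then have \<rho>P: "\<rho> \<in> carrier D.P" using relations_closed by blast
  have "LL (f \<otimes>\<^bsub>D.P\<^esub> \<rho>) = \<zero>\<^bsub>R\<^esub>" if f: "f \<in> carrier D.P" for f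
  proof -
   let ?S = "{\<mu>. f \<mu> \<noteq> \<zero>}"
   have fin: "finite ?S" and k: "\<And>\<mu>. \<mu> \<in> ?S \<Longrightarrow> set_mset \<mu> \<subseteq> carrier M \<times> UNIV"
    using f by (auto simp: D.carrier_mvpoly)
   then have m: "\<And>\<mu>. \<mu> \<in> ?S \<Longrightarrow> mono A (f \<mu>) \<mu> \<in> carrier D.P"
    using f by (intro D.mono_closed) (auto simp: D.coeff_closed)
   have "f \<otimes>\<^bsub>D.P\<^esub> \<rho> = (\<Oplus>\<^bsub>D.P\<^esub>\<mu>\<in>?S. mono A (f \<mu>) \<mu>) \<otimes>\<^bsub>D.P\<^esub> \<rho>"
    using D.poly_eq_finsum_mono[OF f] by simp
   also have "\<dots> = (\<Oplus>\<^bsub>D.P\<^esub>\<mu>\<in>?S. mono A (f \<mu>) \<mu> \<otimes>\<^bsub>D.P\<^esub> \<rho>)"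
    by (rule D.P.finsum_ldistr[OF fin \<rho>P]) (use m in auto)
   finally have e: "f \<otimes>\<^bsub>D.P\<^esub> \<rho> = (\<Oplus>\<^bsub>D.P\<^esub>\<mu>\<in>?S. mono A (f \<mu>) \<mu> \<otimes>\<^bsub>D.P\<^esub> \<rho>)" .
   have "LL (f \<otimes>\<^bsub>D.P\<^esub> \<rho>) = (\<Oplus>\<^bsub>R\<^esub>\<mu>\<in>?S. LL (mono A (f \<mu>) \<mu> \<otimes>\<^bsub>D.P\<^esub> \<rho>))"
    unfolding e by (rule LL_finsum[OF fin]) (use m \<rho>P in auto)
   also have "\<dots> = \<zero>\<^bsub>R\<^esub>"
    by (rule R.finsum_all0) (use LL_mono_relation \<rho> k f in \<open>auto simp: D.coeff_closed\<close>)
   finally show ?thesis .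
  qed
  then show "\<rho> \<in> ?I" using \<rho>P by blast
 qed
 ultimately have "dp_ideal A M \<subseteq> ?I"
  unfolding dp_ideal_def dp_poly_eq by (rule D.P.genideal_minimal)
 then have "f \<in> carrier D.P" "LL (\<one>\<^bsub>D.P\<^esub> \<otimes>\<^bsub>D.P\<^esub> f) = \<zero>\<^bsub>R\<^esub>" using assms by auto
 then show ?thesis by simp
qed

end

section \<open>Quotient modules\<close>

lemma module_image:
 fixes M :: "('a, 'm, 'e) module_scheme" and N :: "('a, 'n, 'f) module_scheme"
 assumes M: "Module.module R M"
  and carr: "carrier N = h ` carrier M"
  and add: "\<And>x y. x \<in> carrier M \<Longrightarrow> y \<in> carrier M \<Longrightarrow> h (x \<oplus>\<^bsub>M\<^esub> y) = h x \<oplus>\<^bsub>N\<^esub> h y"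
  and zero: "h \<zero>\<^bsub>M\<^esub> = \<zero>\<^bsub>N\<^esub>"
  and smult: "\<And>a x. a \<in> carrier R \<Longrightarrow> x \<in> carrier M \<Longrightarrow> h (a \<odot>\<^bsub>M\<^esub> x) = a \<odot>\<^bsub>N\<^esub> h x"
 shows "Module.module R N"
proof -
 interpret M: Module.module R M by (rule M)
 show ?thesis
 proof (rule moduleI)
  show "cring R" ..
  show "abelian_group N"
  proof (rule abelian_groupI)
   fix x assume "x \<in> carrier N"
   then obtain a where a: "a \<in> carrier M" "x = h a" using carr by auto
   show "\<exists>y\<in>carrier N. y \<oplus>\<^bsub>N\<^esub> x = \<zero>\<^bsub>N\<^esub>"
    using a add[of "\<ominus>\<^bsub>M\<^esub> a" a] zero carr
    by (intro bexI[of _ "h (\<ominus>\<^bsub>M\<^esub> a)"]) (auto simp: M.M.l_neg)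
  qed (use carr zero in \<open>auto simp: M.M.a_ac simp flip: add zero\<close>)
 qed (use carr in \<open>auto simp flip: add smult simp: M.smult_l_distr M.smult_r_distr M.smult_assoc1\<close>)
qed

lemma module_restrict_scalars:
 assumes "Module.module A M" "cring W" and h: "h \<in> ring_hom W A"
 shows "Module.module W (res_scalars h M)"
proof -
 interpret M: Module.module A M by fact
 have ab: "abelian_group (res_scalars h M)"
 proof (rule abelian_groupI)
  fix x assume "x \<in> carrier (res_scalars h M)"
  then show "\<exists>y\<in>carrier (res_scalars h M). y \<oplus>\<^bsub>res_scalars h M\<^esub> x = \<zero>\<^bsub>res_scalars h M\<^esub>"
   by (intro bexI[of _ "\<ominus>\<^bsub>M\<^esub> x"]) (auto simp: res_scalars_def M.M.l_neg)
 qed (auto simp: res_scalars_def M.M.a_ac)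
 show ?thesis
  using ring_hom_closed[OF h] ring_hom_add[OF h] ring_hom_mult[OF h] ring_hom_one[OF h] assms(2)
  by (intro moduleI ab) (auto simp: res_scalars_def M.smult_l_distr M.smult_r_distr M.smult_assoc1)
qed

locale plain_module = Module.module R M for R :: "'a ring" (structure) and M :: "('a, 'm) module"
begin

lemma submodule_abelian_subgroup:
 assumes N: "submodule R N M"
 shows "abelian_subgroup N M"
proof (rule abelian_subgroupI3)
 interpret N: submodule R N M by (rule N)
 have neg: "\<ominus>\<^bsub>M\<^esub> x \<in> N" if "x \<in> N" for x
 proof -
  have x: "x \<in> carrier M" using that N.subset by auto
  then show ?thesis using that smult_l_minus[of \<one> x] N.smult_closed[of "\<ominus> \<one>" x] by simp
 qed
 show "additive_subgroup N M"
  unfolding additive_subgroup_def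
 proof (rule group.subgroupI[OF M.a_group], unfold a_inv_def[symmetric])
  show "N \<noteq> {}" using N.zero_closed by blast
 qed (use N.subset N.m_closed neg in auto)
qed (rule M.abelian_group_axioms)

lemma quot_module_basics:
 assumes N: "submodule R N M"
 shows "carrier (quot_module M N) = (\<lambda>x. N +>\<^bsub>M\<^esub> x) ` carrier M"
  and "x \<in> carrier M \<Longrightarrow> y \<in> carrier M \<Longrightarrow> (N +>\<^bsub>M\<^esub> x) \<oplus>\<^bsub>quot_module M N\<^esub> (N +>\<^bsub>M\<^esub> y) = N +>\<^bsub>M\<^esub> (x \<oplus>\<^bsub>M\<^esub> y)"
  and "\<zero>\<^bsub>quot_module M N\<^esub> = N +>\<^bsub>M\<^esub> \<zero>\<^bsub>M\<^esub>"
  and "a \<in> carrier R \<Longrightarrow> x \<in> carrier M \<Longrightarrow> a \<odot>\<^bsub>quot_module M N\<^esub> (N +>\<^bsub>M\<^esub> x) = N +>\<^bsub>M\<^esub> (a \<odot>\<^bsub>M\<^esub> x)"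
  and "x \<in> carrier M \<Longrightarrow> y \<in> carrier M \<Longrightarrow> N +>\<^bsub>M\<^esub> x = N +>\<^bsub>M\<^esub> y \<longleftrightarrow> x \<ominus>\<^bsub>M\<^esub> y \<in> N"
  and "x \<in> carrier M \<Longrightarrow> y \<in> N +>\<^bsub>M\<^esub> x \<longleftrightarrow> y \<in> carrier M \<and> N +>\<^bsub>M\<^esub> y = N +>\<^bsub>M\<^esub> x"
proof -
 interpret S: abelian_subgroup N M by (rule submodule_abelian_subgroup[OF N])
 interpret N: submodule R N M by (rule N)
 have mem: "y \<in> N +>\<^bsub>M\<^esub> x \<longleftrightarrow> y \<in> carrier M \<and> y \<ominus>\<^bsub>M\<^esub> x \<in> N" if "x \<in> carrier M" for x y
 proof
  assume "y \<in> N +>\<^bsub>M\<^esub> x"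
  then obtain n where n: "n \<in> N" "y = n \<oplus>\<^bsub>M\<^esub> x" by (auto simp: a_r_coset_def')
  then show "y \<in> carrier M \<and> y \<ominus>\<^bsub>M\<^esub> x \<in> N"
   using that S.a_subset by (auto simp: M.minus_eq M.a_assoc M.r_neg subset_iff)
 next
  assume y: "y \<in> carrier M \<and> y \<ominus>\<^bsub>M\<^esub> x \<in> N"
  then have "y = (y \<ominus>\<^bsub>M\<^esub> x) \<oplus>\<^bsub>M\<^esub> x" using that by (simp add: M.minus_eq M.a_assoc M.l_neg)
  then show "y \<in> N +>\<^bsub>M\<^esub> x" using y by (auto simp: a_r_coset_def')
 qed
 have self: "x \<in> N +>\<^bsub>M\<^esub> x" if "x \<in> carrier M" for x using that by (rule S.a_rcos_self)
 have ind: "N +>\<^bsub>M\<^esub> x = N +>\<^bsub>M\<^esub> y" if "x \<in> carrier M" "y \<in> N +>\<^bsub>M\<^esub> x" for x y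
  using that by (intro S.a_repr_independence')
 show eq: "N +>\<^bsub>M\<^esub> x = N +>\<^bsub>M\<^esub> y \<longleftrightarrow> x \<ominus>\<^bsub>M\<^esub> y \<in> N" if "x \<in> carrier M" "y \<in> carrier M" for x y
  using mem[of y x] self[of x] ind[of y x] that by auto
 show "y \<in> N +>\<^bsub>M\<^esub> x \<longleftrightarrow> y \<in> carrier M \<and> N +>\<^bsub>M\<^esub> y = N +>\<^bsub>M\<^esub> x" if "x \<in> carrier M" for x y
  using mem[of x y] ind[of x y] self[of y] that by auto
 show "carrier (quot_module M N) = (\<lambda>x. N +>\<^bsub>M\<^esub> x) ` carrier M"
  by (auto simp: quot_module_def A_RCOSETS_def')
 show "(N +>\<^bsub>M\<^esub> x) \<oplus>\<^bsub>quot_module M N\<^esub> (N +>\<^bsub>M\<^esub> y) = N +>\<^bsub>M\<^esub> (x \<oplus>\<^bsub>M\<^esub> y)" if "x \<in> carrier M" "y \<in> carrier M" for x y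
  using S.a_rcos_sum[OF that] by (simp add: quot_module_def)
 show "\<zero>\<^bsub>quot_module M N\<^esub> = N +>\<^bsub>M\<^esub> \<zero>\<^bsub>M\<^esub>"
  using M.a_coset_add_zero[of N] S.a_subset by (simp add: quot_module_def)
 show "a \<odot>\<^bsub>quot_module M N\<^esub> (N +>\<^bsub>M\<^esub> x) = N +>\<^bsub>M\<^esub> (a \<odot>\<^bsub>M\<^esub> x)" if "a \<in> carrier R" "x \<in> carrier M" for a x
 proof -
  have "N +>\<^bsub>M\<^esub> (a \<odot>\<^bsub>M\<^esub> y) = N +>\<^bsub>M\<^esub> (a \<odot>\<^bsub>M\<^esub> x)" if y: "y \<in> N +>\<^bsub>M\<^esub> x" for y
  proof -
   have y': "y \<in> carrier M" "y \<ominus>\<^bsub>M\<^esub> x \<in> N" using y mem \<open>x \<in> carrier M\<close> by auto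
   have "a \<odot>\<^bsub>M\<^esub> y \<ominus>\<^bsub>M\<^esub> a \<odot>\<^bsub>M\<^esub> x = a \<odot>\<^bsub>M\<^esub> (y \<ominus>\<^bsub>M\<^esub> x)"
    using \<open>a \<in> carrier R\<close> \<open>x \<in> carrier M\<close> y' by (simp add: M.minus_eq smult_r_distr smult_r_minus)
   also have "\<dots> \<in> N" using \<open>a \<in> carrier R\<close> y' by (intro N.smult_closed)
   finally show ?thesis using \<open>a \<in> carrier R\<close> \<open>x \<in> carrier M\<close> y' by (subst eq) auto
  qed
  moreover have "N +>\<^bsub>M\<^esub> x \<noteq> {}" using self[OF that(2)] by blast
  ultimately have "(\<Union>y\<in>N +>\<^bsub>M\<^esub> x. N +>\<^bsub>M\<^esub> (a \<odot>\<^bsub>M\<^esub> y)) = N +>\<^bsub>M\<^esub> (a \<odot>\<^bsub>M\<^esub> x)"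
   by (intro SUP_eq_const)
  then show ?thesis by (simp add: quot_module_def)
 qed
qed

lemma module_quot_module:
 assumes N: "submodule R N M"
 shows "Module.module R (quot_module M N)"
 by (rule module_image[where h="\<lambda>x. N +>\<^bsub>M\<^esub> x" and M=M])
  (simp_all add: quot_module_basics[OF N] module_axioms)

end

section \<open>The pairing of divided powers\<close>

abbreviation "lin_maps \<equiv> LinearCombinations.module_hom"

lemma (in Module.module) span_induct:
 assumes S: "S \<subseteq> carrier M" and x: "x \<in> span S" and gen: "\<And>s. s \<in> S \<Longrightarrow> Q s" and zero: "Q \<zero>\<^bsub>M\<^esub>"
  and add: "\<And>x y. x \<in> carrier M \<Longrightarrow> y \<in> carrier M \<Longrightarrow> Q x \<Longrightarrow> Q y \<Longrightarrow> Q (x \<oplus>\<^bsub>M\<^esub> y)"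
  and smult: "\<And>a x. a \<in> carrier R \<Longrightarrow> x \<in> carrier M \<Longrightarrow> Q x \<Longrightarrow> Q (a \<odot>\<^bsub>M\<^esub> x)"
 shows "Q x"
proof -
 have "LinearCombinations.submodule R {x \<in> carrier M. Q x} M"
  using zero add smult by unfold_locales auto
 from span_is_subset[OF _ this, of S] show ?thesis using S x gen by blast
qed

lemma module_of_ring_hom:
 assumes "cring A" "cring Q" "k \<in> ring_hom A Q"
  and M: "carrier M = carrier Q" "add M = add Q" "zero M = zero Q"
   "\<And>a x. a \<in> carrier A \<Longrightarrow> x \<in> carrier Q \<Longrightarrow> a \<odot>\<^bsub>M\<^esub> x = k a \<otimes>\<^bsub>Q\<^esub> x"
 shows "Module.module A M"
proof -
 interpret Q: cring Q by fact
 interpret A: cring A by fact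
 note k = ring_hom_closed[OF assms(3)] ring_hom_add[OF assms(3)] ring_hom_mult[OF assms(3)] ring_hom_one[OF assms(3)]
 show ?thesis
 proof (rule moduleI)
  show "cring A" by fact
  show "abelian_group M"
   proof (rule abelian_groupI)
   show "\<exists>y\<in>carrier M. y \<oplus>\<^bsub>M\<^esub> x = \<zero>\<^bsub>M\<^esub>" if "x \<in> carrier M" for x
    using that by (intro bexI[of _ "\<ominus>\<^bsub>Q\<^esub> x"]) (auto simp: M Q.l_neg)
  qed (auto simp: M Q.a_ac)
 qed (auto simp: M k Q.l_distr Q.r_distr Q.m_assoc)
qed

context divided_powers
begin

definition q :: "(('m \<times> nat) multiset \<Rightarrow> 'a) \<Rightarrow> (('m \<times> nat) multiset \<Rightarrow> 'a) set" where
 "q f = dp_ideal A M +>\<^bsub>D.P\<^esub> f"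

abbreviation "Q \<equiv> D.P Quot dp_ideal A M"

lemma cring_Q: "cring Q"
 by (rule ideal.quotient_is_cring[OF ideal_dp D.P.is_cring])

lemma q_hom: "q \<in> ring_hom D.P Q"
 unfolding q_def[abs_def] by (rule ideal.rcos_ring_hom[OF ideal_dp])

lemma carrier_Q: "carrier Q = q ` carrier D.P"
 by (auto simp: FactRing_def A_RCOSETS_def' q_def)

lemma q_eq_iff: "f \<in> carrier D.P \<Longrightarrow> g \<in> carrier D.P \<Longrightarrow> q f = q g \<longleftrightarrow> f \<ominus>\<^bsub>D.P\<^esub> g \<in> dp_ideal A M"
 using D.P.quotient_eq_iff_same_a_r_cos[OF ideal_dp] by (simp add: q_def)

lemma dp_algebra_simps:
 "carrier (dp_algebra A M) = carrier Q" "add (dp_algebra A M) = add Q" "mult (dp_algebra A M) = mult Q"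
 "zero (dp_algebra A M) = zero Q" "one (dp_algebra A M) = one Q"
 "smult (dp_algebra A M) = (\<lambda>a x. q (mono A a {#}) \<otimes>\<^bsub>Q\<^esub> x)"
 by (simp_all add: dp_algebra_def Let_def ring.extend_def module.fields_def q_def dp_poly_eq indexed_const_eq_mono)

lemma const_hom: "(\<lambda>a. mono A a {#}) \<in> ring_hom A D.P"
 by (rule ring_hom_memI) (auto simp: D.mono_mult D.mono_add D.one_eq_mono intro!: D.mono_closed)

lemma module_dp_algebra: "Module.module A (dp_algebra A M)"
proof (rule module_of_ring_hom[OF is_cring cring_Q])
 show "(\<lambda>a. q (mono A a {#})) \<in> ring_hom A Q"
  using ring_hom_trans[OF const_hom q_hom] by (simp add: o_def)
qed (simp_all add: dp_algebra_simps)

lemma dp_smult: "a \<in> carrier A \<Longrightarrow> f \<in> carrier D.P \<Longrightarrow> a \<odot>\<^bsub>dp_algebra A M\<^esub> q f = q (mono A a {#} \<otimes>\<^bsub>D.P\<^esub> f)"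
 using ring_hom_mult[OF q_hom, of "mono A a {#}" f] by (simp add: dp_algebra_simps D.mono_closed)

lemma dp_add: "f \<in> carrier D.P \<Longrightarrow> g \<in> carrier D.P \<Longrightarrow> q f \<oplus>\<^bsub>dp_algebra A M\<^esub> q g = q (f \<oplus>\<^bsub>D.P\<^esub> g)"
 using ring_hom_add[OF q_hom] by (simp add: dp_algebra_simps)

lemma dp_sym_eq: "dp_sym A M m i = q (gen m i)"
 by (simp add: dp_sym_def q_def dp_poly_eq indexed_var_eq_mono)

lemma mset_closed: "set xs \<subseteq> carrier M \<times> UNIV \<Longrightarrow> mono A \<one> (mset xs) \<in> carrier D.P"
 by (intro D.mono_closed) auto

lemma dp_monomial_eq: "set xs \<subseteq> carrier M \<times> UNIV \<Longrightarrow> dp_monomial A M xs = q (mono A \<one> (mset xs))"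
proof (induction xs)
 case Nil
 show ?case using ring_hom_one[OF q_hom] by (simp add: dp_monomial_def dp_algebra_simps D.one_eq_mono)
next
 case (Cons x xs)
 obtain m i where x: "x = (m, i)" by (cases x)
 have m: "m \<in> carrier M" "set xs \<subseteq> carrier M \<times> UNIV" using Cons.prems by (auto simp: x)
 have g: "gen m i \<in> carrier D.P" using m by (intro D.mono_closed) auto
 have "dp_monomial A M (x # xs) = q (gen m i) \<otimes>\<^bsub>Q\<^esub> q (mono A \<one> (mset xs))"
  using Cons m by (simp add: dp_monomial_def x dp_sym_eq dp_algebra_simps)
 also have "\<dots> = q (gen m i \<otimes>\<^bsub>D.P\<^esub> mono A \<one> (mset xs))"
  using ring_hom_mult[OF q_hom g mset_closed[OF m(2)]] by simp
 also have "gen m i \<otimes>\<^bsub>D.P\<^esub> mono A \<one> (mset xs) = mono A \<one> (mset (x # xs))"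
  using m by (subst D.mono_mult) (auto simp: x)
 finally show ?case .
qed

abbreviation "monos N \<equiv> dp_monomial A M ` dp_lists (carrier M) N"

lemma monos_closed: "monos N \<subseteq> carrier (dp_algebra A M)"
 using mset_closed by (auto simp: dp_lists_def dp_monomial_eq dp_algebra_simps carrier_Q)

lemma dp_power_submodule: "LinearCombinations.submodule A (carrier (dp_power A M N)) (dp_algebra A M)"
 using LinearCombinations.module.span_is_submodule[OF module_dp_algebra monos_closed] by (simp add: dp_power_def)

lemma module_dp_power: "Module.module A (dp_power A M N)"
 using LinearCombinations.module.submodule_is_module[OF module_dp_algebra dp_power_submodule]
 by (simp add: dp_power_def)

lemma dp_power_simps:
 "add (dp_power A M N) = add (dp_algebra A M)" "zero (dp_power A M N) = zero (dp_algebra A M)"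
 "smult (dp_power A M N) = smult (dp_algebra A M)"
 by (simp_all add: dp_power_def)

lemma dp_power_subset: "carrier (dp_power A M N) \<subseteq> q ` carrier D.P"
 using LinearCombinations.module.span_is_subset2[OF module_dp_algebra monos_closed[of N]]
 by (simp add: dp_power_def dp_algebra_simps carrier_Q)

lemma monos_in_power: "monos N \<subseteq> carrier (dp_power A M N)"
 using LinearCombinations.module.in_own_span[OF module_dp_algebra monos_closed[of N]] by (simp add: dp_power_def)

lemma dp_power_span: "carrier (dp_power A M N) = LinearCombinations.module.span A (dp_power A M N) (monos N)"
 using LinearCombinations.module.span_li_not_depend(1)[OF module_dp_algebra monos_in_power[of N] dp_power_submodule[of N]]
 by (simp add: dp_power_def)

text \<open>The lifts \<open>e v j\<close> of the values of linear forms are additive and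
  homogeneous only up to multiples of p. Over a ring killed by p^(n+1),
  \<open>binomial_power_cong\<close> shows that such errors do not disturb the axioms of
  \<open>dp_functional\<close> for N = p^n.\<close>

lemma linear_forms_functional:
 fixes e :: "'m \<Rightarrow> nat \<Rightarrow> 'a" and y :: "nat \<Rightarrow> 'i"
 assumes p: "prime p" and tors: "\<And>x. x \<in> carrier A \<Longrightarrow> add_pow A (p ^ Suc n) x = \<zero>"
  and e: "\<And>v j. v \<in> carrier M \<Longrightarrow> j < k \<Longrightarrow> e v j \<in> carrier A"
  and e_add: "\<And>v v' j. v \<in> carrier M \<Longrightarrow> v' \<in> carrier M \<Longrightarrow> j < k \<Longrightarrow>
    \<exists>d\<in>carrier A. e (v \<oplus>\<^bsub>M\<^esub> v') j = e v j \<oplus> e v' j \<oplus> add_pow A p d"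
  and e_smult: "\<And>a v j. a \<in> carrier A \<Longrightarrow> v \<in> carrier M \<Longrightarrow> j < k \<Longrightarrow>
    \<exists>d\<in>carrier A. e (a \<odot>\<^bsub>M\<^esub> v) j = a \<otimes> e v j \<oplus> add_pow A p d"
 shows "dp_functional A M (mvpoly A (UNIV :: 'i set)) (\<lambda>a. mono A a {#})
   (\<lambda>v. \<Oplus>\<^bsub>mvpoly A (UNIV :: 'i set)\<^esub>j\<in>{..<k}. mono A (e v j) {#y j#}) (p ^ n)"
proof -
 interpret U: mvpolys A "UNIV :: 'i set" by unfold_locales
 let ?G = "\<lambda>v. \<Oplus>\<^bsub>U.P\<^esub>j\<in>{..<k}. mono A (e v j) {#y j#}"
 have mc: "mono A a \<mu> \<in> carrier U.P" if "a \<in> carrier A" for a \<mu> using that by (intro U.mono_closed) auto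
 have Uap: "add_pow U.P (t::nat) (mono A a \<mu>) = mono A (add_pow A t a) \<mu>" if "a \<in> carrier A" for t a \<mu>
  using mc[OF that] that by (auto simp: fun_eq_iff U.coeff_add_pow mono_def)
 have Utors: "add_pow U.P (p ^ Suc n) f = \<zero>\<^bsub>U.P\<^esub>" if "f \<in> carrier U.P" for f
  using that tors by (auto simp: fun_eq_iff U.coeff_add_pow U.coeff_zero U.coeff_closed)
 have Gc: "?G v \<in> carrier U.P" if "v \<in> carrier M" for v
  using that e mc by (auto intro!: U.P.finsum_closed)
 have lin: "?G v = (\<Oplus>\<^bsub>U.P\<^esub>j\<in>{..<k}. mono A (g j) {#y j#}) \<oplus>\<^bsub>U.P\<^esub> add_pow U.P p (\<Oplus>\<^bsub>U.P\<^esub>j\<in>{..<k}. mono A (d j) {#y j#})"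
  if "\<And>j. j < k \<Longrightarrow> g j \<in> carrier A" "\<And>j. j < k \<Longrightarrow> d j \<in> carrier A"
   "\<And>j. j < k \<Longrightarrow> e v j = g j \<oplus> add_pow A p (d j)" for v g d
 proof -
  have "(\<Oplus>\<^bsub>U.P\<^esub>j\<in>{..<k}. mono A (add_pow A p (d j)) {#y j#}) = add_pow U.P p \<one>\<^bsub>U.P\<^esub> \<otimes>\<^bsub>U.P\<^esub> (\<Oplus>\<^bsub>U.P\<^esub>j\<in>{..<k}. mono A (d j) {#y j#})"
   using that(2) mc
   by (subst U.P.finsum_rdistr) (auto simp: U.P.add_pow_ldistr Uap intro!: U.P.finsum_cong')
  also have "\<dots> = add_pow U.P p (\<Oplus>\<^bsub>U.P\<^esub>j\<in>{..<k}. mono A (d j) {#y j#})"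
   using that(2) mc U.P.finsum_closed[of "\<lambda>j. mono A (d j) {#y j#}" "{..<k}"] by (simp add: U.P.add_pow_ldistr Pi_def)
  moreover have "?G v = (\<Oplus>\<^bsub>U.P\<^esub>j\<in>{..<k}. mono A (g j) {#y j#} \<oplus>\<^bsub>U.P\<^esub> mono A (add_pow A p (d j)) {#y j#})"
   using that mc by (intro U.P.finsum_cong') (auto simp: U.mono_add)
  ultimately show ?thesis
   using that mc by (simp add: U.P.finsum_addf Pi_def)
 qed
 show ?thesis
 proof (intro dp_functional.intro dp_functional_axioms.intro)
  show "divided_powers A M" by unfold_locales
  show "plain_cring U.P" by unfold_locales
  show "(\<lambda>a. mono A a {#}) \<in> ring_hom A U.P"
   by (rule ring_hom_memI) (auto simp: U.mono_mult U.mono_add U.one_eq_mono mc)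
  show "?G v \<in> carrier U.P" if "v \<in> carrier M" for v by (rule Gc[OF that])
  fix v i assume v: "v \<in> carrier M"
  show "add_pow U.P (p ^ n choose i) (?G (v \<oplus>\<^bsub>M\<^esub> v') [^]\<^bsub>U.P\<^esub> i) =
    add_pow U.P (p ^ n choose i) ((?G v \<oplus>\<^bsub>U.P\<^esub> ?G v') [^]\<^bsub>U.P\<^esub> i)" if v': "v' \<in> carrier M" for v'
  proof -
   have "\<forall>j. \<exists>d. j < k \<longrightarrow> d \<in> carrier A \<and> e (v \<oplus>\<^bsub>M\<^esub> v') j = e v j \<oplus> e v' j \<oplus> add_pow A p d"
    using e_add[OF v v'] by blast
   then obtain d where d: "\<And>j. j < k \<Longrightarrow> d j \<in> carrier A"
     "\<And>j. j < k \<Longrightarrow> e (v \<oplus>\<^bsub>M\<^esub> v') j = e v j \<oplus> e v' j \<oplus> add_pow A p (d j)" by metis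
   have "(\<Oplus>\<^bsub>U.P\<^esub>j\<in>{..<k}. mono A (e v j \<oplus> e v' j) {#y j#}) = (\<Oplus>\<^bsub>U.P\<^esub>j\<in>{..<k}. mono A (e v j) {#y j#} \<oplus>\<^bsub>U.P\<^esub> mono A (e v' j) {#y j#})"
    using e v v' mc by (intro U.P.finsum_cong') (auto simp: U.mono_add)
   also have "\<dots> = ?G v \<oplus>\<^bsub>U.P\<^esub> ?G v'"
    using e v v' mc by (intro U.P.finsum_addf) auto
   finally have "?G (v \<oplus>\<^bsub>M\<^esub> v') = (?G v \<oplus>\<^bsub>U.P\<^esub> ?G v') \<oplus>\<^bsub>U.P\<^esub> add_pow U.P p (\<Oplus>\<^bsub>U.P\<^esub>j\<in>{..<k}. mono A (d j) {#y j#})"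
    using lin[of "\<lambda>j. e v j \<oplus> e v' j" d "v \<oplus>\<^bsub>M\<^esub> v'"] e v v' d by simp
   moreover have "(\<Oplus>\<^bsub>U.P\<^esub>j\<in>{..<k}. mono A (d j) {#y j#}) \<in> carrier U.P"
    using d mc by (auto intro!: U.P.finsum_closed)
   ultimately show ?thesis
    using U.P.binomial_power_cong[OF p _ _ Utors] Gc[OF v] Gc[OF v'] by simp
  qed
  show "add_pow U.P (p ^ n choose i) (?G (a \<odot>\<^bsub>M\<^esub> v) [^]\<^bsub>U.P\<^esub> i) =
    add_pow U.P (p ^ n choose i) ((mono A a {#} \<otimes>\<^bsub>U.P\<^esub> ?G v) [^]\<^bsub>U.P\<^esub> i)" if a: "a \<in> carrier A" for a
  proof -
   have "\<forall>j. \<exists>d. j < k \<longrightarrow> d \<in> carrier A \<and> e (a \<odot>\<^bsub>M\<^esub> v) j = a \<otimes> e v j \<oplus> add_pow A p d"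
    using e_smult[OF a v] by blast
   then obtain d where d: "\<And>j. j < k \<Longrightarrow> d j \<in> carrier A"
     "\<And>j. j < k \<Longrightarrow> e (a \<odot>\<^bsub>M\<^esub> v) j = a \<otimes> e v j \<oplus> add_pow A p (d j)" by metis
   have "mono A a {#} \<otimes>\<^bsub>U.P\<^esub> ?G v = (\<Oplus>\<^bsub>U.P\<^esub>j\<in>{..<k}. mono A a {#} \<otimes>\<^bsub>U.P\<^esub> mono A (e v j) {#y j#})"
    using e v a mc by (intro U.P.finsum_rdistr) auto
   also have "\<dots> = (\<Oplus>\<^bsub>U.P\<^esub>j\<in>{..<k}. mono A (a \<otimes> e v j) {#y j#})"
    using e v a mc by (intro U.P.finsum_cong') (auto simp: U.mono_mult)
   finally have "?G (a \<odot>\<^bsub>M\<^esub> v) = (mono A a {#} \<otimes>\<^bsub>U.P\<^esub> ?G v) \<oplus>\<^bsub>U.P\<^esub> add_pow U.P p (\<Oplus>\<^bsub>U.P\<^esub>j\<in>{..<k}. mono A (d j) {#y j#})"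
    using lin[of "\<lambda>j. a \<otimes> e v j" d "a \<odot>\<^bsub>M\<^esub> v"] e v a d by simp
   moreover have "(\<Oplus>\<^bsub>U.P\<^esub>j\<in>{..<k}. mono A (d j) {#y j#}) \<in> carrier U.P"
    using d mc by (auto intro!: U.P.finsum_closed)
   ultimately show ?thesis
    using U.P.binomial_power_cong[OF p _ _ Utors] Gc[OF v] mc[OF a] by simp
  qed
 qed
qed

end

section \<open>Coefficients of powers of bilinear forms\<close>

lemma (in mvpolys) power_seq_cong:
 "(\<And>i. i < k \<Longrightarrow> g i = g' i \<and> a i = a' i) \<Longrightarrow> power_seq g a k = power_seq g' a' k"
 by (induction k) auto

lemma monomial_value_mset:
 fixes I :: "'i set"
 assumes F: "dp_functional A M (mvpoly A I) h G N" and xs: "set xs \<subseteq> carrier M \<times> UNIV"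
 shows "monomial_value (mvpoly A I) (dp_functional.gv M (mvpoly A I) G) (mset xs) =
   mvpolys.power_seq A I (\<lambda>i. G (fst (xs ! i))) (\<lambda>i. snd (xs ! i)) (length xs)"
proof -
 interpret F: dp_functional A M "mvpoly A I" h G N by (rule F)
 interpret B: mvpolys A I by unfold_locales
 show ?thesis using xs
 proof (induction xs rule: rev_induct)
  case Nil
  show ?case by simp
 next
  case (snoc x xs)
  have x: "fst x \<in> carrier M" using snoc.prems by (cases x) auto
  have "monomial_value B.P F.gv (mset (xs @ [x])) = monomial_value B.P F.gv {#x#} \<otimes>\<^bsub>B.P\<^esub> monomial_value B.P F.gv (mset xs)"
   by (subst F.R.monomial_value_add[symmetric]) auto
  also have "monomial_value B.P F.gv {#x#} = G (fst x) [^]\<^bsub>B.P\<^esub> snd x"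
   using x by (subst F.R.monomial_value_single) (auto simp: F.gv_def F.G_closed)
  also have "monomial_value B.P F.gv (mset xs) = B.power_seq (\<lambda>i. G (fst ((xs @ [x]) ! i))) (\<lambda>i. snd ((xs @ [x]) ! i)) (length xs)"
   using snoc by (subst B.power_seq_cong[of _ _ "\<lambda>i. G (fst (xs ! i))" _ "\<lambda>i. snd (xs ! i)"]) (auto simp: nth_append)
  finally show ?case by (simp add: nth_append)
 qed
qed

text \<open>The coefficient of \<open>S^a T^b\<close> in \<open>(\<Sum> c\<^sub>i\<^sub>j S\<^sub>i T\<^sub>j)^N\<close>, with \<open>S\<^sub>i\<close> = \<open>Inl i\<close> and \<open>T\<^sub>j\<close> = \<open>Inr j\<close>.\<close>

definition bilinear_power_coeff ::
 "'a ring \<Rightarrow> (nat \<Rightarrow> nat \<Rightarrow> 'a) \<Rightarrow> nat \<Rightarrow> nat \<Rightarrow> nat \<Rightarrow> (nat \<Rightarrow> nat) \<Rightarrow> (nat \<Rightarrow> nat) \<Rightarrow> 'a" where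
 "bilinear_power_coeff A c k l N a b =
   ((\<Oplus>\<^bsub>mvpoly A (UNIV :: (nat + nat) set)\<^esub>i\<in>{..<k}. \<Oplus>\<^bsub>mvpoly A (UNIV :: (nat + nat) set)\<^esub>j\<in>{..<l}. mono A (c i j) {#Inl i, Inr j#})
    [^]\<^bsub>mvpoly A (UNIV :: (nat + nat) set)\<^esub> N)
    ((\<Sum>i<k. replicate_mset (a i) (Inl i)) + (\<Sum>j<l. replicate_mset (b j) (Inr j)))"

context plain_cring
begin

text \<open>The bilinear form is read as a linear form in the S_i whose coefficients are linear in
  the T_j, and \<open>coeff_linear_form_power\<close> applies. The result is the T-coefficient of
  the value that a \<open>dp_functional\<close> takes on a monomial.\<close>

lemma bilinear_power_coeff_left:
 fixes c :: "nat \<Rightarrow> nat \<Rightarrow> 'a"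
 assumes c: "\<And>i j. i < k \<Longrightarrow> j < l \<Longrightarrow> c i j \<in> carrier R"
 shows "bilinear_power_coeff R c k l N a b =
  (if (\<Sum>i<k. a i) = N then add_pow R (multinom_seq a k)
    (mvpolys.power_seq R (UNIV :: (nat + nat) set)
     (\<lambda>i. \<Oplus>\<^bsub>mvpoly R (UNIV :: (nat + nat) set)\<^esub>j\<in>{..<l}. mono R (c i j) {#Inr j#}) a k
     (\<Sum>j<l. replicate_mset (b j) (Inr j))) else \<zero>)"
proof -
 interpret U: mvpolys R "UNIV :: (nat + nat) set" by unfold_locales
 interpret V: mvpolys R "range Inr :: (nat + nat) set" by unfold_locales
 have mc: "mono R x \<mu> \<in> carrier U.P" if "x \<in> carrier R" for x \<mu> using that by (intro U.mono_closed) auto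
 let ?g = "\<lambda>i. \<Oplus>\<^bsub>U.P\<^esub>j\<in>{..<l}. mono R (c i j) {#Inr j :: nat + nat#}"
 have gU: "?g i \<in> carrier U.P" if "i < k" for i
  using c that mc by (auto intro!: U.P.finsum_closed)
 have g: "?g i \<in> carrier V.P" if "i < k" for i
 proof -
  have "(\<Oplus>\<^bsub>V.P\<^esub>j\<in>{..<l}. mono R (c i j) {#Inr j#}) \<in> carrier V.P"
   using c that by (intro V.P.finsum_closed) (auto intro!: V.mono_closed)
  moreover have "?g i = (\<Oplus>\<^bsub>V.P\<^esub>j\<in>{..<l}. mono R (c i j) {#Inr j#})"
  proof
   fix \<mu>
   show "?g i \<mu> = (\<Oplus>\<^bsub>V.P\<^esub>j\<in>{..<l}. mono R (c i j) {#Inr j#}) \<mu>"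
    using c that mc by (subst U.coeff_finsum) (auto simp: V.coeff_finsum V.mono_closed)
  qed
  ultimately show ?thesis by simp
 qed
 have ps: "U.power_seq ?g a k \<in> carrier U.P" using gU by (intro U.power_seq_closed) auto
 have F: "(\<Oplus>\<^bsub>U.P\<^esub>i\<in>{..<k}. \<Oplus>\<^bsub>U.P\<^esub>j\<in>{..<l}. mono R (c i j) {#Inl i, Inr j#}) = (\<Oplus>\<^bsub>U.P\<^esub>i\<in>{..<k}. mono R \<one> {#Inl i#} \<otimes>\<^bsub>U.P\<^esub> ?g i)"
 proof (rule U.P.finsum_cong')
  fix i assume i: "i \<in> {..<k}"
  have "mono R \<one> {#Inl i#} \<otimes>\<^bsub>U.P\<^esub> ?g i = (\<Oplus>\<^bsub>U.P\<^esub>j\<in>{..<l}. mono R \<one> {#Inl i#} \<otimes>\<^bsub>U.P\<^esub> mono R (c i j) {#Inr j#})"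
   using c i mc by (intro U.P.finsum_rdistr) auto
  also have "\<dots> = (\<Oplus>\<^bsub>U.P\<^esub>j\<in>{..<l}. mono R (c i j) {#Inl i, Inr j#})"
   using c i mc by (intro U.P.finsum_cong') (auto simp: U.mono_mult add_mset_commute)
  finally show "(\<Oplus>\<^bsub>U.P\<^esub>j\<in>{..<l}. mono R (c i j) {#Inl i, Inr j#}) = mono R \<one> {#Inl i#} \<otimes>\<^bsub>U.P\<^esub> ?g i" by simp
 qed (use gU mc in auto)
 have "(\<one>\<^bsub>U.P\<^esub> \<otimes>\<^bsub>U.P\<^esub> (\<Oplus>\<^bsub>U.P\<^esub>i\<in>{..<k}. mono R \<one> {#Inl i#} \<otimes>\<^bsub>U.P\<^esub> ?g i) [^]\<^bsub>U.P\<^esub> N)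
    ((\<Sum>j<l. replicate_mset (b j) (Inr j)) + (\<Sum>i<k. replicate_mset (a i) (Inl i))) =
   (if (\<Sum>i<k. a i) = N then add_pow R (multinom_seq a k) ((\<one>\<^bsub>U.P\<^esub> \<otimes>\<^bsub>U.P\<^esub> U.power_seq ?g a k) (\<Sum>j<l. replicate_mset (b j) (Inr j))) else \<zero>)"
 proof (rule U.coeff_linear_form_power[of "range Inr" k Inl])
  show "\<one>\<^bsub>U.P\<^esub> \<in> carrier V.P" using V.mono_closed[of \<one> "{#}"] by (simp add: U.one_eq_mono)
  show "?g i \<in> carrier V.P" if "i < k" for i by (rule g[OF that])
  show "inj_on Inl {..<k}" by (auto simp: inj_on_def)
  show "Inl i \<notin># (\<Sum>j<l. replicate_mset (b j) (Inr j))" for i by (auto simp: set_mset_sum split: if_splits)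
 qed auto
 moreover have "(\<Oplus>\<^bsub>U.P\<^esub>i\<in>{..<k}. mono R \<one> {#Inl i#} \<otimes>\<^bsub>U.P\<^esub> ?g i) \<in> carrier U.P"
  using gU mc by (intro U.P.finsum_closed) auto
 ultimately show ?thesis
  using ps by (simp add: bilinear_power_coeff_def F add.commute)
qed

lemma mvpoly_rename_hom:
 fixes \<sigma> :: "'i \<Rightarrow> 'i"
 assumes \<sigma>: "\<And>x. \<sigma> (\<sigma> x) = x"
 shows "(\<lambda>f \<mu>. f (image_mset \<sigma> \<mu>)) \<in> ring_hom (mvpoly R UNIV) (mvpoly R UNIV)"
proof -
 interpret U: mvpolys R "UNIV :: 'i set" by unfold_locales
 have \<sigma>\<sigma>: "image_mset \<sigma> (image_mset \<sigma> \<mu>) = \<mu>" for \<mu> by (simp add: multiset.map_comp o_def \<sigma>)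
 have inj: "inj (image_mset \<sigma>)" using \<sigma>\<sigma> by (metis injI)
 show ?thesis
 proof (rule ring_hom_memI)
  fix f assume f: "f \<in> carrier U.P"
  have "{\<mu>. f (image_mset \<sigma> \<mu>) \<noteq> \<zero>} = image_mset \<sigma> ` {\<mu>. f \<mu> \<noteq> \<zero>}"
   using \<sigma>\<sigma> by (auto simp: image_iff) metis
  then show "(\<lambda>\<mu>. f (image_mset \<sigma> \<mu>)) \<in> carrier U.P"
   using f by (auto simp: U.carrier_mvpoly)
  fix g assume g: "g \<in> carrier U.P"
  show "(\<lambda>\<mu>. (f \<oplus>\<^bsub>U.P\<^esub> g) (image_mset \<sigma> \<mu>)) = (\<lambda>\<mu>. f (image_mset \<sigma> \<mu>)) \<oplus>\<^bsub>U.P\<^esub> (\<lambda>\<mu>. g (image_mset \<sigma> \<mu>))"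
   by (simp add: fun_eq_iff U.coeff_add)
  show "(\<lambda>\<mu>. (f \<otimes>\<^bsub>U.P\<^esub> g) (image_mset \<sigma> \<mu>)) = (\<lambda>\<mu>. f (image_mset \<sigma> \<mu>)) \<otimes>\<^bsub>U.P\<^esub> (\<lambda>\<mu>. g (image_mset \<sigma> \<mu>))"
  proof
   fix \<mu>
   have sub: "{\<nu>. \<nu> \<subseteq># image_mset \<sigma> \<mu>} = image_mset \<sigma> ` {\<nu>. \<nu> \<subseteq># \<mu>}"
   proof safe
    fix \<nu> assume "\<nu> \<subseteq># image_mset \<sigma> \<mu>"
    then have "image_mset \<sigma> \<nu> \<subseteq># \<mu>" using image_mset_subseteq_mono[of \<nu> "image_mset \<sigma> \<mu>" \<sigma>] by (simp add: \<sigma>\<sigma>)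
    then show "\<nu> \<in> image_mset \<sigma> ` {\<nu>. \<nu> \<subseteq># \<mu>}" using \<sigma>\<sigma>[of \<nu>] by (metis image_eqI mem_Collect_eq)
   qed (auto intro: image_mset_subseteq_mono)
   have c: "f \<nu> \<in> carrier R" "g \<nu> \<in> carrier R" for \<nu> using U.coeff_closed f g by auto
   have "(f \<otimes>\<^bsub>U.P\<^esub> g) (image_mset \<sigma> \<mu>) = (\<Oplus>\<nu>\<in>image_mset \<sigma> ` {\<nu>. \<nu> \<subseteq># \<mu>}. f \<nu> \<otimes> g (image_mset \<sigma> \<mu> - \<nu>))"
    by (simp add: U.coeff_mult sub)
   also have "\<dots> = (\<Oplus>\<nu>\<in>{\<nu>. \<nu> \<subseteq># \<mu>}. f (image_mset \<sigma> \<nu>) \<otimes> g (image_mset \<sigma> \<mu> - image_mset \<sigma> \<nu>))"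
    using inj c by (subst add.finprod_reindex) (auto simp: inj_on_def)
   also have "\<dots> = (\<Oplus>\<nu>\<in>{\<nu>. \<nu> \<subseteq># \<mu>}. f (image_mset \<sigma> \<nu>) \<otimes> g (image_mset \<sigma> (\<mu> - \<nu>)))"
    using c by (intro finsum_cong') (auto simp: image_mset_Diff)
   finally show "(f \<otimes>\<^bsub>U.P\<^esub> g) (image_mset \<sigma> \<mu>) = ((\<lambda>\<mu>. f (image_mset \<sigma> \<mu>)) \<otimes>\<^bsub>U.P\<^esub> (\<lambda>\<mu>. g (image_mset \<sigma> \<mu>))) \<mu>"
    by (simp add: U.coeff_mult)
  qed
 next
  show "(\<lambda>\<mu>. \<one>\<^bsub>U.P\<^esub> (image_mset \<sigma> \<mu>)) = \<one>\<^bsub>U.P\<^esub>"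
   by (auto simp: fun_eq_iff U.one_eq_mono mono_def)
 qed
qed

text \<open>Exchanging the two kinds of variables is an endomorphism of the polynomial ring. By this
  symmetry one construction of functionals serves for vectors and for forms.\<close>

lemma bilinear_power_coeff_swap:
 fixes c :: "nat \<Rightarrow> nat \<Rightarrow> 'a"
 assumes c: "\<And>i j. i < k \<Longrightarrow> j < l \<Longrightarrow> c i j \<in> carrier R"
 shows "bilinear_power_coeff R c k l N a b = bilinear_power_coeff R (\<lambda>j i. c i j) l k N b a"
proof -
 interpret U: mvpolys R "UNIV :: (nat + nat) set" by unfold_locales
 define \<sigma> :: "nat + nat \<Rightarrow> nat + nat" where "\<sigma> = case_sum Inr Inl"
 have \<sigma>: "\<sigma> (\<sigma> x) = x" for x by (cases x) (auto simp: \<sigma>_def)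
 have \<sigma>\<sigma>: "image_mset \<sigma> (image_mset \<sigma> \<mu>) = \<mu>" for \<mu> by (simp add: multiset.map_comp o_def \<sigma>)
 define h where "h = (\<lambda>(f :: (nat + nat) multiset \<Rightarrow> 'a) \<mu>. f (image_mset \<sigma> \<mu>))"
 interpret h: ring_hom_cring U.P U.P h
  unfolding h_def by (intro ring_hom_cringI U.P.is_cring mvpoly_rename_hom \<sigma>)
 have mc: "mono R x \<mu> \<in> carrier U.P" if "x \<in> carrier R" for x and \<mu> :: "(nat + nat) multiset" using that by (intro U.mono_closed) auto
 have hm: "h (mono R x \<mu>) = mono R x (image_mset \<sigma> \<mu>)" for x \<mu>
  using \<sigma>\<sigma> by (auto simp: h_def mono_def fun_eq_iff)
 let ?F = "\<lambda>c k l. \<Oplus>\<^bsub>U.P\<^esub>i\<in>{..<k}. \<Oplus>\<^bsub>U.P\<^esub>j\<in>{..<l}. mono R (c i j) {#Inl i, Inr j#}"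
 have Fc: "?F c k l \<in> carrier U.P" using c mc by (auto intro!: U.P.finsum_closed)
 have "h (?F c k l) = (\<Oplus>\<^bsub>U.P\<^esub>i\<in>{..<k}. \<Oplus>\<^bsub>U.P\<^esub>j\<in>{..<l}. mono R (c i j) {#Inl j, Inr i#})"
 proof -
  have "h (?F c k l) = (\<Oplus>\<^bsub>U.P\<^esub>i\<in>{..<k}. h (\<Oplus>\<^bsub>U.P\<^esub>j\<in>{..<l}. mono R (c i j) {#Inl i, Inr j#}))"
   using c mc by (subst h.hom_finsum) (auto simp: o_def intro!: U.P.finsum_closed)
  also have "\<dots> = (\<Oplus>\<^bsub>U.P\<^esub>i\<in>{..<k}. \<Oplus>\<^bsub>U.P\<^esub>j\<in>{..<l}. h (mono R (c i j) {#Inl i, Inr j#}))"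
  proof (rule U.P.finsum_cong')
   fix i assume "i \<in> {..<k}"
   then show "h (\<Oplus>\<^bsub>U.P\<^esub>j\<in>{..<l}. mono R (c i j) {#Inl i, Inr j#}) = (\<Oplus>\<^bsub>U.P\<^esub>j\<in>{..<l}. h (mono R (c i j) {#Inl i, Inr j#}))"
    using c mc by (subst h.hom_finsum) (auto simp: o_def)
  qed (use c mc in \<open>auto intro!: U.P.finsum_closed h.hom_closed\<close>)
  also have "\<dots> = (\<Oplus>\<^bsub>U.P\<^esub>i\<in>{..<k}. \<Oplus>\<^bsub>U.P\<^esub>j\<in>{..<l}. mono R (c i j) {#Inl j, Inr i#})"
   by (simp add: hm \<sigma>_def add_mset_commute)
  finally show ?thesis .
 qed
 also have "\<dots> = ?F (\<lambda>j i. c i j) l k"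
  using c mc by (subst U.P.finsum_swap) auto
 finally have hF: "h (?F c k l) = ?F (\<lambda>j i. c i j) l k" .
 have im: "image_mset \<sigma> (\<Sum>j<l. replicate_mset (b j) (Inl j)) = (\<Sum>j<l. replicate_mset (b j) (Inr j))"
   "image_mset \<sigma> (\<Sum>i<k. replicate_mset (a i) (Inr i)) = (\<Sum>i<k. replicate_mset (a i) (Inl i))" for l k
  by (induction l, auto simp: \<sigma>_def) (induction k, auto simp: \<sigma>_def)
 have "?F (\<lambda>j i. c i j) l k [^]\<^bsub>U.P\<^esub> N = h (?F c k l [^]\<^bsub>U.P\<^esub> N)"
  using Fc by (simp add: hF[symmetric] h.hom_pow)
 then show ?thesis
  by (simp add: bilinear_power_coeff_def h_def im add.commute)
qed

end

section \<open>Linear forms on divided powers and existence of pairings\<close>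

lemma (in dp_functional) LL_cong:
 "f \<in> carrier D.P \<Longrightarrow> g \<in> carrier D.P \<Longrightarrow> q f = q g \<Longrightarrow> LL f = LL g"
 using LL_ideal[of "f \<ominus>\<^bsub>D.P\<^esub> g"] by (simp add: q_eq_iff LL_minus)

lemma (in dp_functional) LL_const_mult:
 assumes a: "a \<in> carrier A" and f: "f \<in> carrier D.P"
 shows "LL (mono A a {#} \<otimes>\<^bsub>D.P\<^esub> f) = h a \<otimes>\<^bsub>R\<^esub> LL f"
proof -
 have mc: "mono A a {#} \<in> carrier D.P" using a by (intro D.mono_closed) auto
 have co: "(mono A a {#} \<otimes>\<^bsub>D.P\<^esub> f) \<mu> = a \<otimes> f \<mu>" for \<mu>
  using a f by (simp add: D.coeff_mono_mult)
 have fin: "finite {\<mu>. f \<mu> \<noteq> \<zero>}" using f by (simp add: D.carrier_mvpoly)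
 have ha: "h a \<in> carrier R" using a by (rule h.hom_closed)
 have "LL (mono A a {#} \<otimes>\<^bsub>D.P\<^esub> f) = (\<Oplus>\<^bsub>R\<^esub>\<mu>\<in>{\<mu>. f \<mu> \<noteq> \<zero>}. h ((mono A a {#} \<otimes>\<^bsub>D.P\<^esub> f) \<mu>) \<otimes>\<^bsub>R\<^esub> T \<mu>)"
  using mc a f fin by (intro LL_superset) (auto simp: co)
 also have "\<dots> = (\<Oplus>\<^bsub>R\<^esub>\<mu>\<in>{\<mu>. f \<mu> \<noteq> \<zero>}. h a \<otimes>\<^bsub>R\<^esub> (h (f \<mu>) \<otimes>\<^bsub>R\<^esub> T \<mu>))"
  using a f ha by (intro R.finsum_cong') (auto simp: co D.coeff_closed R.m_assoc)
 also have "\<dots> = h a \<otimes>\<^bsub>R\<^esub> LL f"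
  unfolding LL_def using f ha fin by (subst R.finsum_rdistr) (auto simp: D.coeff_closed)
 finally show ?thesis .
qed

definition (in dp_functional) LQ :: "(('m \<times> nat) multiset \<Rightarrow> 'a) set \<Rightarrow> 's" where
 "LQ C = LL (SOME f. f \<in> carrier D.P \<and> q f = C)"

lemma (in dp_functional) LQ_q: "f \<in> carrier D.P \<Longrightarrow> LQ (q f) = LL f"
 unfolding LQ_def by (rule someI2[of _ f]) (auto intro: LL_cong)

lemma self_module_simps:
 "carrier (self_module R) = carrier R" "add (self_module R) = add R" "zero (self_module R) = zero R"
 "smult (self_module R) = mult R"
 by (simp_all add: self_module_def ring.extend_def module.fields_def)

lemma self_module_homI:
 assumes "\<And>x. x \<in> carrier N \<Longrightarrow> f x \<in> carrier R"
  and "\<And>x y. x \<in> carrier N \<Longrightarrow> y \<in> carrier N \<Longrightarrow> f (x \<oplus>\<^bsub>N\<^esub> y) = f x \<oplus>\<^bsub>R\<^esub> f y"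
  and "\<And>a x. a \<in> carrier R \<Longrightarrow> x \<in> carrier N \<Longrightarrow> f (a \<odot>\<^bsub>N\<^esub> x) = a \<otimes>\<^bsub>R\<^esub> f x"
 shows "f \<in> lin_maps R N (self_module R)"
 using assms by (auto simp: LinearCombinations.module_hom_def self_module_simps)

lemma (in divided_powers) dp_powerE:
 assumes "C \<in> carrier (dp_power A M N)"
 obtains f where "f \<in> carrier D.P" "C = q f"
 using subsetD[OF dp_power_subset assms] by (elim imageE) (rule that)

text \<open>\<open>linear_forms_functional\<close> gives a linear map into polynomials in the T_j;
  taking the coefficient at the exponents b is linear and produces scalars.\<close>

lemma (in divided_powers) dp_functional_exists:
 fixes e :: "'m \<Rightarrow> nat \<Rightarrow> 'a"
 assumes p: "prime p" and tors: "\<And>x. x \<in> carrier A \<Longrightarrow> add_pow A (p ^ Suc n) x = \<zero>"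
  and e: "\<And>v j. v \<in> carrier M \<Longrightarrow> j < l \<Longrightarrow> e v j \<in> carrier A"
  and e_add: "\<And>v v' j. v \<in> carrier M \<Longrightarrow> v' \<in> carrier M \<Longrightarrow> j < l \<Longrightarrow>
    \<exists>d\<in>carrier A. e (v \<oplus>\<^bsub>M\<^esub> v') j = e v j \<oplus> e v' j \<oplus> add_pow A p d"
  and e_smult: "\<And>a v j. a \<in> carrier A \<Longrightarrow> v \<in> carrier M \<Longrightarrow> j < l \<Longrightarrow>
    \<exists>d\<in>carrier A. e (a \<odot>\<^bsub>M\<^esub> v) j = a \<otimes> e v j \<oplus> add_pow A p d"
 shows "\<exists>F\<in>lin_maps A (dp_power A M (p ^ n)) (self_module A).
   \<forall>xs\<in>dp_lists (carrier M) (p ^ n). F (dp_monomial A M xs) =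
    bilinear_power_coeff A (\<lambda>i j. e (fst (xs ! i)) j) (length xs) l (p ^ n) (\<lambda>i. snd (xs ! i)) b"
proof -
 let ?P = "mvpoly A (UNIV :: (nat + nat) set)"
 define G where "G = (\<lambda>v. \<Oplus>\<^bsub>?P\<^esub>j\<in>{..<l}. mono A (e v j) {#Inr j :: nat + nat#})"
 define h where "h = (\<lambda>a. mono A a ({#} :: (nat + nat) multiset))"
 have FF: "dp_functional A M ?P h G (p ^ n)"
  unfolding G_def h_def
 proof (rule linear_forms_functional[where y=Inr and e=e and k=l])
  show "prime p" by (rule p)
  show "add_pow A (p ^ Suc n) x = \<zero>" if "x \<in> carrier A" for x using that by (rule tors)
  show "e v j \<in> carrier A" if "v \<in> carrier M" "j < l" for v j using that by (rule e)
  show "\<exists>d\<in>carrier A. e (v \<oplus>\<^bsub>M\<^esub> v') j = e v j \<oplus> e v' j \<oplus> add_pow A p d"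
   if "v \<in> carrier M" "v' \<in> carrier M" "j < l" for v v' j using that by (rule e_add)
  show "\<exists>d\<in>carrier A. e (a \<odot>\<^bsub>M\<^esub> v) j = a \<otimes> e v j \<oplus> add_pow A p d"
   if "a \<in> carrier A" "v \<in> carrier M" "j < l" for a v j using that by (rule e_smult)
 qed
 interpret F: dp_functional A M ?P h G "p ^ n" by (rule FF)
 interpret U: mvpolys A "UNIV :: (nat + nat) set" by unfold_locales
 let ?\<beta> = "\<Sum>j<l. replicate_mset (b j) (Inr j :: nat + nat)"
 let ?F = "\<lambda>C. F.LQ C ?\<beta>"
 have "?F \<in> lin_maps A (dp_power A M (p ^ n)) (self_module A)"
 proof (rule self_module_homI)
  show "?F C \<in> carrier A" if C: "C \<in> carrier (dp_power A M (p ^ n))" for C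
  proof -
   obtain f where "f \<in> carrier D.P" "C = q f" by (rule dp_powerE[OF C])
   then show ?thesis by (simp add: F.LQ_q U.coeff_closed)
  qed
  show "?F (C \<oplus>\<^bsub>dp_power A M (p ^ n)\<^esub> C') = ?F C \<oplus> ?F C'"
   if C: "C \<in> carrier (dp_power A M (p ^ n))" and C': "C' \<in> carrier (dp_power A M (p ^ n))" for C C'
  proof -
   obtain f where "f \<in> carrier D.P" "C = q f" by (rule dp_powerE[OF C])
   moreover obtain g where "g \<in> carrier D.P" "C' = q g" by (rule dp_powerE[OF C'])
   ultimately show ?thesis by (simp add: dp_power_simps dp_add F.LQ_q F.LL_add U.coeff_add)
  qed
  show "?F (a \<odot>\<^bsub>dp_power A M (p ^ n)\<^esub> C) = a \<otimes> ?F C"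
   if a: "a \<in> carrier A" and C: "C \<in> carrier (dp_power A M (p ^ n))" for a C
  proof -
   obtain f where f: "f \<in> carrier D.P" "C = q f" by (rule dp_powerE[OF C])
   have "F.LL (mono A a {#} \<otimes>\<^bsub>D.P\<^esub> f) = mono A a {#} \<otimes>\<^bsub>U.P\<^esub> F.LL f"
    using F.LL_const_mult[OF a f(1)] by (simp add: h_def)
   then show ?thesis using f a D.mono_closed[OF a, of "{#}"]
    by (simp add: dp_power_simps dp_smult F.LQ_q U.coeff_mono_mult)
  qed
 qed
 moreover have "?F (dp_monomial A M xs) =
    bilinear_power_coeff A (\<lambda>i j. e (fst (xs ! i)) j) (length xs) l (p ^ n) (\<lambda>i. snd (xs ! i)) b"
  if xs: "xs \<in> dp_lists (carrier M) (p ^ n)" for xs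
 proof -
  have xs': "set xs \<subseteq> carrier M \<times> UNIV" and w: "weight (mset xs) = p ^ n"
   using xs by (auto simp: dp_lists_def weight_mset sum_list_sum_nth atLeast0LessThan)
  have nth: "fst (xs ! i) \<in> carrier M" if "i < length xs" for i
   using xs' nth_mem[OF that] by (cases "xs ! i") auto
  have eqG: "(\<lambda>i. \<Oplus>\<^bsub>?P\<^esub>j\<in>{..<l}. mono A (e (fst (xs ! i)) j) {#Inr j#}) = (\<lambda>i. G (fst (xs ! i)))"
   by (simp add: G_def)
  have "?F (dp_monomial A M xs) = F.T (mset xs) ?\<beta>"
   using xs' mset_closed[OF xs'] F.LL_mono[of \<one> "mset xs"] F.hom_h by (simp add: dp_monomial_eq F.LQ_q ring_hom_one)
  also have "\<dots> = add_pow A (multinom (mset xs)) (monomial_value U.P F.gv (mset xs) ?\<beta>)"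
   using w by (simp add: F.T_def F.gm_def U.coeff_add_pow)
  also have "\<dots> = bilinear_power_coeff A (\<lambda>i j. e (fst (xs ! i)) j) (length xs) l (p ^ n) (\<lambda>i. snd (xs ! i)) b"
   using w nth e by (subst bilinear_power_coeff_left) (auto simp: weight_mset multinom_mset monomial_value_mset[OF FF xs'] eqG)
  finally show ?thesis .
 qed
 ultimately show ?thesis by (intro bexI[of _ ?F] ballI)
qed

text \<open>The value at \<open>x\<close> of the pairing is the linear form that sends \<open>m' y\<close> to the value at \<open>x\<close> of the
 form prescribed by \<open>y\<close>.\<close>

lemma pairing_exists:
 assumes A: "cring A" and G: "Module.module A G" and G': "Module.module A G'"
  and m: "m ` S \<subseteq> carrier G" "carrier G = LinearCombinations.module.span A G (m ` S)"
  and m': "m' ` S' \<subseteq> carrier G'" "carrier G' = LinearCombinations.module.span A G' (m' ` S')"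
  and l: "\<And>y. y \<in> S' \<Longrightarrow> \<exists>F\<in>lin_maps A G (self_module A). \<forall>x\<in>S. F (m x) = t x y"
  and r: "\<And>x. x \<in> S \<Longrightarrow> \<exists>F\<in>lin_maps A G' (self_module A). \<forall>y\<in>S'. F (m' y) = t x y"
 shows "\<exists>D. bilinear_pairing A G G' D \<and> (\<forall>x\<in>S. \<forall>y\<in>S'. D (m x) (m' y) = t x y)"
proof -
 interpret A: cring A by (rule A)
 interpret G: Module.module A G by (rule G)
 interpret G': Module.module A G' by (rule G')
 let ?H = "lin_maps A G (self_module A)"
 let ?H' = "lin_maps A G' (self_module A)"
 have mh: "f \<in> lin_maps A N (self_module A) \<longleftrightarrow> f \<in> carrier N \<rightarrow> carrier A \<and>
   (\<forall>x\<in>carrier N. \<forall>y\<in>carrier N. f (x \<oplus>\<^bsub>N\<^esub> y) = f x \<oplus>\<^bsub>A\<^esub> f y) \<and>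
   (\<forall>a\<in>carrier A. \<forall>x\<in>carrier N. f (a \<odot>\<^bsub>N\<^esub> x) = a \<otimes>\<^bsub>A\<^esub> f x)" for N :: "('a, 'z) module" and f
  by (auto simp: LinearCombinations.module_hom_def self_module_simps)
 have zero_H: "f \<zero>\<^bsub>N\<^esub> = \<zero>\<^bsub>A\<^esub>" if "Module.module A N" "f \<in> lin_maps A N (self_module A)" for N :: "('a, 'z) module" and f
 proof -
  interpret N: Module.module A N by fact
  have "f (\<zero>\<^bsub>A\<^esub> \<odot>\<^bsub>N\<^esub> \<zero>\<^bsub>N\<^esub>) = \<zero>\<^bsub>A\<^esub> \<otimes>\<^bsub>A\<^esub> f \<zero>\<^bsub>N\<^esub>" "f \<zero>\<^bsub>N\<^esub> \<in> carrier A"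
   using LinearCombinations.module_hom_smult[OF that(2), of "\<zero>\<^bsub>A\<^esub>" "\<zero>\<^bsub>N\<^esub>"] LinearCombinations.module_hom_closed[OF that(2)]
   by (auto simp: self_module_simps)
  then show ?thesis by simp
 qed
 obtain \<Lambda> where \<Lambda>: "\<And>y. y \<in> S' \<Longrightarrow> \<Lambda> y \<in> ?H" "\<And>x y. x \<in> S \<Longrightarrow> y \<in> S' \<Longrightarrow> \<Lambda> y (m x) = t x y"
  using l by metis
 have ex: "\<exists>F\<in>?H'. \<forall>y\<in>S'. F (m' y) = \<Lambda> y g" if g: "g \<in> carrier G" for g
 proof (rule G.span_induct[of "m ` S"])
  show "\<exists>F\<in>?H'. \<forall>y\<in>S'. F (m' y) = \<Lambda> y s" if "s \<in> m ` S" for s using r \<Lambda> that by auto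
  show "\<exists>F\<in>?H'. \<forall>y\<in>S'. F (m' y) = \<Lambda> y \<zero>\<^bsub>G\<^esub>"
  proof (rule bexI[of _ "\<lambda>_. \<zero>\<^bsub>A\<^esub>"])
   show "\<forall>y\<in>S'. \<zero>\<^bsub>A\<^esub> = \<Lambda> y \<zero>\<^bsub>G\<^esub>"
   proof
    fix y assume "y \<in> S'"
    from zero_H[OF G \<Lambda>(1)[OF this]] show "\<zero>\<^bsub>A\<^esub> = \<Lambda> y \<zero>\<^bsub>G\<^esub>" by simp
   qed
  qed (auto simp: mh)
 next
  fix x y assume xy: "x \<in> carrier G" "y \<in> carrier G" "\<exists>F\<in>?H'. \<forall>z\<in>S'. F (m' z) = \<Lambda> z x" "\<exists>F\<in>?H'. \<forall>z\<in>S'. F (m' z) = \<Lambda> z y"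
  then obtain F F' where F: "F \<in> ?H'" "\<forall>z\<in>S'. F (m' z) = \<Lambda> z x" and F': "F' \<in> ?H'" "\<forall>z\<in>S'. F' (m' z) = \<Lambda> z y" by blast
  have c: "F z \<in> carrier A" "F' z \<in> carrier A" if "z \<in> carrier G'" for z using F F' that by (auto simp: mh)
  have "(\<lambda>z. F z \<oplus>\<^bsub>A\<^esub> F' z) \<in> ?H'"
   using F(1) F'(1) by (auto simp: mh A.r_distr c A.a_ac)
  moreover have "\<forall>z\<in>S'. F (m' z) \<oplus>\<^bsub>A\<^esub> F' (m' z) = \<Lambda> z (x \<oplus>\<^bsub>G\<^esub> y)"
   using F(2) F'(2) \<Lambda>(1) xy by (auto simp: mh)
  ultimately show "\<exists>F\<in>?H'. \<forall>z\<in>S'. F (m' z) = \<Lambda> z (x \<oplus>\<^bsub>G\<^esub> y)" by (intro bexI[of _ "\<lambda>z. F z \<oplus>\<^bsub>A\<^esub> F' z"])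
 next
  fix a x assume ax: "a \<in> carrier A" "x \<in> carrier G" "\<exists>F\<in>?H'. \<forall>z\<in>S'. F (m' z) = \<Lambda> z x"
  then obtain F where F: "F \<in> ?H'" "\<forall>z\<in>S'. F (m' z) = \<Lambda> z x" by blast
  have c: "F z \<in> carrier A" if "z \<in> carrier G'" for z using F that by (auto simp: mh)
  have "(\<lambda>z. a \<otimes>\<^bsub>A\<^esub> F z) \<in> ?H'"
   using F(1) ax(1) by (auto simp: mh A.r_distr c A.m_ac)
  moreover have "\<forall>z\<in>S'. a \<otimes>\<^bsub>A\<^esub> F (m' z) = \<Lambda> z (a \<odot>\<^bsub>G\<^esub> x)"
   using F(2) \<Lambda>(1) ax by (auto simp: mh)
  ultimately show "\<exists>F\<in>?H'. \<forall>z\<in>S'. F (m' z) = \<Lambda> z (a \<odot>\<^bsub>G\<^esub> x)" by (intro bexI[of _ "\<lambda>z. a \<otimes>\<^bsub>A\<^esub> F z"])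
 qed (use m g in auto)
 then obtain D where D: "\<And>g. g \<in> carrier G \<Longrightarrow> D g \<in> ?H'" "\<And>g y. g \<in> carrier G \<Longrightarrow> y \<in> S' \<Longrightarrow> D g (m' y) = \<Lambda> y g"
  by metis
 \<comment> \<open>Against a generator m' y the map D is \<Lambda> y, which is linear in g; this
   property is inherited by sums and multiples in the second argument.\<close>
 have H': "(\<lambda>g. D g z) \<in> ?H" if z: "z \<in> carrier G'" for z
 proof (rule G'.span_induct[of "m' ` S'"])
  fix s assume "s \<in> m' ` S'"
  then obtain y where y: "y \<in> S'" "s = m' y" by blast
  show "(\<lambda>g. D g s) \<in> ?H" using \<Lambda>(1)[OF y(1)] y by (auto simp: mh D(2))
 next
  show "(\<lambda>g. D g \<zero>\<^bsub>G'\<^esub>) \<in> ?H" using zero_H[OF G' D(1)] by (auto simp: mh)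
 next
  fix x y assume xy: "x \<in> carrier G'" "y \<in> carrier G'" "(\<lambda>g. D g x) \<in> ?H" "(\<lambda>g. D g y) \<in> ?H"
  have c: "D g x \<in> carrier A" "D g y \<in> carrier A" if "g \<in> carrier G" for g using D(1)[OF that] xy by (auto simp: mh)
  have e: "D g (x \<oplus>\<^bsub>G'\<^esub> y) = D g x \<oplus>\<^bsub>A\<^esub> D g y" if "g \<in> carrier G" for g using D(1)[OF that] xy by (auto simp: mh)
  show "(\<lambda>g. D g (x \<oplus>\<^bsub>G'\<^esub> y)) \<in> ?H"
   using xy(3,4) by (auto simp: mh e c A.r_distr A.a_ac)
 next
  fix a x assume ax: "a \<in> carrier A" "x \<in> carrier G'" "(\<lambda>g. D g x) \<in> ?H"
  have c: "D g x \<in> carrier A" if "g \<in> carrier G" for g using D(1)[OF that] ax by (auto simp: mh)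
  have e: "D g (a \<odot>\<^bsub>G'\<^esub> x) = a \<otimes>\<^bsub>A\<^esub> D g x" if "g \<in> carrier G" for g using D(1)[OF that] ax by (auto simp: mh)
  show "(\<lambda>g. D g (a \<odot>\<^bsub>G'\<^esub> x)) \<in> ?H"
   using ax(1,3) by (auto simp: mh e c A.r_distr A.m_ac)
 qed (use m' z in auto)
 have "D (m x) (m' y) = t x y" if "x \<in> S" "y \<in> S'" for x y
  using D(2)[of "m x" y] \<Lambda>(2) m that by auto
 then show ?thesis
  using D(1) H' by (intro exI[of _ D] conjI ballI) (auto simp: bilinear_pairing_def)
qed

section \<open>The pairing on the divided powers of a vector space\<close>

text \<open>In a ring killed by p^(n+1), changing the c_ij by multiples of p leaves the p^n-th power
  of the form unchanged. Hence the choices made by \<open>witt_lift\<close> do not influence the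
  pairing.\<close>

lemma (in plain_cring) bilinear_power_coeff_cong:
 fixes c c' d :: "nat \<Rightarrow> nat \<Rightarrow> 'a"
 assumes p: "prime p" and tors: "\<And>x. x \<in> carrier R \<Longrightarrow> add_pow R (p ^ Suc n) x = \<zero>"
  and c': "\<And>i j. i < k \<Longrightarrow> j < l \<Longrightarrow> c' i j \<in> carrier R" and d: "\<And>i j. i < k \<Longrightarrow> j < l \<Longrightarrow> d i j \<in> carrier R"
  and c: "\<And>i j. i < k \<Longrightarrow> j < l \<Longrightarrow> c i j = c' i j \<oplus> add_pow R p (d i j)"
 shows "bilinear_power_coeff R c k l (p ^ n) a b = bilinear_power_coeff R c' k l (p ^ n) a b"
proof -
 interpret U: mvpolys R "UNIV :: (nat + nat) set" by unfold_locales
 have mc: "mono R x \<mu> \<in> carrier U.P" if "x \<in> carrier R" for x and \<mu> :: "(nat + nat) multiset" using that by (intro U.mono_closed) auto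
 have Utors: "add_pow U.P (p ^ Suc n) f = \<zero>\<^bsub>U.P\<^esub>" if "f \<in> carrier U.P" for f
  using that tors by (auto simp: fun_eq_iff U.coeff_add_pow U.coeff_zero U.coeff_closed)
 let ?F = "\<lambda>c. \<Oplus>\<^bsub>U.P\<^esub>i\<in>{..<k}. \<Oplus>\<^bsub>U.P\<^esub>j\<in>{..<l}. mono R (c i j) {#Inl i, Inr j#}"
 have Fc: "?F g \<in> carrier U.P" if "\<And>i j. i < k \<Longrightarrow> j < l \<Longrightarrow> g i j \<in> carrier R" for g
  using that mc by (auto intro!: U.P.finsum_closed)
 have co: "?F g \<mu> = (\<Oplus>i\<in>{..<k}. \<Oplus>j\<in>{..<l}. mono R (g i j) {#Inl i, Inr j#} \<mu>)"
  if g: "\<And>i j. i < k \<Longrightarrow> j < l \<Longrightarrow> g i j \<in> carrier R" for g \<mu>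
 proof -
  have "?F g \<mu> = (\<Oplus>i\<in>{..<k}. (\<Oplus>\<^bsub>U.P\<^esub>j\<in>{..<l}. mono R (g i j) {#Inl i, Inr j#}) \<mu>)"
   using g mc by (subst U.coeff_finsum) (auto intro!: U.P.finsum_closed)
  also have "\<dots> = (\<Oplus>i\<in>{..<k}. \<Oplus>j\<in>{..<l}. mono R (g i j) {#Inl i, Inr j#} \<mu>)"
   using g mc by (intro finsum_cong') (auto simp: U.coeff_finsum mono_def intro!: finsum_closed)
  finally show ?thesis .
 qed
 have mcl: "mono R x \<nu> \<mu> \<in> carrier R" if "x \<in> carrier R" for x and \<nu> \<mu> :: "(nat + nat) multiset" using that by (simp add: mono_def)
 have "?F c = ?F c' \<oplus>\<^bsub>U.P\<^esub> add_pow U.P p (?F d)"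
 proof
  fix \<mu>
  have m: "mono R (c i j) {#Inl i, Inr j#} \<mu> = mono R (c' i j) {#Inl i, Inr j#} \<mu> \<oplus> add_pow R p \<one> \<otimes> mono R (d i j) {#Inl i, Inr j#} \<mu>"
   if "i < k" "j < l" for i j using that c[OF that] c' d by (simp add: mono_def add_pow_ldistr)
  have in1: "(\<Oplus>j\<in>{..<l}. mono R (c i j) {#Inl i, Inr j#} \<mu>) = (\<Oplus>j\<in>{..<l}. mono R (c' i j) {#Inl i, Inr j#} \<mu>) \<oplus>
    add_pow R p \<one> \<otimes> (\<Oplus>j\<in>{..<l}. mono R (d i j) {#Inl i, Inr j#} \<mu>)" if i: "i < k" for i
  proof -
   have "(\<Oplus>j\<in>{..<l}. mono R (c i j) {#Inl i, Inr j#} \<mu>) = (\<Oplus>j\<in>{..<l}. mono R (c' i j) {#Inl i, Inr j#} \<mu> \<oplus> add_pow R p \<one> \<otimes> mono R (d i j) {#Inl i, Inr j#} \<mu>)"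
    by (intro finsum_cong') (use i m c' d mcl in auto)
   also have "\<dots> = (\<Oplus>j\<in>{..<l}. mono R (c' i j) {#Inl i, Inr j#} \<mu>) \<oplus> (\<Oplus>j\<in>{..<l}. add_pow R p \<one> \<otimes> mono R (d i j) {#Inl i, Inr j#} \<mu>)"
    by (intro finsum_addf) (use i c' d mcl in auto)
   also have "(\<Oplus>j\<in>{..<l}. add_pow R p \<one> \<otimes> mono R (d i j) {#Inl i, Inr j#} \<mu>) = add_pow R p \<one> \<otimes> (\<Oplus>j\<in>{..<l}. mono R (d i j) {#Inl i, Inr j#} \<mu>)"
    by (rule finsum_rdistr[symmetric]) (use i d mcl in auto)
   finally show ?thesis .
  qed
  have fcl: "(\<Oplus>j\<in>{..<l}. mono R (g i j) {#Inl i, Inr j#} \<mu>) \<in> carrier R" if "\<And>j. j < l \<Longrightarrow> g i j \<in> carrier R" for g i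
   using that mcl by (intro finsum_closed) auto
  have "?F c \<mu> = (\<Oplus>i\<in>{..<k}. \<Oplus>j\<in>{..<l}. mono R (c i j) {#Inl i, Inr j#} \<mu>)"
   by (rule co) (use c c' d in auto)
  also have "\<dots> = (\<Oplus>i\<in>{..<k}. (\<Oplus>j\<in>{..<l}. mono R (c' i j) {#Inl i, Inr j#} \<mu>) \<oplus>
    add_pow R p \<one> \<otimes> (\<Oplus>j\<in>{..<l}. mono R (d i j) {#Inl i, Inr j#} \<mu>))"
   by (intro finsum_cong') (use c' d fcl in1 in auto)
  also have "\<dots> = (\<Oplus>i\<in>{..<k}. \<Oplus>j\<in>{..<l}. mono R (c' i j) {#Inl i, Inr j#} \<mu>) \<oplus> (\<Oplus>i\<in>{..<k}. add_pow R p \<one> \<otimes> (\<Oplus>j\<in>{..<l}. mono R (d i j) {#Inl i, Inr j#} \<mu>))"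
   by (intro finsum_addf) (use c' d fcl in auto)
  also have "(\<Oplus>i\<in>{..<k}. add_pow R p \<one> \<otimes> (\<Oplus>j\<in>{..<l}. mono R (d i j) {#Inl i, Inr j#} \<mu>)) = add_pow R p \<one> \<otimes> (\<Oplus>i\<in>{..<k}. \<Oplus>j\<in>{..<l}. mono R (d i j) {#Inl i, Inr j#} \<mu>)"
   by (rule finsum_rdistr[symmetric]) (use d fcl in auto)
  finally show "?F c \<mu> = (?F c' \<oplus>\<^bsub>U.P\<^esub> add_pow U.P p (?F d)) \<mu>"
   using Fc[of c'] Fc[of d] c' d co[of c' \<mu>] co[of d \<mu>] U.coeff_closed[of "?F d" \<mu>]
   by (simp add: U.coeff_add U.coeff_add_pow add_pow_ldistr)
 qed
 \<comment> \<open>The general congruence is used at i = p^n, where the binomial coefficient is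
   1.\<close>
 then have "add_pow U.P (p ^ n choose p ^ n) (?F c [^]\<^bsub>U.P\<^esub> (p ^ n)) = add_pow U.P (p ^ n choose p ^ n) (?F c' [^]\<^bsub>U.P\<^esub> (p ^ n))"
  using U.P.binomial_power_cong[OF p Fc[of c'] Fc[of d] Utors, where i="p ^ n"] c' d by simp
 then have "?F c [^]\<^bsub>U.P\<^esub> (p ^ n) = ?F c' [^]\<^bsub>U.P\<^esub> (p ^ n)"
  using U.P.nat_pow_closed[OF Fc[of c], of "p ^ n"] U.P.nat_pow_closed[OF Fc[of c'], of "p ^ n"] c c' d by simp
 then show ?thesis by (simp add: bilinear_power_coeff_def)
qed

lemma (in finite_witt) pr_add_pow: "a \<in> carrier W \<Longrightarrow> pr j (add_pow W (m::nat) a) = add_pow (A j) m (pr j a)"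
proof -
 interpret pr: ring_hom_cring W "A j" "pr j" by (rule pr_hom)
 show "a \<in> carrier W \<Longrightarrow> ?thesis" by (induction m) simp_all
qed

lemma (in finite_witt) residue_hom: "witt_residue \<in> ring_hom (A (Suc n)) K"
proof (rule ring_hom_memI)
 note c0 = component0_hom
 interpret pr: ring_hom_cring W "A (Suc n)" "pr (Suc n)" by (rule pr_hom)
 have r: "witt_residue (pr (Suc n) a) = a 0" if "a \<in> carrier W" for a using residue_pr[OF that] by simp
 show "witt_residue x \<in> carrier K" if "x \<in> carrier (A (Suc n))" for x
  using that by (auto simp: carrier_A r) (simp add: carrier_W Pi_iff)
 show "witt_residue (x \<otimes>\<^bsub>A (Suc n)\<^esub> y) = witt_residue x \<otimes> witt_residue y"
    "witt_residue (x \<oplus>\<^bsub>A (Suc n)\<^esub> y) = witt_residue x \<oplus> witt_residue y"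
  if xy: "x \<in> carrier (A (Suc n))" "y \<in> carrier (A (Suc n))" for x y
 proof -
  obtain a b where ab: "a \<in> carrier W" "b \<in> carrier W" "x = pr (Suc n) a" "y = pr (Suc n) b" using xy by (auto simp: carrier_A)
  then have "x \<otimes>\<^bsub>A (Suc n)\<^esub> y = pr (Suc n) (a \<otimes>\<^bsub>W\<^esub> b)" "x \<oplus>\<^bsub>A (Suc n)\<^esub> y = pr (Suc n) (a \<oplus>\<^bsub>W\<^esub> b)" by simp_all
  then show "witt_residue (x \<otimes>\<^bsub>A (Suc n)\<^esub> y) = witt_residue x \<otimes> witt_residue y"
    "witt_residue (x \<oplus>\<^bsub>A (Suc n)\<^esub> y) = witt_residue x \<oplus> witt_residue y"
   using ab r[of "a \<otimes>\<^bsub>W\<^esub> b"] r[of "a \<oplus>\<^bsub>W\<^esub> b"] r[of a] r[of b] ring_hom_mult[OF c0, of a b] ring_hom_add[OF c0, of a b] by simp_all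
 qed
 have "\<one>\<^bsub>A (Suc n)\<^esub> = pr (Suc n) \<one>\<^bsub>W\<^esub>" by simp
 then show "witt_residue \<one>\<^bsub>A (Suc n)\<^esub> = \<one>"
  using ring_hom_one[OF c0] by (simp add: r del: pr.hom_one)
qed

lemma (in finite_witt) residue_eq:
 assumes "x \<in> carrier (A (Suc n))" "y \<in> carrier (A (Suc n))" "witt_residue x = witt_residue y"
 shows "\<exists>d\<in>carrier (A (Suc n)). x = y \<oplus>\<^bsub>A (Suc n)\<^esub> add_pow (A (Suc n)) p d"
proof -
 interpret pr: ring_hom_cring W "A (Suc n)" "pr (Suc n)" by (rule pr_hom)
 obtain a b where ab: "a \<in> carrier W" "b \<in> carrier W" "x = pr (Suc n) a" "y = pr (Suc n) b" using assms by (auto simp: carrier_A)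
 then have "a 0 = b 0" using assms(3) by (simp add: residue_pr)
 then have "(a \<ominus>\<^bsub>W\<^esub> b) 0 = \<zero>" using agree_diff[of a b 1 0] ab by simp
 then obtain c where c: "c \<in> carrier W" "a \<ominus>\<^bsub>W\<^esub> b = add_pow W (p ^ 1) c"
  using p_power_times_iff[of "a \<ominus>\<^bsub>W\<^esub> b" 1] ab by auto
 have "a = b \<oplus>\<^bsub>W\<^esub> (a \<ominus>\<^bsub>W\<^esub> b)" using ab by (simp add: W.minus_eq W.a_ac W.r_neg W.r_neg1)
 then have "a = b \<oplus>\<^bsub>W\<^esub> add_pow W p c" using c by simp
 then have "x = y \<oplus>\<^bsub>A (Suc n)\<^esub> pr (Suc n) (add_pow W p c)" using ab c by simp
 also have "pr (Suc n) (add_pow W p c) = add_pow (A (Suc n)) p (pr (Suc n) c)"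
  by (rule pr_add_pow[OF c(1)])
 finally show ?thesis using c by blast
qed

lemma (in finite_witt) A_torsion: "x \<in> carrier (A j) \<Longrightarrow> add_pow (A j) (p ^ j) x = \<zero>\<^bsub>A j\<^esub>"
proof -
 interpret pr: ring_hom_cring W "A j" "pr j" by (rule pr_hom)
 assume "x \<in> carrier (A j)"
 then obtain a where a: "a \<in> carrier W" "x = pr j a" by (auto simp: carrier_A)
 have "\<forall>i<j. add_pow W (p ^ j) a i = \<zero>\<^bsub>W\<^esub> i" using a by (simp add: p_power_times W_zero)
 then have "pr j (add_pow W (p ^ j) a) = pr j \<zero>\<^bsub>W\<^esub>" using a by (subst pr_eq_iff) auto
 then show ?thesis using a by (simp add: pr_add_pow)
qed

locale finite_space = finite_witt K p r for K :: "'k ring" (structure) and p r +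
 fixes V :: "('k, 'v) module"
 assumes vectorspace_V: "vectorspace K V" and finite_V: "finite (carrier V)"
begin

sublocale V: vectorspace K V by (rule vectorspace_V)

abbreviation "VD \<equiv> dual_space K V"

lemma in_dual_iff: "\<phi> \<in> carrier VD \<longleftrightarrow> \<phi> \<in> extensional (carrier V) \<and> (\<forall>v\<in>carrier V. \<phi> v \<in> carrier K) \<and>
  (\<forall>v\<in>carrier V. \<forall>u\<in>carrier V. \<phi> (v \<oplus>\<^bsub>V\<^esub> u) = \<phi> v \<oplus> \<phi> u) \<and>
  (\<forall>a\<in>carrier K. \<forall>v\<in>carrier V. \<phi> (a \<odot>\<^bsub>V\<^esub> v) = a \<otimes> \<phi> v)"
 by (auto simp: dual_space_def LinearCombinations.module_hom_def self_module_simps Pi_iff)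

lemma dual_simps:
 "\<phi> \<oplus>\<^bsub>VD\<^esub> \<psi> = restrict (\<lambda>v. \<phi> v \<oplus> \<psi> v) (carrier V)" "a \<odot>\<^bsub>VD\<^esub> \<phi> = restrict (\<lambda>v. a \<otimes> \<phi> v) (carrier V)"
 "\<zero>\<^bsub>VD\<^esub> = restrict (\<lambda>v. \<zero>) (carrier V)"
 by (simp_all add: dual_space_def func_space_def)

lemma dual_closed [simp]: "\<phi> \<in> carrier VD \<Longrightarrow> v \<in> carrier V \<Longrightarrow> \<phi> v \<in> carrier K"
 by (simp add: in_dual_iff)

lemma dual_zero: "\<phi> \<in> carrier VD \<Longrightarrow> \<phi> \<zero>\<^bsub>V\<^esub> = \<zero>"
proof -
 assume f: "\<phi> \<in> carrier VD"
 then have "\<phi> (\<zero> \<odot>\<^bsub>V\<^esub> \<zero>\<^bsub>V\<^esub>) = \<zero> \<otimes> \<phi> \<zero>\<^bsub>V\<^esub>" unfolding in_dual_iff by blast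
 then show ?thesis using f by simp
qed

lemma vectorspace_dual: "vectorspace K VD"
proof -
 have "submodule K (carrier VD) (func_space (carrier V))"
 proof (rule submodule.intro)
  show "Module.module K (func_space (carrier V))" by (rule func_space_is_module)
  show "carrier VD \<subseteq> carrier (func_space (carrier V))"
   by (auto simp: in_dual_iff func_space_def PiE_def)
  show "\<zero>\<^bsub>func_space (carrier V)\<^esub> \<in> carrier VD"
   by (auto simp: in_dual_iff func_space_def)
  show "v \<oplus>\<^bsub>func_space (carrier V)\<^esub> w \<in> carrier VD" if "v \<in> carrier VD" "w \<in> carrier VD" for v w
   using that by (auto simp: in_dual_iff func_space_def r_distr a_ac)
  show "c \<odot>\<^bsub>func_space (carrier V)\<^esub> v \<in> carrier VD" if "c \<in> carrier K" "v \<in> carrier VD" for c v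
   using that by (auto simp: in_dual_iff func_space_def r_distr m_ac)
 qed
 then have "Module.module K ((func_space (carrier V))\<lparr>carrier := carrier VD\<rparr>)"
  by (rule LinearCombinations.module.submodule_is_module[OF func_space_is_module])
 moreover have "(func_space (carrier V))\<lparr>carrier := carrier VD\<rparr> = VD"
  by (simp add: dual_space_def)
 ultimately show ?thesis using field_K by (simp add: vectorspace_def)
qed

lemma finite_dual: "finite (carrier VD)"
proof (rule finite_subset)
 show "carrier VD \<subseteq> carrier V \<rightarrow>\<^sub>E carrier K" by (auto simp: in_dual_iff PiE_def)
qed (intro finite_PiE finite_V finite_K)

lemma finite_space_dual: "finite_space K p r VD"
 by (intro finite_space.intro finite_space_axioms.intro vectorspace_dual finite_dual finite_witt_axioms)

abbreviation "VA \<equiv> res_scalars (witt_residue :: 'k witt_quot \<Rightarrow> 'k) V"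

lemma VA_simps: "carrier VA = carrier V" "x \<oplus>\<^bsub>VA\<^esub> y = x \<oplus>\<^bsub>V\<^esub> y" "a \<odot>\<^bsub>VA\<^esub> x = witt_residue a \<odot>\<^bsub>V\<^esub> x"
 by (simp_all add: res_scalars_def)

lemma divided_powers_V: "divided_powers (A (Suc n)) VA"
 by (intro divided_powers.intro plain_cring.intro divided_powers_axioms.intro cring_A
   module_restrict_scalars[OF V.module_axioms cring_A residue_hom])

lemma lift_residue: "c \<in> carrier K \<Longrightarrow> witt_lift p K (Suc n) c \<in> carrier (A (Suc n))"
 "c \<in> carrier K \<Longrightarrow> witt_residue (witt_lift p K (Suc n) c) = c"
 using lift_exists[of c "Suc n"] by auto

abbreviation "Gm n \<equiv> Gamma p K n V"
abbreviation "GmD n \<equiv> Gamma p K n VD"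
abbreviation "Dl n \<equiv> Delta p K n V"
abbreviation "gmon n \<equiv> Gamma_monomial p K n V"
abbreviation "gmonD n \<equiv> Gamma_monomial p K n VD"

definition tau :: "nat \<Rightarrow> ('v \<times> nat) list \<Rightarrow> (('v \<Rightarrow> 'k) \<times> nat) list \<Rightarrow> 'k witt_quot" where
 "tau n xs ys = bilinear_power_coeff (A (Suc n)) (\<lambda>i j. witt_lift p K (Suc n) (fst (ys ! j) (fst (xs ! i))))
   (length xs) (length ys) (p ^ n) (\<lambda>i. snd (xs ! i)) (\<lambda>j. snd (ys ! j))"

lemma nth_fst: "set xs \<subseteq> S \<times> UNIV \<Longrightarrow> i < length xs \<Longrightarrow> fst (xs ! i) \<in> S"
 by (metis mem_Times_iff nth_mem subsetD)

lemma tau_law_coeff_eq: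
 assumes xs: "set xs \<subseteq> carrier V \<times> UNIV" and ys: "set ys \<subseteq> carrier VD \<times> UNIV"
 shows "tau_law_coeff p K n xs ys = tau n xs ys"
proof -
 interpret A: plain_cring "A (Suc n)" by (rule plain_cring.intro, rule cring_A)
 interpret U: mvpolys "A (Suc n)" "UNIV :: (nat + nat) set" by unfold_locales
 let ?c = "\<lambda>i j. witt_lift p K (Suc n) (fst (ys ! j) (fst (xs ! i)))"
 have c: "?c i j \<in> carrier (A (Suc n))" if "i < length xs" "j < length ys" for i j
  using nth_fst[OF xs that(1)] nth_fst[OF ys that(2)] by (intro lift_residue dual_closed)
 have "(\<Oplus>\<^bsub>U.P\<^esub>i\<in>{..<length xs}. \<Oplus>\<^bsub>U.P\<^esub>j\<in>{..<length ys}.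
    ring.indexed_const (A (Suc n)) (?c i j) \<otimes>\<^bsub>U.P\<^esub> (ring.indexed_var (A (Suc n)) (Inl i) \<otimes>\<^bsub>U.P\<^esub> ring.indexed_var (A (Suc n)) (Inr j)))
   = (\<Oplus>\<^bsub>U.P\<^esub>i\<in>{..<length xs}. \<Oplus>\<^bsub>U.P\<^esub>j\<in>{..<length ys}. mono (A (Suc n)) (?c i j) {#Inl i, Inr j#})"
 proof (intro U.P.finsum_cong' refl)
  fix i j assume "i \<in> {..<length xs}" "j \<in> {..<length ys}"
  then have "?c i j \<in> carrier (A (Suc n))" using c by simp
  then show "ring.indexed_const (A (Suc n)) (?c i j) \<otimes>\<^bsub>U.P\<^esub> (ring.indexed_var (A (Suc n)) (Inl i) \<otimes>\<^bsub>U.P\<^esub> ring.indexed_var (A (Suc n)) (Inr j)) = mono (A (Suc n)) (?c i j) {#Inl i, Inr j#}"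
   by (simp add: A.indexed_const_eq_mono A.indexed_var_eq_mono U.mono_mult U.mono_closed add_mset_commute)
 qed (use c in \<open>auto intro!: U.P.finsum_closed U.mono_closed\<close>)
 then show ?thesis
  by (simp add: tau_law_coeff_def Let_def tau_def bilinear_power_coeff_def)
qed

text \<open>For a fixed list of forms, lifts of their values are linear in v modulo p, which is what
  \<open>dp_functional_exists\<close> asks for.\<close>

lemma tau_functional_left:
 assumes ys: "set ys \<subseteq> carrier VD \<times> UNIV"
 shows "\<exists>F\<in>lin_maps (A (Suc n)) (Gm n) (self_module (A (Suc n))).
   \<forall>xs\<in>dp_lists (carrier V) (p ^ n). F (gmon n xs) = tau n xs ys"
proof -
 interpret D: divided_powers "A (Suc n)" VA by (rule divided_powers_V)
 interpret res: ring_hom_cring "A (Suc n)" K witt_residue by (intro ring_hom_cringI cring_A residue_hom is_cring)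
 have yc: "fst (ys ! j) \<in> carrier VD" if "j < length ys" for j using nth_fst[OF ys that] .
 have "\<exists>F\<in>lin_maps (A (Suc n)) (dp_power (A (Suc n)) VA (p ^ n)) (self_module (A (Suc n))).
   \<forall>xs\<in>dp_lists (carrier VA) (p ^ n). F (dp_monomial (A (Suc n)) VA xs) =
    bilinear_power_coeff (A (Suc n)) (\<lambda>i j. witt_lift p K (Suc n) (fst (ys ! j) (fst (xs ! i)))) (length xs) (length ys) (p ^ n) (\<lambda>i. snd (xs ! i)) (\<lambda>j. snd (ys ! j))"
 proof (rule D.dp_functional_exists[where e="\<lambda>v j. witt_lift p K (Suc n) (fst (ys ! j) v)" and p=p])
  show "prime p" by (rule p)
  show "add_pow (A (Suc n)) (p ^ Suc n) x = \<zero>\<^bsub>A (Suc n)\<^esub>" if "x \<in> carrier (A (Suc n))" for x using that by (rule A_torsion)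
  show "witt_lift p K (Suc n) (fst (ys ! j) v) \<in> carrier (A (Suc n))" if "v \<in> carrier VA" "j < length ys" for v j
   using that yc by (simp add: VA_simps lift_residue)
  show "\<exists>d\<in>carrier (A (Suc n)). witt_lift p K (Suc n) (fst (ys ! j) (v \<oplus>\<^bsub>VA\<^esub> v')) =
    witt_lift p K (Suc n) (fst (ys ! j) v) \<oplus>\<^bsub>A (Suc n)\<^esub> witt_lift p K (Suc n) (fst (ys ! j) v') \<oplus>\<^bsub>A (Suc n)\<^esub> add_pow (A (Suc n)) p d"
   if "v \<in> carrier VA" "v' \<in> carrier VA" "j < length ys" for v v' j
  proof -
   have "v \<in> carrier V" "v' \<in> carrier V" using that by (simp_all add: VA_simps)
   moreover have "fst (ys ! j) (v \<oplus>\<^bsub>V\<^esub> v') = fst (ys ! j) v \<oplus> fst (ys ! j) v'" using yc[OF that(3)] calculation unfolding in_dual_iff by blast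
   ultimately show ?thesis using yc[OF that(3)] by (intro residue_eq) (simp_all add: VA_simps lift_residue)
  qed
  show "\<exists>d\<in>carrier (A (Suc n)). witt_lift p K (Suc n) (fst (ys ! j) (a \<odot>\<^bsub>VA\<^esub> v)) =
    a \<otimes>\<^bsub>A (Suc n)\<^esub> witt_lift p K (Suc n) (fst (ys ! j) v) \<oplus>\<^bsub>A (Suc n)\<^esub> add_pow (A (Suc n)) p d"
   if a: "a \<in> carrier (A (Suc n))" and "v \<in> carrier VA" "j < length ys" for a v j
  proof -
   have v: "v \<in> carrier V" using that by (simp add: VA_simps)
   have "fst (ys ! j) (witt_residue a \<odot>\<^bsub>V\<^esub> v) = witt_residue a \<otimes> fst (ys ! j) v"
    using yc[OF that(3)] v res.hom_closed[OF a] unfolding in_dual_iff by blast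
   then show ?thesis using yc[OF that(3)] v a by (intro residue_eq) (simp_all add: VA_simps lift_residue)
  qed
 qed
 then show ?thesis by (simp add: Gamma_def Gamma_monomial_def VA_simps tau_def)
qed

text \<open>The same with evaluations at a fixed list of vectors;
  \<open>bilinear_power_coeff_swap\<close> brings the value into the order of arguments of
  \<open>tau\<close>.\<close>

lemma tau_functional_right:
 assumes xs: "set xs \<subseteq> carrier V \<times> UNIV"
 shows "\<exists>F\<in>lin_maps (A (Suc n)) (GmD n) (self_module (A (Suc n))).
   \<forall>ys\<in>dp_lists (carrier VD) (p ^ n). F (gmonD n ys) = tau n xs ys"
proof -
 interpret VD: finite_space K p r VD by (rule finite_space_dual)
 interpret A: plain_cring "A (Suc n)" by (rule plain_cring.intro, rule cring_A)
 interpret D: divided_powers "A (Suc n)" VD.VA by (rule VD.divided_powers_V)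
 interpret res: ring_hom_cring "A (Suc n)" K witt_residue by (intro ring_hom_cringI cring_A residue_hom is_cring)
 have xc: "fst (xs ! j) \<in> carrier V" if "j < length xs" for j using nth_fst[OF xs that] .
 have ex: "\<exists>F\<in>lin_maps (A (Suc n)) (dp_power (A (Suc n)) VD.VA (p ^ n)) (self_module (A (Suc n))).
   \<forall>ys\<in>dp_lists (carrier VD.VA) (p ^ n). F (dp_monomial (A (Suc n)) VD.VA ys) =
    bilinear_power_coeff (A (Suc n)) (\<lambda>j i. witt_lift p K (Suc n) (fst (ys ! j) (fst (xs ! i)))) (length ys) (length xs) (p ^ n) (\<lambda>j. snd (ys ! j)) (\<lambda>i. snd (xs ! i))"
 proof (rule D.dp_functional_exists[where e="\<lambda>\<phi> i. witt_lift p K (Suc n) (\<phi> (fst (xs ! i)))" and p=p])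
  show "prime p" by (rule p)
  show "add_pow (A (Suc n)) (p ^ Suc n) x = \<zero>\<^bsub>A (Suc n)\<^esub>" if "x \<in> carrier (A (Suc n))" for x using that by (rule A_torsion)
  show "witt_lift p K (Suc n) (\<phi> (fst (xs ! i))) \<in> carrier (A (Suc n))" if "\<phi> \<in> carrier VD.VA" "i < length xs" for \<phi> i
   using that xc by (simp add: VD.VA_simps lift_residue)
  show "\<exists>d\<in>carrier (A (Suc n)). witt_lift p K (Suc n) ((\<phi> \<oplus>\<^bsub>VD.VA\<^esub> \<psi>) (fst (xs ! i))) =
    witt_lift p K (Suc n) (\<phi> (fst (xs ! i))) \<oplus>\<^bsub>A (Suc n)\<^esub> witt_lift p K (Suc n) (\<psi> (fst (xs ! i))) \<oplus>\<^bsub>A (Suc n)\<^esub> add_pow (A (Suc n)) p d"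
   if "\<phi> \<in> carrier VD.VA" "\<psi> \<in> carrier VD.VA" "i < length xs" for \<phi> \<psi> i
   using that xc[OF that(3)] by (intro residue_eq) (simp_all add: VD.VA_simps dual_simps lift_residue)
  show "\<exists>d\<in>carrier (A (Suc n)). witt_lift p K (Suc n) ((a \<odot>\<^bsub>VD.VA\<^esub> \<phi>) (fst (xs ! i))) =
    a \<otimes>\<^bsub>A (Suc n)\<^esub> witt_lift p K (Suc n) (\<phi> (fst (xs ! i))) \<oplus>\<^bsub>A (Suc n)\<^esub> add_pow (A (Suc n)) p d"
   if "a \<in> carrier (A (Suc n))" "\<phi> \<in> carrier VD.VA" "i < length xs" for a \<phi> i
   using that xc[OF that(3)] by (intro residue_eq) (simp_all add: VD.VA_simps dual_simps lift_residue)
 qed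
 have sw: "tau n xs ys = bilinear_power_coeff (A (Suc n)) (\<lambda>j i. witt_lift p K (Suc n) (fst (ys ! j) (fst (xs ! i)))) (length ys) (length xs) (p ^ n) (\<lambda>j. snd (ys ! j)) (\<lambda>i. snd (xs ! i))"
  if "ys \<in> dp_lists (carrier VD) (p ^ n)" for ys
 proof -
  have "set ys \<subseteq> carrier VD \<times> UNIV" using that by (simp add: dp_lists_def)
  then show ?thesis
   unfolding tau_def using xc nth_fst[of ys "carrier VD"]
   by (subst A.bilinear_power_coeff_swap) (auto intro!: lift_residue dual_closed)
 qed
 show ?thesis using ex sw by (simp add: Gamma_def Gamma_monomial_def VD.VA_simps)
qed

lemma Gamma_module: "Module.module (A (Suc n)) (Gm n)"
 using divided_powers.module_dp_power[OF divided_powers_V] by (simp add: Gamma_def)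

lemma Gamma_monos: "gmon n ` dp_lists (carrier V) (p ^ n) \<subseteq> carrier (Gm n)"
 using divided_powers.monos_in_power[OF divided_powers_V[of n], of "p ^ n"]
 by (simp add: Gamma_def Gamma_monomial_def VA_simps)

lemma Gamma_span: "carrier (Gm n) =
  LinearCombinations.module.span (A (Suc n)) (Gm n) (gmon n ` dp_lists (carrier V) (p ^ n))"
 using divided_powers.dp_power_span[OF divided_powers_V[of n], of "p ^ n"]
 by (simp add: Gamma_def Gamma_monomial_def VA_simps)

text \<open>The choice in \<open>Delta\<close> is meaningful, since the functionals on both sides
  feed \<open>pairing_exists\<close>. From here on \<open>Delta\<close> is handled through these two
  properties.\<close>

lemma Delta_spec:
 "bilinear_pairing (A (Suc n)) (Gm n) (GmD n) (Delta p K n V)"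
 "xs \<in> dp_lists (carrier V) (p ^ n) \<Longrightarrow> ys \<in> dp_lists (carrier VD) (p ^ n) \<Longrightarrow>
   Dl n (gmon n xs) (gmonD n ys) = tau n xs ys"
proof -
 interpret VD: finite_space K p r VD by (rule finite_space_dual)
 have sub: "set zs \<subseteq> S \<times> UNIV" if "zs \<in> dp_lists S j" for zs :: "('z \<times> nat) list" and S j using that by (simp add: dp_lists_def)
 have "\<exists>D. bilinear_pairing (A (Suc n)) (Gm n) (GmD n) D \<and>
   (\<forall>xs\<in>dp_lists (carrier V) (p ^ n). \<forall>ys\<in>dp_lists (carrier VD) (p ^ n).
     D (gmon n xs) (gmonD n ys) = tau n xs ys)"
  by (rule pairing_exists[OF cring_A Gamma_module VD.Gamma_module Gamma_monos Gamma_span VD.Gamma_monos VD.Gamma_span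
    tau_functional_left[OF sub] tau_functional_right[OF sub]])
 then obtain D where D: "bilinear_pairing (A (Suc n)) (Gm n) (GmD n) D"
   "\<forall>xs\<in>dp_lists (carrier V) (p ^ n). \<forall>ys\<in>dp_lists (carrier VD) (p ^ n).
     D (gmon n xs) (gmonD n ys) = tau n xs ys" by blast
 define \<Phi> where "\<Phi> = (\<lambda>D. bilinear_pairing (A (Suc n)) (Gm n) (GmD n) D \<and>
   (\<forall>xs\<in>dp_lists (carrier V) (p ^ n). \<forall>ys\<in>dp_lists (carrier VD) (p ^ n).
    D (gmon n xs) (gmonD n ys) = tau_law_coeff p K n xs ys))"
 have "\<Phi> D" using D tau_law_coeff_eq[OF sub sub] by (simp add: \<Phi>_def)
 then have "\<Phi> (SOME D. \<Phi> D)" by (rule someI[of \<Phi> D])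
 moreover have "Dl n = (SOME D. \<Phi> D)" by (simp add: Delta_def \<Phi>_def)
 ultimately have "bilinear_pairing (A (Suc n)) (Gm n) (GmD n) (Delta p K n V) \<and>
   (\<forall>xs\<in>dp_lists (carrier V) (p ^ n). \<forall>ys\<in>dp_lists (carrier VD) (p ^ n).
    Dl n (gmon n xs) (gmonD n ys) = tau_law_coeff p K n xs ys)"
  by (simp add: \<Phi>_def)
 then show "bilinear_pairing (A (Suc n)) (Gm n) (GmD n) (Delta p K n V)"
  "xs \<in> dp_lists (carrier V) (p ^ n) \<Longrightarrow> ys \<in> dp_lists (carrier VD) (p ^ n) \<Longrightarrow>
   Dl n (gmon n xs) (gmonD n ys) = tau n xs ys"
  using tau_law_coeff_eq[OF sub sub, of xs "p ^ n" ys "p ^ n" n] by simp_all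
qed

end

section \<open>Duality and subspace counts over a finite field\<close>

context finite_space
begin

lemma subspace_iff: "VectorSpace.subspace K U V \<longleftrightarrow> U \<subseteq> carrier V \<and> \<zero>\<^bsub>V\<^esub> \<in> U \<and>
  (\<forall>u\<in>U. \<forall>v\<in>U. u \<oplus>\<^bsub>V\<^esub> v \<in> U) \<and> (\<forall>c\<in>carrier K. \<forall>u\<in>U. c \<odot>\<^bsub>V\<^esub> u \<in> U)"
 using vectorspace_V V.module_axioms by (auto simp: VectorSpace.subspace_def submodule_def)

lemma subspace_finite_space:
 assumes "VectorSpace.subspace K U V"
 shows "finite_space K p r (V\<lparr>carrier := U\<rparr>)"
proof (intro finite_space.intro finite_space_axioms.intro finite_witt_axioms)
 show "vectorspace K (V\<lparr>carrier := U\<rparr>)" by (rule V.subspace_is_vs[OF assms])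
 show "finite (carrier (V\<lparr>carrier := U\<rparr>))" using assms finite_V finite_subset by (auto simp: subspace_iff)
qed

lemma basis_exists:
 obtains B where "finite B" "B \<subseteq> carrier V" "V.span B = carrier V"
  "\<And>v. v \<in> carrier V \<Longrightarrow> \<exists>!a. a \<in> B \<rightarrow>\<^sub>E carrier K \<and> V.lincomb a B = v" "card B = V.dim"
proof -
 have "V.span (carrier V) = carrier V"
  using V.in_own_span[of "carrier V"] V.span_is_subset2[of "carrier V"] by blast
 then have "V.fin_dim" unfolding V.fin_dim_def using finite_V by blast
 then obtain B where B: "finite B" "V.basis B" using V.finite_basis_exists by blast
 then have Bc: "B \<subseteq> carrier V" "V.span B = carrier V" by (auto simp: V.basis_def)
 show ?thesis
  using that[OF B(1) Bc] V.basis_criterion[OF B(1) Bc(1)] B(2) V.dim_basis[OF B] by auto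
qed

lemma card_V: "card (carrier V) = (p ^ r) ^ V.dim"
proof -
 obtain B where B: "finite B" "B \<subseteq> carrier V"
  "\<And>v. v \<in> carrier V \<Longrightarrow> \<exists>!a. a \<in> B \<rightarrow>\<^sub>E carrier K \<and> V.lincomb a B = v" "card B = V.dim"
  using basis_exists by metis
 have cl: "V.lincomb a B \<in> carrier V" if "a \<in> B \<rightarrow>\<^sub>E carrier K" for a
  using that B(2) by (intro V.lincomb_closed) auto
 have "bij_betw (\<lambda>a. V.lincomb a B) (B \<rightarrow>\<^sub>E carrier K) (carrier V)"
 proof (rule bij_betw_imageI)
  show "inj_on (\<lambda>a. V.lincomb a B) (B \<rightarrow>\<^sub>E carrier K)"
  proof (rule inj_onI)
   fix a b assume ab: "a \<in> B \<rightarrow>\<^sub>E carrier K" "b \<in> B \<rightarrow>\<^sub>E carrier K" "V.lincomb a B = V.lincomb b B"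
   then show "a = b" using ex1E[OF B(3)[OF cl[OF ab(1)]]] by metis
  qed
  show "(\<lambda>a. V.lincomb a B) ` (B \<rightarrow>\<^sub>E carrier K) = carrier V"
  proof
   show "carrier V \<subseteq> (\<lambda>a. V.lincomb a B) ` (B \<rightarrow>\<^sub>E carrier K)"
   proof
    fix v assume "v \<in> carrier V"
    from ex1_implies_ex[OF B(3)[OF this]] show "v \<in> (\<lambda>a. V.lincomb a B) ` (B \<rightarrow>\<^sub>E carrier K)" by auto
   qed
  qed (use cl in auto)
 qed
 then have "card (carrier V) = card (B \<rightarrow>\<^sub>E carrier K)" by (simp add: bij_betw_same_card)
 then show ?thesis using B by (simp add: card_PiE card_K)
qed

text \<open>The form is a coordinate in which v has a nonzero entry. It is \<open>undefined\<close>
  off the carrier, as the elements of \<open>dual_space\<close> are extensional.\<close>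

lemma dual_separates:
 assumes v: "v \<in> carrier V" "v \<noteq> \<zero>\<^bsub>V\<^esub>"
 shows "\<exists>\<phi>\<in>carrier VD. \<phi> v \<noteq> \<zero>"
proof -
 obtain B where B: "finite B" "B \<subseteq> carrier V"
  and ex1: "\<And>v. v \<in> carrier V \<Longrightarrow> \<exists>!a. a \<in> B \<rightarrow>\<^sub>E carrier K \<and> V.lincomb a B = v"
  using basis_exists by metis
 define co where "co v = (THE a. a \<in> B \<rightarrow>\<^sub>E carrier K \<and> V.lincomb a B = v)" for v
 have co: "co v \<in> B \<rightarrow>\<^sub>E carrier K" "V.lincomb (co v) B = v" if "v \<in> carrier V" for v
  using theI'[OF ex1[OF that]] by (auto simp: co_def)
 have co_eq: "co v = a" if "a \<in> B \<rightarrow>\<^sub>E carrier K" "V.lincomb a B = v" "v \<in> carrier V" for a v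
  using the1_equality[OF ex1[OF that(3)]] that by (simp add: co_def)
 have cK: "co v b \<in> carrier K" if "v \<in> carrier V" "b \<in> B" for v b using co(1)[OF that(1)] that(2) by auto
 have lr: "V.lincomb (restrict a B) B = V.lincomb a B" if "a \<in> B \<rightarrow> carrier K" for a
  unfolding V.lincomb_def using that B by (intro V.M.finsum_cong') auto
 have "(\<lambda>v. if v \<in> carrier V then co v b else undefined) \<in> carrier VD" if b: "b \<in> B" for b
 proof -
  have "co (v \<oplus>\<^bsub>V\<^esub> u) = restrict (\<lambda>b. co v b \<oplus> co u b) B" if vu: "v \<in> carrier V" "u \<in> carrier V" for v u
   using vu co V.lincomb_sum[OF B, of "co v" "co u"] cK by (intro co_eq) (auto simp: lr Pi_iff)
  moreover have "co (c \<odot>\<^bsub>V\<^esub> v) = restrict (\<lambda>b. c \<otimes> co v b) B" if "c \<in> carrier K" "v \<in> carrier V" for c v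
   using that co V.lincomb_smult[OF B(2), of "co v" c] cK by (intro co_eq) (auto simp: lr Pi_iff)
  ultimately show ?thesis using b cK by (auto simp: in_dual_iff extensional_def)
 qed
 moreover have "\<exists>b\<in>B. co v b \<noteq> \<zero>"
 proof (rule ccontr)
  assume "\<not> ?thesis"
  then have "V.lincomb (co v) B = (\<Oplus>\<^bsub>V\<^esub>b\<in>B. \<zero>\<^bsub>V\<^esub>)"
   unfolding V.lincomb_def using B by (intro V.M.finsum_cong') auto
  then show False using co(2)[OF v(1)] v(2) by simp
 qed
 ultimately obtain b where "(\<lambda>v. if v \<in> carrier V then co v b else undefined) \<in> carrier VD" "co v b \<noteq> \<zero>" by blast
 then show ?thesis using v(1) by (intro bexI[of _ "\<lambda>v. if v \<in> carrier V then co v b else undefined"]) simp_all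
qed

lemma card_dual_le: "card (carrier VD) \<le> card (carrier V)"
proof -
 obtain B where B: "finite B" "B \<subseteq> carrier V" "V.span B = carrier V" "card B = V.dim"
  using basis_exists by metis
 have "inj_on (\<lambda>\<phi>. restrict \<phi> B) (carrier VD)"
 proof (rule inj_onI)
  fix \<phi> \<psi> assume \<phi>: "\<phi> \<in> carrier VD" "\<psi> \<in> carrier VD" "restrict \<phi> B = restrict \<psi> B"
  have "\<phi> v = \<psi> v" if "v \<in> carrier V" for v
  proof (rule V.span_induct[OF B(2)])
   show "v \<in> V.span B" using B(3) that by simp
   show "\<phi> s = \<psi> s" if "s \<in> B" for s using \<phi>(3) that by (metis restrict_apply')
   show "\<phi> \<zero>\<^bsub>V\<^esub> = \<psi> \<zero>\<^bsub>V\<^esub>" using \<phi> by (simp add: dual_zero)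
  qed (use \<phi> in \<open>auto simp: in_dual_iff\<close>)
  then show "\<phi> = \<psi>" using \<phi> by (intro extensionalityI[of _ "carrier V"]) (auto simp: in_dual_iff)
 qed
 then have "card (carrier VD) \<le> card (B \<rightarrow>\<^sub>E carrier K)"
  using B(1,2) by (intro card_inj_on_le[of "\<lambda>\<phi>. restrict \<phi> B"] finite_PiE finite_K) auto
 then show ?thesis using B by (simp add: card_PiE card_K card_V)
qed

definition ev :: "'v \<Rightarrow> ('v \<Rightarrow> 'k) \<Rightarrow> 'k" where
 "ev v = restrict (\<lambda>\<phi>. \<phi> v) (carrier VD)"

abbreviation "VDD \<equiv> dual_space K VD"

lemma ev_apply [simp]: "\<phi> \<in> carrier VD \<Longrightarrow> ev v \<phi> = \<phi> v"
 by (simp add: ev_def)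

lemma ev_closed: "v \<in> carrier V \<Longrightarrow> ev v \<in> carrier VDD"
proof -
 interpret VD: finite_space K p r VD by (rule finite_space_dual)
 show "v \<in> carrier V \<Longrightarrow> ?thesis"
  unfolding VD.in_dual_iff using VD.V.M.a_closed VD.V.smult_closed
  by (auto simp: ev_def dual_simps)
qed

lemma dual_diff: "\<phi> \<in> carrier VD \<Longrightarrow> u \<in> carrier V \<Longrightarrow> v \<in> carrier V \<Longrightarrow> \<phi> (u \<ominus>\<^bsub>V\<^esub> v) = \<phi> u \<ominus> \<phi> v"
proof -
 assume a: "\<phi> \<in> carrier VD" "u \<in> carrier V" "v \<in> carrier V"
 then have "\<phi> ((u \<ominus>\<^bsub>V\<^esub> v) \<oplus>\<^bsub>V\<^esub> v) = \<phi> (u \<ominus>\<^bsub>V\<^esub> v) \<oplus> \<phi> v" by (auto simp: in_dual_iff)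
 moreover have "(u \<ominus>\<^bsub>V\<^esub> v) \<oplus>\<^bsub>V\<^esub> v = u" using a by (simp add: V.M.minus_eq V.M.a_assoc V.M.l_neg)
 moreover have "\<phi> (u \<ominus>\<^bsub>V\<^esub> v) \<in> carrier K" "\<phi> v \<in> carrier K" using a by simp_all
 ultimately show ?thesis by (simp add: minus_eq a_assoc r_neg)
qed

lemma eqI_dual:
 assumes "u \<in> carrier V" "v \<in> carrier V" "\<And>\<phi>. \<phi> \<in> carrier VD \<Longrightarrow> \<phi> u = \<phi> v"
 shows "u = v"
proof (rule ccontr)
 assume "u \<noteq> v"
 then have "u \<ominus>\<^bsub>V\<^esub> v \<noteq> \<zero>\<^bsub>V\<^esub>" using assms by simp
 then obtain \<phi> where "\<phi> \<in> carrier VD" "\<phi> (u \<ominus>\<^bsub>V\<^esub> v) \<noteq> \<zero>" using dual_separates[of "u \<ominus>\<^bsub>V\<^esub> v"] assms by auto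
 then show False using assms by (simp add: dual_diff)
qed

lemma inj_ev: "inj_on ev (carrier V)"
 by (rule inj_onI, rule eqI_dual) (auto dest: fun_cong simp flip: ev_apply)

text \<open>Counting replaces the dimension argument: |V| is at most |V**| because evaluation is
  injective, and dualising never enlarges a finite space, so |V|, |V*| and |V**| agree.\<close>

lemma bidual: "carrier VDD = ev ` carrier V" and card_dual: "card (carrier VD) = card (carrier V)"
proof -
 interpret VD: finite_space K p r VD by (rule finite_space_dual)
 have 1: "card (ev ` carrier V) = card (carrier V)" by (rule card_image[OF inj_ev])
 have 2: "ev ` carrier V \<subseteq> carrier VDD" using ev_closed by auto
 have 3: "card (ev ` carrier V) \<le> card (carrier VDD)" by (rule card_mono[OF VD.finite_dual 2])
 show "carrier VDD = ev ` carrier V"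
  using 1 2 3 VD.card_dual_le card_dual_le by (intro card_subset_eq[symmetric] VD.finite_dual) auto
 show "card (carrier VD) = card (carrier V)" using 1 3 VD.card_dual_le card_dual_le by simp
qed

text \<open>Dimensions are traded for cardinalities, so that subspaces can be counted without
  choosing bases in them.\<close>

lemma dim_eq_iff: "V.dim = m \<longleftrightarrow> card (carrier V) = (p ^ r) ^ m"
 using q_gt_1 by (simp add: card_V)

lemma dim_dual: "vectorspace.dim K VD = V.dim"
proof -
 interpret VD: finite_space K p r VD by (rule finite_space_dual)
 show ?thesis using VD.dim_eq_iff card_dual card_V by simp
qed

lemma Gr_eq: "Gr K m V = {W. VectorSpace.subspace K W V \<and> card W = (p ^ r) ^ m}"
 unfolding Gr_def using finite_space.dim_eq_iff[OF subspace_finite_space] by auto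

lemma unit_vector:
 assumes "\<phi> \<in> carrier VD" "x \<in> carrier V" "\<phi> x \<noteq> \<zero>"
 shows "\<exists>y\<in>carrier V. y = inv (\<phi> x) \<odot>\<^bsub>V\<^esub> x \<and> \<phi> y = \<one>"
proof -
 have i: "inv (\<phi> x) \<in> carrier K" "inv (\<phi> x) \<otimes> \<phi> x = \<one>" using assms by (auto intro: inv_closed' inv_cancel)
 then show ?thesis using assms by (auto simp: in_dual_iff)
qed

text \<open>Rescale x to a vector y with \<phi>(y) = 1. Translations by multiples of y identify all
  fibers of \<phi>, and there are p^r of them.\<close>

lemma fiber_card:
 assumes \<phi>: "\<phi> \<in> carrier VD" and x: "x \<in> carrier V" "\<phi> x \<noteq> \<zero>" and c: "c \<in> carrier K"
 shows "card {v \<in> carrier V. \<phi> v = c} * p ^ r = card (carrier V)"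
proof -
 obtain y where y: "y \<in> carrier V" "\<phi> y = \<one>" using unit_vector[OF \<phi> x] by blast
 let ?F = "\<lambda>c. {v \<in> carrier V. \<phi> v = c}"
 have add: "\<phi> (u \<oplus>\<^bsub>V\<^esub> v) = \<phi> u \<oplus> \<phi> v" "\<phi> (a \<odot>\<^bsub>V\<^esub> v) = a \<otimes> \<phi> v" if "u \<in> carrier V" "v \<in> carrier V" "a \<in> carrier K" for u v a
  using \<phi> that by (auto simp: in_dual_iff)
 have eq: "card (?F d) = card (?F \<zero>)" if d: "d \<in> carrier K" for d
 proof (rule bij_betw_same_card[symmetric])
  show "bij_betw (\<lambda>v. v \<oplus>\<^bsub>V\<^esub> d \<odot>\<^bsub>V\<^esub> y) (?F \<zero>) (?F d)"
   by (rule bij_betw_byWitness[where f'="\<lambda>v. v \<ominus>\<^bsub>V\<^esub> d \<odot>\<^bsub>V\<^esub> y"])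
    (use d y \<phi> in \<open>auto simp: add dual_diff V.M.minus_eq V.M.a_assoc V.M.r_neg V.M.l_neg dual_diff[unfolded V.M.minus_eq] minus_eq r_neg\<close>)
 qed
 have "carrier V = (\<Union>d\<in>carrier K. ?F d)" using \<phi> by auto
 then have "card (carrier V) = card (\<Union>d\<in>carrier K. ?F d)" by simp
 also have "\<dots> = (\<Sum>d\<in>carrier K. card (?F d))"
  using finite_K finite_V by (intro card_UN_disjoint) auto
 also have "\<dots> = (\<Sum>d\<in>carrier K. card (?F c))"
  by (rule sum.cong[OF refl trans[OF eq eq[OF c, symmetric]]])
 also have "\<dots> = card (?F c) * p ^ r" by (simp add: card_K)
 finally show ?thesis by simp
qed

lemma kernel_subspace: "\<phi> \<in> carrier VD \<Longrightarrow> VectorSpace.subspace K {v \<in> carrier V. \<phi> v = \<zero>} V"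
 using dual_zero[of \<phi>] by (auto simp: subspace_iff in_dual_iff)

lemma restrict_dual: "VectorSpace.subspace K U V \<Longrightarrow> \<phi> \<in> carrier VD \<Longrightarrow> restrict \<phi> U \<in> carrier (dual_space K (V\<lparr>carrier := U\<rparr>))"
 using finite_space.in_dual_iff[OF subspace_finite_space, of U] by (auto simp: in_dual_iff subspace_iff subset_iff)

lemma subspace_trans: "VectorSpace.subspace K H V \<Longrightarrow> VectorSpace.subspace K U (V\<lparr>carrier := H\<rparr>) \<longleftrightarrow> VectorSpace.subspace K U V \<and> U \<subseteq> H"
 using finite_space.subspace_iff[OF subspace_finite_space, of H] by (auto simp: subspace_iff)

lemma subspace_diff: "VectorSpace.subspace K U V \<Longrightarrow> u \<in> U \<Longrightarrow> v \<in> U \<Longrightarrow> u \<ominus>\<^bsub>V\<^esub> v \<in> U"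
proof -
 assume U: "VectorSpace.subspace K U V" "u \<in> U" "v \<in> U"
 then have "u \<in> carrier V" "v \<in> carrier V" by (auto simp: subspace_iff)
 then have "u \<ominus>\<^bsub>V\<^esub> v = u \<oplus>\<^bsub>V\<^esub> (\<ominus> \<one>) \<odot>\<^bsub>V\<^esub> v" by (simp add: V.M.minus_eq V.smult_l_minus)
 then show ?thesis using U by (simp add: subspace_iff)
qed

end

section \<open>Gaussian binomials and the number of subspaces\<close>

text \<open>Gaussian binomial coefficients; the subtraction only truncates where the second factor is \<open>0\<close>.\<close>

fun gauss_binomial :: "nat \<Rightarrow> nat \<Rightarrow> nat \<Rightarrow> nat" where
 "gauss_binomial q 0 b = 1"
| "gauss_binomial q (Suc a) 0 = 0"
| "gauss_binomial q (Suc a) (Suc b) = gauss_binomial q (Suc a) b + q ^ (b - a) * gauss_binomial q a b"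

lemma gauss_binomial_eq_0: "b < a \<Longrightarrow> gauss_binomial q a b = 0"
 by (induction q a b rule: gauss_binomial.induct) auto

text \<open>In the recursion only one summand survives modulo q: the first one if a < b, because the
  second carries a positive power of q, and the second one if a = b, because the first is
  zero.\<close>

lemma gauss_binomial_mod: "a \<le> b \<Longrightarrow> \<exists>k. gauss_binomial q a b = 1 + q * k"
proof (induction q a b rule: gauss_binomial.induct)
 case (3 q a b)
 then obtain l where l: "gauss_binomial q a b = 1 + q * l" by auto
 show ?case
 proof (cases "a = b")
  case True
  then show ?thesis using l by (auto simp: gauss_binomial_eq_0)
 next
  case False
  then have "Suc a \<le> b" "b - a = Suc (b - a - 1)" using 3 by auto
  moreover obtain k where "gauss_binomial q (Suc a) b = 1 + q * k" using 3 calculation by auto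
  ultimately have "gauss_binomial q (Suc a) (Suc b) = 1 + q * (k + q ^ (b - a - 1) * gauss_binomial q a b)"
   by (metis (no_types, lifting) add.assoc distrib_left gauss_binomial.simps(3) mult.assoc power_Suc)
  then show ?thesis by blast
 qed
qed auto

text \<open>The subspaces outside a hyperplane \<open>ker \<phi>\<close> are counted by the pairs \<open>(W, x)\<close> with \<open>x \<in> W\<close>,
 \<open>\<phi> x = 1\<close>, which correspond to pairs \<open>(W \<inter> ker \<phi>, x)\<close>.\<close>

lemma card_subspaces:
 fixes K :: "'k ring" (structure) and V :: "('k, 'v) module"
 assumes "finite_space K p r V" "card (carrier V) = (p ^ r) ^ b"
 shows "card {W. VectorSpace.subspace K W V \<and> card W = (p ^ r) ^ a} = gauss_binomial (p ^ r) a b"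
 using assms
proof (induction b arbitrary: a V)
 case (0 a V)
 interpret finite_space K p r V by fact
 obtain z where z: "carrier V = {z}" using 0 by (auto simp: card_1_singleton_iff)
 then have z0: "carrier V = {\<zero>\<^bsub>V\<^esub>}" using V.M.zero_closed by auto
 then have sub: "VectorSpace.subspace K W V \<longleftrightarrow> W = {\<zero>\<^bsub>V\<^esub>}" for W by (auto simp: subspace_iff)
 have "(1::nat) = (p ^ r) ^ a \<longleftrightarrow> a = 0" using q_gt_1 by (metis power_0 power_inject_exp)
 moreover have "{W. W = {\<zero>\<^bsub>V\<^esub>} \<and> card W = Suc 0} = {{\<zero>\<^bsub>V\<^esub>}}" by auto
 ultimately show ?case by (cases a) (auto simp: sub)
next
 case (Suc b a V)
 interpret finite_space K p r V by fact
 let ?q = "p ^ r"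
 show ?case
 proof (cases a)
  case 0
  have "{W. VectorSpace.subspace K W V \<and> card W = 1} = {{\<zero>\<^bsub>V\<^esub>}}"
   by (auto simp: subspace_iff card_1_singleton_iff)
  then show ?thesis using 0 by simp
 next
  case (Suc a')
  have "carrier V \<noteq> {\<zero>\<^bsub>V\<^esub>}" using Suc.prems(2) q_gt_1 prime_gt_0_nat[OF p] by (auto simp: power_Suc0_right)
  then obtain v where "v \<in> carrier V" "v \<noteq> \<zero>\<^bsub>V\<^esub>" using V.M.zero_closed by blast
  then obtain \<phi> x0 where \<phi>: "\<phi> \<in> carrier VD" and x0: "x0 \<in> carrier V" "\<phi> x0 \<noteq> \<zero>" using dual_separates by blast
  have add: "\<phi> (u \<oplus>\<^bsub>V\<^esub> v) = \<phi> u \<oplus> \<phi> v" if "u \<in> carrier V" "v \<in> carrier V" for u v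
   using \<phi> that by (auto simp: in_dual_iff)
  have sm: "\<phi> (c \<odot>\<^bsub>V\<^esub> v) = c \<otimes> \<phi> v" if "v \<in> carrier V" "c \<in> carrier K" for v c
   using \<phi> that by (auto simp: in_dual_iff)
  define H where "H = {v \<in> carrier V. \<phi> v = \<zero>}"
  have H: "VectorSpace.subspace K H V" unfolding H_def by (rule kernel_subspace[OF \<phi>])
  have fib: "card {v \<in> carrier V. \<phi> v = c} = ?q ^ b" if "c \<in> carrier K" for c
   using fiber_card[OF \<phi> x0 that] Suc.prems(2) q_gt_1 prime_gt_0_nat[OF p] by simp
  have cH: "card H = ?q ^ b" unfolding H_def by (rule fib) simp
  have IH: "card {W. (VectorSpace.subspace K W V \<and> W \<subseteq> H) \<and> card W = ?q ^ a} = gauss_binomial ?q a b" for a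
   using Suc.IH[OF subspace_finite_space[OF H], of a] cH by (simp add: subspace_trans[OF H])
  let ?in = "{W. (VectorSpace.subspace K W V \<and> W \<subseteq> H) \<and> card W = ?q ^ Suc a'}"
  let ?out = "{W. VectorSpace.subspace K W V \<and> card W = ?q ^ Suc a' \<and> \<not> W \<subseteq> H}"
  let ?low = "{W. (VectorSpace.subspace K W V \<and> W \<subseteq> H) \<and> card W = ?q ^ a'}"
  have fin: "finite {W. VectorSpace.subspace K W V \<and> Q W}" for Q
   by (rule finite_subset[of _ "Pow (carrier V)"]) (auto simp: subspace_iff finite_V)
  have fins: "finite ?in" "finite ?out" "finite ?low"
   using fin[of "\<lambda>W. W \<subseteq> H \<and> card W = ?q ^ Suc a'"] fin[of "\<lambda>W. card W = ?q ^ Suc a' \<and> \<not> W \<subseteq> H"] fin[of "\<lambda>W. W \<subseteq> H \<and> card W = ?q ^ a'"]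
   by (simp_all add: conj_assoc)
  have "{W. VectorSpace.subspace K W V \<and> card W = ?q ^ a} = ?in \<union> ?out" using Suc by auto
  moreover have "card (?in \<union> ?out) = card ?in + card ?out" using fins by (intro card_Un_disjoint) auto
  ultimately have sum: "card {W. VectorSpace.subspace K W V \<and> card W = ?q ^ a} = gauss_binomial ?q (Suc a') b + card ?out"
   using IH[of "Suc a'"] by simp
  have Wfib: "card {v \<in> W. \<phi> v = c} = ?q ^ a'" if W: "W \<in> ?out" and c: "c \<in> carrier K" for W c
  proof -
   have Ws: "VectorSpace.subspace K W V" "card W = ?q ^ Suc a'" "W \<subseteq> carrier V" using W by (auto simp: subspace_iff)
   then obtain x where x: "x \<in> W" "\<phi> x \<noteq> \<zero>" using W by (auto simp: H_def)
   have "card {v \<in> W. restrict \<phi> W v = c} * ?q = ?q ^ Suc a'"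
    using finite_space.fiber_card[OF subspace_finite_space[OF Ws(1)] restrict_dual[OF Ws(1) \<phi>], of x c] x c Ws by simp
   moreover have "{v \<in> W. restrict \<phi> W v = c} = {v \<in> W. \<phi> v = c}" by auto
   ultimately show ?thesis using q_gt_1 prime_gt_0_nat[OF p] by simp
  qed
  let ?L = "SIGMA W:?out. {v \<in> W. \<phi> v = \<one>}"
  let ?R = "?low \<times> {v \<in> carrier V. \<phi> v = \<one>}"
  \<comment> \<open>The inverse of intersecting with H adjoins the line of x, on which \<phi> takes
    each value exactly once.\<close>
  let ?up = "\<lambda>(U, x). ({u \<oplus>\<^bsub>V\<^esub> c \<odot>\<^bsub>V\<^esub> x | u c. u \<in> U \<and> c \<in> carrier K}, x)"
  let ?dn = "\<lambda>(W, x). (W \<inter> H, x)"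
  have LW: "{u \<oplus>\<^bsub>V\<^esub> c \<odot>\<^bsub>V\<^esub> x | u c. u \<in> W \<inter> H \<and> c \<in> carrier K} = W"
   if W: "VectorSpace.subspace K W V" and x: "x \<in> W" "\<phi> x = \<one>" for W x
   proof -
    have xV: "x \<in> carrier V" using W x by (auto simp: subspace_iff)
    have "w \<in> {u \<oplus>\<^bsub>V\<^esub> c \<odot>\<^bsub>V\<^esub> x | u c. u \<in> W \<inter> H \<and> c \<in> carrier K}" if w: "w \<in> W" for w
    proof -
     have wV: "w \<in> carrier V" using W w by (auto simp: subspace_iff)
     then have pw: "\<phi> w \<in> carrier K" using \<phi> by simp
     let ?u = "w \<ominus>\<^bsub>V\<^esub> \<phi> w \<odot>\<^bsub>V\<^esub> x"
     have "?u \<in> W" using W w x pw by (intro subspace_diff) (auto simp: subspace_iff)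
     moreover have "\<phi> ?u = \<zero>" using wV xV pw x \<phi> by (simp add: dual_diff sm minus_eq r_neg)
     moreover have "w = ?u \<oplus>\<^bsub>V\<^esub> \<phi> w \<odot>\<^bsub>V\<^esub> x" using wV xV pw by (simp add: V.M.minus_eq V.M.a_assoc V.M.l_neg)
     moreover have "?u \<in> carrier V" using wV xV pw by simp
     ultimately show ?thesis using pw by (auto simp: H_def)
    qed
    moreover have "u \<oplus>\<^bsub>V\<^esub> c \<odot>\<^bsub>V\<^esub> x \<in> W" if "u \<in> W" "c \<in> carrier K" for u c
     using W x that by (auto simp: subspace_iff)
    ultimately show ?thesis by auto
   qed
   have R: "VectorSpace.subspace K {u \<oplus>\<^bsub>V\<^esub> c \<odot>\<^bsub>V\<^esub> x | u c. u \<in> U \<and> c \<in> carrier K} V"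
    "{u \<oplus>\<^bsub>V\<^esub> c \<odot>\<^bsub>V\<^esub> x | u c. u \<in> U \<and> c \<in> carrier K} \<inter> H = U"
    "card {u \<oplus>\<^bsub>V\<^esub> c \<odot>\<^bsub>V\<^esub> x | u c. u \<in> U \<and> c \<in> carrier K} = card U * ?q"
    "x \<in> {u \<oplus>\<^bsub>V\<^esub> c \<odot>\<^bsub>V\<^esub> x | u c. u \<in> U \<and> c \<in> carrier K}"
    if U: "VectorSpace.subspace K U V" "U \<subseteq> H" and x: "x \<in> carrier V" "\<phi> x = \<one>" for U x
   proof -
    let ?S = "{u \<oplus>\<^bsub>V\<^esub> c \<odot>\<^bsub>V\<^esub> x | u c. u \<in> U \<and> c \<in> carrier K}"
    have U': "u \<in> carrier V" "\<phi> u = \<zero>" if "u \<in> U" for u using U(2) that by (auto simp: H_def)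
    have ph: "\<phi> (u \<oplus>\<^bsub>V\<^esub> c \<odot>\<^bsub>V\<^esub> x) = c" if "u \<in> U" "c \<in> carrier K" for u c
     using U'[OF that(1)] x that(2) by (simp add: add sm)
    have zU: "\<zero>\<^bsub>V\<^esub> \<in> U" using U(1) by (simp add: subspace_iff)
    show "VectorSpace.subspace K ?S V"
     unfolding subspace_iff
    proof (intro conjI ballI)
     show "?S \<subseteq> carrier V" using U' x by auto
     show "\<zero>\<^bsub>V\<^esub> \<in> ?S" using zU x by (intro CollectI exI[of _ "\<zero>\<^bsub>V\<^esub>"] exI[of _ "\<zero>"]) simp
    next
     fix s t assume "s \<in> ?S" "t \<in> ?S"
     then obtain u c u' c' where st: "s = u \<oplus>\<^bsub>V\<^esub> c \<odot>\<^bsub>V\<^esub> x" "t = u' \<oplus>\<^bsub>V\<^esub> c' \<odot>\<^bsub>V\<^esub> x" "u \<in> U" "u' \<in> U" "c \<in> carrier K" "c' \<in> carrier K" by blast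
     then have "s \<oplus>\<^bsub>V\<^esub> t = (u \<oplus>\<^bsub>V\<^esub> u') \<oplus>\<^bsub>V\<^esub> (c \<oplus> c') \<odot>\<^bsub>V\<^esub> x" using U' x by (simp add: V.smult_l_distr V.M.a_ac)
     moreover have "u \<oplus>\<^bsub>V\<^esub> u' \<in> U" using st U(1) by (simp add: subspace_iff)
     ultimately show "s \<oplus>\<^bsub>V\<^esub> t \<in> ?S" using st(5,6) by blast
    next
     fix d s assume d: "d \<in> carrier K" and "s \<in> ?S"
     then obtain u c where st: "s = u \<oplus>\<^bsub>V\<^esub> c \<odot>\<^bsub>V\<^esub> x" "u \<in> U" "c \<in> carrier K" by blast
     then have "d \<odot>\<^bsub>V\<^esub> s = (d \<odot>\<^bsub>V\<^esub> u) \<oplus>\<^bsub>V\<^esub> (d \<otimes> c) \<odot>\<^bsub>V\<^esub> x" using U' x d by (simp add: V.smult_r_distr V.smult_assoc1)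
     moreover have "d \<odot>\<^bsub>V\<^esub> u \<in> U" using st U(1) d by (simp add: subspace_iff)
     ultimately show "d \<odot>\<^bsub>V\<^esub> s \<in> ?S" using st(3) d by blast
    qed
    show "?S \<inter> H = U"
    proof
     show "?S \<inter> H \<subseteq> U"
     proof
      fix s assume s: "s \<in> ?S \<inter> H"
      then obtain u c where st: "s = u \<oplus>\<^bsub>V\<^esub> c \<odot>\<^bsub>V\<^esub> x" "u \<in> U" "c \<in> carrier K" by blast
      then have "c = \<zero>" using s ph by (simp add: H_def)
      then show "s \<in> U" using st U' x by simp
     qed
     show "U \<subseteq> ?S \<inter> H"
     proof
      fix u assume u: "u \<in> U"
      then have "u = u \<oplus>\<^bsub>V\<^esub> \<zero> \<odot>\<^bsub>V\<^esub> x" using U' x by simp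
      then show "u \<in> ?S \<inter> H" using u U(2) by blast
     qed
    qed
    have img: "?S = (\<lambda>(u, c). u \<oplus>\<^bsub>V\<^esub> c \<odot>\<^bsub>V\<^esub> x) ` (U \<times> carrier K)" by auto
    have "inj_on (\<lambda>(u, c). u \<oplus>\<^bsub>V\<^esub> c \<odot>\<^bsub>V\<^esub> x) (U \<times> carrier K)"
    proof (rule inj_onI, clarify)
     fix u c u' c' assume uc: "u \<in> U" "c \<in> carrier K" "u' \<in> U" "c' \<in> carrier K" "u \<oplus>\<^bsub>V\<^esub> c \<odot>\<^bsub>V\<^esub> x = u' \<oplus>\<^bsub>V\<^esub> c' \<odot>\<^bsub>V\<^esub> x"
     then have "c = c'" using ph by metis
     then show "u = u' \<and> c = c'" using uc U' x by simp
    qed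
    then show "card ?S = card U * ?q" unfolding img by (simp add: card_image card_cartesian_product card_K)
    have "x = \<zero>\<^bsub>V\<^esub> \<oplus>\<^bsub>V\<^esub> \<one> \<odot>\<^bsub>V\<^esub> x" using x by simp
    then show "x \<in> ?S" using zU by blast
   qed
  have "bij_betw ?dn ?L ?R"
  proof (rule bij_betw_byWitness[where f'="?up"])
   show "\<forall>z\<in>?L. ?up (?dn z) = z"
   proof (rule ballI)
    fix z assume "z \<in> ?L"
    then obtain W x where z: "z = (W, x)" "VectorSpace.subspace K W V" "x \<in> W" "\<phi> x = \<one>" by (cases z) simp
    show "?up (?dn z) = z" unfolding z(1) using LW[OF z(2-4)] by simp
   qed
   show "\<forall>z\<in>?R. ?dn (?up z) = z"
   proof (rule ballI)
    fix z assume "z \<in> ?R"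
    then obtain U x where z: "z = (U, x)" "VectorSpace.subspace K U V" "U \<subseteq> H" "x \<in> carrier V" "\<phi> x = \<one>" by (cases z) simp
    show "?dn (?up z) = z" unfolding z(1) using R(2)[OF z(2-5)] by simp
   qed
   show "?dn ` ?L \<subseteq> ?R"
   proof (rule image_subsetI)
    fix z assume "z \<in> ?L"
    then obtain W x where z: "z = (W, x)" and W: "VectorSpace.subspace K W V" "card W = ?q ^ Suc a'" "\<not> W \<subseteq> H" and x: "x \<in> W" "\<phi> x = \<one>" by (cases z) simp
    have "W \<inter> H = {v \<in> W. \<phi> v = \<zero>}" using W(1) by (auto simp: H_def subspace_iff)
    then have "card (W \<inter> H) = ?q ^ a'" using Wfib[of W \<zero>] W by simp
    moreover have "VectorSpace.subspace K (W \<inter> H) V" using W(1) H by (auto simp: subspace_iff)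
    moreover have "x \<in> carrier V" using W(1) x by (auto simp: subspace_iff)
    ultimately show "?dn z \<in> ?R" using x by (simp add: z)
   qed
   show "?up ` ?R \<subseteq> ?L"
   proof (rule image_subsetI)
    fix z assume "z \<in> ?R"
    then obtain U x where z: "z = (U, x)" and U: "VectorSpace.subspace K U V" "U \<subseteq> H" "card U = ?q ^ a'" and x: "x \<in> carrier V" "\<phi> x = \<one>" by (cases z) simp
    let ?S = "{u \<oplus>\<^bsub>V\<^esub> c \<odot>\<^bsub>V\<^esub> x | u c. u \<in> U \<and> c \<in> carrier K}"
    have "x \<notin> H" using x by (simp add: H_def)
    then have "\<not> ?S \<subseteq> H" using R(4)[OF U(1,2) x] by blast
    moreover have "card ?S = ?q ^ Suc a'" using R(3)[OF U(1,2) x] U(3) by (simp only: power_Suc mult.commute)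
    ultimately have "?S \<in> ?out" using R(1)[OF U(1,2) x] by (simp only: mem_Collect_eq simp_thms)
    moreover have "x \<in> {v \<in> ?S. \<phi> v = \<one>}" using R(4)[OF U(1,2) x] x(2) by (simp only: mem_Collect_eq simp_thms)
    ultimately show "?up z \<in> ?L" unfolding z case_prod_conv by (rule SigmaI)
   qed
  qed
  then have "card ?L = card ?R" by (rule bij_betw_same_card)
  moreover have "card ?L = card ?out * ?q ^ a'"
  proof -
   have "card ?L = (\<Sum>W\<in>?out. card {v \<in> W. \<phi> v = \<one>})"
    using fins(2) finite_V by (intro card_SigmaI) (auto simp: subspace_iff intro: finite_subset)
   also have "\<dots> = (\<Sum>W\<in>?out. ?q ^ a')" by (intro sum.cong refl Wfib) auto
   finally show ?thesis by simp
  qed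
  moreover have "card ?R = gauss_binomial ?q a' b * ?q ^ b"
   using IH[of a'] fib[of \<one>] by (simp add: card_cartesian_product)
  \<comment> \<open>The pairs counted in two ways: every W outside H has q^(a') vectors with \<phi>
    = 1, and V has q^b of them.\<close>
  ultimately have e: "card ?out * ?q ^ a' = gauss_binomial ?q a' b * ?q ^ b" by simp
  have "card ?out = ?q ^ (b - a') * gauss_binomial ?q a' b"
  proof (cases "a' \<le> b")
   case True
   then have "?q ^ b = ?q ^ (b - a') * ?q ^ a'" by (simp flip: power_add)
   then have "card ?out * ?q ^ a' = (?q ^ (b - a') * gauss_binomial ?q a' b) * ?q ^ a'" using e by (simp add: mult_ac)
   moreover have "?q ^ a' > 0" using q_gt_1 prime_gt_0_nat[OF p] by simp
   ultimately show ?thesis using prime_gt_0_nat[OF p] by simp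
  next
   \<comment> \<open>Here the truncated subtraction gives no meaningful exponent, but the Gaussian
     binomial is zero, so no W lies outside H.\<close>
   case False
   then show ?thesis using e q_gt_1 prime_gt_0_nat[OF p] by (simp add: gauss_binomial_eq_0)
  qed
  then show ?thesis using sum Suc by simp
 qed
qed

context finite_space
begin

lemma card_Gr: "card (Gr K m V) = gauss_binomial (p ^ r) m V.dim"
 unfolding Gr_eq by (rule card_subspaces[OF finite_space_axioms card_V])

text \<open>These are the m-dimensional subspaces of the hyperplane ker \<phi>. The nonzero value of
  \<phi> excludes dimension 0, so the subtraction does not truncate.\<close>

lemma card_Gr_kernel:
 assumes \<phi>: "\<phi> \<in> carrier VD" and x: "x \<in> carrier V" "\<phi> x \<noteq> \<zero>"
 shows "card {W \<in> Gr K m V. \<forall>w\<in>W. \<phi> w = \<zero>} = gauss_binomial (p ^ r) m (V.dim - 1)"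
proof -
 let ?H = "{v \<in> carrier V. \<phi> v = \<zero>}"
 have H: "VectorSpace.subspace K ?H V" by (rule kernel_subspace[OF \<phi>])
 have "card ?H * p ^ r = (p ^ r) ^ V.dim" using fiber_card[OF \<phi> x, of \<zero>] by (simp add: card_V)
 moreover have "V.dim \<noteq> 0"
 proof
  assume "V.dim = 0"
  then have "card (carrier V) = 1" by (simp add: card_V)
  then obtain y where "carrier V = {y}" by (rule card_1_singletonE)
  then have "x = \<zero>\<^bsub>V\<^esub>" using x(1) V.M.zero_closed by simp
  then show False using x dual_zero[OF \<phi>] by simp
 qed
 then have "(p ^ r) ^ V.dim = (p ^ r) ^ (V.dim - 1) * p ^ r" by (metis Suc_pred' mult.commute neq0_conv power_Suc)
 ultimately have cH: "card ?H = (p ^ r) ^ (V.dim - 1)" using q_gt_1 prime_gt_0_nat[OF p] by simp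
 have "{W \<in> Gr K m V. \<forall>w\<in>W. \<phi> w = \<zero>} = {W. VectorSpace.subspace K W (V\<lparr>carrier := ?H\<rparr>) \<and> card W = (p ^ r) ^ m}"
  unfolding Gr_eq subspace_trans[OF H] by (auto simp: subspace_iff)
 then show ?thesis using card_subspaces[OF subspace_finite_space[OF H], of "V.dim - 1" m] cH by simp
qed

end

lemma (in finite_witt) card_Gr_std: "card (Gr_std K a b) = gauss_binomial (p ^ r) a b"
proof -
 have "vectorspace K (func_space {..<b})"
  using func_space_is_module field_K by (simp add: vectorspace_def)
 then have fs: "finite_space K p r (func_space {..<b})"
  by (intro finite_space.intro finite_space_axioms.intro finite_witt_axioms) (auto simp: func_space_def finite_K intro!: finite_PiE)
 have "card (carrier (func_space {..<b})) = (p ^ r) ^ b" by (simp add: func_space_def card_PiE card_K)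
 then show ?thesis
  using finite_space.card_Gr[OF fs, of a] finite_space.dim_eq_iff[OF fs, of b] by (simp add: Gr_std_def)
qed

section \<open>Small Omega powers\<close>

lemma (in plain_cring) bilinear_power_coeff_eqI:
 fixes c c' :: "nat \<Rightarrow> nat \<Rightarrow> 'a"
 assumes "\<And>i j. i < k \<Longrightarrow> j < l \<Longrightarrow> c i j = c' i j" "\<And>i j. i < k \<Longrightarrow> j < l \<Longrightarrow> c' i j \<in> carrier R"
  "\<And>i. i < k \<Longrightarrow> a i = a' i" "\<And>j. j < l \<Longrightarrow> b j = b' j"
 shows "bilinear_power_coeff R c k l N a b = bilinear_power_coeff R c' k l N a' b'"
proof -
 interpret U: mvpolys R "UNIV :: (nat + nat) set" by unfold_locales
 have mc: "mono R x \<mu> \<in> carrier U.P" if "x \<in> carrier R" for x and \<mu> :: "(nat + nat) multiset" using that by (intro U.mono_closed) auto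
 have "(\<Oplus>\<^bsub>U.P\<^esub>i\<in>{..<k}. \<Oplus>\<^bsub>U.P\<^esub>j\<in>{..<l}. mono R (c i j) {#Inl i, Inr j#}) = (\<Oplus>\<^bsub>U.P\<^esub>i\<in>{..<k}. \<Oplus>\<^bsub>U.P\<^esub>j\<in>{..<l}. mono R (c' i j) {#Inl i, Inr j#})"
  using assms(1,2) mc by (intro U.P.finsum_cong' refl) (auto intro!: U.P.finsum_closed)
 moreover have "(\<Sum>i<k. replicate_mset (a i) (Inl i :: nat + nat)) = (\<Sum>i<k. replicate_mset (a' i) (Inl i))"
  "(\<Sum>j<l. replicate_mset (b j) (Inr j :: nat + nat)) = (\<Sum>j<l. replicate_mset (b' j) (Inr j))"
  using assms(3,4) by (auto intro!: sum.cong)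
 ultimately show ?thesis by (simp add: bilinear_power_coeff_def)
qed

lemma (in plain_cring) bilinear_power_coeff_single:
 assumes c: "c \<in> carrier R"
 shows "bilinear_power_coeff R (\<lambda>i j. c) (Suc 0) (Suc 0) N (\<lambda>i. N) (\<lambda>j. N) = c [^] N"
proof -
 interpret U: mvpolys R "UNIV :: (nat + nat) set" by unfold_locales
 have mc: "mono R x \<mu> \<in> carrier U.P" if "x \<in> carrier R" for x and \<mu> :: "(nat + nat) multiset" using that by (intro U.mono_closed) auto
 have pw: "mono R c {#Inl 0, Inr 0#} [^]\<^bsub>U.P\<^esub> M = mono R (c [^] M) (replicate_mset M (Inl 0) + replicate_mset M (Inr (0::nat) :: nat + nat))" for M :: nat
 proof (induction M)
  case 0
  show ?case by (simp add: U.one_eq_mono)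
 next
  case (Suc M)
  then show ?case using c by (simp add: U.mono_mult add_mset_commute)
 qed
 have "bilinear_power_coeff R (\<lambda>i j. c) (Suc 0) (Suc 0) N (\<lambda>i. N) (\<lambda>j. N) =
   (mono R c {#Inl 0, Inr 0#} [^]\<^bsub>U.P\<^esub> N) (replicate_mset N (Inl 0) + replicate_mset N (Inr (0::nat) :: nat + nat))"
  using mc[OF c] by (simp add: bilinear_power_coeff_def lessThan_Suc)
 then show ?thesis unfolding pw by (simp add: mono_def)
qed

context finite_space
begin

lemma Delta_bilinear:
 assumes "x \<in> carrier (Gm n)" "y \<in> carrier (GmD n)"
 shows "Dl n x y \<in> carrier (A (Suc n))"
  and "x' \<in> carrier (Gm n) \<Longrightarrow> Dl n (x \<oplus>\<^bsub>Gm n\<^esub> x') y = Dl n x y \<oplus>\<^bsub>A (Suc n)\<^esub> Dl n x' y"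
  and "a \<in> carrier (A (Suc n)) \<Longrightarrow> Dl n (a \<odot>\<^bsub>Gm n\<^esub> x) y = a \<otimes>\<^bsub>A (Suc n)\<^esub> Dl n x y"
  and "y' \<in> carrier (GmD n) \<Longrightarrow> Dl n x (y \<oplus>\<^bsub>GmD n\<^esub> y') = Dl n x y \<oplus>\<^bsub>A (Suc n)\<^esub> Dl n x y'"
  and "a \<in> carrier (A (Suc n)) \<Longrightarrow> Dl n x (a \<odot>\<^bsub>GmD n\<^esub> y) = a \<otimes>\<^bsub>A (Suc n)\<^esub> Dl n x y"
  and "Dl n \<zero>\<^bsub>Gm n\<^esub> y = \<zero>\<^bsub>A (Suc n)\<^esub>"
  and "Dl n x \<zero>\<^bsub>GmD n\<^esub> = \<zero>\<^bsub>A (Suc n)\<^esub>"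
proof -
 interpret VD: finite_space K p r VD by (rule finite_space_dual)
 interpret A: cring "A (Suc n)" by (rule cring_A)
 interpret G: Module.module "A (Suc n)" "Gm n" by (rule Gamma_module)
 interpret GD: Module.module "A (Suc n)" "GmD n" by (rule VD.Gamma_module)
 have l: "Dl n x \<in> lin_maps (A (Suc n)) (GmD n) (self_module (A (Suc n)))"
  and r: "(\<lambda>x. Dl n x y) \<in> lin_maps (A (Suc n)) (Gm n) (self_module (A (Suc n)))"
  using Delta_spec(1)[of n] assms by (simp_all add: bilinear_pairing_def)
 show c: "Dl n x y \<in> carrier (A (Suc n))"
  using LinearCombinations.module_hom_closed[OF l] assms by (auto simp: self_module_simps)
 show "x' \<in> carrier (Gm n) \<Longrightarrow> Dl n (x \<oplus>\<^bsub>Gm n\<^esub> x') y = Dl n x y \<oplus>\<^bsub>A (Suc n)\<^esub> Dl n x' y"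
  using LinearCombinations.module_hom_add[OF r assms(1), of x'] by (simp add: self_module_simps)
 show ls: "a \<in> carrier (A (Suc n)) \<Longrightarrow> Dl n (a \<odot>\<^bsub>Gm n\<^esub> x) y = a \<otimes>\<^bsub>A (Suc n)\<^esub> Dl n x y" for a
  using LinearCombinations.module_hom_smult[OF r _ assms(1), of a] by (simp add: self_module_simps)
 show "y' \<in> carrier (GmD n) \<Longrightarrow> Dl n x (y \<oplus>\<^bsub>GmD n\<^esub> y') = Dl n x y \<oplus>\<^bsub>A (Suc n)\<^esub> Dl n x y'"
  using LinearCombinations.module_hom_add[OF l assms(2), of y'] by (simp add: self_module_simps)
 show rs: "a \<in> carrier (A (Suc n)) \<Longrightarrow> Dl n x (a \<odot>\<^bsub>GmD n\<^esub> y) = a \<otimes>\<^bsub>A (Suc n)\<^esub> Dl n x y" for a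
  using LinearCombinations.module_hom_smult[OF l _ assms(2), of a] by (simp add: self_module_simps)
 show "Dl n \<zero>\<^bsub>Gm n\<^esub> y = \<zero>\<^bsub>A (Suc n)\<^esub>"
  using ls[OF A.zero_closed] c assms by simp
 show "Dl n x \<zero>\<^bsub>GmD n\<^esub> = \<zero>\<^bsub>A (Suc n)\<^esub>"
  using rs[OF A.zero_closed] c assms by simp
qed

lemma Gamma_induct:
 assumes "x \<in> carrier (Gm n)" and "\<And>xs. xs \<in> dp_lists (carrier V) (p ^ n) \<Longrightarrow> S (gmon n xs)"
  and "S \<zero>\<^bsub>Gm n\<^esub>"
  and "\<And>x y. x \<in> carrier (Gm n) \<Longrightarrow> y \<in> carrier (Gm n) \<Longrightarrow> S x \<Longrightarrow> S y \<Longrightarrow> S (x \<oplus>\<^bsub>Gm n\<^esub> y)"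
  and "\<And>a x. a \<in> carrier (A (Suc n)) \<Longrightarrow> x \<in> carrier (Gm n) \<Longrightarrow> S x \<Longrightarrow> S (a \<odot>\<^bsub>Gm n\<^esub> x)"
 shows "S x"
proof -
 interpret G: Module.module "A (Suc n)" "Gm n" by (rule Gamma_module)
 show ?thesis
 proof (rule G.span_induct[OF Gamma_monos])
  show "x \<in> G.span (gmon n ` dp_lists (carrier V) (p ^ n))" using assms(1) Gamma_span by simp
  show "S s" if "s \<in> gmon n ` dp_lists (carrier V) (p ^ n)" for s
   using that by (elim imageE) (simp add: assms(2))
 qed (use assms(3-5) in simp_all)
qed

lemma Gamma_mono_closed: "xs \<in> dp_lists (carrier V) (p ^ n) \<Longrightarrow> gmon n xs \<in> carrier (Gm n)"
 using Gamma_monos by blast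

lemma tau_swap:
 assumes xs: "set xs \<subseteq> carrier V \<times> UNIV" and ys: "set ys \<subseteq> carrier VD \<times> UNIV"
 shows "finite_space.tau K p n ys (map (apfst ev) xs) = tau n xs ys"
proof -
 interpret VD: finite_space K p r VD by (rule finite_space_dual)
 interpret A: plain_cring "A (Suc n)" by (rule plain_cring.intro, rule cring_A)
 have c: "witt_lift p K (Suc n) (fst (ys ! j) (fst (xs ! i))) \<in> carrier (A (Suc n))" if "i < length xs" "j < length ys" for i j
  using nth_fst[OF xs that(1)] nth_fst[OF ys that(2)] by (intro lift_residue dual_closed)
 have "tau n xs ys = bilinear_power_coeff (A (Suc n)) (\<lambda>j i. witt_lift p K (Suc n) (fst (ys ! j) (fst (xs ! i)))) (length ys) (length xs) (p ^ n) (\<lambda>j. snd (ys ! j)) (\<lambda>i. snd (xs ! i))"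
  unfolding tau_def by (rule A.bilinear_power_coeff_swap) (rule c)
 also have "\<dots> = VD.tau n ys (map (apfst ev) xs)"
  unfolding VD.tau_def length_map
  by (rule A.bilinear_power_coeff_eqI[symmetric]) (use nth_fst[OF ys] c in simp_all)
 finally show ?thesis by simp
qed

lemma map_ev_lists: "xs \<in> dp_lists (carrier V) j \<Longrightarrow> map (apfst ev) xs \<in> dp_lists (carrier VDD) j"
 using ev_closed by (auto simp: dp_lists_def o_def)

text \<open>Under evaluation V -> V**, the pairing for the dual space is the pairing for V with its
  arguments exchanged, because the bilinear forms behind \<open>tau\<close> have the same values
  \<phi>(v).\<close>

lemma Delta_swap:
 assumes y: "y \<in> carrier (GmD n)" and xs: "xs \<in> dp_lists (carrier V) (p ^ n)"
 shows "Delta p K n VD y (Gamma_monomial p K n VDD (map (apfst ev) xs)) = Dl n (gmon n xs) y"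
proof -
 interpret VD: finite_space K p r VD by (rule finite_space_dual)
 interpret VDD: finite_space K p r VDD by (rule VD.finite_space_dual)
 note m = Gamma_mono_closed[OF xs] and mm = VDD.Gamma_mono_closed[OF map_ev_lists[OF xs]]
 show ?thesis
 proof (rule VD.Gamma_induct[OF y])
  fix ys assume ys: "ys \<in> dp_lists (carrier VD) (p ^ n)"
  show "Delta p K n VD (gmonD n ys) (Gamma_monomial p K n VDD (map (apfst ev) xs)) = Dl n (gmon n xs) (gmonD n ys)"
   unfolding VD.Delta_spec(2)[OF ys map_ev_lists[OF xs]] Delta_spec(2)[OF xs ys]
   by (rule tau_swap) (use xs ys in \<open>simp_all add: dp_lists_def\<close>)
 next
  show "Delta p K n VD \<zero>\<^bsub>GmD n\<^esub> (Gamma_monomial p K n VDD (map (apfst ev) xs)) = Dl n (gmon n xs) \<zero>\<^bsub>GmD n\<^esub>"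
   using VD.Delta_bilinear(6)[OF y mm] Delta_bilinear(7)[OF m y] by simp
 next
  fix u v assume "u \<in> carrier (GmD n)" "v \<in> carrier (GmD n)"
   "Delta p K n VD u (Gamma_monomial p K n VDD (map (apfst ev) xs)) = Dl n (gmon n xs) u"
   "Delta p K n VD v (Gamma_monomial p K n VDD (map (apfst ev) xs)) = Dl n (gmon n xs) v"
  then show "Delta p K n VD (u \<oplus>\<^bsub>GmD n\<^esub> v) (Gamma_monomial p K n VDD (map (apfst ev) xs)) = Dl n (gmon n xs) (u \<oplus>\<^bsub>GmD n\<^esub> v)"
   using VD.Delta_bilinear(2)[OF _ mm] Delta_bilinear(4)[OF m] by simp
 next
  fix a u assume "a \<in> carrier (A (Suc n))" "u \<in> carrier (GmD n)"
   "Delta p K n VD u (Gamma_monomial p K n VDD (map (apfst ev) xs)) = Dl n (gmon n xs) u"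
  then show "Delta p K n VD (a \<odot>\<^bsub>GmD n\<^esub> u) (Gamma_monomial p K n VDD (map (apfst ev) xs)) = Dl n (gmon n xs) (a \<odot>\<^bsub>GmD n\<^esub> u)"
   using VD.Delta_bilinear(3)[OF _ mm] Delta_bilinear(5)[OF m] by simp
 qed
qed

lemma in_ker_iff: "x \<in> Delta_ker p K n V \<longleftrightarrow> x \<in> carrier (Gm n) \<and>
  (\<forall>y\<in>carrier (Gamma p K n VD). Dl n x y = \<zero>\<^bsub>A (Suc n)\<^esub>)"
 by (simp add: Delta_ker_def)

text \<open>The kernel for the dual space is formed with the bidual. Evaluation takes monomials over
  V to monomials over the bidual, so an element of that kernel also pairs to zero with everything
  over V, and the pairing descends to classes on both sides.\<close>

lemma ker_bidual:
 assumes y: "y \<in> Delta_ker p K n VD" and x: "x \<in> carrier (Gm n)"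
 shows "Dl n x y = \<zero>\<^bsub>A (Suc n)\<^esub>"
proof -
 interpret VD: finite_space K p r VD by (rule finite_space_dual)
 interpret VDD: finite_space K p r VDD by (rule VD.finite_space_dual)
 interpret A: cring "A (Suc n)" by (rule cring_A)
 have yG: "y \<in> carrier (GmD n)" and y0: "\<And>z. z \<in> carrier (Gamma p K n VDD) \<Longrightarrow> Delta p K n VD y z = \<zero>\<^bsub>A (Suc n)\<^esub>"
  using y by (auto simp: VD.in_ker_iff)
 show ?thesis
 proof (rule Gamma_induct[OF x])
  fix xs assume xs: "xs \<in> dp_lists (carrier V) (p ^ n)"
  show "Dl n (gmon n xs) y = \<zero>\<^bsub>A (Suc n)\<^esub>"
   unfolding Delta_swap[OF yG xs, symmetric] by (rule y0[OF VDD.Gamma_mono_closed[OF map_ev_lists[OF xs]]])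
 next
  show "Dl n \<zero>\<^bsub>Gm n\<^esub> y = \<zero>\<^bsub>A (Suc n)\<^esub>" by (rule Delta_bilinear(6)[OF x yG])
 qed (simp_all add: Delta_bilinear(2)[OF _ yG] Delta_bilinear(3)[OF _ yG])
qed

definition qt :: "nat \<Rightarrow> ('k, 'v) dp_elem \<Rightarrow> ('k, 'v) omega_elem" where
 "qt n x = Delta_ker p K n V +>\<^bsub>Gm n\<^esub> x"

lemma ker_submodule: "submodule (A (Suc n)) (Delta_ker p K n V) (Gm n)"
proof -
 interpret VD: finite_space K p r VD by (rule finite_space_dual)
 interpret G: Module.module "A (Suc n)" "Gm n" by (rule Gamma_module)
 interpret A: cring "A (Suc n)" by (rule cring_A)
 show ?thesis
 proof (rule submodule.intro[OF Gamma_module])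
  show "Delta_ker p K n V \<subseteq> carrier (Gm n)" by (auto simp: in_ker_iff)
  show "\<zero>\<^bsub>Gm n\<^esub> \<in> Delta_ker p K n V"
   unfolding in_ker_iff using Delta_bilinear(6)[OF G.M.zero_closed] by blast
 qed (auto simp: in_ker_iff Delta_bilinear(2,3))
qed

lemma plain_module_Gamma: "plain_module (A (Suc n)) (Gm n)"
 by (rule plain_module.intro[OF Gamma_module])

lemmas qt_basics = plain_module.quot_module_basics[OF plain_module_Gamma ker_submodule, folded qt_def Omega_full_def]

lemma Omega_full_module: "Module.module (A (Suc n)) (Omega_full p K n V)"
 unfolding Omega_full_def by (rule plain_module.module_quot_module[OF plain_module_Gamma ker_submodule])

lemma minus_zero_iff:
 assumes "a \<in> carrier (A j)" "b \<in> carrier (A j)" "c \<in> carrier (A j)" "c \<oplus>\<^bsub>A j\<^esub> b = a"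
 shows "c = \<zero>\<^bsub>A j\<^esub> \<longleftrightarrow> a = b"
proof -
 interpret A: cring "A j" by (rule cring_A)
 have "c = a \<ominus>\<^bsub>A j\<^esub> b" using assms(1-3) unfolding assms(4)[symmetric] by (simp add: A.minus_eq A.a_assoc A.r_neg)
 then show ?thesis using A.r_right_minus_eq[OF assms(1,2)] by simp
qed

lemma qt_eq_iff:
 assumes "x \<in> carrier (Gm n)" "x' \<in> carrier (Gm n)"
 shows "qt n x = qt n x' \<longleftrightarrow> (\<forall>y\<in>carrier (Gamma p K n VD). Dl n x y = Dl n x' y)"
proof -
 interpret G: Module.module "A (Suc n)" "Gm n" by (rule Gamma_module)
 have d: "x \<ominus>\<^bsub>Gm n\<^esub> x' \<in> carrier (Gm n)" using assms by simp
 have s: "(x \<ominus>\<^bsub>Gm n\<^esub> x') \<oplus>\<^bsub>Gm n\<^esub> x' = x" using assms by (simp add: G.M.minus_eq G.M.a_assoc G.M.l_neg)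
 have "Dl n (x \<ominus>\<^bsub>Gm n\<^esub> x') y = \<zero>\<^bsub>A (Suc n)\<^esub> \<longleftrightarrow> Dl n x y = Dl n x' y"
  if y: "y \<in> carrier (GmD n)" for y
  using minus_zero_iff[OF Delta_bilinear(1)[OF assms(1) y] Delta_bilinear(1)[OF assms(2) y] Delta_bilinear(1)[OF d y]]
   Delta_bilinear(2)[OF d y assms(2)] s by simp
 then show ?thesis using qt_basics(5)[OF assms] d by (simp add: in_ker_iff)
qed

lemma qt_dual_eq:
 assumes y: "y \<in> carrier (GmD n)" "y' \<in> carrier (GmD n)" "finite_space.qt K p VD n y = finite_space.qt K p VD n y'"
  and x: "x \<in> carrier (Gm n)"
 shows "Dl n x y = Dl n x y'"
proof -
 interpret VD: finite_space K p r VD by (rule finite_space_dual)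
 interpret G: Module.module "A (Suc n)" "GmD n" by (rule VD.Gamma_module)
 have d: "y \<ominus>\<^bsub>GmD n\<^esub> y' \<in> carrier (GmD n)" using y by simp
 have s: "(y \<ominus>\<^bsub>GmD n\<^esub> y') \<oplus>\<^bsub>GmD n\<^esub> y' = y" using y by (simp add: G.M.minus_eq G.M.a_assoc G.M.l_neg)
 have "Dl n x (y \<ominus>\<^bsub>GmD n\<^esub> y') = \<zero>\<^bsub>A (Suc n)\<^esub>"
  using VD.qt_basics(5)[OF y(1,2)] y(3) by (intro ker_bidual x) simp
 then show ?thesis
  using minus_zero_iff[OF Delta_bilinear(1)[OF x y(1)] Delta_bilinear(1)[OF x y(2)] Delta_bilinear(1)[OF x d]]
   Delta_bilinear(4)[OF x d y(2)] s by simp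
qed

lemma pairing_qt:
 assumes x: "x \<in> carrier (Gm n)" and y: "y \<in> carrier (GmD n)"
 shows "omega_pairing p K n V (qt n x) (finite_space.qt K p VD n y) = Dl n x y"
proof -
 interpret VD: finite_space K p r VD by (rule finite_space_dual)
 show ?thesis
  unfolding omega_pairing_def
 proof (rule the_equality)
  have "x \<in> qt n x" "y \<in> VD.qt n y" using qt_basics(6)[OF x] VD.qt_basics(6)[OF y] x y by simp_all
  then show "\<exists>x'\<in>qt n x. \<exists>y'\<in>VD.qt n y. Dl n x y = Dl n x' y'" by blast
  fix c assume "\<exists>x'\<in>qt n x. \<exists>y'\<in>VD.qt n y. c = Dl n x' y'"
  then obtain x' y' where xy: "x' \<in> qt n x" "y' \<in> VD.qt n y" "c = Dl n x' y'" by blast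
  have x': "x' \<in> carrier (Gm n)" "qt n x' = qt n x" using xy(1) qt_basics(6)[OF x] by simp_all
  have y': "y' \<in> carrier (GmD n)" "VD.qt n y' = VD.qt n y" using xy(2) VD.qt_basics(6)[OF y] by simp_all
  show "c = Dl n x y"
   using xy(3) qt_eq_iff[OF x'(1) x] x'(2) y'(1) qt_dual_eq[OF y'(1) y y'(2) x] by simp
 qed
qed

section \<open>The small Omega power as a module and its pairing\<close>

abbreviation "Om n \<equiv> Omega p K n V"
abbreviation "OmD n \<equiv> Omega p K n VD"
abbreviation "cl n \<equiv> omega_class p K n V"
abbreviation "clD n \<equiv> omega_class p K n VD"
abbreviation "B n \<equiv> omega_pairing p K n V"

lemma single_list: "v \<in> carrier V \<Longrightarrow> [(v, j)] \<in> dp_lists (carrier V) j"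
 by (simp add: dp_lists_def)

lemma cl_eq: "v \<in> carrier V \<Longrightarrow> cl n v = qt n (gmon n [(v, p ^ n)])"
proof -
 assume v: "v \<in> carrier V"
 interpret D: divided_powers "A (Suc n)" VA by (rule divided_powers_V)
 have "dp_monomial (A (Suc n)) VA [(v, p ^ n)] = dp_sym (A (Suc n)) VA v (p ^ n)"
  using v by (subst D.dp_monomial_eq) (auto simp: VA_simps D.dp_sym_eq)
 then show ?thesis by (simp add: omega_class_def qt_def Gamma_monomial_def)
qed

lemma cl_full: "cl n ` carrier V \<subseteq> carrier (Omega_full p K n V)"
 using qt_basics(1) Gamma_mono_closed[OF single_list] by (auto simp: cl_eq)

lemma Om_simps: "carrier (Om n) = LinearCombinations.module.span (A (Suc n)) (Omega_full p K n V) (cl n ` carrier V)"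
 "add (Om n) = add (Omega_full p K n V)" "\<zero>\<^bsub>Om n\<^esub> = \<zero>\<^bsub>Omega_full p K n V\<^esub>"
 "a \<odot>\<^bsub>Om n\<^esub> x = pr (Suc n) a \<odot>\<^bsub>Omega_full p K n V\<^esub> x"
 by (simp_all add: Omega_def res_scalars_def)

lemma Om_submodule: "submodule (A (Suc n)) (carrier (Om n)) (Omega_full p K n V)"
 using LinearCombinations.module.span_is_submodule[OF Omega_full_module cl_full] by (simp add: Om_simps)

lemma Om_module: "Module.module W (Om n)"
proof -
 have "Module.module (A (Suc n)) ((Omega_full p K n V)\<lparr>carrier := carrier (Om n)\<rparr>)"
  by (rule LinearCombinations.module.submodule_is_module[OF Omega_full_module Om_submodule])
 from module_restrict_scalars[OF this W.is_cring ring_hom_pr] show ?thesis by (simp add: Om_simps) (simp add: Omega_def)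
qed

lemma Om_full: "Z \<in> carrier (Om n) \<Longrightarrow> Z \<in> carrier (Omega_full p K n V)"
 using submodule.subset[OF Om_submodule] by blast

lemma cl_closed: "v \<in> carrier V \<Longrightarrow> cl n v \<in> carrier (Om n)"
 using LinearCombinations.module.in_own_span[OF Omega_full_module cl_full] by (auto simp: Om_simps)

lemma Om_induct:
 assumes Z: "Z \<in> carrier (Om n)" and "\<And>v. v \<in> carrier V \<Longrightarrow> S (cl n v)" and "S \<zero>\<^bsub>Om n\<^esub>"
  and "\<And>x y. x \<in> carrier (Om n) \<Longrightarrow> y \<in> carrier (Om n) \<Longrightarrow> S x \<Longrightarrow> S y \<Longrightarrow> S (x \<oplus>\<^bsub>Om n\<^esub> y)"
  and "\<And>a x. a \<in> carrier W \<Longrightarrow> x \<in> carrier (Om n) \<Longrightarrow> S x \<Longrightarrow> S (a \<odot>\<^bsub>Om n\<^esub> x)"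
 shows "S Z"
proof -
 interpret F: Module.module "A (Suc n)" "Omega_full p K n V" by (rule Omega_full_module)
 interpret s: submodule "A (Suc n)" "carrier (Om n)" "Omega_full p K n V" by (rule Om_submodule)
 have "Z \<in> carrier (Om n) \<and> S Z"
 proof (rule F.span_induct[OF cl_full])
  show "Z \<in> F.span (cl n ` carrier V)" using Z by (simp add: Om_simps)
  show "s \<in> carrier (Om n) \<and> S s" if "s \<in> cl n ` carrier V" for s
   using that cl_closed assms(2) by auto
  show "\<zero>\<^bsub>Omega_full p K n V\<^esub> \<in> carrier (Om n) \<and> S \<zero>\<^bsub>Omega_full p K n V\<^esub>"
   using assms(3) s.zero_closed by (simp add: Om_simps(3))
  show "x \<oplus>\<^bsub>Omega_full p K n V\<^esub> y \<in> carrier (Om n) \<and> S (x \<oplus>\<^bsub>Omega_full p K n V\<^esub> y)"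
   if "x \<in> carrier (Om n) \<and> S x" "y \<in> carrier (Om n) \<and> S y" for x y
   using assms(4)[of x y] s.m_closed that by (simp add: Om_simps(2))
  show "a \<odot>\<^bsub>Omega_full p K n V\<^esub> x \<in> carrier (Om n) \<and> S (a \<odot>\<^bsub>Omega_full p K n V\<^esub> x)"
   if a: "a \<in> carrier (A (Suc n))" and "x \<in> carrier (Om n) \<and> S x" for a x
  proof -
   obtain b where "b \<in> carrier W" "a = pr (Suc n) b" using a by (auto simp: carrier_A)
   then show ?thesis using assms(5)[of b x] s.smult_closed a that(2) by (simp add: Om_simps(4))
  qed
 qed
 then show ?thesis ..
qed

lemma full_cases:
 assumes "Z \<in> carrier (Omega_full p K n V)"
 obtains x where "x \<in> carrier (Gm n)" "Z = qt n x"
 using assms unfolding qt_basics(1) by (elim imageE) (rule that)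

text \<open>The second argument may be any class of the full quotient and not only of the small
  Omega power, because nondegeneracy will be tested against the classes of arbitrary
  monomials.\<close>

lemma B_left:
 assumes Z: "Z \<in> carrier (Om n)" and Y: "Y \<in> carrier (Omega_full p K n VD)"
 shows "B n Z Y \<in> carrier (A (Suc n))"
  and "Z' \<in> carrier (Om n) \<Longrightarrow> B n (Z \<oplus>\<^bsub>Om n\<^esub> Z') Y = B n Z Y \<oplus>\<^bsub>A (Suc n)\<^esub> B n Z' Y"
  and "a \<in> carrier W \<Longrightarrow> B n (a \<odot>\<^bsub>Om n\<^esub> Z) Y = pr (Suc n) a \<otimes>\<^bsub>A (Suc n)\<^esub> B n Z Y"
  and "B n \<zero>\<^bsub>Om n\<^esub> Y = \<zero>\<^bsub>A (Suc n)\<^esub>"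
proof -
 interpret VD: finite_space K p r VD by (rule finite_space_dual)
 interpret pr: ring_hom_cring W "A (Suc n)" "pr (Suc n)" by (rule pr_hom)
 interpret G: Module.module "A (Suc n)" "Gm n" by (rule Gamma_module)
 obtain x where x: "x \<in> carrier (Gm n)" "Z = qt n x" by (rule full_cases[OF Om_full[OF Z]])
 obtain y where y: "y \<in> carrier (GmD n)" "Y = VD.qt n y" by (rule VD.full_cases[OF Y])
 show "B n Z Y \<in> carrier (A (Suc n))" using x y by (simp add: pairing_qt Delta_bilinear(1))
 show "B n (Z \<oplus>\<^bsub>Om n\<^esub> Z') Y = B n Z Y \<oplus>\<^bsub>A (Suc n)\<^esub> B n Z' Y" if Z': "Z' \<in> carrier (Om n)"
 proof -
  obtain x' where x': "x' \<in> carrier (Gm n)" "Z' = qt n x'" by (rule full_cases[OF Om_full[OF Z']])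
  show ?thesis using x x' y by (simp add: Om_simps(2) qt_basics(2) pairing_qt Delta_bilinear(2))
 qed
 show "a \<in> carrier W \<Longrightarrow> B n (a \<odot>\<^bsub>Om n\<^esub> Z) Y = pr (Suc n) a \<otimes>\<^bsub>A (Suc n)\<^esub> B n Z Y"
  using x y by (simp add: Om_simps(4) qt_basics(4) pairing_qt Delta_bilinear(3))
 show "B n \<zero>\<^bsub>Om n\<^esub> Y = \<zero>\<^bsub>A (Suc n)\<^esub>"
  using x y by (simp add: Om_simps(3) qt_basics(3) pairing_qt Delta_bilinear(6)[OF x(1)])
qed

lemma B_right:
 assumes Z: "Z \<in> carrier (Om n)" and Y: "Y \<in> carrier (OmD n)"
 shows "B n Z Y \<in> carrier (A (Suc n))"
  and "Y' \<in> carrier (OmD n) \<Longrightarrow> B n Z (Y \<oplus>\<^bsub>OmD n\<^esub> Y') = B n Z Y \<oplus>\<^bsub>A (Suc n)\<^esub> B n Z Y'"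
  and "a \<in> carrier W \<Longrightarrow> B n Z (a \<odot>\<^bsub>OmD n\<^esub> Y) = pr (Suc n) a \<otimes>\<^bsub>A (Suc n)\<^esub> B n Z Y"
  and "B n Z \<zero>\<^bsub>OmD n\<^esub> = \<zero>\<^bsub>A (Suc n)\<^esub>"
proof -
 interpret VD: finite_space K p r VD by (rule finite_space_dual)
 interpret pr: ring_hom_cring W "A (Suc n)" "pr (Suc n)" by (rule pr_hom)
 interpret GD: Module.module "A (Suc n)" "GmD n" by (rule VD.Gamma_module)
 obtain x where x: "x \<in> carrier (Gm n)" "Z = qt n x" by (rule full_cases[OF Om_full[OF Z]])
 obtain y where y: "y \<in> carrier (GmD n)" "Y = VD.qt n y" by (rule VD.full_cases[OF VD.Om_full[OF Y]])
 show "B n Z Y \<in> carrier (A (Suc n))" using x y by (simp add: pairing_qt Delta_bilinear(1))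
 show "B n Z (Y \<oplus>\<^bsub>OmD n\<^esub> Y') = B n Z Y \<oplus>\<^bsub>A (Suc n)\<^esub> B n Z Y'" if Y': "Y' \<in> carrier (OmD n)"
 proof -
  obtain y' where y': "y' \<in> carrier (GmD n)" "Y' = VD.qt n y'" by (rule VD.full_cases[OF VD.Om_full[OF Y']])
  show ?thesis using x y' y by (simp add: VD.Om_simps(2) VD.qt_basics(2) pairing_qt Delta_bilinear(4))
 qed
 show "a \<in> carrier W \<Longrightarrow> B n Z (a \<odot>\<^bsub>OmD n\<^esub> Y) = pr (Suc n) a \<otimes>\<^bsub>A (Suc n)\<^esub> B n Z Y"
  using x y by (simp add: VD.Om_simps(4) VD.qt_basics(4) pairing_qt Delta_bilinear(5))
 show "B n Z \<zero>\<^bsub>OmD n\<^esub> = \<zero>\<^bsub>A (Suc n)\<^esub>"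
  using x y by (simp add: VD.Om_simps(3) VD.qt_basics(3) pairing_qt Delta_bilinear(7)[OF x(1) y(1)])
qed

lemma pr_pow: "a \<in> carrier W \<Longrightarrow> pr j (a [^]\<^bsub>W\<^esub> (m::nat)) = pr j a [^]\<^bsub>A j\<^esub> m"
proof -
 interpret pr: ring_hom_cring W "A j" "pr j" by (rule pr_hom)
 show "a \<in> carrier W \<Longrightarrow> ?thesis" by (induction m) simp_all
qed

lemma lift_power: "c \<in> carrier K \<Longrightarrow> witt_lift p K (Suc n) c [^]\<^bsub>A (Suc n)\<^esub> (p ^ n) = pr (Suc n) (tn n c)"
proof -
 assume c: "c \<in> carrier K"
 obtain a where a: "a \<in> carrier W" "witt_lift p K (Suc n) c = pr (Suc n) a" using lift_residue(1)[OF c] by (auto simp: carrier_A)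
 have "a 0 = c" using lift_residue(2)[OF c, of n] residue_pr[OF a(1), of "Suc n"] a(2) by simp
 then have "pr (Suc n) (a [^]\<^bsub>W\<^esub> (p ^ n)) = pr (Suc n) (teich c [^]\<^bsub>W\<^esub> (p ^ n))"
  using a c by (intro power_cong) simp_all
 then show ?thesis using a by (simp add: pr_pow tn_def)
qed

text \<open>The pairing of two single symbols is the p^n-th power of an arbitrary lift of \<phi>(v),
  which \<open>power_cong\<close> turns into that of the Teichmueller representative.\<close>

lemma B_cl:
 assumes v: "v \<in> carrier V" and \<phi>: "\<phi> \<in> carrier VD"
 shows "B n (cl n v) (clD n \<phi>) = pr (Suc n) (tn n (\<phi> v))"
proof -
 interpret VD: finite_space K p r VD by (rule finite_space_dual)
 interpret A: plain_cring "A (Suc n)" by (rule plain_cring.intro, rule cring_A)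
 have "B n (cl n v) (clD n \<phi>) = tau n [(v, p ^ n)] [(\<phi>, p ^ n)]"
  unfolding cl_eq[OF v] VD.cl_eq[OF \<phi>]
   pairing_qt[OF Gamma_mono_closed[OF single_list[OF v]] VD.Gamma_mono_closed[OF VD.single_list[OF \<phi>]]]
  by (rule Delta_spec(2)[OF single_list[OF v] VD.single_list[OF \<phi>]])
 also have "\<dots> = bilinear_power_coeff (A (Suc n)) (\<lambda>i j. witt_lift p K (Suc n) (\<phi> v)) (Suc 0) (Suc 0) (p ^ n) (\<lambda>i. p ^ n) (\<lambda>j. p ^ n)"
  unfolding tau_def by (simp, rule A.bilinear_power_coeff_eqI) (use v \<phi> in \<open>auto intro: lift_residue\<close>)
 also have "\<dots> = witt_lift p K (Suc n) (\<phi> v) [^]\<^bsub>A (Suc n)\<^esub> (p ^ n)"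
  using v \<phi> by (intro A.bilinear_power_coeff_single lift_residue) simp
 also have "\<dots> = pr (Suc n) (tn n (\<phi> v))" using v \<phi> by (intro lift_power) simp
 finally show ?thesis .
qed

section \<open>Nondegeneracy against classes of forms\<close>

text \<open>Against a fixed monomial in divided powers of forms, the pairing with [v] is a
  coefficient of the p^n-th power of the sum of the T_j [\<phi>_j(v)]. By
  \<open>sp_linear_power\<close> over a polynomial ring, this function of v is a combination of
  pairings with single forms, with coefficients independent of v.\<close>

lemma tau_single:
 assumes ys: "set ys \<subseteq> carrier VD \<times> UNIV"
 shows "\<exists>d\<in>carrier VD \<rightarrow> carrier (A (Suc n)). \<forall>v\<in>carrier V. tau n [(v, p ^ n)] ys =
   (\<Oplus>\<^bsub>A (Suc n)\<^esub>\<psi>\<in>carrier VD. d \<psi> \<otimes>\<^bsub>A (Suc n)\<^esub> pr (Suc n) (tn n (\<psi> v)))"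
proof -
 interpret VD: finite_space K p r VD by (rule finite_space_dual)
 interpret A: plain_cring "A (Suc n)" by (rule plain_cring.intro, rule cring_A)
 let ?P = "mvpoly (A (Suc n)) (UNIV :: (nat + nat) set)"
 let ?m = "mono (A (Suc n)) :: _ \<Rightarrow> (nat + nat) multiset \<Rightarrow> _"
 have cP: "cring ?P" and mc: "\<And>x \<mu>. x \<in> carrier (A (Suc n)) \<Longrightarrow> ?m x \<mu> \<in> carrier ?P"
  and h: "(\<lambda>a. ?m a {#}) \<in> ring_hom (A (Suc n)) ?P"
  and mm: "\<And>x y \<mu> \<nu>. x \<in> carrier (A (Suc n)) \<Longrightarrow> y \<in> carrier (A (Suc n)) \<Longrightarrow> ?m x \<mu> \<otimes>\<^bsub>?P\<^esub> ?m y \<nu> = ?m (x \<otimes>\<^bsub>A (Suc n)\<^esub> y) (\<mu> + \<nu>)"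
  and cf: "\<And>f \<mu>. f \<in> carrier ?P \<Longrightarrow> f \<mu> \<in> carrier (A (Suc n))"
  and cs: "\<And>f \<mu> (I :: ('v \<Rightarrow> 'k) set). f \<in> I \<rightarrow> carrier ?P \<Longrightarrow> (\<Oplus>\<^bsub>?P\<^esub>i\<in>I. f i) \<mu> = (\<Oplus>\<^bsub>A (Suc n)\<^esub>i\<in>I. f i \<mu>)"
  and cm: "\<And>f c \<mu>. f \<in> carrier ?P \<Longrightarrow> c \<in> carrier (A (Suc n)) \<Longrightarrow> (f \<otimes>\<^bsub>?P\<^esub> ?m c {#}) \<mu> = f \<mu> \<otimes>\<^bsub>A (Suc n)\<^esub> c"
 proof -
  interpret U: mvpolys "A (Suc n)" "UNIV :: (nat + nat) set" by unfold_locales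
  show "cring ?P" by (rule U.cring_mvpoly)
  show mc: "\<And>x \<mu>. x \<in> carrier (A (Suc n)) \<Longrightarrow> ?m x \<mu> \<in> carrier ?P" by (intro U.mono_closed) auto
  show "(\<lambda>a. ?m a {#}) \<in> ring_hom (A (Suc n)) ?P"
   by (rule ring_hom_memI) (auto simp: U.mono_mult U.mono_add U.one_eq_mono mc)
  show "\<And>x y \<mu> \<nu>. x \<in> carrier (A (Suc n)) \<Longrightarrow> y \<in> carrier (A (Suc n)) \<Longrightarrow> ?m x \<mu> \<otimes>\<^bsub>?P\<^esub> ?m y \<nu> = ?m (x \<otimes>\<^bsub>A (Suc n)\<^esub> y) (\<mu> + \<nu>)"
   by (intro U.mono_mult) auto
  show "\<And>f \<mu>. f \<in> carrier ?P \<Longrightarrow> f \<mu> \<in> carrier (A (Suc n))" by (rule U.coeff_closed)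
  show "\<And>f \<mu> (I :: ('v \<Rightarrow> 'k) set). f \<in> I \<rightarrow> carrier ?P \<Longrightarrow> (\<Oplus>\<^bsub>?P\<^esub>i\<in>I. f i) \<mu> = (\<Oplus>\<^bsub>A (Suc n)\<^esub>i\<in>I. f i \<mu>)" by (rule U.coeff_finsum)
  show "(f \<otimes>\<^bsub>?P\<^esub> ?m c {#}) \<mu> = f \<mu> \<otimes>\<^bsub>A (Suc n)\<^esub> c" if "f \<in> carrier ?P" "c \<in> carrier (A (Suc n))" for f c \<mu>
   using that mc[OF that(2), of "{#}"] U.coeff_closed[OF that(1)] by (simp add: U.P.m_comm[of f] U.coeff_mono_mult A.m_comm)
 qed
 have hW: "(\<lambda>a. ?m (pr (Suc n) a) {#}) \<in> ring_hom W ?P"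
  using ring_hom_trans[OF ring_hom_pr h] by (simp add: o_def)
 interpret pr: ring_hom_cring W "A (Suc n)" "pr (Suc n)" by (rule pr_hom)
 have wf: "witt_functions K p r ?P (\<lambda>a. ?m (pr (Suc n) a) {#}) (carrier V) (carrier VD)"
 proof (intro witt_functions.intro witt_functions_axioms.intro finite_witt_axioms cP hW finite_dual)
  show "\<psi> v \<in> carrier K" if "\<psi> \<in> carrier VD" "v \<in> carrier V" for \<psi> v using that by simp
  show "\<exists>\<theta>\<in>carrier VD. \<forall>v\<in>carrier V. \<theta> v = \<zero>"
   using VD.V.M.zero_closed by (intro bexI[of _ "\<zero>\<^bsub>VD\<^esub>"]) (simp_all add: dual_simps)
  show "\<exists>\<theta>\<in>carrier VD. \<forall>v\<in>carrier V. \<theta> v = \<chi> v \<oplus> t \<otimes> \<psi> v" if "\<psi> \<in> carrier VD" "\<chi> \<in> carrier VD" "t \<in> carrier K" for \<psi> \<chi> t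
   using that VD.V.M.a_closed[of \<chi> "t \<odot>\<^bsub>VD\<^esub> \<psi>"] VD.V.smult_closed[of t \<psi>]
   by (intro bexI[of _ "\<chi> \<oplus>\<^bsub>VD\<^esub> t \<odot>\<^bsub>VD\<^esub> \<psi>"]) (simp_all add: dual_simps)
 qed
 let ?l = "length ys"
 have ps: "fst (ys ! j) \<in> carrier VD" if "j < ?l" for j using nth_fst[OF ys that] .
 \<comment> \<open>The scalar attached to the j-th form is the monomial S T_j with S =
   \<open>Inl 0\<close>, so that the coefficient at \<open>?\<beta>\<close> is the pairing with the
   monomial of \<open>ys\<close>.\<close>
 have "witt_functions.sp K p ?P (\<lambda>a. ?m (pr (Suc n) a) {#}) (carrier V) (carrier VD) n
   (\<lambda>v. (\<Oplus>\<^bsub>?P\<^esub>j\<in>{..<?l}. ?m \<one>\<^bsub>A (Suc n)\<^esub> {#Inl 0, Inr j#} \<otimes>\<^bsub>?P\<^esub> ?m (pr (Suc n) (teich (fst (ys ! j) v))) {#}) [^]\<^bsub>?P\<^esub> (p ^ n))"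
  by (rule witt_functions.sp_linear_power[OF wf]) (use ps mc in auto)
 then obtain c where c: "c \<in> carrier VD \<rightarrow> carrier ?P" "\<And>v. v \<in> carrier V \<Longrightarrow>
   (\<Oplus>\<^bsub>?P\<^esub>j\<in>{..<?l}. ?m \<one>\<^bsub>A (Suc n)\<^esub> {#Inl 0, Inr j#} \<otimes>\<^bsub>?P\<^esub> ?m (pr (Suc n) (teich (fst (ys ! j) v))) {#}) [^]\<^bsub>?P\<^esub> (p ^ n)
   = (\<Oplus>\<^bsub>?P\<^esub>\<psi>\<in>carrier VD. c \<psi> \<otimes>\<^bsub>?P\<^esub> ?m (pr (Suc n) (tn n (\<psi> v))) {#})"
  unfolding witt_functions.sp_def[OF wf] by blast
 interpret P: cring ?P by (rule cP)
 let ?\<beta> = "replicate_mset (p ^ n) (Inl 0) + (\<Sum>j<?l. replicate_mset (snd (ys ! j)) (Inr j)) :: (nat + nat) multiset"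
 have "tau n [(v, p ^ n)] ys = (\<Oplus>\<^bsub>A (Suc n)\<^esub>\<psi>\<in>carrier VD. c \<psi> ?\<beta> \<otimes>\<^bsub>A (Suc n)\<^esub> pr (Suc n) (tn n (\<psi> v)))" if v: "v \<in> carrier V" for v
 proof -
  have pK: "fst (ys ! j) v \<in> carrier K" if "j < ?l" for j using ps[OF that] v by simp
  \<comment> \<open>Arbitrary lifts are exchanged for Teichmueller representatives at the cost of
    multiples of p, which the p^n-th power does not see.\<close>
  have "\<exists>d\<in>carrier (A (Suc n)). witt_lift p K (Suc n) (fst (ys ! j) v) = pr (Suc n) (teich (fst (ys ! j) v)) \<oplus>\<^bsub>A (Suc n)\<^esub> add_pow (A (Suc n)) p d" if "j < ?l" for j
   using pK[OF that] by (intro residue_eq) (simp_all add: lift_residue residue_pr)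
  then have "\<forall>j. \<exists>d. j < ?l \<longrightarrow> d \<in> carrier (A (Suc n)) \<and> witt_lift p K (Suc n) (fst (ys ! j) v) = pr (Suc n) (teich (fst (ys ! j) v)) \<oplus>\<^bsub>A (Suc n)\<^esub> add_pow (A (Suc n)) p d" by blast
  then obtain d where d: "\<And>j. j < ?l \<Longrightarrow> d j \<in> carrier (A (Suc n))"
   "\<And>j. j < ?l \<Longrightarrow> witt_lift p K (Suc n) (fst (ys ! j) v) = pr (Suc n) (teich (fst (ys ! j) v)) \<oplus>\<^bsub>A (Suc n)\<^esub> add_pow (A (Suc n)) p (d j)"
   using choice_iff by metis
  have "tau n [(v, p ^ n)] ys = bilinear_power_coeff (A (Suc n)) (\<lambda>i j. witt_lift p K (Suc n) (fst (ys ! j) v)) (Suc 0) ?l (p ^ n) (\<lambda>i. p ^ n) (\<lambda>j. snd (ys ! j))"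
   unfolding tau_def by (simp, rule A.bilinear_power_coeff_eqI) (use pK in \<open>auto intro: lift_residue\<close>)
  also have "\<dots> = bilinear_power_coeff (A (Suc n)) (\<lambda>i j. pr (Suc n) (teich (fst (ys ! j) v))) (Suc 0) ?l (p ^ n) (\<lambda>i. p ^ n) (\<lambda>j. snd (ys ! j))"
   by (rule A.bilinear_power_coeff_cong[where d="\<lambda>i j. d j", OF p A_torsion]) (use d pK in auto)
  also have "\<dots> = ((\<Oplus>\<^bsub>?P\<^esub>j\<in>{..<?l}. ?m (pr (Suc n) (teich (fst (ys ! j) v))) {#Inl 0, Inr j#}) [^]\<^bsub>?P\<^esub> (p ^ n)) ?\<beta>"
  proof -
   have "(\<Oplus>\<^bsub>?P\<^esub>j\<in>{..<?l}. ?m (pr (Suc n) (teich (fst (ys ! j) v))) {#Inl 0, Inr j#}) \<in> carrier ?P"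
    using mc pK by (intro P.finsum_closed) auto
   then show ?thesis by (simp add: bilinear_power_coeff_def lessThan_Suc)
  qed
  also have "(\<Oplus>\<^bsub>?P\<^esub>j\<in>{..<?l}. ?m (pr (Suc n) (teich (fst (ys ! j) v))) {#Inl 0, Inr j#}) =
    (\<Oplus>\<^bsub>?P\<^esub>j\<in>{..<?l}. ?m \<one>\<^bsub>A (Suc n)\<^esub> {#Inl 0, Inr j#} \<otimes>\<^bsub>?P\<^esub> ?m (pr (Suc n) (teich (fst (ys ! j) v))) {#})"
   using pK mc by (intro P.finsum_cong') (auto simp: mm)
  also have "(\<dots> [^]\<^bsub>?P\<^esub> (p ^ n)) ?\<beta> = (\<Oplus>\<^bsub>?P\<^esub>\<psi>\<in>carrier VD. c \<psi> \<otimes>\<^bsub>?P\<^esub> ?m (pr (Suc n) (tn n (\<psi> v))) {#}) ?\<beta>"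
   by (simp only: c(2)[OF v])
  also have "\<dots> = (\<Oplus>\<^bsub>A (Suc n)\<^esub>\<psi>\<in>carrier VD. (c \<psi> \<otimes>\<^bsub>?P\<^esub> ?m (pr (Suc n) (tn n (\<psi> v))) {#}) ?\<beta>)"
   using c(1) v mc by (intro cs) auto
  also have "\<dots> = (\<Oplus>\<^bsub>A (Suc n)\<^esub>\<psi>\<in>carrier VD. c \<psi> ?\<beta> \<otimes>\<^bsub>A (Suc n)\<^esub> pr (Suc n) (tn n (\<psi> v)))"
   using c(1) v cf by (intro A.finsum_cong' refl cm Pi_I A.m_closed pr.hom_closed tn_closed dual_closed) auto
  finally show ?thesis .
 qed
 moreover have "(\<lambda>\<psi>. c \<psi> ?\<beta>) \<in> carrier VD \<rightarrow> carrier (A (Suc n))" using c(1) cf by auto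
 ultimately show ?thesis by (intro bexI[of _ "\<lambda>\<psi>. c \<psi> ?\<beta>"]) auto
qed

text \<open>The relation of \<open>tau_single\<close> is linear in the class of v, hence holds for
  every Z in the span of these classes. If Z pairs to zero with single forms, it pairs to zero with
  all monomials of the dual, which means that it vanishes modulo the kernel of
  \<open>Delta\<close>.\<close>

lemma Om_nondegenerate:
 assumes Z: "Z \<in> carrier (Om n)" and 0: "\<And>\<phi>. \<phi> \<in> carrier VD \<Longrightarrow> B n Z (clD n \<phi>) = \<zero>\<^bsub>A (Suc n)\<^esub>"
 shows "Z = \<zero>\<^bsub>Om n\<^esub>"
proof -
 interpret VD: finite_space K p r VD by (rule finite_space_dual)
 interpret A: plain_cring "A (Suc n)" by (rule plain_cring.intro, rule cring_A)
 interpret G: Module.module "A (Suc n)" "Gm n" by (rule Gamma_module)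
 interpret pr: ring_hom_cring W "A (Suc n)" "pr (Suc n)" by (rule pr_hom)
 have m0: "B n Z (VD.qt n (gmonD n ys)) = \<zero>\<^bsub>A (Suc n)\<^esub>" if ys: "ys \<in> dp_lists (carrier VD) (p ^ n)" for ys
 proof -
  let ?Y = "VD.qt n (gmonD n ys)"
  have Y: "?Y \<in> carrier (Omega_full p K n VD)" using VD.qt_basics(1) VD.Gamma_mono_closed[OF ys] by auto
  have "set ys \<subseteq> carrier VD \<times> UNIV" using ys by (simp add: dp_lists_def)
  from tau_single[OF this, of n] obtain d where d1: "d \<in> carrier VD \<rightarrow> carrier (A (Suc n))" and
   d2: "\<forall>v\<in>carrier V. tau n [(v, p ^ n)] ys = (\<Oplus>\<^bsub>A (Suc n)\<^esub>\<psi>\<in>carrier VD. d \<psi> \<otimes>\<^bsub>A (Suc n)\<^esub> pr (Suc n) (tn n (\<psi> v)))"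
   by (elim bexE)
  note d = d1 bspec[OF d2]
  have cY: "clD n \<psi> \<in> carrier (Omega_full p K n VD)" if "\<psi> \<in> carrier VD" for \<psi>
   using VD.Om_full[OF VD.cl_closed[OF that]] .
  have "B n Z ?Y = (\<Oplus>\<^bsub>A (Suc n)\<^esub>\<psi>\<in>carrier VD. d \<psi> \<otimes>\<^bsub>A (Suc n)\<^esub> B n Z (clD n \<psi>))"
  proof (rule Om_induct[OF Z])
   fix v assume v: "v \<in> carrier V"
   have "B n (cl n v) ?Y = tau n [(v, p ^ n)] ys"
    unfolding cl_eq[OF v] pairing_qt[OF Gamma_mono_closed[OF single_list[OF v]] VD.Gamma_mono_closed[OF ys]]
    by (rule Delta_spec(2)[OF single_list[OF v] ys])
   also have "\<dots> = (\<Oplus>\<^bsub>A (Suc n)\<^esub>\<psi>\<in>carrier VD. d \<psi> \<otimes>\<^bsub>A (Suc n)\<^esub> B n (cl n v) (clD n \<psi>))"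
    unfolding d(2)[OF v] using d(1) v by (intro A.finsum_cong' refl) (auto simp: B_cl)
   finally show "B n (cl n v) ?Y = \<dots>" .
  next
   show "B n \<zero>\<^bsub>Om n\<^esub> ?Y = (\<Oplus>\<^bsub>A (Suc n)\<^esub>\<psi>\<in>carrier VD. d \<psi> \<otimes>\<^bsub>A (Suc n)\<^esub> B n \<zero>\<^bsub>Om n\<^esub> (clD n \<psi>))"
    unfolding B_left(4)[OF Z Y]
    by (rule sym, rule A.finsum_all0) (simp add: B_left(4)[OF Z cY] funcset_mem[OF d(1)])
  next
   fix x y assume xy: "x \<in> carrier (Om n)" "y \<in> carrier (Om n)"
    and "B n x ?Y = (\<Oplus>\<^bsub>A (Suc n)\<^esub>\<psi>\<in>carrier VD. d \<psi> \<otimes>\<^bsub>A (Suc n)\<^esub> B n x (clD n \<psi>))"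
     "B n y ?Y = (\<Oplus>\<^bsub>A (Suc n)\<^esub>\<psi>\<in>carrier VD. d \<psi> \<otimes>\<^bsub>A (Suc n)\<^esub> B n y (clD n \<psi>))"
   then have "B n (x \<oplus>\<^bsub>Om n\<^esub> y) ?Y = (\<Oplus>\<^bsub>A (Suc n)\<^esub>\<psi>\<in>carrier VD. d \<psi> \<otimes>\<^bsub>A (Suc n)\<^esub> B n x (clD n \<psi>)) \<oplus>\<^bsub>A (Suc n)\<^esub> (\<Oplus>\<^bsub>A (Suc n)\<^esub>\<psi>\<in>carrier VD. d \<psi> \<otimes>\<^bsub>A (Suc n)\<^esub> B n y (clD n \<psi>))"
    by (simp add: B_left(2)[OF xy(1) Y xy(2)])
   also have "\<dots> = (\<Oplus>\<^bsub>A (Suc n)\<^esub>\<psi>\<in>carrier VD. d \<psi> \<otimes>\<^bsub>A (Suc n)\<^esub> B n x (clD n \<psi>) \<oplus>\<^bsub>A (Suc n)\<^esub> d \<psi> \<otimes>\<^bsub>A (Suc n)\<^esub> B n y (clD n \<psi>))"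
    by (rule A.finsum_addf[symmetric]) (use d(1) B_left(1)[OF xy(1) cY] B_left(1)[OF xy(2) cY] in auto)
   also have "\<dots> = (\<Oplus>\<^bsub>A (Suc n)\<^esub>\<psi>\<in>carrier VD. d \<psi> \<otimes>\<^bsub>A (Suc n)\<^esub> B n (x \<oplus>\<^bsub>Om n\<^esub> y) (clD n \<psi>))"
    by (rule A.finsum_cong') (use d(1) B_left(1)[OF xy(1) cY] B_left(1)[OF xy(2) cY] B_left(2)[OF xy(1) cY xy(2)] in \<open>auto simp: A.r_distr Pi_iff\<close>)
   finally show "B n (x \<oplus>\<^bsub>Om n\<^esub> y) ?Y = \<dots>" .
  next
   fix a x assume ax: "a \<in> carrier W" "x \<in> carrier (Om n)"
    and "B n x ?Y = (\<Oplus>\<^bsub>A (Suc n)\<^esub>\<psi>\<in>carrier VD. d \<psi> \<otimes>\<^bsub>A (Suc n)\<^esub> B n x (clD n \<psi>))"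
   then have "B n (a \<odot>\<^bsub>Om n\<^esub> x) ?Y = pr (Suc n) a \<otimes>\<^bsub>A (Suc n)\<^esub> (\<Oplus>\<^bsub>A (Suc n)\<^esub>\<psi>\<in>carrier VD. d \<psi> \<otimes>\<^bsub>A (Suc n)\<^esub> B n x (clD n \<psi>))"
    by (simp add: B_left(3)[OF ax(2) Y ax(1)])
   also have "\<dots> = (\<Oplus>\<^bsub>A (Suc n)\<^esub>\<psi>\<in>carrier VD. pr (Suc n) a \<otimes>\<^bsub>A (Suc n)\<^esub> (d \<psi> \<otimes>\<^bsub>A (Suc n)\<^esub> B n x (clD n \<psi>)))"
    by (rule A.finsum_rdistr) (use d(1) B_left(1)[OF ax(2) cY] ax finite_dual in auto)
   also have "\<dots> = (\<Oplus>\<^bsub>A (Suc n)\<^esub>\<psi>\<in>carrier VD. d \<psi> \<otimes>\<^bsub>A (Suc n)\<^esub> B n (a \<odot>\<^bsub>Om n\<^esub> x) (clD n \<psi>))"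
    by (rule A.finsum_cong') (use d(1) ax B_left(1)[OF ax(2) cY] B_left(3)[OF ax(2) cY ax(1)] in \<open>auto simp: A.m_lcomm Pi_iff\<close>)
   finally show "B n (a \<odot>\<^bsub>Om n\<^esub> x) ?Y = \<dots>" .
  qed
  also have "\<dots> = \<zero>\<^bsub>A (Suc n)\<^esub>" by (rule A.finsum_all0) (simp add: 0 funcset_mem[OF d(1)])
  finally show ?thesis .
 qed
 obtain x where x: "x \<in> carrier (Gm n)" "Z = qt n x" by (rule full_cases[OF Om_full[OF Z]])
 have "Dl n x y = \<zero>\<^bsub>A (Suc n)\<^esub>" if y: "y \<in> carrier (GmD n)" for y
 proof (rule VD.Gamma_induct[OF y])
  show "Dl n x (gmonD n ys) = \<zero>\<^bsub>A (Suc n)\<^esub>" if ys: "ys \<in> dp_lists (carrier VD) (p ^ n)" for ys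
   using m0[OF ys] unfolding x(2) pairing_qt[OF x(1) VD.Gamma_mono_closed[OF ys]] .
  show "Dl n x \<zero>\<^bsub>GmD n\<^esub> = \<zero>\<^bsub>A (Suc n)\<^esub>" by (rule Delta_bilinear(7)[OF x(1) y])
 qed (simp_all add: Delta_bilinear(4,5)[OF x(1)])
 then have "qt n x = qt n \<zero>\<^bsub>Gm n\<^esub>"
  using Delta_bilinear(6)[OF x(1)] by (subst qt_eq_iff) (use x in auto)
 then show ?thesis using x by (simp add: Om_simps(3) qt_basics(3))
qed

lemma Om_eqI:
 assumes Z: "Z \<in> carrier (Om n)" "Z' \<in> carrier (Om n)" and eq: "\<And>\<phi>. \<phi> \<in> carrier VD \<Longrightarrow> B n Z (clD n \<phi>) = B n Z' (clD n \<phi>)"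
 shows "Z = Z'"
proof -
 interpret VD: finite_space K p r VD by (rule finite_space_dual)
 interpret O: Module.module W "Om n" by (rule Om_module)
 have d: "Z \<ominus>\<^bsub>Om n\<^esub> Z' \<in> carrier (Om n)" using Z by simp
 have s: "(Z \<ominus>\<^bsub>Om n\<^esub> Z') \<oplus>\<^bsub>Om n\<^esub> Z' = Z" using Z by (simp add: O.M.minus_eq O.M.a_assoc O.M.l_neg)
 have "Z \<ominus>\<^bsub>Om n\<^esub> Z' = \<zero>\<^bsub>Om n\<^esub>"
 proof (rule Om_nondegenerate[OF d])
  fix \<phi> assume \<phi>: "\<phi> \<in> carrier VD"
  note Y = VD.Om_full[OF VD.cl_closed[OF \<phi>, of n]]
  show "B n (Z \<ominus>\<^bsub>Om n\<^esub> Z') (clD n \<phi>) = \<zero>\<^bsub>A (Suc n)\<^esub>"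
   using minus_zero_iff[OF B_left(1)[OF Z(1) Y] B_left(1)[OF Z(2) Y] B_left(1)[OF d Y]] B_left(2)[OF d Y Z(2)] s eq[OF \<phi>] by simp
 qed
 then show ?thesis using Z by simp
qed

text \<open>The values of the linear map are found by nondegeneracy from the functionals \<open>\<Lambda> \<psi>\<close>, which
 are allowed to live in a larger truncation into which \<open>S\<close> embeds \<open>W\<^sub>n'\<^sub>+\<^sub>1(k)\<close>.\<close>

lemma omega_lin_exists:
 fixes U :: "('k, 'u) module"
 assumes U: "finite_space K p r U" and g: "\<And>v. v \<in> carrier V \<Longrightarrow> g v \<in> carrier (Omega p K n' U)"
  and S: "\<And>x. x \<in> carrier (A (Suc n')) \<Longrightarrow> S x \<in> carrier (A m)"
   "\<And>x y. x \<in> carrier (A (Suc n')) \<Longrightarrow> y \<in> carrier (A (Suc n')) \<Longrightarrow> S (x \<oplus>\<^bsub>A (Suc n')\<^esub> y) = S x \<oplus>\<^bsub>A m\<^esub> S y"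
   "\<And>a x. a \<in> carrier W \<Longrightarrow> x \<in> carrier (A (Suc n')) \<Longrightarrow> S (pr (Suc n') a \<otimes>\<^bsub>A (Suc n')\<^esub> x) = pr m a \<otimes>\<^bsub>A m\<^esub> S x"
   "inj_on S (carrier (A (Suc n')))"
  and \<Lambda>: "\<And>\<psi> Z. \<psi> \<in> carrier (dual_space K U) \<Longrightarrow> Z \<in> carrier (Om n) \<Longrightarrow> \<Lambda> \<psi> Z \<in> carrier (A m)"
   "\<And>\<psi> Z Z'. \<psi> \<in> carrier (dual_space K U) \<Longrightarrow> Z \<in> carrier (Om n) \<Longrightarrow> Z' \<in> carrier (Om n) \<Longrightarrow> \<Lambda> \<psi> (Z \<oplus>\<^bsub>Om n\<^esub> Z') = \<Lambda> \<psi> Z \<oplus>\<^bsub>A m\<^esub> \<Lambda> \<psi> Z'"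
   "\<And>\<psi> a Z. \<psi> \<in> carrier (dual_space K U) \<Longrightarrow> a \<in> carrier W \<Longrightarrow> Z \<in> carrier (Om n) \<Longrightarrow> \<Lambda> \<psi> (a \<odot>\<^bsub>Om n\<^esub> Z) = pr m a \<otimes>\<^bsub>A m\<^esub> \<Lambda> \<psi> Z"
  and val: "\<And>\<psi> v. \<psi> \<in> carrier (dual_space K U) \<Longrightarrow> v \<in> carrier V \<Longrightarrow>
    \<Lambda> \<psi> (cl n v) = S (omega_pairing p K n' U (g v) (omega_class p K n' (dual_space K U) \<psi>))"
 shows "omega_lin p K n V (Omega p K n' U) g \<in> lin_maps W (Om n) (Omega p K n' U)"
  and "v \<in> carrier V \<Longrightarrow> omega_lin p K n V (Omega p K n' U) g (cl n v) = g v"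
  and "Z \<in> carrier (Om n) \<Longrightarrow> \<psi> \<in> carrier (dual_space K U) \<Longrightarrow>
    S (omega_pairing p K n' U (omega_lin p K n V (Omega p K n' U) g Z) (omega_class p K n' (dual_space K U) \<psi>)) = \<Lambda> \<psi> Z"
proof -
 interpret U: finite_space K p r U by (rule U)
 interpret UD: finite_space K p r U.VD by (rule U.finite_space_dual)
 interpret O: Module.module W "Om n" by (rule Om_module)
 interpret OU: Module.module W "U.Om n'" by (rule U.Om_module)
 interpret Am: cring "A m" by (rule cring_A)
 interpret An: cring "A (Suc n')" by (rule cring_A)
 interpret prm: ring_hom_cring W "A m" "pr m" by (rule pr_hom)
 interpret prn: ring_hom_cring W "A (Suc n')" "pr (Suc n')" by (rule pr_hom)
 note Y = UD.Om_full[OF UD.cl_closed]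
 \<comment> \<open>Q says that T has the pairings prescribed for Z. It is a linear relation, total
   by induction over the span and single-valued by nondegeneracy, hence the graph of the wanted
   map.\<close>
 define Q where "Q Z T \<longleftrightarrow> T \<in> carrier (U.Om n') \<and> (\<forall>\<psi>\<in>carrier U.VD. S (U.B n' T (U.clD n' \<psi>)) = \<Lambda> \<psi> Z)" for Z T
 have S0: "S \<zero>\<^bsub>A (Suc n')\<^esub> = \<zero>\<^bsub>A m\<^esub>" using S(3)[OF W.zero_closed An.zero_closed] S(1)[OF An.zero_closed] by simp
 have \<Lambda>0: "\<Lambda> \<psi> \<zero>\<^bsub>Om n\<^esub> = \<zero>\<^bsub>A m\<^esub>" if "\<psi> \<in> carrier U.VD" for \<psi>
  using \<Lambda>(3)[OF that W.zero_closed O.M.zero_closed] \<Lambda>(1)[OF that O.M.zero_closed] by simp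
 have Q_cl: "Q (cl n v) (g v)" if "v \<in> carrier V" for v using g[OF that] val[OF _ that] by (simp add: Q_def)
 have Q0: "Q \<zero>\<^bsub>Om n\<^esub> \<zero>\<^bsub>U.Om n'\<^esub>"
  unfolding Q_def using U.B_left(4)[OF OU.M.zero_closed Y] S0 \<Lambda>0 by auto
 have Q_add: "Q (Z \<oplus>\<^bsub>Om n\<^esub> Z') (T \<oplus>\<^bsub>U.Om n'\<^esub> T')" if "Z \<in> carrier (Om n)" "Z' \<in> carrier (Om n)" "Q Z T" "Q Z' T'" for Z Z' T T'
  using that unfolding Q_def by (auto simp: U.B_left(1,2)[OF _ Y] S(2) \<Lambda>(2))
 have Q_smult: "Q (a \<odot>\<^bsub>Om n\<^esub> Z) (a \<odot>\<^bsub>U.Om n'\<^esub> T)" if "a \<in> carrier W" "Z \<in> carrier (Om n)" "Q Z T" for a Z T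
  using that unfolding Q_def by (auto simp: U.B_left(1,3)[OF _ Y] S(3) \<Lambda>(3))
 have Q_unique: "T = T'" if "Q Z T" "Q Z T'" for Z T T'
 proof (rule U.Om_eqI)
  show T: "T \<in> carrier (U.Om n')" "T' \<in> carrier (U.Om n')" using that by (simp_all add: Q_def)
  fix \<psi> assume \<psi>: "\<psi> \<in> carrier U.VD"
  have "S (U.B n' T (U.clD n' \<psi>)) = S (U.B n' T' (U.clD n' \<psi>))" using that \<psi> by (simp add: Q_def)
  then show "U.B n' T (U.clD n' \<psi>) = U.B n' T' (U.clD n' \<psi>)"
   by (rule inj_onD[OF S(4)]) (use U.B_left(1)[OF _ Y[OF \<psi>]] T in auto)
 qed
 have Q_ex: "\<exists>T. Q Z T" if "Z \<in> carrier (Om n)" for Z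
 proof (rule Om_induct[OF that])
  show "\<exists>T. Q (cl n v) T" if "v \<in> carrier V" for v using Q_cl[OF that] by (rule exI)
  show "\<exists>T. Q \<zero>\<^bsub>Om n\<^esub> T" using Q0 by (rule exI)
  show "\<exists>T. Q (x \<oplus>\<^bsub>Om n\<^esub> y) T" if xy: "x \<in> carrier (Om n)" "y \<in> carrier (Om n)" and ex: "\<exists>T. Q x T" "\<exists>T. Q y T" for x y
  proof -
   obtain T where T: "Q x T" using ex(1) by (elim exE)
   obtain T' where T': "Q y T'" using ex(2) by (elim exE)
   show ?thesis using Q_add[OF xy T T'] by (rule exI)
  qed
  show "\<exists>T. Q (a \<odot>\<^bsub>Om n\<^esub> x) T" if ax: "a \<in> carrier W" "x \<in> carrier (Om n)" and ex: "\<exists>T. Q x T" for a x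
  proof -
   obtain T where T: "Q x T" using ex by (elim exE)
   show ?thesis using Q_smult[OF ax T] by (rule exI)
  qed
 qed
 define F where "F Z = (SOME T. Q Z T)" for Z
 have F: "Q Z (F Z)" if "Z \<in> carrier (Om n)" for Z unfolding F_def by (rule someI_ex[OF Q_ex[OF that]])
 have FO: "F Z \<in> carrier (U.Om n')" if "Z \<in> carrier (Om n)" for Z using F[OF that] by (simp add: Q_def)
 have "F \<in> lin_maps W (Om n) (U.Om n')"
  unfolding LinearCombinations.module_hom_def
 proof (intro CollectI conjI allI impI Pi_I; (elim conjE)?)
  show "F Z \<in> carrier (U.Om n')" if "Z \<in> carrier (Om n)" for Z using FO[OF that] .
  show "F (x \<oplus>\<^bsub>Om n\<^esub> y) = F x \<oplus>\<^bsub>U.Om n'\<^esub> F y" if "x \<in> carrier (Om n)" "y \<in> carrier (Om n)" for x y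
   by (rule Q_unique[OF F Q_add[OF that F F]]) (use that in auto)
  show "F (a \<odot>\<^bsub>Om n\<^esub> x) = a \<odot>\<^bsub>U.Om n'\<^esub> F x" if "a \<in> carrier W" "x \<in> carrier (Om n)" for a x
   by (rule Q_unique[OF F Q_smult[OF that F]]) (use that in auto)
 qed
 moreover have "F (cl n v) = g v" if "v \<in> carrier V" for v
  by (rule Q_unique[OF F[OF cl_closed[OF that]] Q_cl[OF that]])
 ultimately have ex: "\<exists>F. F \<in> lin_maps W (Om n) (U.Om n') \<and> (\<forall>v\<in>carrier V. F (cl n v) = g v)" by blast
 \<comment> \<open>\<open>omega_lin\<close> chooses some linear map with the given values on
   classes, so its pairings are obtained by a separate induction rather than from F.\<close>
 define L where "L = omega_lin p K n V (U.Om n') g"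
 have L: "L \<in> lin_maps W (Om n) (U.Om n')" "\<And>v. v \<in> carrier V \<Longrightarrow> L (cl n v) = g v"
  using someI_ex[OF ex] by (simp_all add: L_def omega_lin_def)
 show "omega_lin p K n V (Omega p K n' U) g \<in> lin_maps W (Om n) (Omega p K n' U)"
  "v \<in> carrier V \<Longrightarrow> omega_lin p K n V (Omega p K n' U) g (cl n v) = g v"
  using L by (simp_all add: L_def)
 have Lz: "L \<zero>\<^bsub>Om n\<^esub> = \<zero>\<^bsub>U.Om n'\<^esub>"
  using LinearCombinations.module_hom_smult[OF L(1) W.zero_closed O.M.zero_closed]
   funcset_mem[OF LinearCombinations.module_hom_closed[OF L(1)] O.M.zero_closed] by simp
 have "Q Z (L Z)" if "Z \<in> carrier (Om n)" for Z
 proof (rule Om_induct[OF that])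
  show "Q (cl n v) (L (cl n v))" if "v \<in> carrier V" for v using Q_cl[OF that] L(2)[OF that] by simp
  show "Q \<zero>\<^bsub>Om n\<^esub> (L \<zero>\<^bsub>Om n\<^esub>)" using Q0 Lz by simp
  show "Q (x \<oplus>\<^bsub>Om n\<^esub> y) (L (x \<oplus>\<^bsub>Om n\<^esub> y))" if "x \<in> carrier (Om n)" "y \<in> carrier (Om n)" "Q x (L x)" "Q y (L y)" for x y
   using Q_add[OF that] LinearCombinations.module_hom_add[OF L(1) that(1,2)] by simp
  show "Q (a \<odot>\<^bsub>Om n\<^esub> x) (L (a \<odot>\<^bsub>Om n\<^esub> x))" if "a \<in> carrier W" "x \<in> carrier (Om n)" "Q x (L x)" for a x
   using Q_smult[OF that] LinearCombinations.module_hom_smult[OF L(1) that(1,2)] by simp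
 qed
 then show "Z \<in> carrier (Om n) \<Longrightarrow> \<psi> \<in> carrier (dual_space K U) \<Longrightarrow>
    S (omega_pairing p K n' U (omega_lin p K n V (Omega p K n' U) g Z) (omega_class p K n' (dual_space K U) \<psi>)) = \<Lambda> \<psi> Z"
  by (simp add: Q_def L_def)
qed

end

section \<open>Transfers\<close>

context finite_witt
begin

lemma shift_facts:
 shows shift_closed: "x \<in> carrier (A j) \<Longrightarrow> witt_shift p K j d x \<in> carrier (A (j + d))"
  and shift_add: "x \<in> carrier (A j) \<Longrightarrow> y \<in> carrier (A j) \<Longrightarrow> witt_shift p K j d (x \<oplus>\<^bsub>A j\<^esub> y) = witt_shift p K j d x \<oplus>\<^bsub>A (j + d)\<^esub> witt_shift p K j d y"
  and shift_smult: "a \<in> carrier W \<Longrightarrow> x \<in> carrier (A j) \<Longrightarrow> witt_shift p K j d (pr j a \<otimes>\<^bsub>A j\<^esub> x) = pr (j + d) a \<otimes>\<^bsub>A (j + d)\<^esub> witt_shift p K j d x"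
  and shift_inj: "inj_on (witt_shift p K j d) (carrier (A j))"
  and shift_zero: "witt_shift p K j d \<zero>\<^bsub>A j\<^esub> = \<zero>\<^bsub>A (j + d)\<^esub>"
proof -
 interpret prj: ring_hom_cring W "A j" "pr j" by (rule pr_hom)
 interpret prd: ring_hom_cring W "A (j + d)" "pr (j + d)" by (rule pr_hom)
 have ap: "add_pow W (p ^ d) a \<in> carrier W" if "a \<in> carrier W" for a using that by simp
 show "witt_shift p K j d x \<in> carrier (A (j + d))" if x: "x \<in> carrier (A j)"
 proof -
  obtain a where a: "a \<in> carrier W" "x = pr j a" using x by (auto simp: carrier_A)
  show ?thesis unfolding a(2) shift_pr[OF a(1)] by (rule prd.hom_closed[OF ap[OF a(1)]])
 qed
 show "witt_shift p K j d (x \<oplus>\<^bsub>A j\<^esub> y) = witt_shift p K j d x \<oplus>\<^bsub>A (j + d)\<^esub> witt_shift p K j d y" if xy: "x \<in> carrier (A j)" "y \<in> carrier (A j)"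
 proof -
  obtain a where a: "a \<in> carrier W" "x = pr j a" using xy(1) by (auto simp: carrier_A)
  obtain b where b: "b \<in> carrier W" "y = pr j b" using xy(2) by (auto simp: carrier_A)
  show ?thesis
   unfolding a(2) b(2) prj.hom_add[OF a(1) b(1), symmetric] shift_pr[OF a(1)] shift_pr[OF b(1)] shift_pr[OF W.a_closed[OF a(1) b(1)]]
    prd.hom_add[OF ap[OF a(1)] ap[OF b(1)], symmetric]
   by (simp only: W.add.nat_pow_distrib[OF a(1) b(1)])
 qed
 show "witt_shift p K j d (pr j a \<otimes>\<^bsub>A j\<^esub> x) = pr (j + d) a \<otimes>\<^bsub>A (j + d)\<^esub> witt_shift p K j d x" if a: "a \<in> carrier W" and x: "x \<in> carrier (A j)"
 proof -
  obtain b where b: "b \<in> carrier W" "x = pr j b" using x by (auto simp: carrier_A)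
  show ?thesis
   unfolding b(2) prj.hom_mult[OF a b(1), symmetric] shift_pr[OF b(1)] shift_pr[OF W.m_closed[OF a b(1)]]
    prd.hom_mult[OF a ap[OF b(1)], symmetric]
   by (simp only: W.add_pow_rdistr[OF a b(1)])
 qed
 show "inj_on (witt_shift p K j d) (carrier (A j))"
 proof (rule inj_onI)
  fix x y assume xy: "x \<in> carrier (A j)" "y \<in> carrier (A j)" and eq: "witt_shift p K j d x = witt_shift p K j d y"
  obtain a where a: "a \<in> carrier W" "x = pr j a" using xy(1) by (auto simp: carrier_A)
  obtain b where b: "b \<in> carrier W" "y = pr j b" using xy(2) by (auto simp: carrier_A)
  have "\<forall>i<j + d. add_pow W (p ^ d) a i = add_pow W (p ^ d) b i"
   using eq unfolding a(2) b(2) shift_pr[OF a(1)] shift_pr[OF b(1)] pr_eq_iff[OF ap[OF a(1)] ap[OF b(1)]] .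
  \<comment> \<open>The components of the p^d-fold multiple are the p^d-th powers of the components,
    shifted by d, and p^d-th powers are injective on k.\<close>
  then have pe: "a i [^] (p ^ d) = b i [^] (p ^ d)" if "i < j" for i
   using that by (simp add: p_power_times[OF a(1)] p_power_times[OF b(1)]) (metis add_diff_cancel_right' add_less_cancel_right not_add_less2)
  have "a i \<in> carrier K" "b i \<in> carrier K" for i using a(1) b(1) by (simp_all add: carrier_W Pi_iff)
  then have "\<forall>i<j. a i = b i" using pow_pow_inj[OF _ _ pe] by blast
  then show "x = y" unfolding a(2) b(2) pr_eq_iff[OF a(1) b(1)] .
 qed
 have "\<zero>\<^bsub>A j\<^esub> = pr j \<zero>\<^bsub>W\<^esub>" "\<zero>\<^bsub>A (j + d)\<^esub> = pr (j + d) \<zero>\<^bsub>W\<^esub>" by simp_all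
 then show "witt_shift p K j d \<zero>\<^bsub>A j\<^esub> = \<zero>\<^bsub>A (j + d)\<^esub>"
  by (simp only: shift_pr[OF W.zero_closed] W.add.nat_pow_one)
qed

lemma A_minus_eqI:
 assumes "a \<in> carrier (A j)" "b \<in> carrier (A j)" "c \<in> carrier (A j)" "c \<oplus>\<^bsub>A j\<^esub> b = a"
 shows "c = a \<ominus>\<^bsub>A j\<^esub> b"
proof -
 interpret A: cring "A j" by (rule cring_A)
 show ?thesis using assms(1-3) unfolding assms(4)[symmetric] by (simp add: A.minus_eq A.a_assoc A.r_neg)
qed

lemma finsum_if_const:
 assumes "finite I" "s \<in> carrier (A j)"
 shows "(\<Oplus>\<^bsub>A j\<^esub>i\<in>I. if Q i then s else \<zero>\<^bsub>A j\<^esub>) = add_pow (A j) (card {i \<in> I. Q i}) s"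
proof -
 interpret A: cring "A j" by (rule cring_A)
 show ?thesis using assms(1)
 proof (induction I rule: finite_induct)
  case (insert i I)
  have "{k \<in> insert i I. Q k} = (if Q i then insert i {k \<in> I. Q k} else {k \<in> I. Q k})" by auto
  moreover have "(\<Oplus>\<^bsub>A j\<^esub>k\<in>insert i I. if Q k then s else \<zero>\<^bsub>A j\<^esub>) = (if Q i then s else \<zero>\<^bsub>A j\<^esub>) \<oplus>\<^bsub>A j\<^esub> (\<Oplus>\<^bsub>A j\<^esub>k\<in>I. if Q k then s else \<zero>\<^bsub>A j\<^esub>)"
   using insert(1,2) assms(2) by (intro A.finsum_insert) auto
  ultimately show ?case using insert assms(2) by (simp add: A.a_comm)
 qed simp
qed

end

context finite_space
begin

lemma B_finsum_left:
 assumes I: "finite I" and Z: "\<And>i. i \<in> I \<Longrightarrow> Z i \<in> carrier (Om n)" and Y: "Y \<in> carrier (Omega_full p K n VD)"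
 shows "B n (\<Oplus>\<^bsub>Om n\<^esub>i\<in>I. Z i) Y = (\<Oplus>\<^bsub>A (Suc n)\<^esub>i\<in>I. B n (Z i) Y)"
proof -
 interpret A: cring "A (Suc n)" by (rule cring_A)
 interpret O: Module.module W "Om n" by (rule Om_module)
 show ?thesis using I Z
 proof (induction I rule: finite_induct)
  case empty
  show ?case using B_left(4)[OF O.M.zero_closed Y] by simp
 next
  case (insert i I)
  have c: "(\<Oplus>\<^bsub>Om n\<^esub>i\<in>I. Z i) \<in> carrier (Om n)" using insert(4) by (intro O.M.finsum_closed) auto
  have zi: "Z i \<in> carrier (Om n)" using insert(4) by simp
  have "(\<Oplus>\<^bsub>Om n\<^esub>i\<in>insert i I. Z i) = Z i \<oplus>\<^bsub>Om n\<^esub> (\<Oplus>\<^bsub>Om n\<^esub>i\<in>I. Z i)" using insert by (intro O.M.finsum_insert) auto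
  moreover have "(\<Oplus>\<^bsub>A (Suc n)\<^esub>i\<in>insert i I. B n (Z i) Y) = B n (Z i) Y \<oplus>\<^bsub>A (Suc n)\<^esub> (\<Oplus>\<^bsub>A (Suc n)\<^esub>i\<in>I. B n (Z i) Y)"
   using insert B_left(1)[OF _ Y] by (intro A.finsum_insert) auto
  ultimately show ?case using insert(3,4) B_left(2)[OF zi Y c] by simp
 qed
qed

lemma B_finsum_right:
 assumes I: "finite I" and Z: "\<And>i. i \<in> I \<Longrightarrow> Y i \<in> carrier (OmD n)" and Y: "Z \<in> carrier (Om n)"
 shows "B n Z (\<Oplus>\<^bsub>OmD n\<^esub>i\<in>I. Y i) = (\<Oplus>\<^bsub>A (Suc n)\<^esub>i\<in>I. B n Z (Y i))"
proof -
 interpret VD: finite_space K p r VD by (rule finite_space_dual)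
 interpret A: cring "A (Suc n)" by (rule cring_A)
 interpret O: Module.module W "OmD n" by (rule VD.Om_module)
 show ?thesis using I Z
 proof (induction I rule: finite_induct)
  case empty
  show ?case using B_right(4)[OF Y O.M.zero_closed] by simp
 next
  case (insert i I)
  have c: "(\<Oplus>\<^bsub>OmD n\<^esub>i\<in>I. Y i) \<in> carrier (OmD n)" using insert(4) by (intro O.M.finsum_closed) auto
  have zi: "Y i \<in> carrier (OmD n)" using insert(4) by simp
  have "(\<Oplus>\<^bsub>OmD n\<^esub>i\<in>insert i I. Y i) = Y i \<oplus>\<^bsub>OmD n\<^esub> (\<Oplus>\<^bsub>OmD n\<^esub>i\<in>I. Y i)" using insert by (intro O.M.finsum_insert) auto
  moreover have "(\<Oplus>\<^bsub>A (Suc n)\<^esub>i\<in>insert i I. B n Z (Y i)) = B n Z (Y i) \<oplus>\<^bsub>A (Suc n)\<^esub> (\<Oplus>\<^bsub>A (Suc n)\<^esub>i\<in>I. B n Z (Y i))"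
   using insert B_right(1)[OF Y] by (intro A.finsum_insert) auto
  ultimately show ?case using insert(3,4) B_right(2)[OF Y zi c] by simp
 qed
qed

lemma pr_finsum: "finite S \<Longrightarrow> (\<And>i. i \<in> S \<Longrightarrow> f i \<in> carrier W) \<Longrightarrow> (\<Oplus>\<^bsub>A j\<^esub>i\<in>S. pr j (f i)) = pr j (\<Oplus>\<^bsub>W\<^esub>i\<in>S. f i)"
proof -
 interpret pr: ring_hom_cring W "A j" "pr j" by (rule pr_hom)
 assume "finite S" "\<And>i. i \<in> S \<Longrightarrow> f i \<in> carrier W"
 then show ?thesis by (subst pr.hom_finsum) (auto simp: o_def)
qed

lemma pr_minus: "a \<in> carrier W \<Longrightarrow> b \<in> carrier W \<Longrightarrow> pr j (a \<ominus>\<^bsub>W\<^esub> b) = pr j a \<ominus>\<^bsub>A j\<^esub> pr j b"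
proof -
 interpret pr: ring_hom_cring W "A j" "pr j" by (rule pr_hom)
 assume ab: "a \<in> carrier W" "b \<in> carrier W"
 have "(a \<ominus>\<^bsub>W\<^esub> b) \<oplus>\<^bsub>W\<^esub> b = a" using ab by (simp add: W.minus_eq W.a_assoc W.l_neg)
 then have "pr j (a \<ominus>\<^bsub>W\<^esub> b) \<oplus>\<^bsub>A j\<^esub> pr j b = pr j a" using ab pr.hom_add[of "a \<ominus>\<^bsub>W\<^esub> b" b] by simp
 then show ?thesis using ab by (intro A_minus_eqI) simp_all
qed

text \<open>The shape of the classes that represent transfers: \<open>S\<close> will be a fiber and
  \<open>S'\<close> the kernel, taken in V for the ascending and in the bidual of V for the
  descending transfer.\<close>

definition cls_diff :: "nat \<Rightarrow> 'v set \<Rightarrow> 'v set \<Rightarrow> ('k, 'v) omega_elem" where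
 "cls_diff n S S' = (\<Oplus>\<^bsub>Om n\<^esub>v\<in>S. cl n v) \<ominus>\<^bsub>Om n\<^esub> (\<Oplus>\<^bsub>Om n\<^esub>v\<in>S'. cl n v)"

lemma cls_diff_closed:
 assumes "S \<subseteq> carrier V" "S' \<subseteq> carrier V"
 shows "cls_diff n S S' \<in> carrier (Om n)"
  and "cls_diff n S S' \<oplus>\<^bsub>Om n\<^esub> (\<Oplus>\<^bsub>Om n\<^esub>v\<in>S'. cl n v) = (\<Oplus>\<^bsub>Om n\<^esub>v\<in>S. cl n v)"
  and "T \<subseteq> carrier V \<Longrightarrow> (\<Oplus>\<^bsub>Om n\<^esub>v\<in>T. cl n v) \<in> carrier (Om n)"
proof -
 interpret O: Module.module W "Om n" by (rule Om_module)
 have c: "(\<Oplus>\<^bsub>Om n\<^esub>v\<in>T. cl n v) \<in> carrier (Om n)" if "T \<subseteq> carrier V" for T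
  using that cl_closed by (intro O.M.finsum_closed) auto
 then show "T \<subseteq> carrier V \<Longrightarrow> (\<Oplus>\<^bsub>Om n\<^esub>v\<in>T. cl n v) \<in> carrier (Om n)" .
 show "cls_diff n S S' \<in> carrier (Om n)" using c[OF assms(1)] c[OF assms(2)] by (simp add: cls_diff_def)
 show "cls_diff n S S' \<oplus>\<^bsub>Om n\<^esub> (\<Oplus>\<^bsub>Om n\<^esub>v\<in>S'. cl n v) = (\<Oplus>\<^bsub>Om n\<^esub>v\<in>S. cl n v)"
  using c[OF assms(1)] c[OF assms(2)] by (simp add: cls_diff_def O.M.minus_eq O.M.a_assoc O.M.l_neg)
qed

lemma B_cls_diff_left:
 assumes S: "S \<subseteq> carrier V" "S' \<subseteq> carrier V" and \<phi>: "\<phi> \<in> carrier VD"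
 shows "B n (cls_diff n S S') (clD n \<phi>) = pr (Suc n) ((\<Oplus>\<^bsub>W\<^esub>v\<in>S. tn n (\<phi> v)) \<ominus>\<^bsub>W\<^esub> (\<Oplus>\<^bsub>W\<^esub>v\<in>S'. tn n (\<phi> v)))"
proof -
 interpret VD: finite_space K p r VD by (rule finite_space_dual)
 interpret A: cring "A (Suc n)" by (rule cring_A)
 note Y = VD.Om_full[OF VD.cl_closed[OF \<phi>]]
 have s: "B n (\<Oplus>\<^bsub>Om n\<^esub>v\<in>T. cl n v) (clD n \<phi>) = pr (Suc n) (\<Oplus>\<^bsub>W\<^esub>v\<in>T. tn n (\<phi> v))" if T: "T \<subseteq> carrier V" for T
 proof -
  have fT: "finite T" using T finite_V by (rule finite_subset)
  have "B n (\<Oplus>\<^bsub>Om n\<^esub>v\<in>T. cl n v) (clD n \<phi>) = (\<Oplus>\<^bsub>A (Suc n)\<^esub>v\<in>T. B n (cl n v) (clD n \<phi>))"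
   using T by (intro B_finsum_left[OF fT _ Y] cl_closed) auto
  also have "\<dots> = (\<Oplus>\<^bsub>A (Suc n)\<^esub>v\<in>T. pr (Suc n) (tn n (\<phi> v)))"
   using T \<phi> ring_hom_closed[OF ring_hom_pr] by (intro A.finsum_cong' refl) (auto simp: B_cl subset_iff)
  also have "\<dots> = pr (Suc n) (\<Oplus>\<^bsub>W\<^esub>v\<in>T. tn n (\<phi> v))"
   using T \<phi> by (intro pr_finsum fT) auto
  finally show ?thesis .
 qed
 have cW: "(\<Oplus>\<^bsub>W\<^esub>v\<in>T. tn n (\<phi> v)) \<in> carrier W" if "T \<subseteq> carrier V" for T
  using that \<phi> by (intro W.finsum_closed) auto
 note cd = cls_diff_closed[OF S, where n=n]
 show ?thesis
  unfolding pr_minus[OF cW[OF S(1)] cW[OF S(2)]] s[OF S(1), symmetric] s[OF S(2), symmetric]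
  by (rule A_minus_eqI[OF B_left(1)[OF cd(3)[OF S(1)] Y] B_left(1)[OF cd(3)[OF S(2)] Y] B_left(1)[OF cd(1) Y]])
   (simp only: B_left(2)[OF cd(1) Y cd(3)[OF S(2)], symmetric] cd(2))
qed

lemma B_cls_diff_right:
 assumes S: "S \<subseteq> carrier VD" "S' \<subseteq> carrier VD" and v: "v \<in> carrier V"
 shows "B n (cl n v) (finite_space.cls_diff K p VD n S S') = pr (Suc n) ((\<Oplus>\<^bsub>W\<^esub>\<phi>\<in>S. tn n (\<phi> v)) \<ominus>\<^bsub>W\<^esub> (\<Oplus>\<^bsub>W\<^esub>\<phi>\<in>S'. tn n (\<phi> v)))"
proof -
 interpret VD: finite_space K p r VD by (rule finite_space_dual)
 interpret A: cring "A (Suc n)" by (rule cring_A)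
 note Z = cl_closed[OF v, of n]
 have s: "B n (cl n v) (\<Oplus>\<^bsub>OmD n\<^esub>\<phi>\<in>T. clD n \<phi>) = pr (Suc n) (\<Oplus>\<^bsub>W\<^esub>\<phi>\<in>T. tn n (\<phi> v))" if T: "T \<subseteq> carrier VD" for T
 proof -
  have fT: "finite T" using T finite_dual by (rule finite_subset)
  have "B n (cl n v) (\<Oplus>\<^bsub>OmD n\<^esub>\<phi>\<in>T. clD n \<phi>) = (\<Oplus>\<^bsub>A (Suc n)\<^esub>\<phi>\<in>T. B n (cl n v) (clD n \<phi>))"
   using T by (intro B_finsum_right[OF fT _ Z] VD.cl_closed) auto
  also have "\<dots> = (\<Oplus>\<^bsub>A (Suc n)\<^esub>\<phi>\<in>T. pr (Suc n) (tn n (\<phi> v)))"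
   using T v ring_hom_closed[OF ring_hom_pr] by (intro A.finsum_cong' refl) (auto simp: B_cl subset_iff)
  also have "\<dots> = pr (Suc n) (\<Oplus>\<^bsub>W\<^esub>\<phi>\<in>T. tn n (\<phi> v))"
   using T v by (intro pr_finsum fT) auto
  finally show ?thesis .
 qed
 have cW: "(\<Oplus>\<^bsub>W\<^esub>\<phi>\<in>T. tn n (\<phi> v)) \<in> carrier W" if "T \<subseteq> carrier VD" for T
  using that v by (intro W.finsum_closed) auto
 note cd = VD.cls_diff_closed[OF S, where n=n]
 show ?thesis
  unfolding pr_minus[OF cW[OF S(1)] cW[OF S(2)]] s[OF S(1), symmetric] s[OF S(2), symmetric]
  by (rule A_minus_eqI[OF B_right(1)[OF Z cd(3)[OF S(1)]] B_right(1)[OF Z cd(3)[OF S(2)]] B_right(1)[OF Z cd(1)]])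
   (simp only: B_right(2)[OF Z cd(1) cd(3)[OF S(2)], symmetric] cd(2))
qed

end

section \<open>Fibers of a surjection and the two transfers\<close>

locale surjection = finite_space K p r V + U: finite_space K p r U
 for K :: "'k ring" (structure) and p r and V :: "('k, 'v) module" and U :: "('k, 'u) module" +
 fixes \<pi> :: "'v \<Rightarrow> 'u"
 assumes \<pi>_closed: "v \<in> carrier V \<Longrightarrow> \<pi> v \<in> carrier U"
  and \<pi>_add: "u \<in> carrier V \<Longrightarrow> v \<in> carrier V \<Longrightarrow> \<pi> (u \<oplus>\<^bsub>V\<^esub> v) = \<pi> u \<oplus>\<^bsub>U\<^esub> \<pi> v"
  and \<pi>_smult: "a \<in> carrier K \<Longrightarrow> v \<in> carrier V \<Longrightarrow> \<pi> (a \<odot>\<^bsub>V\<^esub> v) = a \<odot>\<^bsub>U\<^esub> \<pi> v"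
  and \<pi>_surj: "w \<in> carrier U \<Longrightarrow> \<exists>v\<in>carrier V. \<pi> v = w"
begin

definition fib :: "'u \<Rightarrow> 'v set" where "fib w = {v \<in> carrier V. \<pi> v = w}"

abbreviation "kr \<equiv> fib \<zero>\<^bsub>U\<^esub>"

definition c :: nat where "c = vectorspace.dim K (V\<lparr>carrier := kr\<rparr>)"

abbreviation "pull \<equiv> dual_map V \<pi>"

lemma fib_sub: "fib w \<subseteq> carrier V" by (auto simp: fib_def)

lemma \<pi>_zero: "\<pi> \<zero>\<^bsub>V\<^esub> = \<zero>\<^bsub>U\<^esub>"
 using \<pi>_smult[OF zero_closed V.M.zero_closed] \<pi>_closed[OF V.M.zero_closed] by simp

lemma \<pi>_minus: "u \<in> carrier V \<Longrightarrow> v \<in> carrier V \<Longrightarrow> \<pi> (u \<ominus>\<^bsub>V\<^esub> v) = \<pi> u \<ominus>\<^bsub>U\<^esub> \<pi> v"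
proof -
 assume uv: "u \<in> carrier V" "v \<in> carrier V"
 have "(u \<ominus>\<^bsub>V\<^esub> v) \<oplus>\<^bsub>V\<^esub> v = u" using uv by (simp add: V.M.minus_eq V.M.a_assoc V.M.l_neg)
 then have "\<pi> (u \<ominus>\<^bsub>V\<^esub> v) \<oplus>\<^bsub>U\<^esub> \<pi> v = \<pi> u" using uv \<pi>_add[of "u \<ominus>\<^bsub>V\<^esub> v" v] by simp
 moreover have "\<pi> (u \<ominus>\<^bsub>V\<^esub> v) \<in> carrier U" "\<pi> v \<in> carrier U" using uv by (auto intro: \<pi>_closed)
 ultimately show ?thesis using U.V.M.minus_eq U.V.M.a_assoc U.V.M.r_neg by (metis U.V.M.a_inv_closed U.V.M.r_zero)
qed

lemma kr_subspace: "VectorSpace.subspace K kr V"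
 by (auto simp: subspace_iff fib_def \<pi>_zero \<pi>_add \<pi>_smult)

lemma fib_bij: "v0 \<in> fib w \<Longrightarrow> bij_betw (\<lambda>v. v \<oplus>\<^bsub>V\<^esub> v0) kr (fib w)"
proof (rule bij_betw_byWitness[where f'="\<lambda>v. v \<ominus>\<^bsub>V\<^esub> v0"])
 assume "v0 \<in> fib w"
 then have v0: "v0 \<in> carrier V" "\<pi> v0 = w" "w \<in> carrier U" using \<pi>_closed by (auto simp: fib_def)
 show "\<forall>v\<in>kr. v \<oplus>\<^bsub>V\<^esub> v0 \<ominus>\<^bsub>V\<^esub> v0 = v" using v0 by (auto simp: fib_def V.M.minus_eq V.M.a_assoc V.M.r_neg)
 show "\<forall>v\<in>fib w. v \<ominus>\<^bsub>V\<^esub> v0 \<oplus>\<^bsub>V\<^esub> v0 = v" using v0 by (auto simp: fib_def V.M.minus_eq V.M.a_assoc V.M.l_neg)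
 show "(\<lambda>v. v \<oplus>\<^bsub>V\<^esub> v0) ` kr \<subseteq> fib w" using v0 by (auto simp: fib_def \<pi>_add)
 show "(\<lambda>v. v \<ominus>\<^bsub>V\<^esub> v0) ` fib w \<subseteq> kr" using v0 by (auto simp: fib_def \<pi>_minus U.V.M.minus_eq U.V.M.r_neg)
qed

lemma fib_ne: "w \<in> carrier U \<Longrightarrow> \<exists>v. v \<in> fib w"
 using \<pi>_surj by (auto simp: fib_def)

lemma card_kr: "card kr = p ^ (r * c)"
 using finite_space.card_V[OF subspace_finite_space[OF kr_subspace]] by (simp add: c_def power_mult)

lemma card_fib: "w \<in> carrier U \<Longrightarrow> card (fib w) = p ^ (r * c)"
 using fib_ne bij_betw_same_card[OF fib_bij] card_kr by metis

text \<open>The descending transfer reads its codimension off the dimensions of the two spaces, the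
  ascending one off the kernel; counting V by fibers shows that they agree.\<close>

lemma dim_diff: "V.dim - U.V.dim = c"
proof -
 have "carrier V = (\<Union>w\<in>carrier U. fib w)" using \<pi>_closed by (auto simp: fib_def)
 then have "card (carrier V) = card (\<Union>w\<in>carrier U. fib w)" by simp
 also have "\<dots> = (\<Sum>w\<in>carrier U. card (fib w))"
  using U.finite_V finite_subset[OF fib_sub finite_V] by (intro card_UN_disjoint) (auto simp: fib_def)
 also have "\<dots> = card (carrier U) * p ^ (r * c)" by (simp add: card_fib)
 finally have "(p ^ r) ^ V.dim = (p ^ r) ^ (U.V.dim + c)" by (simp add: card_V U.card_V power_add power_mult)
 then have "V.dim = U.V.dim + c" using q_gt_1 by (metis power_inject_exp)
 then show ?thesis by simp
qed

lemma pull_apply: "v \<in> carrier V \<Longrightarrow> pull \<psi> v = \<psi> (\<pi> v)"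
 by (simp add: dual_map_def)

lemma pull_closed: "\<psi> \<in> carrier U.VD \<Longrightarrow> pull \<psi> \<in> carrier VD"
 unfolding in_dual_iff
 by (auto simp: dual_map_def \<pi>_closed \<pi>_add \<pi>_smult U.in_dual_iff)

lemma pull_inj: "inj_on pull (carrier U.VD)"
proof (rule inj_onI)
 fix \<psi> \<chi> assume a: "\<psi> \<in> carrier U.VD" "\<chi> \<in> carrier U.VD" "pull \<psi> = pull \<chi>"
 have "\<psi> u = \<chi> u" if u: "u \<in> carrier U" for u
 proof -
  obtain v where "v \<in> carrier V" "\<pi> v = u" using \<pi>_surj[OF u] by blast
  then show ?thesis using fun_cong[OF a(3), of v] by (simp add: pull_apply)
 qed
 then show "\<psi> = \<chi>" using a by (intro extensionalityI[of _ "carrier U"]) (auto simp: U.in_dual_iff)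
qed

text \<open>A form that vanishes on the kernel is constant on fibers, so composing it with any
  section of \<pi> gives the form on U. The section need not be linear; linearity comes from
  \<phi>.\<close>

lemma in_pull_iff:
 assumes \<phi>: "\<phi> \<in> carrier VD"
 shows "\<phi> \<in> pull ` carrier U.VD \<longleftrightarrow> (\<forall>v\<in>kr. \<phi> v = \<zero>)"
proof
 assume "\<phi> \<in> pull ` carrier U.VD"
 then show "\<forall>v\<in>kr. \<phi> v = \<zero>" by (auto simp: fib_def pull_apply U.dual_zero)
next
 assume 0: "\<forall>v\<in>kr. \<phi> v = \<zero>"
 have eq: "\<phi> u = \<phi> v" if uv: "u \<in> carrier V" "v \<in> carrier V" "\<pi> u = \<pi> v" for u v
 proof -
  have "u \<ominus>\<^bsub>V\<^esub> v \<in> kr" using uv \<pi>_closed[OF uv(2)] by (simp add: fib_def \<pi>_minus U.V.M.minus_eq U.V.M.r_neg)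
  then have "\<phi> u \<ominus> \<phi> v = \<zero>" using 0 dual_diff[OF \<phi> uv(1,2)] by simp
  then show ?thesis using \<phi> uv by simp
 qed
 define s where "s u = (SOME v. v \<in> carrier V \<and> \<pi> v = u)" for u
 have s: "s u \<in> carrier V" "\<pi> (s u) = u" if "u \<in> carrier U" for u
  using someI_ex[of "\<lambda>v. v \<in> carrier V \<and> \<pi> v = u"] \<pi>_surj[OF that] by (auto simp: s_def)
 define \<psi> where "\<psi> = restrict (\<lambda>u. \<phi> (s u)) (carrier U)"
 have \<psi>v: "\<psi> (\<pi> v) = \<phi> v" if "v \<in> carrier V" for v
  using that s[OF \<pi>_closed[OF that]] \<pi>_closed[OF that] eq[of "s (\<pi> v)" v] by (simp add: \<psi>_def)
 have "\<psi> \<in> carrier U.VD"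
  unfolding U.in_dual_iff
 proof (intro conjI ballI)
  show "\<psi> \<in> extensional (carrier U)" by (simp add: \<psi>_def)
  show "\<psi> u \<in> carrier K" if "u \<in> carrier U" for u using that s[OF that] \<phi> by (simp add: \<psi>_def)
  show "\<psi> (u \<oplus>\<^bsub>U\<^esub> u') = \<psi> u \<oplus> \<psi> u'" if u: "u \<in> carrier U" "u' \<in> carrier U" for u u'
  proof -
   have "\<psi> (\<pi> (s u \<oplus>\<^bsub>V\<^esub> s u')) = \<phi> (s u) \<oplus> \<phi> (s u')" using s u \<phi> \<psi>v by (simp add: in_dual_iff)
   then show ?thesis using s u by (simp add: \<pi>_add \<psi>_def)
  qed
  show "\<psi> (a \<odot>\<^bsub>U\<^esub> u) = a \<otimes> \<psi> u" if u: "a \<in> carrier K" "u \<in> carrier U" for a u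
  proof -
   have "\<psi> (\<pi> (a \<odot>\<^bsub>V\<^esub> s u)) = a \<otimes> \<phi> (s u)" using s u \<phi> \<psi>v by (simp add: in_dual_iff)
   then show ?thesis using s u by (simp add: \<pi>_smult \<psi>_def)
  qed
 qed
 moreover have "pull \<psi> = \<phi>"
  using \<phi> \<psi>v by (intro extensionalityI[of _ "carrier V"]) (auto simp: dual_map_def in_dual_iff)
 ultimately show "\<phi> \<in> pull ` carrier U.VD" by blast
qed

text \<open>If \<open>\<phi>\<close> does not vanish on the kernel, then the fiber contains a zero of \<open>\<phi>\<close>, and translation by it
 matches the two sums.\<close>

lemma fiber_sum:
 assumes \<phi>: "\<phi> \<in> carrier VD" and w: "w \<in> carrier U"
 shows "(\<Oplus>\<^bsub>W\<^esub>v\<in>fib w. tn n (\<phi> v)) \<ominus>\<^bsub>W\<^esub> (\<Oplus>\<^bsub>W\<^esub>v\<in>kr. tn n (\<phi> v)) =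
   (if \<phi> \<in> pull ` carrier U.VD then add_pow W (p ^ (r * c)) (tn n (the_inv_into (carrier U.VD) pull \<phi> w)) else \<zero>\<^bsub>W\<^esub>)"
proof (cases "\<phi> \<in> pull ` carrier U.VD")
 case True
 then obtain \<psi> where \<psi>: "\<psi> \<in> carrier U.VD" "\<phi> = pull \<psi>" by blast
 have i: "the_inv_into (carrier U.VD) pull \<phi> = \<psi>" using the_inv_into_f_f[OF pull_inj \<psi>(1)] \<psi>(2) by simp
 have \<psi>w: "\<psi> w \<in> carrier K" using \<psi> w by simp
 have "(\<Oplus>\<^bsub>W\<^esub>v\<in>fib w. tn n (\<phi> v)) = (\<Oplus>\<^bsub>W\<^esub>v\<in>fib w. tn n (\<psi> w))"
  using \<psi>w by (intro W.finsum_cong' refl) (auto simp: fib_def \<psi>(2) pull_apply)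
 also have "\<dots> = add_pow W (p ^ (r * c)) (tn n (\<psi> w))"
  using W.add.finprod_const[of "tn n (\<psi> w)" "fib w"] \<psi>w by (simp add: card_fib[OF w])
 finally have "(\<Oplus>\<^bsub>W\<^esub>v\<in>fib w. tn n (\<phi> v)) = add_pow W (p ^ (r * c)) (tn n (\<psi> w))" .
 moreover have "(\<Oplus>\<^bsub>W\<^esub>v\<in>kr. tn n (\<phi> v)) = \<zero>\<^bsub>W\<^esub>"
  using True in_pull_iff[OF \<phi>] by (intro W.finsum_all0) (auto simp: tn_zero)
 ultimately show ?thesis using True i \<psi>w by (simp add: W.minus_eq)
next
 case False
 then obtain x where x: "x \<in> kr" "\<phi> x \<noteq> \<zero>" using in_pull_iff[OF \<phi>] by blast
 have xV: "x \<in> carrier V" using x fib_sub by blast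
 obtain y where y: "y \<in> carrier V" "y = inv (\<phi> x) \<odot>\<^bsub>V\<^esub> x" "\<phi> y = \<one>" using unit_vector[OF \<phi> xV x(2)] by blast
 have ix: "inv (\<phi> x) \<in> carrier K" using x(2) xV \<phi> by (intro inv_closed') simp_all
 have yk: "\<pi> y = \<zero>\<^bsub>U\<^esub>" using x(1) ix xV by (simp add: y(2) \<pi>_smult fib_def)
 obtain v where v: "v \<in> carrier V" "\<pi> v = w" using \<pi>_surj[OF w] by blast
 have fv: "\<phi> v \<in> carrier K" using v \<phi> by simp
 \<comment> \<open>A preimage of w is corrected by a multiple of the kernel vector y with \<phi>(y)
   = 1, which produces a zero of \<phi> in the fiber.\<close>
 let ?v = "v \<ominus>\<^bsub>V\<^esub> \<phi> v \<odot>\<^bsub>V\<^esub> y"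
 have sm: "\<phi> (\<phi> v \<odot>\<^bsub>V\<^esub> y) = \<phi> v \<otimes> \<phi> y" using \<phi> fv y(1) by (simp add: in_dual_iff)
 have v0: "?v \<in> fib w" using v y(1) yk fv w by (simp add: fib_def \<pi>_minus \<pi>_smult U.V.M.minus_eq)
 have \<phi>0: "\<phi> ?v = \<zero>" using dual_diff[OF \<phi> v(1), of "\<phi> v \<odot>\<^bsub>V\<^esub> y"] v y(1,3) fv sm by (simp add: minus_eq r_neg)
 have vV: "?v \<in> carrier V" using v0 fib_sub by blast
 note bij = fib_bij[OF v0]
 have \<phi>K: "tn n (\<phi> u) \<in> carrier W" if "u \<in> fib w'" for u w' using subsetD[OF fib_sub that] \<phi> by simp
 have "(\<Oplus>\<^bsub>W\<^esub>u\<in>fib w. tn n (\<phi> u)) = (\<Oplus>\<^bsub>W\<^esub>u\<in>(\<lambda>u. u \<oplus>\<^bsub>V\<^esub> ?v) ` kr. tn n (\<phi> u))"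
  using bij by (simp add: bij_betw_def)
 also have "\<dots> = (\<Oplus>\<^bsub>W\<^esub>u\<in>kr. tn n (\<phi> (u \<oplus>\<^bsub>V\<^esub> ?v)))"
  using bij \<phi>K by (intro W.add.finprod_reindex) (auto simp: bij_betw_def)
 also have "\<dots> = (\<Oplus>\<^bsub>W\<^esub>u\<in>kr. tn n (\<phi> u))"
 proof (rule W.finsum_cong')
  fix u assume "u \<in> kr"
  then have u: "u \<in> carrier V" using fib_sub by blast
  have "\<phi> (u \<oplus>\<^bsub>V\<^esub> ?v) = \<phi> u \<oplus> \<phi> ?v" using \<phi> u vV unfolding in_dual_iff by blast
  then show "tn n (\<phi> (u \<oplus>\<^bsub>V\<^esub> ?v)) = tn n (\<phi> u)" using u \<phi> by (simp add: \<phi>0)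
 qed (use \<phi>K in auto)
 finally have e: "(\<Oplus>\<^bsub>W\<^esub>v\<in>fib w. tn n (\<phi> v)) = (\<Oplus>\<^bsub>W\<^esub>v\<in>kr. tn n (\<phi> v))" .
 have "(\<Oplus>\<^bsub>W\<^esub>v\<in>kr. tn n (\<phi> v)) \<in> carrier W" using \<phi>K by (intro W.finsum_closed) auto
 then show ?thesis using False by (simp add: e W.minus_eq W.r_neg)
qed

text \<open>After truncation, the factor p^(rc) becomes \<open>witt_shift\<close>, and
  \<open>tn\<close> at level n + rc is \<open>tn\<close> at level n. Both transfers are built on
  this identity.\<close>

lemma fiber_sum_pr:
 assumes \<phi>: "\<phi> \<in> carrier VD" and w: "w \<in> carrier U"
 shows "pr (Suc (n + r * c)) ((\<Oplus>\<^bsub>W\<^esub>v\<in>fib w. tn (n + r * c) (\<phi> v)) \<ominus>\<^bsub>W\<^esub> (\<Oplus>\<^bsub>W\<^esub>v\<in>kr. tn (n + r * c) (\<phi> v))) =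
   (if \<phi> \<in> pull ` carrier U.VD then witt_shift p K (Suc n) (r * c) (pr (Suc n) (tn n (the_inv_into (carrier U.VD) pull \<phi> w)))
   else \<zero>\<^bsub>A (Suc (n + r * c))\<^esub>)"
proof -
 interpret pr: ring_hom_cring W "A (Suc (n + r * c))" "pr (Suc (n + r * c))" by (rule pr_hom)
 have "the_inv_into (carrier U.VD) pull \<phi> w \<in> carrier K" if "\<phi> \<in> pull ` carrier U.VD"
  using the_inv_into_into[OF pull_inj that subset_refl] w by simp
 then show ?thesis
  unfolding fiber_sum[OF assms] by (simp add: shift_pr tn_add_r)
qed

definition DT :: "nat \<Rightarrow> ('k, 'v \<Rightarrow> 'k) omega_elem \<Rightarrow> ('k, 'u \<Rightarrow> 'k) omega_elem" where
 "DT n = desc_transfer p r K n U.VD VD pull"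

text \<open>\<open>omega_lin_exists\<close> is applied to the dual of V. An element of the bidual of
  U is evaluation at some w in U; its functional is the pairing with the fiber of w minus the
  kernel, both moved to the bidual of V, and by \<open>fiber_sum_pr\<close> this has the values that
  the transfer requires.\<close>

lemma DT_props:
 shows "DT n \<in> lin_maps W (OmD (n + r * c)) (U.OmD n)"
  and "\<phi> \<in> carrier VD \<Longrightarrow> DT n (clD (n + r * c) \<phi>) =
   (if \<phi> \<in> pull ` carrier U.VD then U.clD n (the_inv_into (carrier U.VD) pull \<phi>) else \<zero>\<^bsub>U.OmD n\<^esub>)"
proof -
 interpret VD: finite_space K p r VD by (rule finite_space_dual)
 interpret VDD: finite_space K p r VDD by (rule VD.finite_space_dual)
 interpret UD: finite_space K p r U.VD by (rule U.finite_space_dual)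
 interpret UDD: finite_space K p r U.VDD by (rule UD.finite_space_dual)
 interpret OU: Module.module W "U.OmD n" by (rule UD.Om_module)
 let ?n = "n + r * c"
 let ?g = "\<lambda>\<phi>. if \<phi> \<in> pull ` carrier U.VD then U.clD n (the_inv_into (carrier U.VD) pull \<phi>) else \<zero>\<^bsub>U.OmD n\<^esub>"
 have eq: "DT n = omega_lin p K ?n VD (U.OmD n) ?g"
  by (simp add: DT_def desc_transfer_def Let_def dim_dual U.dim_dual dim_diff)
 define w where "w \<psi> = inv_into (carrier U) U.ev \<psi>" for \<psi>
 have w: "w \<psi> \<in> carrier U" "U.ev (w \<psi>) = \<psi>" if "\<psi> \<in> carrier U.VDD" for \<psi>
  using inv_into_into[of \<psi> U.ev "carrier U"] f_inv_into_f[of \<psi> U.ev "carrier U"] that by (simp_all add: w_def U.bidual)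
 have evs: "ev ` T \<subseteq> carrier VDD" if "T \<subseteq> carrier V" for T using that ev_closed by blast
 let ?Y = "\<lambda>\<psi>. VDD.cls_diff ?n (ev ` fib (w \<psi>)) (ev ` kr)"
 note Yc = VDD.cls_diff_closed(1)[OF evs[OF fib_sub] evs[OF fib_sub], of ?n]
 note Y = VDD.Om_full[OF Yc]
 have g: "?g \<phi> \<in> carrier (U.OmD n)" if "\<phi> \<in> carrier VD" for \<phi>
  using UD.cl_closed[OF the_inv_into_into[OF pull_inj _ subset_refl]] by simp
 have re: "(\<Oplus>\<^bsub>W\<^esub>\<chi>\<in>ev ` T. tn ?n (\<chi> \<phi>)) = (\<Oplus>\<^bsub>W\<^esub>v\<in>T. tn ?n (\<phi> v))" if T: "T \<subseteq> carrier V" and \<phi>: "\<phi> \<in> carrier VD" for T \<phi>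
 proof -
  have "(\<Oplus>\<^bsub>W\<^esub>\<chi>\<in>ev ` T. tn ?n (\<chi> \<phi>)) = (\<Oplus>\<^bsub>W\<^esub>v\<in>T. tn ?n (ev v \<phi>))"
   using T \<phi> inj_on_subset[OF inj_ev T] by (intro W.add.finprod_reindex) auto
  then show ?thesis using \<phi> by simp
 qed
 have val: "VD.B ?n (clD ?n \<phi>) (?Y \<psi>) = witt_shift p K (Suc n) (r * c) (UD.B n (?g \<phi>) (UD.clD n \<psi>))"
  if \<psi>: "\<psi> \<in> carrier U.VDD" and \<phi>: "\<phi> \<in> carrier VD" for \<psi> \<phi>
 proof -
  have l: "VD.B ?n (clD ?n \<phi>) (?Y \<psi>) = (if \<phi> \<in> pull ` carrier U.VD then witt_shift p K (Suc n) (r * c) (pr (Suc n) (tn n (the_inv_into (carrier U.VD) pull \<phi> (w \<psi>))))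
   else \<zero>\<^bsub>A (Suc ?n)\<^esub>)"
   unfolding VD.B_cls_diff_right[OF evs[OF fib_sub] evs[OF fib_sub] \<phi>] re[OF fib_sub \<phi>]
   by (rule fiber_sum_pr[OF \<phi> w(1)[OF \<psi>]])
  show ?thesis
  proof (cases "\<phi> \<in> pull ` carrier U.VD")
   case True
   let ?i = "the_inv_into (carrier U.VD) pull \<phi>"
   have i: "?i \<in> carrier U.VD" by (rule the_inv_into_into[OF pull_inj True subset_refl])
   have "\<psi> ?i = ?i (w \<psi>)" using U.ev_apply[OF i, of "w \<psi>"] w(2)[OF \<psi>] by simp
   then show ?thesis using True UD.B_cl[OF i \<psi>, of n] unfolding l by simp
  next
   case False
   then show ?thesis using UD.B_left(4)[OF OU.M.zero_closed UDD.Om_full[OF UDD.cl_closed[OF \<psi>]]] shift_zero[of "Suc n" "r * c"]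
    unfolding l by simp
  qed
 qed
 note L = VD.omega_lin_exists[where U=U.VD and n="?n" and n'=n and m="Suc n + r * c" and g="?g" and S="witt_shift p K (Suc n) (r * c)" and \<Lambda>="\<lambda>\<psi> Z. VD.B ?n Z (?Y \<psi>)"]
 have L': "Suc n + r * c = Suc ?n" by simp
 show "DT n \<in> lin_maps W (OmD (n + r * c)) (U.OmD n)"
  unfolding eq by (rule L(1)[OF U.finite_space_dual g shift_closed shift_add shift_smult shift_inj, unfolded L'])
   (use VD.B_left[OF _ Y] val in simp_all)
 show "DT n (clD (n + r * c) \<phi>) = ?g \<phi>" if "\<phi> \<in> carrier VD"
  unfolding eq by (rule L(2)[OF U.finite_space_dual g shift_closed shift_add shift_smult shift_inj, unfolded L'])
   (use VD.B_left[OF _ Y] val that in simp_all)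
qed

text \<open>The definite description needs a witness for every x. For the class of w it is the fiber
  sum minus the kernel sum, checked on classes of forms by \<open>fiber_sum_pr\<close>; witnesses
  add and scale along with x, and uniqueness is nondegeneracy.\<close>

lemma asc_transfer_props:
 assumes x: "x \<in> carrier (U.Om n)"
 shows "asc_transfer p r K n V U \<pi> x \<in> carrier (Om (n + r * c))"
  and "\<phi> \<in> carrier VD \<Longrightarrow> B (n + r * c) (asc_transfer p r K n V U \<pi> x) (clD (n + r * c) \<phi>) =
   (if \<phi> \<in> pull ` carrier U.VD then witt_shift p K (Suc n) (r * c) (U.B n x (U.clD n (the_inv_into (carrier U.VD) pull \<phi>)))
    else \<zero>\<^bsub>A (Suc (n + r * c))\<^esub>)"
proof -
 interpret VD: finite_space K p r VD by (rule finite_space_dual)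
 interpret UD: finite_space K p r U.VD by (rule U.finite_space_dual)
 interpret O: Module.module W "Om (n + r * c)" by (rule Om_module)
 interpret OD: Module.module W "OmD (n + r * c)" by (rule VD.Om_module)
 interpret OU: Module.module W "U.Om n" by (rule U.Om_module)
 interpret OUD: Module.module W "U.OmD n" by (rule UD.Om_module)
 let ?n = "n + r * c"
 let ?S = "witt_shift p K (Suc n) (r * c)"
 have S: "?S a \<oplus>\<^bsub>A (Suc ?n)\<^esub> ?S b = ?S (a \<oplus>\<^bsub>A (Suc n)\<^esub> b)" "pr (Suc ?n) t \<otimes>\<^bsub>A (Suc ?n)\<^esub> ?S a = ?S (pr (Suc n) t \<otimes>\<^bsub>A (Suc n)\<^esub> a)"
  "?S \<zero>\<^bsub>A (Suc n)\<^esub> = \<zero>\<^bsub>A (Suc ?n)\<^esub>"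
  if "a \<in> carrier (A (Suc n))" "b \<in> carrier (A (Suc n))" "t \<in> carrier W" for a b t
  using shift_add[OF that(1,2), of "r * c"] shift_smult[OF that(3,1), of "r * c"] shift_zero[of "Suc n" "r * c"] by simp_all
 have S0: "?S \<zero>\<^bsub>A (Suc n)\<^esub> = \<zero>\<^bsub>A (Suc ?n)\<^esub>" using shift_zero[of "Suc n" "r * c"] by simp
 note hom = DT_props(1)[of n]
 have DTc: "DT n y \<in> carrier (U.OmD n)" if "y \<in> carrier (OmD ?n)" for y
  using funcset_mem[OF LinearCombinations.module_hom_closed[OF hom] that] .
 have DT0: "DT n \<zero>\<^bsub>OmD ?n\<^esub> = \<zero>\<^bsub>U.OmD n\<^esub>"
  using LinearCombinations.module_hom_smult[OF hom W.zero_closed OD.M.zero_closed] DTc[OF OD.M.zero_closed] by simp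
 have Bc: "U.B n x (DT n y) \<in> carrier (A (Suc n))" if "x \<in> carrier (U.Om n)" "y \<in> carrier (OmD ?n)" for x y
  by (rule U.B_right(1)[OF that(1) DTc[OF that(2)]])
 let ?P = "\<lambda>x z. z \<in> carrier (Om ?n) \<and> (\<forall>y\<in>carrier (OmD ?n). B ?n z y = ?S (U.B n x (DT n y)))"
 have "\<exists>z. ?P x z"
 proof (rule U.Om_induct[OF x])
  fix w assume w: "w \<in> carrier U"
  let ?z = "cls_diff ?n (fib w) kr"
  have zc: "?z \<in> carrier (Om ?n)" by (rule cls_diff_closed(1)[OF fib_sub fib_sub])
  note cw = U.cl_closed[OF w, of n]
  have "B ?n ?z y = ?S (U.B n (U.cl n w) (DT n y))" if y: "y \<in> carrier (OmD ?n)" for y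
  proof (rule VD.Om_induct[OF y])
   fix \<phi> assume \<phi>: "\<phi> \<in> carrier VD"
   show "B ?n ?z (clD ?n \<phi>) = ?S (U.B n (U.cl n w) (DT n (clD ?n \<phi>)))"
    unfolding B_cls_diff_left[OF fib_sub fib_sub \<phi>] fiber_sum_pr[OF \<phi> w] DT_props(2)[OF \<phi>]
    using U.B_cl[OF w the_inv_into_into[OF pull_inj _ subset_refl], of \<phi> n] U.B_right(4)[OF cw OUD.M.zero_closed] S0 by simp
  next
   show "B ?n ?z \<zero>\<^bsub>OmD ?n\<^esub> = ?S (U.B n (U.cl n w) (DT n \<zero>\<^bsub>OmD ?n\<^esub>))"
    unfolding DT0 U.B_right(4)[OF cw OUD.M.zero_closed] B_right(4)[OF zc OD.M.zero_closed] S0 ..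
  next
   fix y y' assume yy: "y \<in> carrier (OmD ?n)" "y' \<in> carrier (OmD ?n)"
    and "B ?n ?z y = ?S (U.B n (U.cl n w) (DT n y))" "B ?n ?z y' = ?S (U.B n (U.cl n w) (DT n y'))"
   then show "B ?n ?z (y \<oplus>\<^bsub>OmD ?n\<^esub> y') = ?S (U.B n (U.cl n w) (DT n (y \<oplus>\<^bsub>OmD ?n\<^esub> y')))"
    unfolding B_right(2)[OF zc yy] LinearCombinations.module_hom_add[OF hom yy] U.B_right(2)[OF cw DTc[OF yy(1)] DTc[OF yy(2)]]
    by (simp add: S(1)[OF Bc[OF cw yy(1)] Bc[OF cw yy(2)] W.zero_closed])
  next
   fix a y assume a: "a \<in> carrier W" and yy: "y \<in> carrier (OmD ?n)"
    and "B ?n ?z y = ?S (U.B n (U.cl n w) (DT n y))"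
   then show "B ?n ?z (a \<odot>\<^bsub>OmD ?n\<^esub> y) = ?S (U.B n (U.cl n w) (DT n (a \<odot>\<^bsub>OmD ?n\<^esub> y)))"
    unfolding B_right(3)[OF zc yy a] LinearCombinations.module_hom_smult[OF hom a yy] U.B_right(3)[OF cw DTc[OF yy] a]
    by (simp add: S(2)[OF Bc[OF cw yy] Bc[OF cw yy] a])
  qed
  then show "\<exists>z. ?P (U.cl n w) z" using zc by (intro exI[of _ ?z]) simp
 next
  have "B ?n \<zero>\<^bsub>Om ?n\<^esub> y = ?S (U.B n \<zero>\<^bsub>U.Om n\<^esub> (DT n y))" if y: "y \<in> carrier (OmD ?n)" for y
   unfolding B_left(4)[OF O.M.zero_closed VD.Om_full[OF y]] U.B_left(4)[OF OU.M.zero_closed UD.Om_full[OF DTc[OF y]]] S0 ..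
  then show "\<exists>z. ?P \<zero>\<^bsub>U.Om n\<^esub> z" by (intro exI[of _ "\<zero>\<^bsub>Om ?n\<^esub>"]) simp
 next
  fix x x' assume xx: "x \<in> carrier (U.Om n)" "x' \<in> carrier (U.Om n)" and "\<exists>z. ?P x z" and ex': "\<exists>z. ?P x' z"
  then obtain z where z: "z \<in> carrier (Om ?n)" "\<And>y. y \<in> carrier (OmD ?n) \<Longrightarrow> B ?n z y = ?S (U.B n x (DT n y))" by auto
  obtain z' where z': "z' \<in> carrier (Om ?n)" "\<And>y. y \<in> carrier (OmD ?n) \<Longrightarrow> B ?n z' y = ?S (U.B n x' (DT n y))" using ex' by auto
  have "B ?n (z \<oplus>\<^bsub>Om ?n\<^esub> z') y = ?S (U.B n (x \<oplus>\<^bsub>U.Om n\<^esub> x') (DT n y))" if y: "y \<in> carrier (OmD ?n)" for y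
   unfolding B_left(2)[OF z(1) VD.Om_full[OF y] z'(1)] U.B_left(2)[OF xx(1) UD.Om_full[OF DTc[OF y]] xx(2)] z(2)[OF y] z'(2)[OF y]
   by (rule S(1)[OF Bc[OF xx(1) y] Bc[OF xx(2) y] W.zero_closed])
  then show "\<exists>z. ?P (x \<oplus>\<^bsub>U.Om n\<^esub> x') z" using z(1) z'(1) by (intro exI[of _ "z \<oplus>\<^bsub>Om ?n\<^esub> z'"]) simp
 next
  fix a x assume a: "a \<in> carrier W" and xx: "x \<in> carrier (U.Om n)" and "\<exists>z. ?P x z"
  then obtain z where z: "z \<in> carrier (Om ?n)" "\<And>y. y \<in> carrier (OmD ?n) \<Longrightarrow> B ?n z y = ?S (U.B n x (DT n y))" by auto
  have "B ?n (a \<odot>\<^bsub>Om ?n\<^esub> z) y = ?S (U.B n (a \<odot>\<^bsub>U.Om n\<^esub> x) (DT n y))" if y: "y \<in> carrier (OmD ?n)" for y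
   unfolding B_left(3)[OF z(1) VD.Om_full[OF y] a] U.B_left(3)[OF xx UD.Om_full[OF DTc[OF y]] a] z(2)[OF y]
   by (rule S(2)[OF Bc[OF xx y] Bc[OF xx y] a])
  then show "\<exists>z. ?P (a \<odot>\<^bsub>U.Om n\<^esub> x) z" using z(1) a by (intro exI[of _ "a \<odot>\<^bsub>Om ?n\<^esub> z"]) simp
 qed
 then obtain z where z: "?P x z" by (elim exE)
 have "asc_transfer p r K n V U \<pi> x = (THE z. ?P x z)"
  by (simp add: asc_transfer_def Let_def c_def fib_def DT_def)
 also have "\<dots> = z"
 proof (rule the_equality)
  show "?P x z" by (rule z)
  fix z' assume z': "?P x z'"
  show "z' = z"
  proof (rule Om_eqI)
   show "z' \<in> carrier (Om ?n)" using z' by (rule conjunct1)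
   show "z \<in> carrier (Om ?n)" using z by (rule conjunct1)
   fix \<phi> assume "\<phi> \<in> carrier VD"
   note cl = VD.cl_closed[OF this, of ?n]
   show "B ?n z' (clD ?n \<phi>) = B ?n z (clD ?n \<phi>)"
    using bspec[OF conjunct2[OF z'] cl] bspec[OF conjunct2[OF z] cl] by simp
  qed
 qed
 finally have e: "asc_transfer p r K n V U \<pi> x = z" .
 show "asc_transfer p r K n V U \<pi> x \<in> carrier (Om (n + r * c))" using z by (simp add: e)
 show "\<phi> \<in> carrier VD \<Longrightarrow> B (n + r * c) (asc_transfer p r K n V U \<pi> x) (clD (n + r * c) \<phi>) =
   (if \<phi> \<in> pull ` carrier U.VD then ?S (U.B n x (U.clD n (the_inv_into (carrier U.VD) pull \<phi>))) else \<zero>\<^bsub>A (Suc (n + r * c))\<^esub>)"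
  using z VD.cl_closed[of \<phi> ?n] U.B_right(4)[OF x OUD.M.zero_closed] S0 by (simp add: e DT_props(2))
qed

text \<open>The functionals for \<open>omega_lin_exists\<close> are the pairings with pullbacks of
  forms. The truncation does not change, so the embedding there is the identity.\<close>

lemma omega_map_props:
 assumes x: "x \<in> carrier (Om n)"
 shows "omega_map p K n V U \<pi> x \<in> carrier (U.Om n)"
  and "\<psi> \<in> carrier U.VD \<Longrightarrow> U.B n (omega_map p K n V U \<pi> x) (U.clD n \<psi>) = B n x (clD n (pull \<psi>))"
proof -
 interpret VD: finite_space K p r VD by (rule finite_space_dual)
 note Y = VD.Om_full[OF VD.cl_closed[OF pull_closed]]
 have v: "B n (cl n v) (clD n (pull \<psi>)) = U.B n (U.cl n (\<pi> v)) (U.clD n \<psi>)" if "\<psi> \<in> carrier U.VD" "v \<in> carrier V" for \<psi> v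
  unfolding B_cl[OF that(2) pull_closed[OF that(1)]] U.B_cl[OF \<pi>_closed[OF that(2)] that(1)] by (simp add: pull_apply that)
 note L = omega_lin_exists[where U=U and n=n and n'=n and m="Suc n" and g="\<lambda>v. U.cl n (\<pi> v)" and S="\<lambda>x. x" and \<Lambda>="\<lambda>\<psi> Z. B n Z (clD n (pull \<psi>))"]
 have "omega_lin p K n V (U.Om n) (\<lambda>v. U.cl n (\<pi> v)) \<in> lin_maps W (Om n) (U.Om n)"
  by (rule L(1)[OF U.finite_space_axioms U.cl_closed[OF \<pi>_closed]]) (use B_left[OF _ Y] v in simp_all)
 then show "omega_map p K n V U \<pi> x \<in> carrier (U.Om n)"
  unfolding omega_map_def using funcset_mem[OF LinearCombinations.module_hom_closed x] by blast
 show "U.B n (omega_map p K n V U \<pi> x) (U.clD n \<psi>) = B n x (clD n (pull \<psi>))" if "\<psi> \<in> carrier U.VD"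
  unfolding omega_map_def
  by (rule L(3)[OF U.finite_space_axioms U.cl_closed[OF \<pi>_closed]]) (use B_left[OF _ Y] v x that in simp_all)
qed

text \<open>If \<phi> is the pullback of \<psi>, the transfer pairs the image of x with \<psi>, and
  moving the image across the pairing gives back the pullback of \<psi>, which is \<phi>.\<close>

lemma asc_omega_map:
 assumes x: "x \<in> carrier (Om n)"
 shows "asc_transfer p r K n V U \<pi> (omega_map p K n V U \<pi> x) \<in> carrier (Om (n + r * c))"
  and "\<phi> \<in> carrier VD \<Longrightarrow> B (n + r * c) (asc_transfer p r K n V U \<pi> (omega_map p K n V U \<pi> x)) (clD (n + r * c) \<phi>) =
   (if \<forall>v\<in>kr. \<phi> v = \<zero> then witt_shift p K (Suc n) (r * c) (B n x (clD n \<phi>)) else \<zero>\<^bsub>A (Suc (n + r * c))\<^esub>)"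
proof -
 note o = omega_map_props[OF x] and a = asc_transfer_props[OF omega_map_props(1)[OF x]]
 show "asc_transfer p r K n V U \<pi> (omega_map p K n V U \<pi> x) \<in> carrier (Om (n + r * c))" by (rule a(1))
 show "B (n + r * c) (asc_transfer p r K n V U \<pi> (omega_map p K n V U \<pi> x)) (clD (n + r * c) \<phi>) =
   (if \<forall>v\<in>kr. \<phi> v = \<zero> then witt_shift p K (Suc n) (r * c) (B n x (clD n \<phi>)) else \<zero>\<^bsub>A (Suc (n + r * c))\<^esub>)"
  if \<phi>: "\<phi> \<in> carrier VD"
  unfolding a(2)[OF \<phi>] in_pull_iff[OF \<phi>, symmetric]
  using o(2)[OF the_inv_into_into[OF pull_inj _ subset_refl], of \<phi>] f_the_inv_into_f[OF pull_inj, of \<phi>] by simp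
qed

end

section \<open>The Verschiebung and the sum over subspaces\<close>

context finite_space
begin

text \<open>The functional at \<phi> is the shifted pairing with the class of \<phi> at level n. It
  has the required value on classes of vectors since \<open>tn\<close> agrees at the two
  levels.\<close>

lemma Ver_props:
 assumes x: "x \<in> carrier (Om n)"
 shows "Ver p r K m n V x \<in> carrier (Om (n + m * r))"
  and "\<phi> \<in> carrier VD \<Longrightarrow> B (n + m * r) (Ver p r K m n V x) (clD (n + m * r) \<phi>) = witt_shift p K (Suc n) (m * r) (B n x (clD n \<phi>))"
proof -
 interpret VD: finite_space K p r VD by (rule finite_space_dual)
 let ?n = "n + m * r"
 interpret O: Module.module W "Om ?n" by (rule Om_module)
 interpret pr: ring_hom_cring W "A (Suc ?n)" "pr (Suc ?n)" by (rule pr_hom)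
 let ?S = "witt_shift p K (Suc n) (m * r)"
 let ?g = "\<lambda>v. add_pow (Om ?n) (p ^ (m * r)) (cl ?n v)"
 note Y = VD.Om_full[OF VD.cl_closed]
 have gc: "?g v \<in> carrier (Om ?n)" if "v \<in> carrier V" for v using cl_closed[OF that] by simp
 have Bp: "B ?n (add_pow (Om ?n) (k::nat) Z) Y = add_pow (A (Suc ?n)) k (B ?n Z Y)"
  if Z: "Z \<in> carrier (Om ?n)" and Y: "Y \<in> carrier (Omega_full p K ?n VD)" for k Z Y
  by (induction k) (use B_left(4)[OF Z Y] B_left(2)[OF O.M.add.nat_pow_closed[OF Z] Y Z] in simp_all)
 have v: "?S (B n (cl n v) (clD n \<psi>)) = B ?n (?g v) (clD ?n \<psi>)" if \<psi>: "\<psi> \<in> carrier VD" and v: "v \<in> carrier V" for \<psi> v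
 proof -
  have \<psi>v: "\<psi> v \<in> carrier K" using \<psi> v by simp
  have "B ?n (?g v) (clD ?n \<psi>) = add_pow (A (Suc ?n)) (p ^ (m * r)) (pr (Suc ?n) (tn ?n (\<psi> v)))"
   unfolding Bp[OF cl_closed[OF v] Y[OF \<psi>]] B_cl[OF v \<psi>] ..
  also have "\<dots> = pr (Suc ?n) (add_pow W (p ^ (m * r)) (tn n (\<psi> v)))"
   using tn_add_r[OF \<psi>v, of n m] \<psi>v by (simp add: pr_add_pow mult.commute)
  also have "\<dots> = ?S (B n (cl n v) (clD n \<psi>))"
   unfolding B_cl[OF v \<psi>] shift_pr[OF tn_closed[OF \<psi>v]] by simp
  finally show ?thesis by simp
 qed
 note sh = shift_closed[of _ "Suc n" "m * r"] shift_add[of _ "Suc n" _ "m * r"] shift_smult[of _ _ "Suc n" "m * r"]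
 note L = omega_lin_exists[where U=V and n=n and n'="?n" and m="Suc ?n" and g="?g" and S="\<lambda>x. x" and \<Lambda>="\<lambda>\<psi> Z. ?S (B n Z (clD n \<psi>))"]
 have "omega_lin p K n V (Om ?n) ?g \<in> lin_maps W (Om n) (Om ?n)"
  by (rule L(1)[OF finite_space_axioms gc]) (use B_left[OF _ Y] v sh in simp_all)
 then show "Ver p r K m n V x \<in> carrier (Om (n + m * r))"
  unfolding Ver_def using funcset_mem[OF LinearCombinations.module_hom_closed x] by blast
 show "B ?n (Ver p r K m n V x) (clD ?n \<phi>) = ?S (B n x (clD n \<phi>))" if "\<phi> \<in> carrier VD"
  unfolding Ver_def
  by (rule L(3)[OF finite_space_axioms gc]) (use B_left[OF _ Y] v sh x that in simp_all)
qed

lemma quotient_surjection: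
 assumes U: "U \<in> Gr K m V"
 shows "surjection K p r V (quot_module V U) (\<lambda>v. U +>\<^bsub>V\<^esub> v)"
  and "{v \<in> carrier V. U +>\<^bsub>V\<^esub> v = \<zero>\<^bsub>quot_module V U\<^esub>} = U"
proof -
 have sub: "VectorSpace.subspace K U V" using U by (simp add: Gr_eq)
 then have sm: "submodule K U V" by (simp add: VectorSpace.subspace_def)
 have pm: "plain_module K V" by (rule plain_module.intro[OF V.module_axioms])
 note qb = plain_module.quot_module_basics[OF pm sm]
 have "vectorspace K (quot_module V U)"
  using plain_module.module_quot_module[OF pm sm] field_K by (simp add: vectorspace_def)
 then have "finite_space K p r (quot_module V U)"
  using finite_V by (intro finite_space.intro finite_space_axioms.intro finite_witt_axioms) (simp_all add: qb(1))
 then show "surjection K p r V (quot_module V U) (\<lambda>v. U +>\<^bsub>V\<^esub> v)"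
  by (intro surjection.intro surjection_axioms.intro finite_space_axioms) (auto simp: qb(1,2,4))
 have "v \<ominus>\<^bsub>V\<^esub> \<zero>\<^bsub>V\<^esub> = v" if "v \<in> carrier V" for v using that by (simp add: V.M.minus_eq)
 then show "{v \<in> carrier V. U +>\<^bsub>V\<^esub> v = \<zero>\<^bsub>quot_module V U\<^esub>} = U"
  using qb(5)[OF _ V.M.zero_closed] sub by (auto simp: qb(3) subspace_iff)
qed

text \<open>The zero form vanishes on every subspace, so its terms in the sum are counted by all of
  \<open>Gr K m V\<close> instead of by the subspaces of a hyperplane. The vanishing of its pairing
  makes the different count harmless.\<close>

lemma B_zero_class: "x \<in> carrier (Om n) \<Longrightarrow> B n x (clD n \<zero>\<^bsub>VD\<^esub>) = \<zero>\<^bsub>A (Suc n)\<^esub>"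
proof -
 interpret VD: finite_space K p r VD by (rule finite_space_dual)
 interpret pr: ring_hom_cring W "A (Suc n)" "pr (Suc n)" by (rule pr_hom)
 note Y = VD.Om_full[OF VD.cl_closed[OF VD.V.M.zero_closed, of n]]
 assume x: "x \<in> carrier (Om n)"
 show ?thesis
 proof (rule Om_induct[OF x])
  show "B n (cl n v) (clD n \<zero>\<^bsub>VD\<^esub>) = \<zero>\<^bsub>A (Suc n)\<^esub>" if "v \<in> carrier V" for v
   using B_cl[OF that VD.V.M.zero_closed] that by (simp add: dual_simps tn_zero)
  show "B n \<zero>\<^bsub>Om n\<^esub> (clD n \<zero>\<^bsub>VD\<^esub>) = \<zero>\<^bsub>A (Suc n)\<^esub>" by (rule B_left(4)[OF x Y])
 qed (simp_all add: B_left(2,3)[OF _ Y])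
qed

text \<open>For nonzero \<phi> every subspace inside ker \<phi> contributes the pairing of the
  Verschiebung. The number of these subspaces is congruent to 1 modulo p^r by
  \<open>gauss_binomial_mod\<close>, which rests on the upper bound for m, so it is a unit of the
  Witt vectors.\<close>

lemma verschiebung_integral:
 assumes m: "1 \<le> m" "m \<le> V.dim - 1" and x: "x \<in> carrier (Om n)"
 shows "inv\<^bsub>W\<^esub> (add_pow W (card (Gr_std K m (V.dim - 1))) \<one>\<^bsub>W\<^esub>) \<odot>\<^bsub>Om (n + m * r)\<^esub>
   (\<Oplus>\<^bsub>Om (n + m * r)\<^esub>U\<in>Gr K m V. asc_transfer p r K n V (quot_module V U) (\<lambda>v. U +>\<^bsub>V\<^esub> v)
    (omega_map p K n V (quot_module V U) (\<lambda>v. U +>\<^bsub>V\<^esub> v) x)) = Ver p r K m n V x"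
proof -
 interpret VD: finite_space K p r VD by (rule finite_space_dual)
 let ?n = "n + m * r"
 interpret A: cring "A (Suc ?n)" by (rule cring_A)
 interpret O: Module.module W "Om ?n" by (rule Om_module)
 interpret pr: ring_hom_cring W "A (Suc ?n)" "pr (Suc ?n)" by (rule pr_hom)
 let ?T = "\<lambda>U. asc_transfer p r K n V (quot_module V U) (\<lambda>v. U +>\<^bsub>V\<^esub> v) (omega_map p K n V (quot_module V U) (\<lambda>v. U +>\<^bsub>V\<^esub> v) x)"
 let ?S = "witt_shift p K (Suc n) (m * r)"
 define N where "N = card (Gr_std K m (V.dim - 1))"
 define u where "u = add_pow W N \<one>\<^bsub>W\<^esub>"
 have T: "?T U \<in> carrier (Om ?n)" "\<phi> \<in> carrier VD \<Longrightarrow> B ?n (?T U) (clD ?n \<phi>) =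
   (if \<forall>v\<in>U. \<phi> v = \<zero> then ?S (B n x (clD n \<phi>)) else \<zero>\<^bsub>A (Suc ?n)\<^esub>)" if U: "U \<in> Gr K m V" for U \<phi>
 proof -
  interpret s: surjection K p r V "quot_module V U" "\<lambda>v. U +>\<^bsub>V\<^esub> v" by (rule quotient_surjection(1)[OF U])
  have k: "s.kr = U" using quotient_surjection(2)[OF U] by (simp add: s.fib_def)
  have "s.c = m" unfolding s.c_def k using U by (simp add: Gr_def)
  then have nn: "n + r * s.c = ?n" "r * s.c = m * r" by simp_all
  show "?T U \<in> carrier (Om ?n)" using s.asc_omega_map(1)[OF x] unfolding nn .
  show "\<phi> \<in> carrier VD \<Longrightarrow> B ?n (?T U) (clD ?n \<phi>) = (if \<forall>v\<in>U. \<phi> v = \<zero> then ?S (B n x (clD n \<phi>)) else \<zero>\<^bsub>A (Suc ?n)\<^esub>)"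
   using s.asc_omega_map(2)[OF x, of \<phi>] unfolding nn k .
 qed
 have fin: "finite (Gr K m V)"
  by (rule finite_subset[of _ "Pow (carrier V)"]) (auto simp: Gr_eq subspace_iff finite_V)
 have uW: "u \<in> carrier W" by (simp add: u_def)
 obtain k where N: "N = 1 + p ^ r * k" using gauss_binomial_mod[OF m(2), of "p ^ r"] by (auto simp: N_def card_Gr_std)
 have "p dvd p ^ r * k" using dvd_power[of r p] r_pos by (intro dvd_mult2) simp
 then have "p dvd N \<longleftrightarrow> p dvd 1" unfolding N by (rule dvd_add_left_iff)
 then have nd: "\<not> p dvd N" using prime_gt_1_nat[OF p] by simp
 interpret c0: ring_hom_cring W K "\<lambda>u. u 0" by (intro ring_hom_cringI W.is_cring is_cring component0_hom)
 have "(add_pow W k \<one>\<^bsub>W\<^esub>) 0 = add_pow K k \<one>" for k :: nat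
  by (induction k) simp_all
 then have "u 0 \<noteq> \<zero>" using add_pow_one_nonzero[OF nd] by (simp add: u_def)
 then have "u \<in> Units W" by (rule Units_W[OF uW])
 then have iu: "inv\<^bsub>W\<^esub> u \<in> carrier W" "inv\<^bsub>W\<^esub> u \<otimes>\<^bsub>W\<^esub> u = \<one>\<^bsub>W\<^esub>" by simp_all
 let ?Z = "\<Oplus>\<^bsub>Om ?n\<^esub>U\<in>Gr K m V. ?T U"
 have Zc: "?Z \<in> carrier (Om ?n)" using T(1) by (intro O.M.finsum_closed) auto
 note V' = Ver_props[OF x, where m=m]
 have "inv\<^bsub>W\<^esub> u \<odot>\<^bsub>Om ?n\<^esub> ?Z = Ver p r K m n V x"
 proof (rule Om_eqI)
  show "inv\<^bsub>W\<^esub> u \<odot>\<^bsub>Om ?n\<^esub> ?Z \<in> carrier (Om ?n)" using iu(1) Zc by simp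
  show "Ver p r K m n V x \<in> carrier (Om ?n)" by (rule V'(1))
  fix \<phi> assume \<phi>: "\<phi> \<in> carrier VD"
  note Y = VD.Om_full[OF VD.cl_closed[OF \<phi>, of ?n]]
  let ?s = "?S (B n x (clD n \<phi>))"
  have s: "?s \<in> carrier (A (Suc ?n))"
   using shift_closed[OF B_left(1)[OF x VD.Om_full[OF VD.cl_closed[OF \<phi>]]], of "m * r"] by simp
  have "B ?n ?Z (clD ?n \<phi>) = (\<Oplus>\<^bsub>A (Suc ?n)\<^esub>U\<in>Gr K m V. B ?n (?T U) (clD ?n \<phi>))"
   by (rule B_finsum_left[OF fin T(1) Y])
  also have "\<dots> = (\<Oplus>\<^bsub>A (Suc ?n)\<^esub>U\<in>Gr K m V. if \<forall>v\<in>U. \<phi> v = \<zero> then ?s else \<zero>\<^bsub>A (Suc ?n)\<^esub>)"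
   using T(2)[OF _ \<phi>] s by (intro A.finsum_cong') auto
  also have "\<dots> = add_pow (A (Suc ?n)) (card {U \<in> Gr K m V. \<forall>v\<in>U. \<phi> v = \<zero>}) ?s"
   by (rule finsum_if_const[OF fin s])
  also have "\<dots> = add_pow (A (Suc ?n)) N ?s"
  proof (cases "\<forall>v\<in>carrier V. \<phi> v = \<zero>")
   case True
   then have "\<phi> = \<zero>\<^bsub>VD\<^esub>" using \<phi> by (intro extensionalityI[of _ "carrier V"]) (auto simp: dual_simps in_dual_iff)
   then have "?s = \<zero>\<^bsub>A (Suc ?n)\<^esub>" using B_zero_class[OF x] shift_zero[of "Suc n" "m * r"] by simp
   then show ?thesis by simp
  next
   case False
   then obtain y where "y \<in> carrier V" "\<phi> y \<noteq> \<zero>" by blast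
   then show ?thesis using card_Gr_kernel[OF \<phi>] by (simp add: N_def card_Gr_std)
  qed
  also have "\<dots> = pr (Suc ?n) u \<otimes>\<^bsub>A (Suc ?n)\<^esub> ?s"
   using s by (simp add: u_def pr_add_pow A.add_pow_ldistr)
  finally have Z: "B ?n ?Z (clD ?n \<phi>) = pr (Suc ?n) u \<otimes>\<^bsub>A (Suc ?n)\<^esub> ?s" .
  have "B ?n (inv\<^bsub>W\<^esub> u \<odot>\<^bsub>Om ?n\<^esub> ?Z) (clD ?n \<phi>) = pr (Suc ?n) (inv\<^bsub>W\<^esub> u) \<otimes>\<^bsub>A (Suc ?n)\<^esub> (pr (Suc ?n) u \<otimes>\<^bsub>A (Suc ?n)\<^esub> ?s)"
   unfolding B_left(3)[OF Zc Y iu(1)] Z ..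
  also have "\<dots> = pr (Suc ?n) (inv\<^bsub>W\<^esub> u \<otimes>\<^bsub>W\<^esub> u) \<otimes>\<^bsub>A (Suc ?n)\<^esub> ?s"
   using iu(1) uW s by (simp add: A.m_assoc)
  also have "\<dots> = ?s" unfolding iu(2) using s by simp
  finally show "B ?n (inv\<^bsub>W\<^esub> u \<odot>\<^bsub>Om ?n\<^esub> ?Z) (clD ?n \<phi>) = B ?n (Ver p r K m n V x) (clD ?n \<phi>)"
   unfolding V'(2)[OF \<phi>] .
 qed
 then show ?thesis by (simp only: u_def N_def)
qed

end

theorem proposition13p12:
  fixes p r n m :: nat
    and K :: "'k ring"
    and V :: "('k, 'v) module"
  assumes "prime p"
    and "field K" and "finite (carrier K)" and "card (carrier K) = p ^ r"
    and "n \<ge> 1"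
    and "vectorspace K V" and "vectorspace.fin_dim K V" and "carrier V \<noteq> {\<zero>\<^bsub>V\<^esub>}"
    and "1 \<le> m" and "m \<le> vectorspace.dim K V - 1"
  shows "\<forall>x\<in>carrier (Omega p K n V).
    inv\<^bsub>witt_ring p K\<^esub>
      (add_pow (witt_ring p K) (card (Gr_std K m (vectorspace.dim K V - 1))) \<one>\<^bsub>witt_ring p K\<^esub>)
    \<odot>\<^bsub>Omega p K (n + m * r) V\<^esub>
      (\<Oplus>\<^bsub>Omega p K (n + m * r) V\<^esub>W\<in>Gr K m V.
         asc_transfer p r K n V (quot_module V W) (\<lambda>v. W +>\<^bsub>V\<^esub> v)
           (omega_map p K n V (quot_module V W) (\<lambda>v. W +>\<^bsub>V\<^esub> v) x))
    = Ver p r K m n V x"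
proof
 interpret K: field K by fact
 interpret V: vectorspace K V by fact
 have pc: "plain_cring K" by (rule plain_cring.intro) (rule K.is_cring)
 \<comment> \<open>Finite dimension over a finite field means finitely many vectors: V is the image
   of the finite set of coefficient functions on a basis.\<close>
 obtain B where B: "finite B" "B \<subseteq> carrier V" "\<forall>v. v \<in> carrier V \<longrightarrow> (\<exists>!a. a \<in> B \<rightarrow>\<^sub>E carrier K \<and> V.lincomb a B = v)"
  using V.finite_basis_exists[OF assms(7)] V.basis_criterion V.basis_def by metis
 have "finite ((\<lambda>a. V.lincomb a B) ` (B \<rightarrow>\<^sub>E carrier K))" using B(1) assms(3) by (intro finite_imageI finite_PiE) auto
 moreover have "carrier V \<subseteq> (\<lambda>a. V.lincomb a B) ` (B \<rightarrow>\<^sub>E carrier K)"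
 proof
  fix v assume "v \<in> carrier V"
  then have "\<exists>a. a \<in> B \<rightarrow>\<^sub>E carrier K \<and> V.lincomb a B = v" using B(3) by (blast intro: ex1_implies_ex)
  then show "v \<in> (\<lambda>a. V.lincomb a B) ` (B \<rightarrow>\<^sub>E carrier K)" by (elim exE conjE) (rule image_eqI, auto)
 qed
 ultimately have fV: "finite (carrier V)" by (rule finite_subset[rotated])
 have "finite_space K p r V"
  by (intro finite_space.intro finite_space_axioms.intro finite_witt.intro finite_witt_axioms.intro witt.intro witt_axioms.intro pc assms fV)
 then show "inv\<^bsub>witt_ring p K\<^esub>
   (add_pow (witt_ring p K) (card (Gr_std K m (vectorspace.dim K V - 1))) \<one>\<^bsub>witt_ring p K\<^esub>)
  \<odot>\<^bsub>Omega p K (n + m * r) V\<^esub>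
   (\<Oplus>\<^bsub>Omega p K (n + m * r) V\<^esub>W\<in>Gr K m V.
     asc_transfer p r K n V (quot_module V W) (\<lambda>v. W +>\<^bsub>V\<^esub> v)
      (omega_map p K n V (quot_module V W) (\<lambda>v. W +>\<^bsub>V\<^esub> v) x))
  = Ver p r K m n V x" if "x \<in> carrier (Omega p K n V)" for x
  using assms(9,10) that by (intro finite_space.verschiebung_integral)
qed

end
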